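(* For $m\ge1$ and real $\theta,\eta,v_1,v_2$ set $$\begin{aligned}\tilde a&=(2m)^{1/3}\big(1+\tfrac16\theta m^{-2/5}+\tfrac12\eta m^{-3/5}\big),\\ \tilde b&=(2m)^{1/3}\big(-1-\tfrac16\theta m^{-2/5}+\tfrac12\eta m^{-3/5}\big),\\ \xi_i&=-(2m)^{2/3}\big(1-\tfrac16\theta m^{-2/5}-\tfrac12(v_i-\tfrac1{18}\theta^2)m^{-4/5}\big),\quad i=1,2.\end{aligned}$$ Then $$\lim_{m\to\infty}\frac{2^{-1/3}m^{-2/15}}{(2\pi i)^2}\int_\Omega d\omega\int_{\widetilde\Omega}d\widetilde\omega\,\frac{e^{-\omega^3/3+\xi_2\omega}}{e^{-\widetilde\omega^3/3+\xi_1\widetilde\omega}}\,\frac1{\omega-\widetilde\omega}\left(\frac{\omega-\tilde b}{\omega-\tilde a}\right)^m\left(\frac{\widetilde\omega-\tilde a}{\widetilde\omega-\tilde b}\right)^m=K^{\mathcal Q}(\theta,\eta;v_1,v_2),$$ where $K^{\mathcal Q}$ is the quintic kernel $$K^{\mathcal Q}(\theta,\eta;v_1,v_2):=\frac1{(2\pi i)^2}\int_{\mathcal C}dz\int_{\widetilde{\mathcal C}}d\tilde z\,\frac1{z-\tilde z}\,\frac{e^{\frac25z^5-\frac13\theta z^3-\eta z^2+v_2z}}{e^{\frac25\tilde z^5-\frac13\theta\tilde z^3-\eta\tilde z^2+v_1\tilde z}}.$$ The limit is uniform for $\theta,\eta,v_1,v_2$ in a bounded set.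
   Context: Contours before the limit (for $m$ large, $\tilde b<0<\tilde a$): $\Omega$ is the union of an infinite curve going from $e^{-2\pi i/3}\infty$ to $e^{2\pi i/3}\infty$ crossing the real axis between $\tilde b$ and $\tilde a$, and of a simple closed loop around $\tilde a$, oriented counterclockwise, not enclosing $\tilde b$; $\widetilde\Omega$ is the union of an infinite curve going from $e^{\pi i/3}\infty$ to $e^{-\pi i/3}\infty$ crossing the real axis between $\tilde b$ and $\tilde a$, and of a simple closed loop around $\tilde b$, oriented counterclockwise, not enclosing $\tilde a$. The four curves are pairwise disjoint (they may be allowed to touch at a single point of $(\tilde b,\tilde a)$) and from left to right they are: the loop around $\tilde b$, the infinite curve of $\Omega$, the infinite curve of $\widetilde\Omega$, the loop around $\tilde a$. Contours of the quintic kernel: $\mathcal C$ consists of the rays from $e^{-3\pi i/5}\infty$ to $0$, from $0$ to $e^{3\pi i/5}\infty$, from $e^{\pi i/5}\infty$ to $0$ and from $0$ to $e^{-\pi i/5}\infty$; $\widetilde{\mathcal C}$ consists of the rays from $e^{2\pi i/5}\infty$ to $0$, from $0$ to $e^{-2\pi i/5}\infty$, from $e^{-4\pi i/5}\infty$ to $0$ and from $0$ to $e^{4\pi i/5}\infty$. *)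

theory Defs
  imports "HOL-Complex_Analysis.Complex_Analysis"
begin

text \<open>
  Unbounded contours are parametrised by the whole real line. The Henstock--Kurzweil integral over
  \<^term>\<open>UNIV\<close> is the improper contour integral, that is, the limit of the integrals over \<open>{s..t}\<close>
  as \<open>s\<close> and \<open>t\<close> tend independently to minus and plus infinity. It is the same integral that
  \<^const>\<open>contour_integral\<close> uses on compact parameter intervals.
\<close>

definition line_integral :: "(real \<Rightarrow> complex) \<Rightarrow> (complex \<Rightarrow> complex) \<Rightarrow> complex" where
  "line_integral \<gamma> f = integral UNIV (\<lambda>t. f (\<gamma> t) * vector_derivative \<gamma> (at t))"

text \<open>A piecewise continuously differentiable curve from \<open>cis \<alpha> \<cdot> \<infinity>\<close> to \<open>cis \<beta> \<cdot> \<infinity>\<close>.\<close>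

definition infinite_curve :: "real \<Rightarrow> real \<Rightarrow> (real \<Rightarrow> complex) \<Rightarrow> bool" where
  "infinite_curve \<alpha> \<beta> \<gamma> \<longleftrightarrow>
     (\<forall>T>0. \<gamma> piecewise_C1_differentiable_on {-T..T}) \<and>
     filterlim \<gamma> at_infinity at_bot \<and> ((\<lambda>t. sgn (\<gamma> t)) \<longlongrightarrow> cis \<alpha>) at_bot \<and>
     filterlim \<gamma> at_infinity at_top \<and> ((\<lambda>t. sgn (\<gamma> t)) \<longlongrightarrow> cis \<beta>) at_top"

definition crosses_real_axis_between :: "real \<Rightarrow> real \<Rightarrow> (real \<Rightarrow> complex) \<Rightarrow> bool" where
  "crosses_real_axis_between b a \<gamma> \<longleftrightarrow>
     (\<exists>x. complex_of_real x \<in> range \<gamma>) \<and> (\<forall>x. complex_of_real x \<in> range \<gamma> \<longrightarrow> b < x \<and> x < a)"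

definition ccw_loop_around :: "complex \<Rightarrow> complex \<Rightarrow> (real \<Rightarrow> complex) \<Rightarrow> bool" where
  "ccw_loop_around c d g \<longleftrightarrow>
     valid_path g \<and> simple_path g \<and> pathfinish g = pathstart g \<and>
     c \<in> inside (path_image g) \<and> winding_number g c = 1 \<and> d \<in> outside (path_image g)"

text \<open>
  The left (right) side of an infinite curve is the component of its complement containing the real
  points near minus (plus) infinity. A set lies on one side if all its points off the curve do, so
  that it may touch the curve.
\<close>

definition left_of_curve :: "complex set \<Rightarrow> (real \<Rightarrow> complex) \<Rightarrow> bool" where
  "left_of_curve S \<gamma> \<longleftrightarrow> (\<forall>z \<in> S - range \<gamma>.
     \<forall>\<^sub>F x in at_bot. connected_component (- range \<gamma>) z (complex_of_real x))"

definition right_of_curve :: "complex set \<Rightarrow> (real \<Rightarrow> complex) \<Rightarrow> bool" where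
  "right_of_curve S \<gamma> \<longleftrightarrow> (\<forall>z \<in> S - range \<gamma>.
     \<forall>\<^sub>F x in at_top. connected_component (- range \<gamma>) z (complex_of_real x))"

text \<open>
  \<open>\<Omega>\<close> is the union of the infinite curve \<open>\<gamma>\<close> and the loop \<open>g\<close> around \<open>a\<close>; \<open>\<Omega>~\<close> is the union of the
  infinite curve \<open>\<gamma>'\<close> and the loop \<open>g'\<close> around \<open>b\<close>. Distinct curves have at most the one point \<open>p\<close>
  in common; if they are pairwise disjoint, \<open>p\<close> is arbitrary.
\<close>

definition admissible_contours ::
    "real \<Rightarrow> real \<Rightarrow> (real \<Rightarrow> complex) \<Rightarrow> (real \<Rightarrow> complex) \<Rightarrow>
     (real \<Rightarrow> complex) \<Rightarrow> (real \<Rightarrow> complex) \<Rightarrow> bool" where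
  "admissible_contours a b \<gamma> g \<gamma>' g' \<longleftrightarrow>
     b < 0 \<and> 0 < a \<and>
     infinite_curve (-2*pi/3) (2*pi/3) \<gamma> \<and> crosses_real_axis_between b a \<gamma> \<and>
     ccw_loop_around a b g \<and>
     infinite_curve (pi/3) (-pi/3) \<gamma>' \<and> crosses_real_axis_between b a \<gamma>' \<and>
     ccw_loop_around b a g' \<and>
     (\<exists>p::real. b < p \<and> p < a \<and>
        path_image g' \<inter> range \<gamma> \<subseteq> {complex_of_real p} \<and>
        path_image g' \<inter> range \<gamma>' \<subseteq> {complex_of_real p} \<and>
        path_image g' \<inter> path_image g \<subseteq> {complex_of_real p} \<and>
        range \<gamma> \<inter> range \<gamma>' \<subseteq> {complex_of_real p} \<and>
        range \<gamma> \<inter> path_image g \<subseteq> {complex_of_real p} \<and>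
        range \<gamma>' \<inter> path_image g \<subseteq> {complex_of_real p}) \<and>
     left_of_curve (path_image g') \<gamma> \<and> left_of_curve (path_image g') \<gamma>' \<and>
     left_of_curve (range \<gamma>) \<gamma>' \<and> right_of_curve (range \<gamma>') \<gamma> \<and>
     right_of_curve (path_image g) \<gamma> \<and> right_of_curve (path_image g) \<gamma>'"

definition a_scaled :: "nat \<Rightarrow> real \<Rightarrow> real \<Rightarrow> real" where
  "a_scaled m \<theta> \<eta> = (2 * real m) powr (1/3) *
     (1 + 1/6 * \<theta> * real m powr (-2/5) + 1/2 * \<eta> * real m powr (-3/5))"

definition b_scaled :: "nat \<Rightarrow> real \<Rightarrow> real \<Rightarrow> real" where
  "b_scaled m \<theta> \<eta> = (2 * real m) powr (1/3) *
     (-1 - 1/6 * \<theta> * real m powr (-2/5) + 1/2 * \<eta> * real m powr (-3/5))"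

definition xi_scaled :: "nat \<Rightarrow> real \<Rightarrow> real \<Rightarrow> real" where
  "xi_scaled m \<theta> v = - ((2 * real m) powr (2/3)) *
     (1 - 1/6 * \<theta> * real m powr (-2/5) - 1/2 * (v - 1/18 * \<theta>\<^sup>2) * real m powr (-4/5))"

definition prelimit_integrand ::
    "nat \<Rightarrow> real \<Rightarrow> real \<Rightarrow> real \<Rightarrow> real \<Rightarrow> complex \<Rightarrow> complex \<Rightarrow> complex" where
  "prelimit_integrand m a b \<xi>1 \<xi>2 w w' =
     exp (- (w^3) / 3 + of_real \<xi>2 * w) / exp (- (w'^3) / 3 + of_real \<xi>1 * w') * (1 / (w - w')) *
     ((w - of_real b) / (w - of_real a)) ^ m * ((w' - of_real a) / (w' - of_real b)) ^ m"

definition rescaled_prelimit_kernel ::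
    "nat \<Rightarrow> real \<Rightarrow> real \<Rightarrow> real \<Rightarrow> real \<Rightarrow>
     (real \<Rightarrow> complex) \<Rightarrow> (real \<Rightarrow> complex) \<Rightarrow> (real \<Rightarrow> complex) \<Rightarrow> (real \<Rightarrow> complex) \<Rightarrow> complex" where
  "rescaled_prelimit_kernel m \<theta> \<eta> v1 v2 \<gamma> g \<gamma>' g' =
     (let f = prelimit_integrand m (a_scaled m \<theta> \<eta>) (b_scaled m \<theta> \<eta>)
                (xi_scaled m \<theta> v1) (xi_scaled m \<theta> v2);
          inner = (\<lambda>w. line_integral \<gamma>' (f w) + contour_integral g' (f w))
      in of_real (2 powr (-1/3) * real m powr (-2/15)) / (2 * of_real pi * \<i>)^2 *
           (line_integral \<gamma> inner + contour_integral g inner))"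

definition outgoing_ray_integral :: "real \<Rightarrow> (complex \<Rightarrow> complex) \<Rightarrow> complex" where
  "outgoing_ray_integral \<phi> f = integral {0..} (\<lambda>r. f (of_real r * cis \<phi>) * cis \<phi>)"

definition quintic_contour_integral :: "(complex \<Rightarrow> complex) \<Rightarrow> complex" where
  "quintic_contour_integral f =
     - outgoing_ray_integral (-3*pi/5) f + outgoing_ray_integral (3*pi/5) f
     - outgoing_ray_integral (pi/5) f + outgoing_ray_integral (-pi/5) f"

definition quintic_contour_integral' :: "(complex \<Rightarrow> complex) \<Rightarrow> complex" where
  "quintic_contour_integral' f =
     - outgoing_ray_integral (2*pi/5) f + outgoing_ray_integral (-2*pi/5) f
     - outgoing_ray_integral (-4*pi/5) f + outgoing_ray_integral (4*pi/5) f"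

definition quintic_exponent :: "real \<Rightarrow> real \<Rightarrow> real \<Rightarrow> complex \<Rightarrow> complex" where
  "quintic_exponent \<theta> \<eta> v z =
     2/5 * z^5 - 1/3 * of_real \<theta> * z^3 - of_real \<eta> * z^2 + of_real v * z"

text \<open>
  The contours meet at the origin, where the inner integral is not defined; this is a null set for
  the outer integration, and the inner integral has only a logarithmic singularity there.
\<close>

definition quintic_kernel :: "real \<Rightarrow> real \<Rightarrow> real \<Rightarrow> real \<Rightarrow> complex" where
  "quintic_kernel \<theta> \<eta> v1 v2 =
     1 / (2 * of_real pi * \<i>)^2 *
     quintic_contour_integral (\<lambda>z. quintic_contour_integral' (\<lambda>z'.
       1 / (z - z') * (exp (quintic_exponent \<theta> \<eta> v2 z) / exp (quintic_exponent \<theta> \<eta> v1 z'))))"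

end

theory Submission
  imports Defs "HOL-Real_Asymp.Real_Asymp"
begin

text \<open>
  Integrating over the inner variable gives one function \<open>M\<close>, holomorphic except at the two
  singular points, plus locally constant multiples of the entire function \<open>exp ((\<xi>2 - \<xi>1) w)\<close>, which
  come from the pole on the diagonal. These multiples integrate to zero over the outer contour, because
  the winding number of the inner loop is constant between consecutive visits of the outer curve to the
  possible point of contact. Hence the double integral does not depend on the contours, and they may be
  replaced by rays from the midpoint \<open>c\<close> of the two singularities at angles \<open>\<plusminus> 3 * pi/5\<close> together with a
  circular sector of half-angle \<open>pi/5\<close>, and by the opposite curves for the inner variable.

  With \<open>w = c + D z\<close>, where \<open>D = (a - b) / 2 * \<epsilon>\<close> and \<open>\<epsilon> = m powr (-1/5)\<close>, the exponent becomes
  \<open>m * Phi (\<epsilon> * z)\<close> plus a convergent cubic polynomial, where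
  \<open>Phi s = Ln (1 + s) - Ln (1 - s) - 2 * s - 2 * s\<^sup>3 / 3\<close> behaves like \<open>2 * s\<^sup>5 / 5\<close> at the origin. The real part of
  \<open>Phi\<close> decreases along the rays, with a cubic bound after rescaling, and is bounded away from zero on the
  arc of radius \<open>sqrt 2\<close>, so that dominated convergence applies and the arc disappears in the limit.
  Uniformity follows since the convergence holds along every convergent sequence of parameters.
\<close>

section \<open>Improper integrals over the real line\<close>

text \<open>The pole of 1/(w - w') is the obstacle throughout. Before the limit, all four curves may
  share a point where the inner integral has no meaning; the outer curve may visit it infinitely
  often and may have infinite length far out. Integrals along it are therefore treated through
  primitives, as possibly conditionally convergent integrals, with countably many exceptional
  parameters. In the limit all curves pass through the origin. With y the negative of the rescaled
  inner variable, a bound |z + y| \<ge> C sqrt (|z| |y|) dominates the integrand by a product of one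
  function of each parameter, each with an integrable singularity 1 / sqrt r. The angles pi/5 and 3
  pi/5 are directions in which z^5 is negative. The rays at 3 pi/5 are only pi/15 away from the
  prescribed direction 2 pi/3, so the cubic exponential still decays along them. In the variable s
  of \<open>Phi\<close> the singularities are at \<plusminus> 1, so the arc needs a radius above 1;
  its square must stay below 1 / cos (2 pi/5), where Re Phi stops decreasing along the sides of the
  sector. The radius sqrt 2 does both and simplifies the derivative along the arc.\<close>

definition jump_sum :: "(nat \<Rightarrow> real) \<Rightarrow> real \<Rightarrow> real" where
  "jump_sum s t = (\<Sum>n. (1/2)^n * (of_bool (s n < t) + of_bool (s n \<le> t)))"

lemma jump_sum_summable: "summable (\<lambda>n. (1/2)^n * (of_bool (s n < t) + of_bool (s n \<le> t)) :: real)"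
proof (rule summable_comparison_test')
  show "summable (\<lambda>n. 2 * (1/2)^n :: real)"
    by (intro summable_mult) simp
qed (auto simp: of_bool_def)

lemma jump_sum_bounds: "0 \<le> jump_sum s t" "jump_sum s t \<le> 4"
proof -
  show "0 \<le> jump_sum s t"
    unfolding jump_sum_def by (rule suminf_nonneg[OF jump_sum_summable]) auto
  have "jump_sum s t \<le> (\<Sum>n. 2 * (1/2)^n :: real)"
    unfolding jump_sum_def
    by (rule suminf_le[OF _ jump_sum_summable]) (auto simp: of_bool_def intro!: summable_mult)
  also have "\<dots> = 4"
    by (simp add: suminf_mult suminf_geometric)
  finally show "jump_sum s t \<le> 4" .
qed

lemma jump_sum_mono: "u \<le> v \<Longrightarrow> jump_sum s u \<le> jump_sum s v"
  unfolding jump_sum_def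
  by (rule suminf_le[OF _ jump_sum_summable jump_sum_summable]) (auto simp: of_bool_def)

text \<open>\<open>jump_sum\<close> counts \<open>s n\<close> once with < and once with \<le>, so it
  jumps on both sides of \<open>s n\<close>; an interval that has \<open>s n\<close> only as an
  endpoint therefore also sees a jump.\<close>

lemma jump_sum_jump:
  assumes "u < v" "u \<le> s n" "s n \<le> v"
  shows "(1/2)^n \<le> jump_sum s v - jump_sum s u"
proof -
  define \<psi> where "\<psi> t n = (1/2)^n * (of_bool (s n < t) + of_bool (s n \<le> t) :: real)" for t n
  have sm: "summable (\<psi> t)" for t
    unfolding \<psi>_def by (rule jump_sum_summable)
  have "(1/2)^n \<le> \<psi> v n - \<psi> u n"
    using assms by (auto simp: \<psi>_def of_bool_def field_simps)
  also have "\<dots> = (\<Sum>i\<in>{n}. \<psi> v i - \<psi> u i)" by simp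
  also have "\<dots> \<le> (\<Sum>i. \<psi> v i - \<psi> u i)"
    using assms by (intro sum_le_suminf summable_diff sm) (auto simp: \<psi>_def of_bool_def)
  also have "\<dots> = jump_sum s v - jump_sum s u"
    unfolding suminf_diff[OF sm sm, symmetric] unfolding jump_sum_def \<psi>_def ..
  finally show ?thesis .
qed

text \<open>The exceptional points \<open>s n\<close> are paid for by the increments of the monotone function
  \<^const>\<open>jump_sum\<close>, which jumps by at least \<open>2\<^sup>-\<^sup>n\<close> on every nondegenerate interval containing \<open>s n\<close>.\<close>

theorem fundamental_theorem_of_calculus_countable:
  fixes F :: "real \<Rightarrow> 'a::banach"
  assumes "countable S" "a \<le> b" and cont: "continuous_on {a..b} F"
    and der: "\<And>x. x \<in> {a..b} - S \<Longrightarrow> (F has_vector_derivative f x) (at x within {a..b})"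
  shows "(f has_integral (F b - F a)) {a..b}"
proof -
  \<comment> \<open>\<open>a\<close> is inserted to make the enumerated set nonempty;
    \<open>s\<close> then runs through all of \<open>S\<close>.\<close>
  define s where "s = from_nat_into (insert a S)"
  have s: "\<exists>n. s n = x" if "x \<in> S" for x
    using that \<open>countable S\<close> unfolding s_def
    by (metis countable_insert from_nat_into_surj insertCI)
  \<comment> \<open>On the null set \<open>S\<close> the integrand may be changed. With the value 0,
    only the increment of \<open>F\<close> is left to estimate at a tag in \<open>S\<close>.\<close>
  define f0 where "f0 x = (if x \<in> S then 0 else f x)" for x
  have "(f0 has_integral (F b - F a)) {a..b}"
    unfolding has_integral_real
  proof (intro allI impI)
    fix e :: real assume "e > 0"
    \<comment> \<open>4 is the bound on \<open>jump_sum\<close>, so the total error is at most e'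
      times \<open>D\<close>, which is e / 2.\<close>
    define D where "D = b - a + 4"
    define e' where "e' = e / (2 * D)"
    have "D > 0" using \<open>a \<le> b\<close> by (simp add: D_def)
    then have e': "e' > 0" "e' * (b - a + 4) < e"
      using \<open>e > 0\<close> unfolding D_def[symmetric] e'_def by simp_all
    define \<phi> where "\<phi> t = jump_sum s t" for t
    \<comment> \<open>Straddle estimate. Its right-hand side is a multiple of an increment of t +
      \<phi> t, so the errors telescope over a tagged division.\<close>
    have "\<exists>d>0. \<forall>u v. u \<in> {a..b} \<and> v \<in> {a..b} \<and> u \<le> x \<and> x \<le> v \<and> \<bar>u - x\<bar> < d \<and> \<bar>v - x\<bar> < d
          \<longrightarrow> norm ((v - u) *\<^sub>R f0 x - (F v - F u)) \<le> e' * ((v - u) + (\<phi> v - \<phi> u))"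
      if x: "x \<in> {a..b}" for x
    proof (cases "x \<in> S")
      case True
      then obtain n where n: "s n = x" using s by blast
      \<comment> \<open>Half of what one jump at \<open>s n\<close> pays for, since the increment of
        \<open>F\<close> is split at x into two.\<close>
      have "e' / 2 * (1/2)^n > 0" using e' by simp
      with cont x have "\<exists>d>0. \<forall>y\<in>{a..b}. dist y x < d \<longrightarrow> dist (F y) (F x) < e' / 2 * (1/2)^n"
        unfolding continuous_on_iff by blast
      then obtain d where d: "d > 0"
        "\<And>y. y \<in> {a..b} \<Longrightarrow> dist y x < d \<Longrightarrow> dist (F y) (F x) < e' / 2 * (1/2)^n"
        by blast
      show ?thesis
      proof (intro exI[of _ d] conjI allI impI d(1); elim conjE)
        fix u v assume uv: "u \<in> {a..b}" "v \<in> {a..b}" "u \<le> x" "x \<le> v" "\<bar>u - x\<bar> < d" "\<bar>v - x\<bar> < d"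
        show "norm ((v - u) *\<^sub>R f0 x - (F v - F u)) \<le> e' * ((v - u) + (\<phi> v - \<phi> u))"
        proof (cases "u = v")
          case False
          then have "u < v" using uv by simp
          have "norm (F v - F u) \<le> dist (F v) (F x) + dist (F u) (F x)"
            by (metis dist_norm dist_triangle2)
          also have "\<dots> \<le> e' * (1/2)^n"
            using d(2)[of v] d(2)[of u] uv by (simp add: dist_real_def)
          also have "\<dots> \<le> e' * (\<phi> v - \<phi> u)"
            using jump_sum_jump[OF \<open>u < v\<close>, of s n] uv n e' by (simp add: \<phi>_def)
          also have "\<dots> \<le> e' * ((v - u) + (\<phi> v - \<phi> u))"
            using e' \<open>u < v\<close> by simp
          finally show ?thesis using True by (simp add: f0_def norm_minus_commute)
        qed simp
      qed
    next
      case False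
      with der x have "(F has_derivative (\<lambda>h. h *\<^sub>R f x)) (at x within {a..b})"
        unfolding has_vector_derivative_def by auto
      then obtain d where d: "d > 0"
        "\<And>y. y \<in> {a..b} \<Longrightarrow> norm (y - x) < d \<Longrightarrow> norm (F y - F x - (y - x) *\<^sub>R f x) \<le> e' * norm (y - x)"
        unfolding has_derivative_within_alt using e' by meson
      show ?thesis
      proof (intro exI[of _ d] conjI allI impI d(1); elim conjE)
        fix u v assume uv: "u \<in> {a..b}" "v \<in> {a..b}" "u \<le> x" "x \<le> v" "\<bar>u - x\<bar> < d" "\<bar>v - x\<bar> < d"
        have "norm ((v - u) *\<^sub>R f0 x - (F v - F u))
            = norm ((F u - F x - (u - x) *\<^sub>R f x) - (F v - F x - (v - x) *\<^sub>R f x))"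
          using False by (simp add: f0_def algebra_simps)
        also have "\<dots> \<le> e' * norm (u - x) + e' * norm (v - x)"
          using d(2)[of v] d(2)[of u] uv by (intro order_trans[OF norm_triangle_ineq4 add_mono]) auto
        also have "\<dots> = e' * (v - u)" using uv by (simp add: algebra_simps)
        also have "\<dots> \<le> e' * ((v - u) + (\<phi> v - \<phi> u))"
          using e' jump_sum_mono[of u v s] uv by (simp add: \<phi>_def)
        finally show "norm ((v - u) *\<^sub>R f0 x - (F v - F u)) \<le> e' * ((v - u) + (\<phi> v - \<phi> u))" .
      qed
    qed
    then obtain d where d: "\<And>x. x \<in> {a..b} \<Longrightarrow> d x > 0"
      "\<And>x u v. \<lbrakk>x \<in> {a..b}; u \<in> {a..b}; v \<in> {a..b}; u \<le> x; x \<le> v; \<bar>u - x\<bar> < d x; \<bar>v - x\<bar> < d x\<rbrakk>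
          \<Longrightarrow> norm ((v - u) *\<^sub>R f0 x - (F v - F u)) \<le> e' * ((v - u) + (\<phi> v - \<phi> u))"
      by metis
    define \<gamma> where "\<gamma> x = ball x (if x \<in> {a..b} then d x else 1)" for x
    show "\<exists>\<gamma>. gauge \<gamma> \<and> (\<forall>p. p tagged_division_of {a..b} \<and> \<gamma> fine p \<longrightarrow>
        norm (sum (\<lambda>(x,k). measure lborel k *\<^sub>R f0 x) p - (F b - F a)) < e)"
    proof (intro exI[of _ \<gamma>] conjI allI impI; (elim conjE)?)
      show "gauge \<gamma>" using d(1) by (auto simp: \<gamma>_def gauge_def)
      fix p assume p: "p tagged_division_of {a..b}" and fine: "\<gamma> fine p"
      let ?\<psi> = "\<lambda>t. t + \<phi> t"
      have *: "norm (measure lborel K *\<^sub>R f0 x - (F (Sup K) - F (Inf K))) \<le> e' * (?\<psi> (Sup K) - ?\<psi> (Inf K))"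
        if xK: "(x, K) \<in> p" for x K
      proof -
        from p xK have K: "x \<in> K" "K \<subseteq> {a..b}" by (auto dest: tagged_division_ofD)
        from tagged_division_ofD(4)[OF p xK] obtain u v where uv: "K = {u..v}" by (auto simp: box_real)
        have "u \<le> v" using K uv by auto
        have "K \<subseteq> \<gamma> x" using fine xK by (auto simp: fine_def)
        moreover have "u \<in> K" "v \<in> K" using \<open>u \<le> v\<close> uv by auto
        ultimately have "u \<in> \<gamma> x" "v \<in> \<gamma> x" by auto
        moreover have "x \<in> {a..b}" "u \<in> {a..b}" "v \<in> {a..b}" using K \<open>u \<in> K\<close> \<open>v \<in> K\<close> by auto
        ultimately have "norm ((v - u) *\<^sub>R f0 x - (F v - F u)) \<le> e' * ((v - u) + (\<phi> v - \<phi> u))"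
          using K uv by (intro d(2)) (auto simp: \<gamma>_def dist_real_def)
        then show ?thesis using \<open>u \<le> v\<close> uv by (simp add: algebra_simps)
      qed
      have fin: "finite p" using p by auto
      have "norm (sum (\<lambda>(x,k). measure lborel k *\<^sub>R f0 x) p - (F b - F a))
          = norm (\<Sum>(x,K)\<in>p. measure lborel K *\<^sub>R f0 x - (F (Sup K) - F (Inf K)))"
        unfolding additive_tagged_division_1[OF \<open>a \<le> b\<close> p, of F, symmetric] sum_subtractf[symmetric]
        by (simp add: case_prod_unfold)
      also have "\<dots> \<le> (\<Sum>(x,K)\<in>p. e' * (?\<psi> (Sup K) - ?\<psi> (Inf K)))"
        by (rule sum_norm_le) (use * in auto)
      also have "\<dots> = e' * (?\<psi> b - ?\<psi> a)"
        unfolding additive_tagged_division_1[OF \<open>a \<le> b\<close> p, of ?\<psi>, symmetric]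
        by (simp add: sum_distrib_left case_prod_unfold)
      also have "\<dots> \<le> e' * (b - a + 4)"
        using e' jump_sum_bounds[of s a] jump_sum_bounds[of s b] by (simp add: \<phi>_def)
      also have "\<dots> < e" by (rule e')
      finally show "norm (sum (\<lambda>(x,k). measure lborel k *\<^sub>R f0 x) p - (F b - F a)) < e" .
    qed
  qed
  moreover have "negligible S"
    using \<open>countable S\<close> by (simp add: negligible_iff_null_sets countable_imp_null_set_lborel null_sets_completionI)
  ultimately show ?thesis
    using has_integral_spike[of S "{a..b}" f f0 "F b - F a"] by (auto simp: f0_def)
qed

text \<open>An interval containing a large ball has its endpoints where \<open>G\<close> is already
  close to its two limits. Only these limits enter, so conditionally convergent integrals are
  covered.\<close>

lemma has_integral_UNIV_limit:
  fixes f :: "real \<Rightarrow> 'a::banach"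
  assumes int: "\<And>s t. s \<le> t \<Longrightarrow> (f has_integral (G t - G s)) {s..t}"
    and top: "(G \<longlongrightarrow> B) at_top" and bot: "(G \<longlongrightarrow> A) at_bot"
  shows "(f has_integral (B - A)) UNIV"
  unfolding has_integral_alt'
proof (intro conjI allI impI)
  show "(\<lambda>x. if x \<in> UNIV then f x else 0) integrable_on cbox a b" for a b
    using int[of a b] by (cases "a \<le> b") (auto simp: integrable_on_def box_real)
  fix e :: real assume "e > 0"
  then have "e / 2 > 0" by simp
  from top this obtain T where T: "\<And>t. t \<ge> T \<Longrightarrow> dist (G t) B < e / 2"
    unfolding tendsto_iff eventually_at_top_linorder by meson
  from bot \<open>e/2 > 0\<close> obtain S where S: "\<And>t. t \<le> S \<Longrightarrow> dist (G t) A < e / 2"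
    unfolding tendsto_iff eventually_at_bot_linorder by meson
  define R where "R = \<bar>T\<bar> + \<bar>S\<bar> + 1"
  show "\<exists>R>0. \<forall>a b. ball 0 R \<subseteq> cbox a b \<longrightarrow>
      norm (integral (cbox a b) (\<lambda>x. if x \<in> UNIV then f x else 0) - (B - A)) < e"
  proof (intro exI[of _ R] conjI allI impI)
    show "R > 0" by (simp add: R_def)
    fix a b :: real assume sub: "ball 0 R \<subseteq> cbox a b"
    have "T \<in> ball 0 R" "S \<in> ball 0 R" by (auto simp: R_def)
    with sub have ab: "a \<le> S" "T \<le> b" "a \<le> b" by (auto simp: box_real)
    then have eq: "integral (cbox a b) f = G b - G a"
      using int by (simp add: box_real integral_unique)
    have "norm (integral (cbox a b) (\<lambda>x. if x \<in> UNIV then f x else 0) - (B - A))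
       = norm ((G b - B) - (G a - A))" by (simp only: if_True UNIV_I eq) (simp add: algebra_simps)
    also have "\<dots> \<le> dist (G b) B + dist (G a) A"
      unfolding dist_norm by (rule norm_triangle_ineq4)
    also have "\<dots> < e" using T[OF ab(2)] S[OF ab(1)] by simp
    finally show "norm (integral (cbox a b) (\<lambda>x. if x \<in> UNIV then f x else 0) - (B - A)) < e" .
  qed
qed

section \<open>Curves that tend to infinity\<close>

text \<open>Since the aperture \<open>arccos (9/10)\<close> is less than \<open>pi/6\<close>, the real part of \<open>z\<^sup>3\<close> keeps its sign on the
  tails in the directions \<open>\<beta> = \<plusminus> pi/3\<close> and \<open>\<beta> = \<plusminus> 2 * pi/3\<close>. The tails also contain the rays at angles
  \<open>\<plusminus> 3 * pi/5\<close> and \<open>\<plusminus> 2 * pi/5\<close> of the limiting contours.\<close>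

definition tail :: "real \<Rightarrow> real \<Rightarrow> complex set" where
  "tail \<beta> R = {z. 9/10 * norm z < Re (z * cis (-\<beta>)) \<and> R < Re (z * cis (-\<beta>))}"

lemma open_tail: "open (tail \<beta> R)"
  unfolding tail_def by (intro open_Collect_conj open_Collect_less continuous_intros)

text \<open>Both defining conditions say that a convex function lies below the real linear
  functional \<open>L\<close>.\<close>

lemma convex_tail: "convex (tail \<beta> R)"
proof (rule convexI)
  fix x y u v assume xy: "x \<in> tail \<beta> R" "y \<in> tail \<beta> R" and uv: "0 \<le> u" "0 \<le> v" "u + v = (1::real)"
  define L where "L z = Re (z * cis (-\<beta>))" for z
  have L: "L (u *\<^sub>R x + v *\<^sub>R y) = u * L x + v * L y"
    by (simp add: L_def algebra_simps scaleR_conv_of_real)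
  have tail: "z \<in> tail \<beta> R \<longleftrightarrow> 9/10 * norm z < L z \<and> R < L z" for z
    by (simp add: tail_def L_def)
  have comb: "u * p + v * q < u * p' + v * q'" if "p < p'" "q < q'" for p p' q q' :: real
    using that uv by (cases "u = 0") (auto intro!: add_less_le_mono mult_left_mono mult_strict_left_mono)
  have "9/10 * norm (u *\<^sub>R x + v *\<^sub>R y) \<le> u * (9/10 * norm x) + v * (9/10 * norm y)"
    using norm_triangle_ineq[of "u *\<^sub>R x" "v *\<^sub>R y"] uv by simp
  also have "\<dots> < u * L x + v * L y"
    using xy by (intro comb) (auto simp: tail)
  finally have 1: "9/10 * norm (u *\<^sub>R x + v *\<^sub>R y) < L (u *\<^sub>R x + v *\<^sub>R y)" using L by simp
  have "R = u * R + v * R" using uv by (metis distrib_right mult_1)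
  also have "\<dots> < u * L x + v * L y"
    using xy by (intro comb) (auto simp: tail)
  finally have 2: "R < L (u *\<^sub>R x + v *\<^sub>R y)" using L by simp
  from 1 2 show "u *\<^sub>R x + v *\<^sub>R y \<in> tail \<beta> R" by (simp add: tail)
qed

lemma tail_norm: "z \<in> tail \<beta> R \<Longrightarrow> R < norm z"
  using complex_Re_le_cmod[of "z * cis (-\<beta>)"] by (auto simp: tail_def norm_mult)

lemma ray_in_tail: "max R 0 < \<rho> \<Longrightarrow> of_real \<rho> * cis \<beta> \<in> tail \<beta> R"
proof -
  assume "max R 0 < \<rho>"
  moreover have "of_real \<rho> * cis \<beta> * cis (-\<beta>) = of_real \<rho>"
    by (simp add: mult.assoc cis_mult)
  ultimately show ?thesis unfolding tail_def mem_Collect_eq by (simp only: norm_mult) simp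
qed

text \<open>The exponential bound makes a primitive Cauchy along the central ray. At any other point
  of the tail it is compared with the ray point of equal norm along a chord on which f is still
  exponentially small. So the primitive has one limit at infinity, whatever path is taken within the
  tail and however long that path is.\<close>

lemma tail_primitive:
  assumes holo: "f holomorphic_on tail \<beta> R" and "0 \<le> C"
    and bnd: "\<And>z. z \<in> tail \<beta> R \<Longrightarrow> norm (f z) \<le> C * exp (- norm z)"
  obtains P l where "\<And>z. z \<in> tail \<beta> R \<Longrightarrow> (P has_field_derivative f z) (at z)"
    "\<And>(c::real\<Rightarrow>complex) F. \<lbrakk>filterlim c at_infinity F; eventually (\<lambda>t. c t \<in> tail \<beta> R) F\<rbrakk> \<Longrightarrow> ((\<lambda>t. P (c t)) \<longlongrightarrow> l) F"
proof -
  obtain P where P: "\<And>z. z \<in> tail \<beta> R \<Longrightarrow> (P has_field_derivative f z) (at z)"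
    using holomorphic_convex_primitive'[OF convex_tail open_tail holo] at_within_open[OF _ open_tail] by metis
  define u where "u = (\<lambda>\<rho>::real. P (of_real \<rho> * cis \<beta>))"
  have u': "(u has_vector_derivative f (of_real \<rho> * cis \<beta>) * cis \<beta>) (at \<rho>)" if "max R 0 < \<rho>" for \<rho>
  proof -
    have "((\<lambda>\<rho>. of_real \<rho> * cis \<beta>) has_vector_derivative cis \<beta>) (at \<rho>)"
      by (auto intro!: derivative_eq_intros)
    from field_vector_diff_chain_at[OF this P[OF ray_in_tail[OF that]]]
    show ?thesis by (simp add: u_def o_def mult.commute)
  qed
  have u_diff: "norm (u y - u x) \<le> C * exp (-x)" if xy: "max R 0 < x" "x \<le> y" for x y
  proof (cases "x = y")
    case False
    then have "x < y" using xy by simp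
    then have "norm (u y - u x) \<le> (- C * exp (-y)) - (- C * exp (-x))"
    proof (rule differentiable_bound_general)
      show "continuous_on {x..y} u"
      proof (rule continuous_at_imp_continuous_on, rule ballI)
        fix t assume "t \<in> {x..y}"
        then show "isCont u t" using has_vector_derivative_continuous[OF u'[of t]] xy by auto
      qed
      show "(u has_vector_derivative f (of_real t * cis \<beta>) * cis \<beta>) (at t)" if "x < t" "t < y" for t
        using u' xy that by auto
      show "((\<lambda>t. - C * exp (-t)) has_vector_derivative C * exp (-t)) (at t)" if "x < t" "t < y" for t
        unfolding has_real_derivative_iff_has_vector_derivative[symmetric]
        by (auto intro!: derivative_eq_intros)
      show "norm (f (complex_of_real t * cis \<beta>) * cis \<beta>) \<le> C * exp (-t)" if "x < t" "t < y" for t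
        using bnd[OF ray_in_tail[of R t]] xy that by (simp add: norm_mult)
    qed (intro continuous_intros)
    also have "\<dots> \<le> C * exp (-x)" using \<open>0 \<le> C\<close> by simp
    finally show ?thesis .
  qed (use \<open>0 \<le> C\<close> in simp)
  have lim0: "((\<lambda>x. C * exp (-x)) \<longlongrightarrow> 0) at_top"
    by real_asymp
  have "Cauchy (\<lambda>n. u (real n))"
  proof (rule metric_CauchyI)
    fix e :: real assume "e > 0"
    then have "eventually (\<lambda>x. dist (C * exp (-x)) 0 < e \<and> x > max R 0) at_top"
      using lim0 eventually_gt_at_top unfolding tendsto_iff by (intro eventually_conj) blast+
    then obtain X where X0: "\<forall>x\<ge>X. dist (C * exp (-x)) 0 < e \<and> x > max R 0"
      unfolding eventually_at_top_linorder by blast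
    have X: "C * exp (-x) < e \<and> x > max R 0" if "x \<ge> X" for x
      using X0[rule_format, OF that] by (auto simp: dist_real_def)
    show "\<exists>M. \<forall>m\<ge>M. \<forall>n\<ge>M. dist (u (real m)) (u (real n)) < e"
    proof (intro exI[of _ "nat \<lceil>X\<rceil>"] allI impI)
      fix m n assume mn: "nat \<lceil>X\<rceil> \<le> m" "nat \<lceil>X\<rceil> \<le> n"
      have *: "dist (u (real m)) (u (real n)) < e" if "m \<le> n" "nat \<lceil>X\<rceil> \<le> m" for m n
      proof -
        have "real m \<ge> X" using that by linarith
        then show ?thesis
          using u_diff[of "real m" "real n"] X[of "real m"] that by (auto simp: dist_norm norm_minus_commute)
      qed
      show "dist (u (real m)) (u (real n)) < e"
        using *[of m n] *[of n m] mn by (cases "m \<le> n") (auto simp: dist_commute)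
    qed
  qed
  then obtain l where l: "(\<lambda>n. u (real n)) \<longlonglongrightarrow> l"
    using convergent_eq_Cauchy by blast
  have ul: "norm (l - u x) \<le> C * exp (-x)" if "max R 0 < x" for x
  proof (rule tendsto_upperbound)
    show "(\<lambda>n. norm (u (real n) - u x)) \<longlonglongrightarrow> norm (l - u x)" by (intro tendsto_intros l)
    have "eventually (\<lambda>n. x \<le> real n) sequentially"
      using eventually_ge_at_top[of "nat \<lceil>x\<rceil>"] by eventually_elim linarith
    then show "eventually (\<lambda>n. norm (u (real n) - u x) \<le> C * exp (-x)) sequentially"
      by eventually_elim (use u_diff that in auto)
  qed simp
  have Pz: "norm (P z - l) \<le> (2 * norm z * (C * exp (- (9/10 * norm z)))) + C * exp (- norm z)"
    if z: "z \<in> tail \<beta> R" "norm z > max R 0" for z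
  proof -
    define \<rho> where "\<rho> = norm z"
    let ?r = "of_real \<rho> * cis \<beta>"
    have r: "?r \<in> tail \<beta> R" using z by (intro ray_in_tail) (auto simp: \<rho>_def)
    have seg: "closed_segment ?r z \<subseteq> tail \<beta> R"
      using closed_segment_subset_convex_hull r z convex_tail by (meson closed_segment_subset)
    \<comment> \<open>Both ends of the chord lie in the half plane \<open>HS\<close>, hence so does
      the whole chord.\<close>
    have lower: "9/10 * \<rho> \<le> norm w" if "w \<in> closed_segment ?r z" for w
    proof -
      define HS where "HS = {w. inner (cis \<beta>) w \<ge> 9/10 * \<rho>}"
      have HS: "w \<in> HS \<longleftrightarrow> 9/10 * \<rho> \<le> Re (w * cis (-\<beta>))" for w
        by (simp add: HS_def inner_complex_def mult.commute)
      have "convex HS" unfolding HS_def by (rule convex_halfspace_ge)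
      moreover have "?r * cis (-\<beta>) = of_real \<rho>" by (simp add: mult.assoc cis_mult)
      then have "?r \<in> HS" unfolding HS by (simp only:) (simp add: \<rho>_def)
      moreover have "z \<in> HS" using z(1) unfolding HS tail_def \<rho>_def mem_Collect_eq by (elim conjE less_imp_le)
      ultimately have "closed_segment ?r z \<subseteq> HS" by (intro closed_segment_subset)
      with that have "9/10 * \<rho> \<le> Re (w * cis (-\<beta>))" using HS by blast
      then show ?thesis
        using complex_Re_le_cmod[of "w * cis (-\<beta>)"] unfolding norm_mult norm_cis by linarith
    qed
    have "norm (P z - P ?r) \<le> (C * exp (- (9/10 * \<rho>))) * norm (z - ?r)"
    proof (rule field_differentiable_bound[where S = "closed_segment ?r z" and f' = f])
      show "(P has_field_derivative f w) (at w within closed_segment ?r z)" if "w \<in> closed_segment ?r z" for w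
        using P seg that has_field_derivative_at_within by blast
      show "norm (f w) \<le> C * exp (- (9/10 * \<rho>))" if "w \<in> closed_segment ?r z" for w
      proof -
        have "norm (f w) \<le> C * exp (- norm w)" using bnd seg that by auto
        also have "\<dots> \<le> C * exp (- (9/10 * \<rho>))"
          using lower[OF that] \<open>0 \<le> C\<close> by (intro mult_left_mono) auto
        finally show ?thesis .
      qed
    qed auto
    also have "norm (z - ?r) \<le> 2 * \<rho>"
      using norm_triangle_ineq4[of z ?r] by (simp add: \<rho>_def norm_mult)
    finally have "norm (P z - P ?r) \<le> (C * exp (- (9/10 * \<rho>))) * (2 * \<rho>)"
      using \<open>0 \<le> C\<close> by (simp add: mult_left_mono)
    moreover have "norm (l - P ?r) \<le> C * exp (- \<rho>)"
      using ul[of \<rho>] z by (simp add: u_def \<rho>_def)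
    ultimately have "norm (P z - l) \<le> (C * exp (- (9/10 * \<rho>))) * (2 * \<rho>) + C * exp (- \<rho>)"
      by (smt (verit) dist_norm dist_triangle2)
    then show ?thesis by (simp add: \<rho>_def mult_ac)
  qed
  have lim1: "((\<lambda>x::real. (2 * x * (C * exp (- (9/10 * x)))) + C * exp (- x)) \<longlongrightarrow> 0) at_top"
    by real_asymp
  show ?thesis
  proof (rule that[of P l])
    fix c :: "real \<Rightarrow> complex" and F assume c: "filterlim c at_infinity F" "eventually (\<lambda>t. c t \<in> tail \<beta> R) F"
    from c(1) have nc: "filterlim (\<lambda>t. norm (c t)) at_top F"
      by (rule filterlim_at_infinity_imp_norm_at_top)
    have "((\<lambda>t. P (c t) - l) \<longlongrightarrow> 0) F"
    proof (rule Lim_null_comparison)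
      show "((\<lambda>t. (2 * norm (c t) * (C * exp (- (9/10 * norm (c t))))) + C * exp (- norm (c t))) \<longlongrightarrow> 0) F"
        by (rule filterlim_compose[OF lim1 nc])
      have "eventually (\<lambda>t. norm (c t) > max R 0) F"
        using nc unfolding filterlim_at_top_dense by (rule spec)
      with c(2) show "eventually (\<lambda>t. norm (P (c t) - l) \<le> (2 * norm (c t) * (C * exp (- (9/10 * norm (c t))))) + C * exp (- norm (c t))) F"
        by eventually_elim (rule Pz)
    qed
    then show "((\<lambda>t. P (c t)) \<longlongrightarrow> l) F" using LIM_zero_iff by blast
  qed (rule P)
qed

section \<open>Integrals along curves parametrised by the whole line\<close>

definition line_curve :: "(real \<Rightarrow> complex) \<Rightarrow> bool" where
  "line_curve c \<longleftrightarrow> (\<forall>T>0. c piecewise_C1_differentiable_on {-T..T})"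

text \<open>Weaker than \<open>infinite_curve\<close>: the direction has to stay within the aperture
  of the tails, but need not converge to \<alpha> or \<beta>. This admits the rays at 3 pi/5 as
  curves towards 2 pi/3.\<close>

definition cone_curve :: "real \<Rightarrow> real \<Rightarrow> (real \<Rightarrow> complex) \<Rightarrow> bool" where
  "cone_curve \<alpha> \<beta> c \<longleftrightarrow> line_curve c \<and>
     (\<forall>R. eventually (\<lambda>t. c t \<in> tail \<alpha> R) at_bot) \<and> (\<forall>R. eventually (\<lambda>t. c t \<in> tail \<beta> R) at_top)"

lemma line_curve_subinterval:
  "line_curve c \<Longrightarrow> c piecewise_C1_differentiable_on {s..t}"
proof -
  assume c: "line_curve c"
  define T where "T = \<bar>s\<bar> + \<bar>t\<bar> + 1"
  have "T > 0" "{s..t} \<subseteq> {-T..T}" by (auto simp: T_def)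
  with c show ?thesis
    unfolding line_curve_def by (blast intro: piecewise_C1_differentiable_on_subset)
qed

lemma line_curve_continuous_on:
  assumes "line_curve c" shows "continuous_on S c"
proof -
  have "isCont c t" for t
  proof -
    have "continuous_on {t-1..t+1} c"
      using line_curve_subinterval[OF assms, of "t-1" "t+1"] by (simp add: piecewise_C1_differentiable_on_def)
    then show ?thesis by (simp add: continuous_on_interior)
  qed
  then show ?thesis by (simp add: continuous_at_imp_continuous_on)
qed

lemma line_curve_deriv:
  assumes "line_curve c"
  obtains S where "countable S" "\<And>t. t \<notin> S \<Longrightarrow> (c has_vector_derivative vector_derivative c (at t)) (at t)"
proof -
  have "\<exists>S. finite S \<and> (\<forall>t\<in>{-real n..real n} - S. (c has_vector_derivative vector_derivative c (at t)) (at t))" for n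
  proof -
    have "c piecewise_C1_differentiable_on {-real n..real n}" by (rule line_curve_subinterval[OF assms])
    then obtain S where "finite S" "c C1_differentiable_on ({-real n..real n} - S)"
      unfolding piecewise_C1_differentiable_on_def by blast
    then show ?thesis
      unfolding C1_differentiable_on_eq by (auto simp: vector_derivative_works intro!: exI[of _ S])
  qed
  then obtain S where S: "\<And>n. finite (S n)"
    "\<And>n t. t \<in> {-real n..real n} - S n \<Longrightarrow> (c has_vector_derivative vector_derivative c (at t)) (at t)"
    by metis
  show ?thesis
  proof (rule that[of "\<Union>n. S n"])
    show "countable (\<Union>n. S n)" using S(1) by (auto intro: countable_finite)
    fix t assume "t \<notin> (\<Union>n. S n)"
    moreover obtain n where "\<bar>t\<bar> \<le> real n" using real_arch_simple by blast
    ultimately show "(c has_vector_derivative vector_derivative c (at t)) (at t)"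
      by (intro S(2)[of t n]) auto
  qed
qed

definition seg :: "(real \<Rightarrow> complex) \<Rightarrow> real \<Rightarrow> real \<Rightarrow> real \<Rightarrow> complex" where
  "seg c s t = c \<circ> (\<lambda>x. (t - s) *\<^sub>R x + s)"

lemma seg_path:
  assumes "line_curve c" "s < t"
  shows "valid_path (seg c s t)" "path_image (seg c s t) = c ` {s..t}"
    "pathstart (seg c s t) = c s" "pathfinish (seg c s t) = c t"
proof -
  have im: "(\<lambda>x. (t - s) * x + s) ` {0..1} = {s..t}"
    using \<open>s < t\<close> by (simp add: image_affinity_atLeastAtMost)
  show "valid_path (seg c s t)"
    unfolding valid_path_def seg_def
    by (rule piecewise_C1_differentiable_affine) (simp add: im line_curve_subinterval[OF assms(1)])
  show "path_image (seg c s t) = c ` {s..t}"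
    unfolding path_image_def seg_def image_comp[symmetric] using im by simp
qed (simp_all add: seg_def pathstart_def pathfinish_def)

text \<open>Affine change of variables. The chain rule for \<open>seg\<close> holds off the preimage
  of the countable exceptional set of \<open>c\<close>, which is again countable and hence
  null.\<close>

lemma has_integral_seg:
  assumes c: "line_curve c" and "s < t" and f: "(f has_contour_integral i) (seg c s t)"
  shows "((\<lambda>x. f (c x) * vector_derivative c (at x)) has_integral i) {s..t}"
proof -
  define F where "F x = f (c x) * vector_derivative c (at x)" for x
  obtain S where S: "countable S" "\<And>t. t \<notin> S \<Longrightarrow> (c has_vector_derivative vector_derivative c (at t)) (at t)"
    by (rule line_curve_deriv[OF c]) (rule that, assumption+)
  define A where "A = (\<lambda>x. (t - s) * x + s)"
  define S' where "S' = A -` S"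
  have "inj A" using \<open>s < t\<close> by (auto simp: inj_def A_def)
  moreover have "countable (A ` S')"
    using S(1) by (rule countable_subset[rotated]) (auto simp: S'_def)
  ultimately have "countable S'"
    by (meson countable_image_inj_on inj_on_subset subset_UNIV)
  then have neg: "negligible S'"
    by (simp add: negligible_iff_null_sets countable_imp_null_set_lborel null_sets_completionI)
  have 1: "((\<lambda>x. f (seg c s t x) * vector_derivative (seg c s t) (at x)) has_integral i) {0..1}"
    using f unfolding has_contour_integral_def has_integral_localized_vector_derivative .
  have vd: "vector_derivative (seg c s t) (at x) = (t - s) *\<^sub>R vector_derivative c (at (A x))" if "x \<notin> S'" for x
  proof (rule vector_derivative_at)
    have "(A has_vector_derivative (t - s)) (at x)"
      unfolding A_def by (auto intro!: derivative_eq_intros)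
    from vector_diff_chain_at[OF this S(2)[of "A x"]] that
    show "(seg c s t has_vector_derivative (t - s) *\<^sub>R vector_derivative c (at (A x))) (at x)"
      by (simp add: S'_def seg_def A_def)
  qed
  have "((\<lambda>x. (t - s) *\<^sub>R F (A x)) has_integral i) {0..1}"
    by (rule has_integral_spike[OF neg _ 1]) (simp add: vd F_def, simp add: A_def seg_def)
  then have H: "((\<lambda>x. (t - s) *\<^sub>R F (A x)) has_integral i) (cbox 0 1)" by (simp add: box_real)
  have "((\<lambda>x. (t - s) *\<^sub>R F (A ((1/(t-s)) *\<^sub>R x + (- s/(t-s))))) has_integral (inverse (\<bar>1/(t-s)\<bar> ^ DIM(real))) *\<^sub>R i)
     ((\<lambda>x. (1/(1/(t-s))) *\<^sub>R x + -((1/(1/(t-s))) *\<^sub>R (- s/(t-s)))) ` cbox 0 1)"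
    using has_integral_affinity[OF H, of "1/(t-s)" "-s/(t-s)"] \<open>s < t\<close> by simp
  moreover have "A ((1/(t-s)) *\<^sub>R x + (- s/(t-s))) = x" for x
  proof -
    have "(1/(t-s)) *\<^sub>R x + (- s/(t-s)) = (x - s) / (t - s)" by (simp add: diff_divide_distrib)
    then show ?thesis using \<open>s < t\<close> by (simp add: A_def)
  qed
  moreover have "(\<lambda>x. (1/(1/(t-s))) *\<^sub>R x + -((1/(1/(t-s))) *\<^sub>R (- s/(t-s)))) ` cbox 0 1 = {s..t}"
    using \<open>s < t\<close> image_affinity_atLeastAtMost[of "t-s" s 0 1] by (simp add: box_real)
  ultimately have "((\<lambda>x. (t - s) *\<^sub>R F x) has_integral (t - s) *\<^sub>R i) {s..t}"
    using \<open>s < t\<close> by simp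
  then have "((\<lambda>x. (1/(t-s)) *\<^sub>R ((t - s) *\<^sub>R F x)) has_integral (1/(t-s)) *\<^sub>R ((t - s) *\<^sub>R i)) {s..t}"
    by (rule has_integral_cmul)
  then have "(F has_integral i) {s..t}" using \<open>s < t\<close> by simp
  then show ?thesis unfolding F_def[abs_def] .
qed

lemma line_integrand_integrable:
  assumes c: "line_curve c" and k: "k holomorphic_on W" "open W" "c ` {s..t} \<subseteq> W"
  shows "(\<lambda>x. k (c x) * vector_derivative c (at x)) integrable_on {s..t}"
proof (cases "s < t")
  case True
  have "k contour_integrable_on seg c s t"
    by (rule contour_integrable_holomorphic_simple[OF k(1,2)]) (use seg_path[OF c True] k(3) in auto)
  then show ?thesis
    using has_integral_seg[OF c True] has_contour_integral_integral by blast
next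
  case False
  then show ?thesis by (cases "s = t") (auto simp: integrable_on_def intro: has_integral_empty)
qed

lemma line_integral_primitive:
  assumes c: "line_curve c" and "s \<le> t"
    and P: "\<And>x. x \<in> {s..t} \<Longrightarrow> (P has_field_derivative k (c x)) (at (c x))"
  shows "((\<lambda>x. k (c x) * vector_derivative c (at x)) has_integral (P (c t) - P (c s))) {s..t}"
proof -
  obtain S where S: "countable S" "\<And>t. t \<notin> S \<Longrightarrow> (c has_vector_derivative vector_derivative c (at t)) (at t)"
    by (rule line_curve_deriv[OF c]) (rule that, assumption+)
  show ?thesis
  proof (rule fundamental_theorem_of_calculus_countable[where F = "\<lambda>x. P (c x)", OF S(1) \<open>s \<le> t\<close>])
    show "continuous_on {s..t} (\<lambda>x. P (c x))"
    proof (rule continuous_on_compose2[where f = c and g = P])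
      show "continuous_on (c ` {s..t}) P"
      proof (rule continuous_at_imp_continuous_on, rule ballI)
        fix z assume "z \<in> c ` {s..t}"
        then obtain x where "x \<in> {s..t}" "z = c x" by blast
        then show "isCont P z" using DERIV_isCont[OF P[of x]] by simp
      qed
    qed (rule line_curve_continuous_on[OF c], rule order_refl)
    show "((\<lambda>x. P (c x)) has_vector_derivative k (c x) * vector_derivative c (at x)) (at x within {s..t})"
      if "x \<in> {s..t} - S" for x
    proof -
      have "((P \<circ> c) has_vector_derivative vector_derivative c (at x) * k (c x)) (at x)"
        by (rule field_vector_diff_chain_at[OF S(2) P]) (use that in auto)
      then show ?thesis
        unfolding o_def mult.commute[of "k (c x)"] by (rule has_vector_derivative_at_within)
    qed
  qed
qed

lemma cone_curve_at_infinity: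
  assumes "cone_curve \<alpha> \<beta> c"
  shows "filterlim c at_infinity at_bot" "filterlim c at_infinity at_top"
proof -
  have "filterlim (\<lambda>t. norm (c t)) at_top F" if "\<forall>R. eventually (\<lambda>t. c t \<in> tail \<gamma> R) F" for \<gamma> F
    unfolding filterlim_at_top_dense
  proof
    fix Z
    show "eventually (\<lambda>t. norm (c t) > Z) F"
      using that[rule_format, of Z] by eventually_elim (rule tail_norm)
  qed
  then show "filterlim c at_infinity at_bot" "filterlim c at_infinity at_top"
    using assms unfolding cone_curve_def by (blast intro: filterlim_norm_at_top_imp_at_infinity)+
qed

text \<open>On each tail the integral is the increment of a primitive that has a limit along
  \<open>c\<close>; only the middle piece is an honest contour integral over a compact path.\<close>

lemma has_integral_line_tails:
  assumes c: "cone_curve \<alpha> \<beta> c" and k: "k holomorphic_on W" "open W" "range c \<subseteq> W"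
    and "T > 0" and T: "\<And>t. t \<ge> T \<Longrightarrow> c t \<in> tail \<beta> R" "\<And>t. t \<le> -T \<Longrightarrow> c t \<in> tail \<alpha> R"
    and P1: "\<And>z. z \<in> tail \<alpha> R \<Longrightarrow> (P1 has_field_derivative k z) (at z)"
      "((\<lambda>t. P1 (c t)) \<longlongrightarrow> l1) at_bot"
    and P2: "\<And>z. z \<in> tail \<beta> R \<Longrightarrow> (P2 has_field_derivative k z) (at z)"
      "((\<lambda>t. P2 (c t)) \<longlongrightarrow> l2) at_top"
  shows "((\<lambda>t. k (c t) * vector_derivative c (at t)) has_integral
     (contour_integral (seg c (-T) T) k + (l2 - P2 (c T)) + (P1 (c (-T)) - l1))) UNIV"
proof -
  have lc: "line_curve c" using c by (simp add: cone_curve_def)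
  define F where "F t = k (c t) * vector_derivative c (at t)" for t
  have int: "F integrable_on {s..t}" for s t
    unfolding F_def by (rule line_integrand_integrable[OF lc k(1,2)]) (use k(3) in auto)
  define I where "I = contour_integral (seg c (-T) T) k"
  have I: "integral {-T..T} F = I"
  proof -
    have "k contour_integrable_on seg c (-T) T"
      by (rule contour_integrable_holomorphic_simple[OF k(1,2)]) (use seg_path[OF lc, of "-T" T] k(3) \<open>T > 0\<close> in auto)
    from has_integral_seg[OF lc _ has_contour_integral_integral[OF this]] \<open>T > 0\<close> show ?thesis
      unfolding F_def[abs_def] I_def by (intro integral_unique) auto
  qed
  define G where "G t = (if -T \<le> t then integral {-T..t} F else - integral {t..-T} F)" for t
  have "(F has_integral (G t - G s)) {s..t}" if "s \<le> t" for s t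
  proof -
    have comb: "integral {u..v} F + integral {v..w} F = integral {u..w} F" if "u \<le> v" "v \<le> w" for u v w
      using that int by (intro Henstock_Kurzweil_Integration.integral_combine) auto
    have "integral {s..t} F = G t - G s"
      using that comb[of "-T" s t] comb[of s "-T" t] comb[of s t "-T"]
      by (auto simp: G_def algebra_simps)
    with int show ?thesis by (metis has_integral_integral)
  qed
  moreover have "(G \<longlongrightarrow> I + (l2 - P2 (c T))) at_top"
  proof -
    have eq: "G t = I + (P2 (c t) - P2 (c T))" if "t \<ge> T" for t
    proof -
      have "integral {T..t} F = P2 (c t) - P2 (c T)"
        unfolding F_def by (intro integral_unique line_integral_primitive[OF lc that] P2(1) T) auto
      moreover have "integral {-T..T} F + integral {T..t} F = integral {-T..t} F"
        using that \<open>T > 0\<close> int by (intro Henstock_Kurzweil_Integration.integral_combine) auto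
      ultimately show ?thesis using I that \<open>T > 0\<close> by (auto simp: G_def)
    qed
    have "((\<lambda>t. I + (P2 (c t) - P2 (c T))) \<longlongrightarrow> I + (l2 - P2 (c T))) at_top"
      by (intro tendsto_intros P2)
    then show ?thesis
      by (rule Lim_transform_eventually) (use eq in \<open>auto simp: eventually_at_top_linorder intro!: exI[of _ T]\<close>)
  qed
  moreover have "(G \<longlongrightarrow> l1 - P1 (c (-T))) at_bot"
  proof -
    have eq: "G t = P1 (c t) - P1 (c (-T))" if "t \<le> -T" for t
    proof -
      have "integral {t..-T} F = P1 (c (-T)) - P1 (c t)"
        unfolding F_def by (intro integral_unique line_integral_primitive[OF lc that] P1(1) T) auto
      then show ?thesis by (cases "t = -T") (use that in \<open>auto simp: G_def\<close>)
    qed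
    have "((\<lambda>t. P1 (c t) - P1 (c (-T))) \<longlongrightarrow> l1 - P1 (c (-T))) at_bot"
      by (intro tendsto_intros P1)
    then show ?thesis
      by (rule Lim_transform_eventually) (use eq in \<open>auto simp: eventually_at_bot_linorder intro!: exI[of _ "-T"]\<close>)
  qed
  ultimately have A: "(F has_integral (I + (l2 - P2 (c T)) - (l1 - P1 (c (-T))))) UNIV"
    by (rule has_integral_UNIV_limit)
  have eq: "I + (l2 - P2 (c T)) - (l1 - P1 (c (-T))) = I + (l2 - P2 (c T)) + (P1 (c (-T)) - l1)"
    by simp
  have Feq: "F = (\<lambda>t. k (c t) * vector_derivative c (at t))"
    by (rule ext) (rule F_def)
  show ?thesis using A unfolding eq unfolding Feq I_def .
qed

section \<open>Closing up two curves with common ends\<close>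

text \<open>The closed curve \<open>\<Gamma>\<close> follows \<open>c1\<close>, returns along \<open>c2\<close>, and connects the two within the tails.\<close>

definition closing_loop :: "(real \<Rightarrow> complex) \<Rightarrow> (real \<Rightarrow> complex) \<Rightarrow> complex set \<Rightarrow> (real \<Rightarrow> complex) \<Rightarrow> bool" where
  "closing_loop c1 c2 S \<Gamma> \<longleftrightarrow> valid_path \<Gamma> \<and> pathfinish \<Gamma> = pathstart \<Gamma> \<and>
     path_image \<Gamma> \<subseteq> range c1 \<union> range c2 \<union> S \<and>
     (\<forall>k W C. k holomorphic_on W \<and> open W \<and> range c1 \<union> range c2 \<union> S \<subseteq> W \<and> 0 \<le> C \<and>
        (\<forall>z\<in>S. norm (k z) \<le> C * exp (- norm z)) \<longrightarrow>
      (\<lambda>t. k (c1 t) * vector_derivative c1 (at t)) integrable_on UNIV \<and>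
      (\<lambda>t. k (c2 t) * vector_derivative c2 (at t)) integrable_on UNIV \<and>
      line_integral c1 k - line_integral c2 k = contour_integral \<Gamma> k)"

lemma closing_loop_integral:
  assumes "closing_loop c1 c2 S \<Gamma>" "k holomorphic_on W" "open W" "range c1 \<union> range c2 \<union> S \<subseteq> W" "0 \<le> C"
    and "\<And>z. z \<in> S \<Longrightarrow> norm (k z) \<le> C * exp (- norm z)"
  shows "line_integral c1 k - line_integral c2 k = contour_integral \<Gamma> k"
    and "(\<lambda>t. k (c1 t) * vector_derivative c1 (at t)) integrable_on UNIV"
    and "(\<lambda>t. k (c2 t) * vector_derivative c2 (at t)) integrable_on UNIV"
proof -
  have "k holomorphic_on W \<and> open W \<and> range c1 \<union> range c2 \<union> S \<subseteq> W \<and> 0 \<le> C \<and>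
        (\<forall>z\<in>S. norm (k z) \<le> C * exp (- norm z))"
    by (intro conjI ballI assms)
  note * = assms(1)[unfolded closing_loop_def, THEN conjunct2, THEN conjunct2, THEN conjunct2, rule_format, OF this]
  show "line_integral c1 k - line_integral c2 k = contour_integral \<Gamma> k"
    by (rule *[THEN conjunct2, THEN conjunct2])
  show "(\<lambda>t. k (c1 t) * vector_derivative c1 (at t)) integrable_on UNIV"
    by (rule *[THEN conjunct1])
  show "(\<lambda>t. k (c2 t) * vector_derivative c2 (at t)) integrable_on UNIV"
    by (rule *[THEN conjunct2, THEN conjunct1])
qed

text \<open>Both curves see the same limits \<open>l1\<close> and \<open>l2\<close> of the same
  primitives, so these cancel in the difference; what remains is replaced by segments inside the
  convex tails. The curve \<Gamma> is fixed before the integrand \<open>k\<close>: later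
  \<open>k\<close> is \<open>kint w\<close>, and winding numbers of one \<Gamma> are compared for
  different \<open>w\<close>.\<close>

lemma closing_loop_exists:
  assumes c1: "cone_curve \<alpha> \<beta> c1" and c2: "cone_curve \<alpha> \<beta> c2"
  shows "\<exists>\<Gamma>. closing_loop c1 c2 (tail \<alpha> R \<union> tail \<beta> R) \<Gamma>"
proof -
  have lc: "line_curve c1" "line_curve c2" using c1 c2 by (auto simp: cone_curve_def)
  have "eventually (\<lambda>t. c1 t \<in> tail \<beta> R \<and> c2 t \<in> tail \<beta> R) at_top"
    using c1 c2 by (intro eventually_conj) (auto simp: cone_curve_def)
  then obtain T1 where T1: "\<And>t. t \<ge> T1 \<Longrightarrow> c1 t \<in> tail \<beta> R \<and> c2 t \<in> tail \<beta> R"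
    unfolding eventually_at_top_linorder by blast
  have "eventually (\<lambda>t. c1 t \<in> tail \<alpha> R \<and> c2 t \<in> tail \<alpha> R) at_bot"
    using c1 c2 by (intro eventually_conj) (auto simp: cone_curve_def)
  then obtain T2 where T2: "\<And>t. t \<le> T2 \<Longrightarrow> c1 t \<in> tail \<alpha> R \<and> c2 t \<in> tail \<alpha> R"
    unfolding eventually_at_bot_linorder by blast
  define T where "T = \<bar>T1\<bar> + \<bar>T2\<bar> + 1"
  have T: "T > 0" "T \<ge> T1" "-T \<le> T2" by (auto simp: T_def)
  have lp: "closed_segment (c1 T) (c2 T) \<subseteq> tail \<beta> R" "closed_segment (c2 (-T)) (c1 (-T)) \<subseteq> tail \<alpha> R"
    using T1[of T] T2[of "-T"] T by (intro closed_segment_subset convex_tail; simp)+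
  have mT: "-T < T" using T by simp
  note sp1 = seg_path[OF lc(1) mT] and sp2 = seg_path[OF lc(2) mT]
  let ?U = "range c1 \<union> range c2 \<union> tail \<alpha> R \<union> tail \<beta> R"
  have im: "path_image (seg c1 (-T) T) \<subseteq> ?U" "path_image (seg c2 (-T) T) \<subseteq> ?U"
      "path_image (reversepath (seg c2 (-T) T)) \<subseteq> ?U"
      "path_image (linepath (c1 T) (c2 T)) \<subseteq> ?U" "path_image (linepath (c2 (-T)) (c1 (-T))) \<subseteq> ?U"
    using lp unfolding path_image_reversepath sp1(2) sp2(2) path_image_linepath by blast+
  define \<Gamma> where "\<Gamma> = seg c1 (-T) T +++ linepath (c1 T) (c2 T) +++ reversepath (seg c2 (-T) T) +++ linepath (c2 (-T)) (c1 (-T))"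
  have valid: "valid_path \<Gamma>"
    unfolding \<Gamma>_def by (intro valid_path_join valid_path_imp_reverse valid_path_linepath sp1(1) sp2(1))
      (simp_all only: sp1(3,4) sp2(3,4) pathstart_join pathfinish_join pathstart_linepath pathfinish_linepath
        pathstart_reversepath pathfinish_reversepath)
  have closed: "pathfinish \<Gamma> = pathstart \<Gamma>"
    unfolding \<Gamma>_def by (simp only: sp1(3) pathstart_join pathfinish_join pathfinish_linepath)
  have image: "path_image \<Gamma> \<subseteq> range c1 \<union> range c2 \<union> (tail \<alpha> R \<union> tail \<beta> R)"
    unfolding Un_assoc[symmetric] \<Gamma>_def by (intro order_trans[OF path_image_join_subset] Un_least im)
  show ?thesis
    unfolding closing_loop_def
  proof (rule exI[of _ \<Gamma>], rule conjI[OF valid conjI[OF closed conjI[OF image]]], intro allI impI, elim conjE)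
    fix k W C
    assume k: "k holomorphic_on W" "open W" and sub': "range c1 \<union> range c2 \<union> (tail \<alpha> R \<union> tail \<beta> R) \<subseteq> W" and "0 \<le> C"
      and bnd': "\<forall>z\<in>tail \<alpha> R \<union> tail \<beta> R. norm (k z) \<le> C * exp (- norm z)"
    have sub: "range c1 \<union> range c2 \<union> tail \<alpha> R \<union> tail \<beta> R \<subseteq> W" using sub' by blast
    have bnd: "norm (k z) \<le> C * exp (- norm z)" if "z \<in> tail \<alpha> R \<union> tail \<beta> R" for z
      using bnd' that by blast
    have "k holomorphic_on tail \<alpha> R" "k holomorphic_on tail \<beta> R"
      using k(1) sub by (auto intro: holomorphic_on_subset)
    note holo = this
    obtain P1 l1 where P1: "\<And>z. z \<in> tail \<alpha> R \<Longrightarrow> (P1 has_field_derivative k z) (at z)"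
        "\<And>(c::real\<Rightarrow>complex) F. \<lbrakk>filterlim c at_infinity F; eventually (\<lambda>t. c t \<in> tail \<alpha> R) F\<rbrakk> \<Longrightarrow> ((\<lambda>t. P1 (c t)) \<longlongrightarrow> l1) F"
      by (rule tail_primitive[OF holo(1) \<open>0 \<le> C\<close> bnd[OF UnI1]]) (assumption, rule that, assumption+)
    obtain P2 l2 where P2: "\<And>z. z \<in> tail \<beta> R \<Longrightarrow> (P2 has_field_derivative k z) (at z)"
        "\<And>(c::real\<Rightarrow>complex) F. \<lbrakk>filterlim c at_infinity F; eventually (\<lambda>t. c t \<in> tail \<beta> R) F\<rbrakk> \<Longrightarrow> ((\<lambda>t. P2 (c t)) \<longlongrightarrow> l2) F"
      by (rule tail_primitive[OF holo(2) \<open>0 \<le> C\<close> bnd[OF UnI2]]) (assumption, rule that, assumption+)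
    have H: "((\<lambda>t. k (c t) * vector_derivative c (at t)) has_integral
         (contour_integral (seg c (-T) T) k + (l2 - P2 (c T)) + (P1 (c (-T)) - l1))) UNIV"
      if c: "cone_curve \<alpha> \<beta> c" "c = c1 \<or> c = c2" for c
    proof (rule has_integral_line_tails[OF c(1) k _ T(1), where R = R])
      show "((\<lambda>t. P1 (c t)) \<longlongrightarrow> l1) at_bot"
        by (rule P1(2)[OF cone_curve_at_infinity(1)[OF c(1)]]) (use c(1) in \<open>simp add: cone_curve_def\<close>)
      show "((\<lambda>t. P2 (c t)) \<longlongrightarrow> l2) at_top"
        by (rule P2(2)[OF cone_curve_at_infinity(2)[OF c(1)]]) (use c(1) in \<open>simp add: cone_curve_def\<close>)
      show "c t \<in> tail \<beta> R" if "T \<le> t" for t using c(2) T1[of t] T that by auto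
      show "c t \<in> tail \<alpha> R" if "t \<le> -T" for t using c(2) T2[of t] T that by auto
      show "range c \<subseteq> W" using c(2) sub by blast
    qed (rule P1(1) P2(1), assumption)+
    have ci: "k contour_integrable_on p" if "valid_path p" "path_image p \<subseteq> ?U" for p
      by (rule contour_integrable_holomorphic_simple[OF k that(1) order_trans[OF that(2) sub]])
    note ci1 = ci[OF sp1(1) im(1)] and ci2 = ci[OF sp2(1) im(2)]
      and ci2' = ci[OF valid_path_imp_reverse[OF sp2(1)] im(3)]
      and ci3 = ci[OF valid_path_linepath im(4)] and ci4 = ci[OF valid_path_linepath im(5)]
    have I3: "contour_integral (linepath (c1 T) (c2 T)) k = P2 (c2 T) - P2 (c1 T)"
      using contour_integral_unique[OF contour_integral_primitive[OF has_field_derivative_at_within[OF P2(1)]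
          valid_path_linepath lp(1)[folded path_image_linepath]]] by simp
    have I4: "contour_integral (linepath (c2 (-T)) (c1 (-T))) k = P1 (c1 (-T)) - P1 (c2 (-T))"
      using contour_integral_unique[OF contour_integral_primitive[OF has_field_derivative_at_within[OF P1(1)]
          valid_path_linepath lp(2)[folded path_image_linepath]]] by simp
    have "contour_integral \<Gamma> k = contour_integral (seg c1 (-T) T) k + (contour_integral (linepath (c1 T) (c2 T)) k
        + (contour_integral (reversepath (seg c2 (-T) T)) k + contour_integral (linepath (c2 (-T)) (c1 (-T))) k))"
    proof -
      let ?c = "reversepath (seg c2 (-T) T)" and ?d = "linepath (c2 (-T)) (c1 (-T))"
      have v2: "valid_path ?c" by (rule valid_path_imp_reverse[OF sp2(1)])
      have v3: "valid_path (?c +++ ?d)"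
        by (rule valid_path_join[OF v2 valid_path_linepath]) (simp add: sp2(3))
      have v4: "valid_path (linepath (c1 T) (c2 T) +++ ?c +++ ?d)"
        by (rule valid_path_join[OF valid_path_linepath v3]) (simp add: sp2(4))
      have i: "k contour_integrable_on ?c +++ ?d"
        by (rule contour_integrable_joinI[OF ci2' ci4 v2 valid_path_linepath])
      have i': "k contour_integrable_on linepath (c1 T) (c2 T) +++ ?c +++ ?d"
        by (rule contour_integrable_joinI[OF ci3 i valid_path_linepath v3])
      show ?thesis
        unfolding \<Gamma>_def contour_integral_join[OF ci1 i' sp1(1) v4]
          contour_integral_join[OF ci3 i valid_path_linepath v3]
          contour_integral_join[OF ci2' ci4 v2 valid_path_linepath] ..
    qed
    also have "contour_integral (reversepath (seg c2 (-T) T)) k = - contour_integral (seg c2 (-T) T) k"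
      by (rule contour_integral_reversepath[OF sp2(1)])
    finally have G: "contour_integral \<Gamma> k = contour_integral (seg c1 (-T) T) k + (P2 (c2 T) - P2 (c1 T))
        - contour_integral (seg c2 (-T) T) k + (P1 (c1 (-T)) - P1 (c2 (-T)))"
      by (simp add: I3 I4)
    show "(\<lambda>t. k (c1 t) * vector_derivative c1 (at t)) integrable_on UNIV \<and>
      (\<lambda>t. k (c2 t) * vector_derivative c2 (at t)) integrable_on UNIV \<and>
      line_integral c1 k - line_integral c2 k = contour_integral \<Gamma> k"
    proof (intro conjI)
      note H1 = H[OF c1 disjI1[OF refl]] and H2 = H[OF c2 disjI2[OF refl]]
      show "line_integral c1 k - line_integral c2 k = contour_integral \<Gamma> k"
        unfolding line_integral_def integral_unique[OF H1] integral_unique[OF H2] G by simp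
    qed (rule has_integral_integrable[OF H[OF c1 disjI1[OF refl]]] has_integral_integrable[OF H[OF c2 disjI2[OF refl]]])+
  qed
qed

section \<open>Cauchy transforms along wedges\<close>

lemma exp_minus_abs_integrable: "(\<lambda>t::real. exp (- \<bar>t\<bar>)) integrable_on UNIV"
proof -
  define G where "G t = (if t \<le> 0 then exp t - 1 else 1 - exp (-t))" for t :: real
  have cont: "continuous_on S G" for S
  proof -
    have "continuous_on ({..0} \<union> {0..}) G"
      unfolding G_def by (rule continuous_on_cases) (auto intro!: continuous_intros)
    then show ?thesis by (rule continuous_on_subset) auto
  qed
  have der: "(G has_vector_derivative exp (- \<bar>t\<bar>)) (at t)" if "t \<noteq> 0" for t
  proof (cases "t < 0")
    case True
    have "((\<lambda>t. exp t - 1) has_vector_derivative exp (- \<bar>t\<bar>)) (at t)"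
      unfolding has_real_derivative_iff_has_vector_derivative[symmetric]
      using True by (auto intro!: derivative_eq_intros)
    then show ?thesis
      by (rule has_vector_derivative_transform_within_open[of _ _ _ "{..<0}"]) (auto simp: G_def True)
  next
    case False
    then have "t > 0" using that by simp
    have "((\<lambda>t. 1 - exp (-t)) has_vector_derivative exp (- \<bar>t\<bar>)) (at t)"
      unfolding has_real_derivative_iff_has_vector_derivative[symmetric]
      using \<open>t > 0\<close> by (auto intro!: derivative_eq_intros)
    then show ?thesis
      by (rule has_vector_derivative_transform_within_open[of _ _ _ "{0<..}"]) (auto simp: G_def \<open>t > 0\<close>)
  qed
  have "((\<lambda>t::real. exp (- \<bar>t\<bar>)) has_integral (1 - (-1))) UNIV"
  proof (rule has_integral_UNIV_limit)
    show "((\<lambda>t. exp (- \<bar>t\<bar>)) has_integral G t - G s) {s..t}" if "s \<le> t" for s t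
      by (rule fundamental_theorem_of_calculus_countable[of "{0}"])
         (use that cont der in \<open>auto intro: has_vector_derivative_at_within\<close>)
    have "((\<lambda>t::real. 1 - exp (-t)) \<longlongrightarrow> 1) at_top" by real_asymp
    moreover have "eventually (\<lambda>t. 1 - exp (-t) = G t) at_top"
      using eventually_gt_at_top[of 0] by eventually_elim (simp add: G_def)
    ultimately show "(G \<longlongrightarrow> 1) at_top" by (rule Lim_transform_eventually)
    have "((\<lambda>t::real. exp t - 1) \<longlongrightarrow> -1) at_bot" by real_asymp
    moreover have "eventually (\<lambda>t. exp t - 1 = G t) at_bot"
      using eventually_le_at_bot[of 0] by eventually_elim (simp add: G_def)
    ultimately show "(G \<longlongrightarrow> -1) at_bot" by (rule Lim_transform_eventually)
  qed
  then show ?thesis by blast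
qed

lemma cauchy_transform_integrable:
  fixes c \<phi> :: "real \<Rightarrow> complex"
  assumes S: "S \<in> sets lebesgue" and \<phi>: "\<phi> absolutely_integrable_on S" and c: "continuous_on S c"
    and "\<delta> > 0" and \<delta>: "\<And>t. t \<in> S \<Longrightarrow> \<delta> \<le> norm (w - c t)"
  shows "(\<lambda>t. \<phi> t / (w - c t)) absolutely_integrable_on S"
    and "norm (integral S (\<lambda>t. \<phi> t / (w - c t))) \<le> integral S (\<lambda>t. norm (\<phi> t)) / \<delta>"
proof -
  have cont: "continuous_on S (\<lambda>t. 1 / (w - c t))"
    using \<delta> \<open>\<delta> > 0\<close> c by (intro continuous_intros) force+
  have "bounded ((\<lambda>t. 1 / (w - c t)) ` S)"
    unfolding bounded_iff
  proof (intro exI[of _ "1/\<delta>"] ballI, elim imageE)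
    fix x t assume "x = 1 / (w - c t)" "t \<in> S"
    with \<delta>[of t] \<open>\<delta> > 0\<close> show "norm x \<le> 1 / \<delta>" by (simp add: norm_divide frac_le)
  qed
  with cont have "(\<lambda>t. (1 / (w - c t)) * \<phi> t) absolutely_integrable_on S"
    by (intro absolutely_integrable_bounded_measurable_product[OF _ _ S _ \<phi>] continuous_imp_measurable_on_sets_lebesgue S)
       (auto simp: bilinear_times)
  then show 1: "(\<lambda>t. \<phi> t / (w - c t)) absolutely_integrable_on S" by simp
  have "norm (integral S (\<lambda>t. \<phi> t / (w - c t))) \<le> integral S (\<lambda>t. norm (\<phi> t) / \<delta>)"
  proof (rule integral_norm_bound_integral)
    show "(\<lambda>t. \<phi> t / (w - c t)) integrable_on S" using 1 by (rule set_lebesgue_integral_eq_integral(1))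
    show "(\<lambda>t. norm (\<phi> t) / \<delta>) integrable_on S"
    proof -
      have "(\<lambda>t. inverse \<delta> * norm (\<phi> t)) integrable_on S"
        using \<phi> by (intro integrable_on_mult_right) (simp add: absolutely_integrable_on_def)
      then show ?thesis by (simp add: divide_inverse mult.commute)
    qed
    show "norm (\<phi> t / (w - c t)) \<le> norm (\<phi> t) / \<delta>" if "t \<in> S" for t
      using \<delta>[OF that] \<open>\<delta> > 0\<close> by (simp add: norm_divide frac_le)
  qed
  then show "norm (integral S (\<lambda>t. \<phi> t / (w - c t))) \<le> integral S (\<lambda>t. norm (\<phi> t)) / \<delta>" by simp
qed

text \<open>The error of the difference quotient at \<open>w0\<close> is exactly w - w0 times a
  further Cauchy transform, whose density has been divided twice by w0 - c t. For w within
  \<delta>/2 of \<open>w0\<close> the distance to the curve is still \<delta>/2, which bounds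
  it.\<close>

lemma cauchy_transform_holomorphic:
  fixes c \<phi> :: "real \<Rightarrow> complex"
  assumes S: "S \<in> sets lebesgue" and \<phi>: "\<phi> absolutely_integrable_on S" and c: "continuous_on S c"
    and U: "open U" "\<And>w. w \<in> U \<Longrightarrow> \<exists>\<delta>>0. \<forall>t\<in>S. \<delta> \<le> norm (w - c t)"
  shows "(\<lambda>w. integral S (\<lambda>t. \<phi> t / (w - c t))) holomorphic_on U"
  unfolding holomorphic_on_open[OF U(1)]
proof
  fix w0 assume "w0 \<in> U"
  then obtain \<delta> where \<delta>: "\<delta> > 0" "\<And>t. t \<in> S \<Longrightarrow> \<delta> \<le> norm (w0 - c t)" using U(2) by meson
  define F where "F w = integral S (\<lambda>t. \<phi> t / (w - c t))" for w
  note i0 = cauchy_transform_integrable[OF S \<phi> c \<delta>]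
  note i1 = cauchy_transform_integrable[OF S i0(1) c \<delta>]
  define D where "D = - integral S (\<lambda>t. \<phi> t / (w0 - c t) / (w0 - c t))"
  define M where "M = integral S (\<lambda>t. norm (\<phi> t / (w0 - c t) / (w0 - c t))) / (\<delta>/2)"
  have near: "norm ((F w - F w0) / (w - w0) - D) \<le> M * norm (w - w0)" if w: "w \<noteq> w0" "norm (w - w0) < \<delta>/2" for w
  proof -
    have \<delta>': "\<delta>/2 \<le> norm (w - c t)" if "t \<in> S" for t
    proof -
      have "norm (w0 - c t) \<le> norm (w - c t) + norm (w - w0)"
        by (metis add.commute diff_add_cancel norm_minus_commute norm_triangle_ineq add_diff_eq)
      then show ?thesis using \<delta>(2)[OF that] w by linarith
    qed
    have "\<delta>/2 > 0" using \<delta> by simp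
    note j = cauchy_transform_integrable[OF S \<phi> c \<open>\<delta>/2 > 0\<close> \<delta>']
    note j2 = cauchy_transform_integrable[OF S i1(1) c \<open>\<delta>/2 > 0\<close> \<delta>']
    note ii = set_lebesgue_integral_eq_integral(1)
    have ne: "w \<noteq> c t" "w0 \<noteq> c t" if "t \<in> S" for t using \<delta>'[OF that] \<delta>(2)[OF that] \<delta>(1) by auto
    have "F w - F w0 - D * (w - w0) = (w - w0)^2 * integral S (\<lambda>t. \<phi> t / (w0 - c t) / (w0 - c t) / (w - c t))"
    proof -
      have "F w - F w0 - D * (w - w0) = integral S (\<lambda>t. \<phi> t / (w - c t) - \<phi> t / (w0 - c t) + (w - w0) * (\<phi> t / (w0 - c t) / (w0 - c t)))"
      proof -
        have "((\<lambda>t. \<phi> t / (w - c t) - \<phi> t / (w0 - c t) + (w - w0) * (\<phi> t / (w0 - c t) / (w0 - c t)))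
          has_integral (F w - F w0 + (w - w0) * (- D))) S"
          unfolding F_def D_def minus_minus
          by (intro has_integral_add has_integral_diff has_integral_mult_right integrable_integral
              ii[OF j(1)] ii[OF i0(1)] ii[OF i1(1)])
        then show ?thesis by (simp add: integral_unique algebra_simps)
      qed
      also have "\<dots> = integral S (\<lambda>t. (w - w0)^2 * (\<phi> t / (w0 - c t) / (w0 - c t) / (w - c t)))"
      proof (rule integral_cong)
        fix t assume "t \<in> S"
        have id: "x / A - x / B + (A - B) * (x / B / B) = (A - B)^2 * (x / B / B / A)" if "A \<noteq> 0" "B \<noteq> 0" for x A B :: complex
          using that by (simp add: divide_simps power2_eq_square) (simp add: algebra_simps)
        show "\<phi> t / (w - c t) - \<phi> t / (w0 - c t) + (w - w0) * (\<phi> t / (w0 - c t) / (w0 - c t))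
            = (w - w0)^2 * (\<phi> t / (w0 - c t) / (w0 - c t) / (w - c t))"
          using id[of "w - c t" "w0 - c t" "\<phi> t"] ne[OF \<open>t \<in> S\<close>] by simp
      qed
      finally show ?thesis by (simp only: integral_mult_right)
    qed
    then have "(F w - F w0) / (w - w0) - D = (w - w0) * integral S (\<lambda>t. \<phi> t / (w0 - c t) / (w0 - c t) / (w - c t))"
      using w(1) by (simp add: field_simps power2_eq_square)
    also have "norm \<dots> = norm (w - w0) * norm (integral S (\<lambda>t. \<phi> t / (w0 - c t) / (w0 - c t) / (w - c t)))"
      by (rule norm_mult)
    also have "\<dots> \<le> norm (w - w0) * M"
      unfolding M_def by (rule mult_left_mono[OF j2(2) norm_ge_zero])
    finally show ?thesis by (simp add: mult.commute)
  qed
  have "((\<lambda>w. (F w - F w0) / (w - w0) - D) \<longlongrightarrow> 0) (at w0)"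
  proof (rule Lim_null_comparison)
    show "eventually (\<lambda>w. norm ((F w - F w0) / (w - w0) - D) \<le> M * norm (w - w0)) (at w0)"
      unfolding eventually_at using \<delta>(1)
      by (intro exI[of _ "\<delta>/2"]) (use near in \<open>auto simp: dist_norm\<close>)
    show "((\<lambda>w. M * norm (w - w0)) \<longlongrightarrow> 0) (at w0)"
      by (auto intro!: tendsto_eq_intros)
  qed
  then have "(F has_field_derivative D) (at w0)"
    unfolding has_field_derivative_iff by (rule LIM_zero_cancel)
  then show "\<exists>f'. ((\<lambda>w. integral S (\<lambda>t. \<phi> t / (w - c t))) has_field_derivative f') (at w0)"
    unfolding F_def by blast
qed

section \<open>Curves made of two rays\<close>

definition vee :: "complex \<Rightarrow> real \<Rightarrow> real \<Rightarrow> real \<Rightarrow> real \<Rightarrow> complex" where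
  "vee p D \<alpha> \<beta> t = p + of_real (D * \<bar>t\<bar>) * cis (if t < 0 then \<alpha> else \<beta>)"

definition vee_deriv :: "real \<Rightarrow> real \<Rightarrow> real \<Rightarrow> real \<Rightarrow> complex" where
  "vee_deriv D \<alpha> \<beta> t = (if t < 0 then - of_real D * cis \<alpha> else of_real D * cis \<beta>)"

lemma vee_has_derivative:
  assumes "t \<noteq> 0"
  shows "(vee p D \<alpha> \<beta> has_vector_derivative vee_deriv D \<alpha> \<beta> t) (at t)"
proof (cases "t < 0")
  case True
  have "((\<lambda>t. p + of_real (D * (-t)) * cis \<alpha>) has_vector_derivative vee_deriv D \<alpha> \<beta> t) (at t)"
    using True by (auto intro!: derivative_eq_intros simp: vee_deriv_def)
  then show ?thesis
    by (rule has_vector_derivative_transform_within_open[of _ _ _ "{..<0}"]) (auto simp: vee_def True)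
next
  case False
  then have "t > 0" using assms by simp
  have "((\<lambda>t. p + of_real (D * t) * cis \<beta>) has_vector_derivative vee_deriv D \<alpha> \<beta> t) (at t)"
    using \<open>t > 0\<close> by (auto intro!: derivative_eq_intros simp: vee_deriv_def)
  then show ?thesis
    by (rule has_vector_derivative_transform_within_open[of _ _ _ "{0<..}"]) (auto simp: vee_def \<open>t > 0\<close>)
qed

lemma vee_continuous: "continuous_on S (vee p D \<alpha> \<beta>)"
proof -
  have "continuous_on ({..0} \<union> {0..}) (\<lambda>t. if t \<in> {..0} then p + of_real (D * (-t)) * cis \<alpha> else p + of_real (D * t) * cis \<beta>)"
    by (rule continuous_on_cases) (auto intro!: continuous_intros)
  moreover have "vee p D \<alpha> \<beta> = (\<lambda>t. if t \<in> {..0} then p + of_real (D * (-t)) * cis \<alpha> else p + of_real (D * t) * cis \<beta>)"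
    by (auto simp: vee_def fun_eq_iff)
  moreover have "{..0} \<union> {0..} = (UNIV :: real set)" by auto
  ultimately show ?thesis by (metis continuous_on_subset subset_UNIV)
qed

lemma vee_deriv_continuous: "0 \<notin> S \<Longrightarrow> continuous_on S (vee_deriv D \<alpha> \<beta>)"
proof -
  assume "0 \<notin> S"
  have "continuous_on ({..<0} \<union> {0<..}) (vee_deriv D \<alpha> \<beta>)"
  proof (rule continuous_on_open_Un)
    show "continuous_on {..<0} (vee_deriv D \<alpha> \<beta>)"
      by (rule continuous_on_eq[of _ "\<lambda>_. - of_real D * cis \<alpha>"]) (auto simp: vee_deriv_def)
    show "continuous_on {0<..} (vee_deriv D \<alpha> \<beta>)"
      by (rule continuous_on_eq[of _ "\<lambda>_. of_real D * cis \<beta>"]) (auto simp: vee_deriv_def)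
  qed auto
  then show ?thesis
  proof (rule continuous_on_subset, intro subsetI)
    fix x assume "x \<in> S"
    with \<open>0 \<notin> S\<close> have "x \<noteq> 0" by blast
    then show "x \<in> {..<0} \<union> {0<..}" by auto
  qed
qed

lemma vee_line_curve: "line_curve (vee p D \<alpha> \<beta>)"
  unfolding line_curve_def piecewise_C1_differentiable_on_def C1_differentiable_on_def
  by (intro allI impI conjI vee_continuous exI[of _ "{0}"] exI[of _ "vee_deriv D \<alpha> \<beta>"] ballI vee_has_derivative vee_deriv_continuous) auto

text \<open>The vertex \<open>p\<close> changes each side of the tail condition by a bounded amount;
  the margin D (k - 9/10) r grows without bound and absorbs this.\<close>

lemma ray_eventually_in_tail:
  assumes "D > 0" "9/10 < cos (\<alpha> - \<alpha>')"
  shows "eventually (\<lambda>r. p + of_real (D * r) * cis \<alpha> \<in> tail \<alpha>' R) at_top"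
proof -
  define k where "k = cos (\<alpha> - \<alpha>')"
  have Re: "Re ((p + of_real (D * r) * cis \<alpha>) * cis (-\<alpha>')) = Re (p * cis (-\<alpha>')) + D * r * k" for r
  proof -
    have "(p + of_real (D * r) * cis \<alpha>) * cis (-\<alpha>') = p * cis (-\<alpha>') + of_real (D * r) * cis (\<alpha> - \<alpha>')"
      by (simp add: algebra_simps cis_mult)
    then show ?thesis by (simp add: k_def)
  qed
  have "filterlim (\<lambda>r. D * (k - 9/10) * r) at_top at_top" "filterlim (\<lambda>r. D * k * r) at_top at_top"
    using assms by (auto intro!: filterlim_tendsto_pos_mult_at_top[OF tendsto_const _ filterlim_ident] simp: k_def)
  then have "eventually (\<lambda>r. D * (k - 9/10) * r > 2 * norm p) at_top" "eventually (\<lambda>r. D * k * r > R + norm p) at_top"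
    unfolding filterlim_at_top_dense by auto
  then show ?thesis using eventually_ge_at_top[of 0]
  proof eventually_elim
    case (elim r)
    have "- norm p \<le> Re (p * cis (-\<alpha>'))"
      using complex_Re_le_cmod[of "- (p * cis (-\<alpha>'))"] by (simp only: norm_minus_cancel norm_mult norm_cis uminus_complex.sel mult_1_right)
    moreover have "norm (p + of_real (D * r) * cis \<alpha>) \<le> norm p + D * r"
      using norm_triangle_ineq[of p "of_real (D * r) * cis \<alpha>"] elim assms by (simp add: norm_mult)
    moreover define y where "y = D * r"
    moreover have "k * y - 9/10 * y > 2 * norm p" "k * y > R + norm p" "D * r * k = k * y"
      using elim by (simp_all add: y_def algebra_simps)
    moreover have "norm p \<ge> 0" by simp
    ultimately show ?case
      unfolding tail_def mem_Collect_eq Re by linarith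
  qed
qed

lemma vee_cone_curve:
  assumes "D > 0" "9/10 < cos (\<alpha> - \<alpha>')" "9/10 < cos (\<beta> - \<beta>')"
  shows "cone_curve \<alpha>' \<beta>' (vee p D \<alpha> \<beta>)"
  unfolding cone_curve_def
proof (intro conjI allI vee_line_curve)
  fix R
  have "eventually (\<lambda>r. p + of_real (D * r) * cis \<beta> \<in> tail \<beta>' R) at_top"
    using assms by (intro ray_eventually_in_tail)
  then show "eventually (\<lambda>t. vee p D \<alpha> \<beta> t \<in> tail \<beta>' R) at_top"
    using eventually_ge_at_top[of 0] by eventually_elim (simp add: vee_def)
  have "eventually (\<lambda>r. p + of_real (D * r) * cis \<alpha> \<in> tail \<alpha>' R) at_top"
    using assms by (intro ray_eventually_in_tail)
  then have "eventually (\<lambda>t. p + of_real (D * (-t)) * cis \<alpha> \<in> tail \<alpha>' R) at_bot"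
    by (simp add: at_bot_mirror eventually_filtermap)
  then show "eventually (\<lambda>t. vee p D \<alpha> \<beta> t \<in> tail \<alpha>' R) at_bot"
    using eventually_gt_at_bot[of 0] by eventually_elim (simp add: vee_def)
qed

text \<open>Points of the curve near a limit point l have norm below norm l + 1, so they lie on a
  compact part of the curve.\<close>

lemma closed_range_cone_curve:
  assumes c: "cone_curve \<alpha> \<beta> c"
  shows "closed (range c)"
  unfolding closed_sequential_limits
proof (intro allI impI; elim conjE)
  fix x l assume x: "\<forall>n. x n \<in> range c" and l: "x \<longlonglongrightarrow> l"
  have "eventually (\<lambda>t. c t \<in> tail \<alpha> (norm l + 1)) at_bot" "eventually (\<lambda>t. c t \<in> tail \<beta> (norm l + 1)) at_top"
    using c by (auto simp: cone_curve_def)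
  then obtain S T where S: "\<And>t. t \<le> S \<Longrightarrow> c t \<in> tail \<alpha> (norm l + 1)" and T: "\<And>t. t \<ge> T \<Longrightarrow> c t \<in> tail \<beta> (norm l + 1)"
    unfolding eventually_at_bot_linorder eventually_at_top_linorder by blast
  have cl: "closed (c ` {S..T})"
    using c by (intro compact_imp_closed compact_continuous_image line_curve_continuous_on) (auto simp: cone_curve_def)
  have "eventually (\<lambda>n. dist (x n) l < 1) sequentially"
    using l by (simp add: tendsto_iff)
  then have "eventually (\<lambda>n. x n \<in> c ` {S..T}) sequentially"
  proof eventually_elim
    case (elim n)
    obtain t where t: "x n = c t" using x by blast
    have "norm (c t) < norm l + 1"
      using elim norm_triangle_ineq2[of "x n" l] by (simp add: t dist_norm)
    then have "\<not> t \<le> S" "\<not> T \<le> t" using tail_norm[OF S[of t]] tail_norm[OF T[of t]] by auto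
    then show ?case by (auto simp: t)
  qed
  then have "l \<in> c ` {S..T}"
    using Lim_in_closed_set[OF cl _ _ l] by auto
  then show "l \<in> range c" by auto
qed

section \<open>Decay of the cubic exponential\<close>

text \<open>With x = Re y and n = norm y one has Re (y^3) = x (4 x^2 - 3 n^2), and x > 9 n / 10
  makes this at least 0.216 n^3.\<close>

lemma tail_cubic:
  assumes "z \<in> tail \<beta> R" "y = z * cis (-\<beta>)"
  shows "norm z ^ 3 / 5 \<le> Re (y^3)"
proof -
  define x where "x = Re y"
  define n where "n = norm z"
  have ny: "norm y = n" by (simp add: assms(2) norm_mult n_def)
  have x: "9/10 * n < x" using assms by (simp add: tail_def x_def n_def)
  have n: "0 \<le> n" by (simp add: n_def)
  have "n\<^sup>2 = x\<^sup>2 + (Im y)\<^sup>2" unfolding ny[symmetric] x_def by (rule cmod_power2)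
  then have "Re (y^3) = x * (4 * x\<^sup>2 - 3 * n\<^sup>2)"
    by (simp add: x_def power3_eq_cube power2_eq_square algebra_simps)
  moreover have "(9/10 * n) * (4 * (9/10 * n)\<^sup>2 - 3 * n\<^sup>2) \<le> x * (4 * x\<^sup>2 - 3 * n\<^sup>2)"
  proof (rule mult_mono)
    have "(9/10 * n)\<^sup>2 \<le> x\<^sup>2" using x n by (intro power_mono) auto
    then show "4 * (9/10 * n)\<^sup>2 - 3 * n\<^sup>2 \<le> 4 * x\<^sup>2 - 3 * n\<^sup>2" by simp
    show "0 \<le> 4 * (9/10 * n)\<^sup>2 - 3 * n\<^sup>2" by (simp add: power2_eq_square algebra_simps)
  qed (use x n in auto)
  moreover have "n ^ 3 / 5 \<le> (9/10 * n) * (4 * (9/10 * n)\<^sup>2 - 3 * n\<^sup>2)"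
    using zero_le_power[OF n, of 3] by (simp add: power2_eq_square power3_eq_cube algebra_simps)
  ultimately show ?thesis by (simp add: n_def)
qed

lemma tail_Re_Im:
  assumes "z \<in> tail \<beta> R"
  shows "\<bar>Im (z * cis (-\<beta>))\<bar> \<le> 11/25 * norm z" "9/10 * norm z < Re (z * cis (-\<beta>))" "0 < norm z"
proof -
  define y where "y = z * cis (-\<beta>)"
  have ny: "norm y = norm z" by (simp add: y_def norm_mult)
  show x: "9/10 * norm z < Re (z * cis (-\<beta>))" using assms by (simp add: tail_def)
  have "(Im y)\<^sup>2 = (norm z)\<^sup>2 - (Re y)\<^sup>2" using cmod_power2[of y] ny by simp
  moreover have "(9/10 * norm z)\<^sup>2 \<le> (Re y)\<^sup>2"
    using x unfolding y_def by (intro power_mono) auto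
  \<comment> \<open>The constant 11/25 works because 1 - 81/100 = 0.19 is below 121/625 =
    0.1936.\<close>
  moreover have "(9/10 * norm z)\<^sup>2 = 81/100 * (norm z)\<^sup>2" "(11/25 * norm z)\<^sup>2 = 121/625 * (norm z)\<^sup>2"
    by (simp_all add: power2_eq_square)
  moreover have "0 \<le> (norm z)\<^sup>2" by simp
  ultimately have "(Im y)\<^sup>2 \<le> (11/25 * norm z)\<^sup>2" by linarith
  then have "\<bar>Im y\<bar> \<le> \<bar>11/25 * norm z\<bar>" by (simp only: abs_le_square_iff)
  then show "\<bar>Im (z * cis (-\<beta>))\<bar> \<le> 11/25 * norm z" by (simp add: y_def)
  show "0 < norm z" using x by (cases "z = 0") auto
qed

text \<open>Directions in these tails differ from \<plusminus> pi/3 by less than pi/6, so the tails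
  stay away from both axes; 1/20 is a rational lower bound for the cosine of the extreme angle. The
  sign \<sigma> treats both tails together.\<close>

lemma tail_pi_third:
  assumes "z \<in> tail (pi/3) R \<or> z \<in> tail (-pi/3) R"
  shows "norm z / 20 \<le> Re z" "Im z \<noteq> 0"
proof -
  have c: "cos (pi/3) = 1/2" "sin (pi/3) = sqrt 3 / 2" by (rule cos_60 sin_60)+
  have s3: "sqrt 3 < 17321/10000" by (rule real_less_lsqrt) (simp_all add: power2_eq_square)
  have s3': "1732/1000 < sqrt 3" by (rule real_less_rsqrt) (simp add: power2_eq_square)
  obtain \<sigma> where \<sigma>: "\<sigma> = 1 \<or> \<sigma> = (-1::real)" and t: "z \<in> tail (\<sigma> * pi/3) R" using assms
    by (metis mult.left_neutral mult_minus1 )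
  define x y where "x = Re (z * cis (- (\<sigma> * pi/3)))" and "y = Im (z * cis (- (\<sigma> * pi/3)))"
  have "z = Complex x y * cis (\<sigma> * pi/3)"
    unfolding x_def y_def complex_surj by (simp add: mult.assoc cis_mult)
  then have "Re z = x * cos (\<sigma> * pi/3) - y * sin (\<sigma> * pi/3)" "Im z = x * sin (\<sigma> * pi/3) + y * cos (\<sigma> * pi/3)"
    by simp_all
  moreover have "cos (\<sigma> * pi/3) = 1/2" "sin (\<sigma> * pi/3) = \<sigma> * sqrt 3 / 2" using \<sigma> c by auto
  ultimately have R: "Re z = x / 2 - \<sigma> * (y * sqrt 3) / 2" "Im z = \<sigma> * (x * sqrt 3) / 2 + y / 2" by simp_all
  note xy = tail_Re_Im[OF t, folded x_def y_def]
  have "\<bar>y * sqrt 3\<bar> \<le> (11/25 * norm z) * (17321/10000)"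
    unfolding abs_mult using xy s3 s3' by (intro mult_mono) auto
  moreover have "x * sqrt 3 \<ge> (9/10 * norm z) * (1732/1000)" using xy s3 s3' by (intro mult_mono) auto
  moreover define u v where "u = x * sqrt 3" and "v = y * sqrt 3"
  moreover have "\<bar>y\<bar> \<le> 11/25 * norm z" "9/10 * norm z < x" "0 < norm z" by (rule xy)+
  ultimately have b: "v \<le> 11/25 * norm z * (17321/10000)" "- v \<le> 11/25 * norm z * (17321/10000)" "9/10 * norm z * (1732/1000) \<le> u"
      "y \<le> 11/25 * norm z" "- y \<le> 11/25 * norm z" "9/10 * norm z < x" "0 < norm z"
    by (simp_all add: abs_le_iff)
  have R': "Re z = x / 2 - \<sigma> * v / 2" "Im z = \<sigma> * u / 2 + y / 2" using R by (simp_all add: u_def v_def)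
  show "norm z / 20 \<le> Re z" using \<sigma>
  proof
    assume "\<sigma> = 1" then show ?thesis using b R'(1) by simp
  next
    assume "\<sigma> = -1" then show ?thesis using b R'(1) by simp
  qed
  show "Im z \<noteq> 0" using \<sigma>
  proof
    assume "\<sigma> = 1"
    moreover have "u / 2 + y / 2 > 0" using b(3,5,7) by linarith
    ultimately show ?thesis using R'(2) by simp
  next
    assume "\<sigma> = -1"
    moreover have "- u / 2 + y / 2 < 0" using b(3,4,7) by linarith
    ultimately show ?thesis using R'(2) by simp
  qed
qed

lemma tail_uminus: "z \<in> tail \<beta> R \<Longrightarrow> cis \<beta>' = - cis \<beta> \<Longrightarrow> - z \<in> tail \<beta>' R"
proof -
  assume z: "z \<in> tail \<beta> R" and c: "cis \<beta>' = - cis \<beta>"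
  have "cis (-\<beta>') = - cis (-\<beta>)" using c by (metis cis_cnj complex_cnj_minus)
  then have "- z * cis (-\<beta>') = z * cis (-\<beta>)" by simp
  then show ?thesis using z unfolding tail_def mem_Collect_eq norm_minus_cancel by simp
qed

lemma cis_two_thirds: "cis (-pi/3) = - cis (2*pi/3)" "cis (pi/3) = - cis (-2*pi/3)"
proof -
  have "cis (2*pi/3 - pi) = - cis (2*pi/3)" unfolding cis_divide[symmetric] cis_pi by simp
  moreover have "2*pi/3 - pi = -pi/3" by (simp add: field_simps)
  ultimately show "cis (-pi/3) = - cis (2*pi/3)" by simp
  have "cis (-2*pi/3 + pi) = - cis (-2*pi/3)" unfolding cis_mult[symmetric] cis_pi by simp
  moreover have "-2*pi/3 + pi = pi/3" by (simp add: field_simps)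
  ultimately show "cis (pi/3) = - cis (-2*pi/3)" by simp
qed

lemma tail_two_pi_third:
  assumes "z \<in> tail (-2*pi/3) R \<or> z \<in> tail (2*pi/3) R"
  shows "Re z \<le> - norm z / 20" "Im z \<noteq> 0"
proof -
  have "- z \<in> tail (pi/3) R \<or> - z \<in> tail (-pi/3) R"
    using assms tail_uminus cis_two_thirds by blast
  from tail_pi_third[OF this] show "Re z \<le> - norm z / 20" "Im z \<noteq> 0" by auto
qed

text \<open>15 = 3 * 5 combines the 1/3 of the exponent with the 1/5 of \<open>tail_cubic\<close>.
  For r \<ge> 15 (|\<xi>| + 1) the cubic term dominates (|\<xi>| + 1) r, which pays for the linear
  term and leaves -r.\<close>

lemma tail_exp_decay:
  fixes \<xi> r X Y :: real
  assumes "r \<ge> 15 * (\<bar>\<xi>\<bar> + 1)" "X \<le> - (r^3/15)" "Y \<le> \<bar>\<xi>\<bar> * r"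
  shows "exp (X + Y) \<le> exp (- r)"
proof -
  define A where "A = \<bar>\<xi>\<bar>"
  have "A \<ge> 0" "15 * (A + 1) \<le> r" using assms(1) by (simp_all add: A_def)
  then have r: "1 \<le> r" by simp
  have "15 * (\<bar>\<xi>\<bar> + 1) * r \<le> r * r" using assms(1) r by (intro mult_right_mono) auto
  also have "\<dots> \<le> r * r * r" using r by (simp add: mult_ge1_I)
  finally have "(\<bar>\<xi>\<bar> + 1) * r \<le> r^3 / 15" by (simp add: power3_eq_cube algebra_simps)
  then show ?thesis using assms(2,3) by (simp add: algebra_simps)
qed

text \<open>Rotation by -\<beta> with 3 \<beta> = \<plusminus> 2 pi leaves z^3 unchanged, so
  \<open>tail_cubic\<close> bounds Re (z^3) itself.\<close>

lemma exp_decay_left: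
  assumes z: "z \<in> tail (-2*pi/3) R \<or> z \<in> tail (2*pi/3) R" and r: "norm z \<ge> 15 * (\<bar>\<xi>\<bar> + 1)"
  shows "norm (exp (- (z^3) / 3 + of_real \<xi> * z)) \<le> exp (- norm z)"
proof -
  obtain \<beta> where \<beta>: "z \<in> tail \<beta> R" "cis (3 * \<beta>) = 1"
  proof -
    have "3 * (-2*pi/3) = - (2*pi)" "3 * (2*pi/3) = 2*pi" by simp_all
    then have "cis (3 * (-2*pi/3)) = 1" "cis (3 * (2*pi/3)) = 1"
      by (simp_all only: cis_2pi cis_cnj[symmetric]) simp
    with z that show ?thesis by blast
  qed
  have "cis (-\<beta>) ^ 3 = cnj (cis (3 * \<beta>))" by (simp add: Complex.DeMoivre cis_cnj)
  then have "cis (-\<beta>) ^ 3 = 1" using \<beta>(2) by simp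
  then have "(z * cis (-\<beta>))^3 = z^3" by (simp add: power_mult_distrib)
  then have "norm z ^ 3 / 5 \<le> Re (z^3)" using tail_cubic[OF \<beta>(1) refl] by simp
  moreover have "\<xi> * Re z \<le> \<bar>\<xi>\<bar> * norm z"
    using mult_left_mono[OF abs_Re_le_cmod[of z] abs_ge_zero[of \<xi>]] abs_ge_self[of "\<xi> * Re z"]
    unfolding abs_mult by linarith
  ultimately show ?thesis
    using tail_exp_decay[of \<xi> "norm z" "- Re (z^3) / 3" "\<xi> * Re z"] r by simp
qed

lemma exp_decay_right:
  assumes z: "z \<in> tail (pi/3) R \<or> z \<in> tail (-pi/3) R" and r: "norm z \<ge> 15 * (\<bar>\<xi>\<bar> + 1)"
  shows "norm (exp (z^3 / 3 - of_real \<xi> * z)) \<le> exp (- norm z)"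
proof -
  have "cis (2*pi/3) = - cis (-pi/3)" "cis (-2*pi/3) = - cis (pi/3)" using cis_two_thirds by simp_all
  then have "- z \<in> tail (-2*pi/3) R \<or> - z \<in> tail (2*pi/3) R"
    using z tail_uminus by blast
  from exp_decay_left[OF this, of \<xi>] r show ?thesis by simp
qed

lemma ratio_power_bound:
  fixes z :: complex and a b :: real
  assumes "norm z \<ge> \<bar>b\<bar> + 2 * \<bar>a\<bar> + 1"
  shows "norm (((z - of_real b) / (z - of_real a)) ^ m) \<le> 2 ^ m"
proof -
  have "norm (z - of_real b) \<le> norm z + \<bar>b\<bar>" using norm_triangle_ineq4[of z "of_real b"] by simp
  moreover have "norm z - \<bar>a\<bar> \<le> norm (z - of_real a)" using norm_triangle_ineq2[of z "of_real a"] by simp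
  ultimately have "norm (z - of_real b) \<le> 2 * norm (z - of_real a)" "0 < norm (z - of_real a)" using assms by linarith+
  then have "norm ((z - of_real b) / (z - of_real a)) \<le> 2" by (simp add: norm_divide divide_simps)
  then show ?thesis by (simp only: norm_power) (rule power_mono, auto)
qed

section \<open>Countability of transversal visits to a point\<close>

lemma separated_countable:
  fixes A :: "real set"
  assumes "e > 0" and sep: "\<And>s t. s \<in> A \<Longrightarrow> t \<in> A \<Longrightarrow> s \<noteq> t \<Longrightarrow> e \<le> \<bar>s - t\<bar>"
  shows "countable A"
proof -
  have "inj_on (\<lambda>t. \<lfloor>t / e\<rfloor>) A"
  proof (rule inj_onI, rule ccontr)
    fix s t assume st: "s \<in> A" "t \<in> A" "\<lfloor>s / e\<rfloor> = \<lfloor>t / e\<rfloor>" "s \<noteq> t"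
    then have "\<bar>s / e - t / e\<bar> < 1" by linarith
    then have "\<bar>s - t\<bar> < e" using \<open>e > 0\<close> by (simp add: diff_divide_distrib[symmetric] abs_divide divide_less_eq)
    with sep[OF st(1,2,4)] show False by simp
  qed
  then show ?thesis by (rule countable_image_inj_on[rotated]) simp
qed

text \<open>A visit to \<open>p\<close> with nonzero velocity is isolated among all visits. Visits
  isolated at scale 1 / (n + 1) are separated by that distance, hence countable, and the union over
  n exhausts them.\<close>

lemma countable_transversal_hits:
  fixes c :: "real \<Rightarrow> complex"
  assumes "\<And>t. t \<in> A \<Longrightarrow> c t = p \<and> (c has_vector_derivative d t) (at t) \<and> d t \<noteq> 0"
  shows "countable A"
proof -
  define B where "B n = {t \<in> A. \<forall>s. s \<noteq> t \<and> \<bar>s - t\<bar> < 1 / real (Suc n) \<longrightarrow> c s \<noteq> p}" for n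
  have "countable (B n)" for n
    by (rule separated_countable[of "1 / real (Suc n)"]) (use assms in \<open>force simp: B_def\<close>)+
  moreover have "A \<subseteq> (\<Union>n. B n)"
  proof
    fix t assume t: "t \<in> A"
    note a = assms[OF t]
    then have "(c has_derivative (\<lambda>h. h *\<^sub>R d t)) (at t)" by (simp add: has_vector_derivative_def)
    moreover have "norm (d t) / 2 > 0" using a by simp
    ultimately obtain \<delta> where \<delta>: "\<delta> > 0"
      "\<And>s. norm (s - t) < \<delta> \<Longrightarrow> norm (c s - c t - (s - t) *\<^sub>R d t) \<le> norm (d t) / 2 * norm (s - t)"
      unfolding has_derivative_at_alt by meson
    obtain n where n: "1 / real (Suc n) < \<delta>" using \<delta>(1) nat_approx_posE by blast
    have "c s \<noteq> p" if "s \<noteq> t" "\<bar>s - t\<bar> < 1 / real (Suc n)" for s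
    proof
      assume "c s = p"
      then have "\<bar>s - t\<bar> * norm (d t) \<le> norm (d t) / 2 * \<bar>s - t\<bar>"
        using \<delta>(2)[of s] that n a by simp
      then show False using that a by simp
    qed
    with t have "t \<in> B n" by (auto simp: B_def)
    then show "t \<in> (\<Union>n. B n)" by blast
  qed
  ultimately show ?thesis by (meson countable_UN countable_subset countableI_type)
qed

section \<open>Independence of the contours\<close>

lemma winding_number_zero_unbounded:
  assumes "path \<Gamma>" "pathfinish \<Gamma> = pathstart \<Gamma>" "connected Y" "\<not> bounded Y" "Y \<inter> path_image \<Gamma> = {}" "w \<in> Y"
  shows "winding_number \<Gamma> w = 0"
proof -
  have "Y \<subseteq> connected_component_set (- path_image \<Gamma>) w"
    using assms by (intro connected_component_maximal) auto
  then have "w \<in> outside (path_image \<Gamma>)"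
    using assms bounded_subset unfolding outside_def by blast
  then show ?thesis using assms winding_number_zero_in_outside by blast
qed

lemma unbounded_real_ray: "\<not> bounded (of_real ` {..x::real} :: complex set)"
proof
  assume "bounded (of_real ` {..x::real} :: complex set)"
  then obtain B where B: "\<And>y. y \<le> x \<Longrightarrow> norm (of_real y :: complex) \<le> B"
    unfolding bounded_iff by blast
  define y where "y = min x (- \<bar>B\<bar> - 1)"
  have "y \<le> x" "y \<le> - \<bar>B\<bar> - 1" by (auto simp: y_def)
  with B[of y] show False by simp
qed

lemma connected_real_ray: "connected (of_real ` {..x::real} :: complex set)"
  by (intro connected_continuous_image continuous_intros) (auto intro: convex_connected)

locale kernel_data =
  fixes a b \<xi>1 \<xi>2 :: real and m :: nat
  assumes ba: "b < a"
begin

definition Hf :: "complex \<Rightarrow> complex" where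
  "Hf w = exp (- (w^3) / 3 + of_real \<xi>2 * w) * ((w - of_real b) / (w - of_real a)) ^ m"

definition hf :: "complex \<Rightarrow> complex" where
  "hf w = exp (w^3 / 3 - of_real \<xi>1 * w) * ((w - of_real a) / (w - of_real b)) ^ m"

definition kint :: "complex \<Rightarrow> complex \<Rightarrow> complex" where
  "kint w z = hf z / (w - z)"

lemma prelimit_integrand_eq: "prelimit_integrand m a b \<xi>1 \<xi>2 w = (\<lambda>z. Hf w * kint w z)"
proof
  fix z :: complex
  have e: "exp (z^3 / 3 - of_real \<xi>1 * z) = inverse (exp (- (z^3) / 3 + of_real \<xi>1 * z))"
    unfolding exp_minus[symmetric] by (rule arg_cong[where f = exp]) simp
  show "prelimit_integrand m a b \<xi>1 \<xi>2 w z = Hf w * kint w z"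
  proof -
    have g: "A / E * (1 / d) * x * y = (A * x) * ((inverse E * y) / d)" for A E d x y :: complex
      by (simp add: divide_inverse mult_ac)
    show ?thesis unfolding prelimit_integrand_def Hf_def kint_def hf_def e by (rule g)
  qed
qed

text \<open>Up to sign this is the residue of the integrand at z = w. The m-th powers cancel, so it
  extends to an entire function, which has a primitive on the whole plane and integrates to zero
  over every closed curve.\<close>

lemma Hf_hf:
  assumes "w \<noteq> of_real a" "w \<noteq> of_real b"
  shows "Hf w * hf w = exp (of_real (\<xi>2 - \<xi>1) * w)"
proof -
  have "((w - of_real b) / (w - of_real a)) ^ m * ((w - of_real a) / (w - of_real b)) ^ m = 1"
    using assms by (simp add: power_mult_distrib[symmetric])
  moreover have "exp (- (w^3) / 3 + of_real \<xi>2 * w) * exp (w^3 / 3 - of_real \<xi>1 * w) = exp (of_real (\<xi>2 - \<xi>1) * w)"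
    unfolding exp_add[symmetric] by (rule arg_cong[where f = exp]) (simp add: algebra_simps)
  moreover have g: "(A * x) * (B * y) = (A * B) * (x * y)" for A B x y :: complex
    by (simp add: mult_ac)
  ultimately show ?thesis unfolding Hf_def hf_def by (subst g) (simp only: mult_1_right)
qed

lemma Hf_holomorphic: "Hf holomorphic_on - {of_real a}"
  unfolding Hf_def by (intro holomorphic_intros) auto

lemma hf_holomorphic: "hf holomorphic_on - {of_real b}"
  unfolding hf_def by (intro holomorphic_intros) auto

lemma kint_holomorphic: "kint w holomorphic_on - {of_real b, w}"
  unfolding kint_def
  by (intro holomorphic_intros holomorphic_on_subset[OF hf_holomorphic]) auto

lemma Hf_decay:
  assumes "z \<in> tail (-2*pi/3) R \<union> tail (2*pi/3) R" "norm z \<ge> 15 * (\<bar>\<xi>2\<bar> + 1)" "norm z \<ge> \<bar>b\<bar> + 2 * \<bar>a\<bar> + 1"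
  shows "norm (Hf z) \<le> 2 ^ m * exp (- norm z)"
proof -
  have "z \<in> tail (-2*pi/3) R \<or> z \<in> tail (2*pi/3) R" using assms(1) by blast
  from mult_mono[OF exp_decay_left[OF this assms(2)] ratio_power_bound[OF assms(3), of m]]
  show ?thesis by (simp add: Hf_def norm_mult mult.commute)
qed

lemma hf_decay:
  assumes "z \<in> tail (pi/3) R \<union> tail (-pi/3) R" "norm z \<ge> 15 * (\<bar>\<xi>1\<bar> + 1)" "norm z \<ge> \<bar>a\<bar> + 2 * \<bar>b\<bar> + 1"
  shows "norm (hf z) \<le> 2 ^ m * exp (- norm z)"
proof -
  have "z \<in> tail (pi/3) R \<or> z \<in> tail (-pi/3) R" using assms(1) by blast
  from mult_mono[OF exp_decay_right[OF this assms(2)] ratio_power_bound[OF assms(3), of m]]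
  show ?thesis by (simp add: hf_def norm_mult mult.commute)
qed

text \<open>Beyond this radius both thresholds of \<open>hf_decay\<close> are met.\<close>

definition R1 :: real where "R1 = 15 * (\<bar>\<xi>1\<bar> + 1) + \<bar>a\<bar> + 2 * \<bar>b\<bar> + 1"

lemma kint_decay:
  assumes "norm w + 1 \<le> R" "R1 \<le> R" and z: "z \<in> tail (pi/3) R \<union> tail (-pi/3) R"
  shows "norm (kint w z) \<le> 2 ^ m * exp (- norm z)"
proof -
  have nz: "norm z > R" using z tail_norm by blast
  have "norm (hf z) \<le> 2 ^ m * exp (- norm z)"
    using nz assms(2) by (intro hf_decay[OF z]) (auto simp: R1_def)
  moreover have "1 \<le> norm (w - z)"
    using nz assms(1) norm_triangle_ineq2[of z w] by (simp add: norm_minus_commute)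
  ultimately show ?thesis
    unfolding kint_def norm_divide
    by (smt (verit) divide_le_eq_1_pos divide_right_mono frac_le norm_ge_zero div_by_1)
qed

section \<open>The inner integral along a reference curve\<close>

text \<open>Reference curve in the half plane Re z \<ge> q. Its speed is 1, so integrals of decaying
  functions along it converge absolutely.\<close>

definition V :: "real \<Rightarrow> real \<Rightarrow> complex" where
  "V q = vee (of_real q) 1 (pi/3) (-pi/3)"

lemma V_cone_curve: "cone_curve (pi/3) (-pi/3) (V q)"
  unfolding V_def by (rule vee_cone_curve) auto

lemma Re_V: "Re (V q t) = q + \<bar>t\<bar> / 2"
  by (simp add: V_def vee_def cos_60)

lemma Re_V_ge: "q \<le> Re (V q t)"
  by (simp add: Re_V)

definition Eq :: "real \<Rightarrow> complex \<Rightarrow> complex" where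
  "Eq q w = line_integral (V q) (kint w)"

text \<open>The curve is placed to the right of \<open>w\<close> and \<open>b\<close>, so that \<open>Ef\<close> continues the inner integral
  from the left of a contour to the whole plane.\<close>

definition Ef :: "complex \<Rightarrow> complex" where
  "Ef w = Eq (max (Re w) b + 1) w"

text \<open>Both curves, and the tails in which they are joined, lie in the half plane to the right
  of \<open>b\<close> and \<open>w\<close>. It contains no singularity of \<open>kint w\<close> and
  is convex, so Cauchy's theorem applies to the closing loop.\<close>

lemma Eq_indep:
  assumes "b < q" "Re w < q" "q \<le> q'"
  shows "Eq q w = Eq q' w"
proof -
  \<comment> \<open>On the tails Re z \<ge> norm z / 20, so the summand 20 |q| puts them to the
    right of q; the other summands secure the decay of \<open>kint w\<close>.\<close>
  define R where "R = 20 * \<bar>q\<bar> + norm w + 1 + \<bar>R1\<bar>"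
  have Rb: "norm w + 1 \<le> R" "R1 \<le> R"
    using norm_ge_zero[of w] abs_ge_zero[of R1] abs_ge_self[of R1] abs_ge_zero[of q] unfolding R_def by linarith+
  define W where "W = {z. max b (Re w) < Re z}"
  obtain \<Gamma> where cl: "closing_loop (V q) (V q') (tail (pi/3) R \<union> tail (-pi/3) R) \<Gamma>"
    using closing_loop_exists[OF V_cone_curve V_cone_curve] by blast
  then have \<Gamma>: "valid_path \<Gamma>" "pathfinish \<Gamma> = pathstart \<Gamma>"
    "path_image \<Gamma> \<subseteq> range (V q) \<union> range (V q') \<union> (tail (pi/3) R \<union> tail (-pi/3) R)"
    by (simp_all add: closing_loop_def)
  have openW: "open W" and convW: "convex W"
    unfolding W_def by (simp_all only: open_halfspace_Re_gt convex_halfspace_Re_gt)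
  have tails: "z \<in> W" if "z \<in> tail (pi/3) R \<union> tail (-pi/3) R" for z
  proof -
    have "norm z > R" using that tail_norm by blast
    moreover have "norm z / 20 \<le> Re z" using that by (intro tail_pi_third(1)[of z R]) auto
    ultimately have "q < Re z"
      using norm_ge_zero[of w] abs_ge_zero[of R1] abs_ge_self[of q] abs_ge_zero[of q] unfolding R_def by linarith
    then show ?thesis using assms by (auto simp: W_def)
  qed
  have Vs: "V q t \<in> W" "V q' t \<in> W" for t
    using assms Re_V_ge[of q t] Re_V_ge[of q' t] by (auto simp: W_def)
  have sub: "range (V q) \<union> range (V q') \<union> (tail (pi/3) R \<union> tail (-pi/3) R) \<subseteq> W"
    using tails Vs by blast
  have holo: "kint w holomorphic_on W"
    by (rule holomorphic_on_subset[OF kint_holomorphic]) (auto simp: W_def)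
  have "line_integral (V q) (kint w) - line_integral (V q') (kint w) = contour_integral \<Gamma> (kint w)"
    by (rule closing_loop_integral(1)[OF cl holo openW sub, of "2^m"]) (simp, rule kint_decay[OF Rb])
  also have "\<dots> = 0"
    using Cauchy_theorem_convex_simple[OF holo convW \<Gamma>(1) order_trans[OF \<Gamma>(3) sub] \<Gamma>(2)]
    by (rule contour_integral_unique)
  finally show ?thesis by (simp add: Eq_def)
qed

lemma Ef_eq: "b < q \<Longrightarrow> Re w < q \<Longrightarrow> Ef w = Eq q w"
  unfolding Ef_def using Eq_indep[of q w "max q (max (Re w) b + 1)"] Eq_indep[of "max (Re w) b + 1" w "max q (max (Re w) b + 1)"]
  by simp

text \<open>The density that turns \<open>Eq q\<close> into a Cauchy transform.
  \<open>vee_deriv\<close> agrees with the velocity of the curve except at the corner t = 0, a null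
  set.\<close>

definition \<phi> :: "real \<Rightarrow> real \<Rightarrow> complex" where
  "\<phi> q t = hf (V q t) * vee_deriv 1 (pi/3) (-pi/3) t"

lemma Eq_alt: "Eq q w = integral UNIV (\<lambda>t. \<phi> q t / (w - V q t))"
  unfolding Eq_def line_integral_def
proof (rule integral_spike[of "{0}"])
  fix t :: real assume "t \<in> UNIV - {0}"
  then have "vector_derivative (V q) (at t) = vee_deriv 1 (pi/3) (-pi/3) t"
    unfolding V_def by (intro vector_derivative_at vee_has_derivative) auto
  then show "\<phi> q t / (w - V q t) = kint w (V q t) * vector_derivative (V q) (at t)"
    by (simp add: \<phi>_def kint_def)
qed simp

text \<open>Continuity bounds the density on a compact interval, \<open>hf_decay\<close> beyond it;
  as norm (V q t) \<ge> |t| - |q|, one multiple of exp (-|t|) dominates both parts.\<close>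

lemma \<phi>_absolutely_integrable:
  assumes "b < q"
  shows "\<phi> q absolutely_integrable_on UNIV"
proof -
  have ne: "V q t \<noteq> of_real b" for t using Re_V_ge[of q t] assms by auto
  have contV: "continuous_on UNIV (V q)" unfolding V_def by (rule vee_continuous)
  have conth: "continuous_on UNIV (\<lambda>t. hf (V q t))"
    by (rule continuous_on_compose2[OF holomorphic_on_imp_continuous_on[OF hf_holomorphic] contV])
      (metis ComplI imageE ne singletonD subsetI)
  have "vee_deriv 1 (pi/3) (-pi/3) \<in> borel_measurable borel"
    unfolding vee_deriv_def[abs_def] by measurable
  then have vm: "vee_deriv 1 (pi/3) (-pi/3) \<in> borel_measurable lebesgue"
    by (intro measurable_completion) simp
  have meas: "\<phi> q \<in> borel_measurable (lebesgue_on UNIV)"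
    unfolding \<phi>_def lebesgue_on_UNIV_eq
    using continuous_imp_measurable_on_sets_lebesgue[OF conth] vm
    by (intro borel_measurable_times) (auto simp: lebesgue_on_UNIV_eq)
  obtain T where T: "\<And>t. \<bar>t\<bar> \<ge> T \<Longrightarrow> V q t \<in> tail (pi/3) R1 \<union> tail (-pi/3) R1"
  proof -
    have "eventually (\<lambda>t. V q t \<in> tail (pi/3) R1) at_bot" "eventually (\<lambda>t. V q t \<in> tail (-pi/3) R1) at_top"
      using V_cone_curve by (auto simp: cone_curve_def)
    then obtain S T where "\<And>t. t \<le> S \<Longrightarrow> V q t \<in> tail (pi/3) R1" "\<And>t. t \<ge> T \<Longrightarrow> V q t \<in> tail (-pi/3) R1"
      unfolding eventually_at_bot_linorder eventually_at_top_linorder by blast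
    then have "V q t \<in> tail (pi/3) R1 \<union> tail (-pi/3) R1" if "\<bar>t\<bar> \<ge> max (\<bar>S\<bar>) (\<bar>T\<bar>)" for t
      using that by (cases "t \<ge> 0") auto
    then show ?thesis using that by blast
  qed
  have "compact ((\<lambda>t. hf (V q t)) ` {-\<bar>T\<bar>..\<bar>T\<bar>})"
    by (intro compact_continuous_image continuous_on_subset[OF conth]) auto
  then have "bounded ((\<lambda>t. hf (V q t)) ` {-\<bar>T\<bar>..\<bar>T\<bar>})" by (rule compact_imp_bounded)
  then obtain M where M0: "\<forall>x\<in>(\<lambda>t. hf (V q t)) ` {-\<bar>T\<bar>..\<bar>T\<bar>}. norm x \<le> M"
    unfolding bounded_iff by blast
  have M: "norm (hf (V q t)) \<le> M" if "\<bar>t\<bar> \<le> \<bar>T\<bar>" for t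
    using M0 that by (auto simp: abs_le_iff)
  have vd: "norm (vee_deriv 1 (pi/3) (-pi/3) t) = 1" for t by (simp add: vee_deriv_def)
  define K where "K = max (\<bar>M\<bar> * exp \<bar>T\<bar>) (2^m * exp \<bar>q\<bar>)"
  have "norm (\<phi> q t) \<le> K * exp (- \<bar>t\<bar>)" for t
  proof (cases "\<bar>t\<bar> \<le> \<bar>T\<bar>")
    case True
    have "norm (\<phi> q t) \<le> \<bar>M\<bar>" using M[OF True] unfolding \<phi>_def norm_mult vd by simp
    also have "\<dots> \<le> \<bar>M\<bar> * (exp \<bar>T\<bar> * exp (- \<bar>t\<bar>))"
    proof -
      have "1 \<le> exp \<bar>T\<bar> * exp (- \<bar>t\<bar>)" using True by (simp add: exp_add[symmetric])
      then show ?thesis by (simp add: mult_le_cancel_left1)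
    qed
    also have "\<dots> \<le> K * exp (- \<bar>t\<bar>)" by (simp add: K_def mult.assoc[symmetric])
    finally show ?thesis .
  next
    case False
    then have tl: "V q t \<in> tail (pi/3) R1 \<union> tail (-pi/3) R1" by (intro T) auto
    have nV: "norm (V q t) > R1" using tl tail_norm by blast
    have "norm (\<phi> q t) \<le> 2^m * exp (- norm (V q t))"
      using hf_decay[OF tl] nV unfolding \<phi>_def norm_mult vd by (auto simp: R1_def)
    also have "\<dots> \<le> 2^m * exp (\<bar>q\<bar> - \<bar>t\<bar>)"
    proof -
      have "norm (V q t - of_real q) = \<bar>t\<bar>" by (simp add: V_def vee_def norm_mult)
      then have "\<bar>t\<bar> \<le> norm (V q t) + \<bar>q\<bar>" using norm_triangle_ineq4[of "V q t" "of_real q"] by simp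
      then show ?thesis by simp
    qed
    also have "\<dots> = (2^m * exp \<bar>q\<bar>) * exp (- \<bar>t\<bar>)" by (simp add: exp_diff exp_minus divide_inverse)
    also have "\<dots> \<le> K * exp (- \<bar>t\<bar>)" by (intro mult_right_mono) (auto simp: K_def)
    finally show ?thesis .
  qed
  then show ?thesis
    using measurable_bounded_by_integrable_imp_absolutely_integrable[OF meas _
        integrable_on_mult_right[OF exp_minus_abs_integrable, of K]] by simp
qed

lemma V_dist: "norm (w - V q t) \<ge> q - Re w"
  using Re_V_ge[of q t] abs_Re_le_cmod[of "w - V q t"] by simp

lemma Eq_holomorphic:
  assumes "b < q"
  shows "Eq q holomorphic_on {w. Re w < q}"
proof -
  have "(\<lambda>w. integral UNIV (\<lambda>t. \<phi> q t / (w - V q t))) holomorphic_on {w. Re w < q}"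
  proof (rule cauchy_transform_holomorphic)
    show "continuous_on UNIV (V q)" unfolding V_def by (rule vee_continuous)
    show "\<exists>\<delta>>0. \<forall>t\<in>UNIV. \<delta> \<le> cmod (w - V q t)" if "w \<in> {w. Re w < q}" for w
      using that V_dist[where q = q and w = w] by (intro exI[of _ "q - Re w"]) auto
  qed (use \<phi>_absolutely_integrable[OF assms] in \<open>auto simp: open_halfspace_Re_lt\<close>)
  then show ?thesis by (simp add: Eq_alt[abs_def])
qed

lemma Ef_holomorphic: "Ef holomorphic_on S"
proof -
  have "Ef field_differentiable at w" for w
  proof -
    define q where "q = max (Re w) b + 1"
    have q: "b < q" "Re w < q" by (auto simp: q_def)
    have "Ef holomorphic_on {w. Re w < q}"
      by (rule holomorphic_transform[OF Eq_holomorphic[OF q(1)]]) (use q in \<open>auto simp: Ef_eq\<close>)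
    then show ?thesis
      using q(2) by (intro holomorphic_on_imp_differentiable_at[of _ "{w. Re w < q}"]) (auto simp: open_halfspace_Re_lt)
  qed
  then show ?thesis by (auto simp: holomorphic_on_def intro: field_differentiable_at_within)
qed

text \<open>One reference curve serves all points with Re w \<le> 0, at distance at least 1 from
  them. The tails of the outer infinite curve lie in this half plane.\<close>

lemma Ef_bounded_left:
  obtains M where "\<And>w. Re w \<le> 0 \<Longrightarrow> norm (Ef w) \<le> M"
proof -
  define q where "q = max b 0 + 1"
  have q: "b < q" "1 \<le> q" by (auto simp: q_def)
  have "norm (Ef w) \<le> integral UNIV (\<lambda>t. norm (\<phi> q t)) / 1" if "Re w \<le> 0" for w
  proof -
    have "Ef w = Eq q w" using q that by (intro Ef_eq) auto
    also have "norm \<dots> \<le> integral UNIV (\<lambda>t. norm (\<phi> q t)) / 1"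
      unfolding Eq_alt
    proof (rule cauchy_transform_integrable(2))
      show "continuous_on UNIV (V q)" unfolding V_def by (rule vee_continuous)
      show "1 \<le> cmod (w - V q t)" for t using V_dist[of q w t] q that by linarith
    qed (use \<phi>_absolutely_integrable[OF q(1)] in auto)
    finally show ?thesis .
  qed
  then show ?thesis by (rule that)
qed

section \<open>The loop around the left singularity and the function Mf\<close>

text \<open>The contribution of a loop around \<open>b\<close> that does not enclose \<open>w\<close>.\<close>

definition Rf :: "complex \<Rightarrow> complex" where
  "Rf w = 2 * of_real pi * \<i> * residue (kint w) (of_real b)"

lemma Rf_circle:
  assumes "0 < r" "w \<notin> cball (of_real b) r"
  shows "(kint w has_contour_integral Rf w) (circlepath (of_real b) r)"
proof -
  have "(kint w has_contour_integral 2 * pi * \<i> * residue (kint w) (of_real b)) (circlepath (of_real b) r)"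
  proof (rule base_residue[of "- {w}"])
    show "kint w holomorphic_on - {w} - {of_real b}"
      by (rule holomorphic_on_subset[OF kint_holomorphic]) auto
  qed (use assms in auto)
  then show ?thesis by (simp add: Rf_def)
qed

text \<open>For \<open>w\<close> near \<open>w0\<close> the residue is an integral over one fixed
  circle around \<open>b\<close>, hence a Cauchy transform in \<open>w\<close>.\<close>

lemma Rf_holomorphic: "Rf holomorphic_on - {of_real b}"
proof -
  have "Rf field_differentiable at w0" if "w0 \<noteq> of_real b" for w0
  proof -
    \<comment> \<open>With a quarter of the distance, the ball of radius r around \<open>w0\<close>
      stays at distance at least 2 r from the circle of radius r around \<open>b\<close>.\<close>
    define r where "r = dist w0 (of_real b) / 4"
    have "r > 0" using that by (simp add: r_def)
    define c where "c = circlepath (of_real b) r"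
    define ph where "ph t = hf (c t) * vector_derivative c (at t)" for t
    have im: "c ` {0..1} = sphere (of_real b) r"
      using \<open>r > 0\<close> unfolding c_def path_image_def[symmetric] by (simp add: path_image_circlepath)
    have cc: "continuous_on {0..1} c" unfolding c_def by (metis path_circlepath path_def)
    have "continuous_on {0..1} ph"
    proof -
      have "continuous_on {0..1} (\<lambda>t. hf (c t))"
        using im \<open>r > 0\<close> by (intro continuous_on_compose2[OF holomorphic_on_imp_continuous_on[OF hf_holomorphic] cc]) auto
      moreover have "continuous_on {0..1} (\<lambda>t. vector_derivative c (at t))"
        unfolding c_def vector_derivative_circlepath by (intro continuous_intros)
      ultimately show ?thesis unfolding ph_def by (intro continuous_intros)
    qed
    then have phi: "ph absolutely_integrable_on {0..1}"
      by (rule absolutely_integrable_continuous_real)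
    have "(\<lambda>w. integral {0..1} (\<lambda>t. ph t / (w - c t))) holomorphic_on ball w0 r"
    proof (rule cauchy_transform_holomorphic[OF _ phi cc])
      show "\<exists>\<delta>>0. \<forall>t\<in>{0..1}. \<delta> \<le> cmod (w - c t)" if "w \<in> ball w0 r" for w
      proof (intro exI[of _ r] conjI ballI \<open>r > 0\<close>)
        fix t :: real assume "t \<in> {0..1}"
        then have "dist (of_real b) (c t) = r" using im by auto
        moreover have "dist w0 (of_real b) \<le> dist w0 w + dist w (c t) + dist (c t) (of_real b)"
          by (metis add_mono_thms_linordered_semiring(3) dist_triangle order_trans)
        moreover have "dist w0 w < r" "4 * r = dist w0 (of_real b)" using that by (auto simp: r_def)
        moreover have "dist (c t) (of_real b) = dist (of_real b) (c t)" by (rule dist_commute)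
        ultimately have "r \<le> dist w (c t)" using \<open>r > 0\<close> by linarith
        then show "r \<le> cmod (w - c t)" by (simp add: dist_norm)
      qed
    qed auto
    moreover have "integral {0..1} (\<lambda>t. ph t / (w - c t)) = Rf w" if "w \<in> ball w0 r" for w
    proof -
      have "w \<notin> cball (of_real b) r"
      proof
        assume "w \<in> cball (of_real b) r"
        then have "dist w (of_real b) \<le> r" by (simp add: dist_commute)
        moreover have "dist w0 w < r" "dist w0 (of_real b) = 4 * r" using that by (auto simp: r_def)
        ultimately show False using dist_triangle[of w0 "of_real b" w] \<open>r > 0\<close> by linarith
      qed
      from contour_integral_unique[OF Rf_circle[OF \<open>r > 0\<close> this]] show ?thesis
        unfolding contour_integral_integral by (simp add: ph_def c_def kint_def)
    qed
    ultimately have "Rf holomorphic_on ball w0 r" by (rule holomorphic_transform)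
    then show ?thesis
      using \<open>r > 0\<close> by (intro holomorphic_on_imp_differentiable_at[of _ "ball w0 r"]) auto
  qed
  then show ?thesis by (auto simp: holomorphic_on_def intro: field_differentiable_at_within)
qed

lemma Rf_bounded:
  obtains M where "\<And>w. norm (w - of_real b) \<ge> 2 \<Longrightarrow> norm (Rf w) \<le> M"
proof -
  have "compact (hf ` sphere (of_real b) 1)"
    by (intro compact_continuous_image holomorphic_on_imp_continuous_on holomorphic_on_subset[OF hf_holomorphic]) auto
  then obtain M0 where M0: "\<And>z. z \<in> sphere (of_real b) 1 \<Longrightarrow> norm (hf z) \<le> M0"
    using compact_imp_bounded bounded_iff by (metis imageI)
  have "norm (Rf w) \<le> \<bar>M0\<bar> * (2 * pi * 1)" if w: "norm (w - of_real b) \<ge> 2" for w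
  proof (rule has_contour_integral_bound_circlepath[OF Rf_circle])
    show "norm (kint w z) \<le> \<bar>M0\<bar>" if z: "norm (z - of_real b) = 1" for z
    proof -
      have "1 \<le> norm (w - z)" using norm_triangle_ineq2[of "w - of_real b" "z - of_real b"] w z by simp
      moreover have "norm (hf z) \<le> \<bar>M0\<bar>" using M0[of z] z by (auto simp: dist_norm norm_minus_commute)
      ultimately show ?thesis unfolding kint_def norm_divide
        using frac_le[of "\<bar>M0\<bar>" "norm (hf z)" 1 "norm (w - z)"] by simp
    qed
  qed (use w in \<open>auto simp: dist_norm norm_minus_commute\<close>)
  then show ?thesis by (rule that)
qed

text \<open>The inner integral for \<open>w\<close> to the left of the infinite curve and outside the loop. For other
  positions of \<open>w\<close> it differs by a multiple of \<open>exp ((\<xi>2 - \<xi>1) w)\<close>, the residue at the diagonal.\<close>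

definition Mf :: "complex \<Rightarrow> complex" where
  "Mf w = Hf w * (Ef w + Rf w)"

lemma Mf_holomorphic: "Mf holomorphic_on - {of_real a, of_real b}"
  unfolding Mf_def
  by (intro holomorphic_intros holomorphic_on_subset[OF Hf_holomorphic] holomorphic_on_subset[OF Rf_holomorphic] Ef_holomorphic) auto

text \<open>The decay is that of \<open>Hf\<close>; on the tails \<open>Ef\<close> is bounded
  because they lie in Re w \<le> 0, and \<open>Rf\<close> because they stay away from
  \<open>b\<close>.\<close>

lemma Mf_decay:
  obtains C R where "0 \<le> C" "0 \<le> R" "\<And>z. z \<in> tail (-2*pi/3) R \<union> tail (2*pi/3) R \<Longrightarrow> norm (Mf z) \<le> C * exp (- norm z)"
proof -
  obtain M1 where M1: "\<And>w. Re w \<le> 0 \<Longrightarrow> norm (Ef w) \<le> M1" by (rule Ef_bounded_left) (rule that)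
  obtain M2 where M2: "\<And>w. norm (w - of_real b) \<ge> 2 \<Longrightarrow> norm (Rf w) \<le> M2" by (rule Rf_bounded) (rule that)
  define R where "R = 15 * (\<bar>\<xi>2\<bar> + 1) + \<bar>b\<bar> + 2 * \<bar>a\<bar> + 3"
  have "norm (Mf z) \<le> (2^m * (\<bar>M1\<bar> + \<bar>M2\<bar>)) * exp (- norm z)" if z: "z \<in> tail (-2*pi/3) R \<union> tail (2*pi/3) R" for z
  proof -
    have n: "norm z > R" using z tail_norm by blast
    have z': "z \<in> tail (-2*pi/3) R \<or> z \<in> tail (2*pi/3) R" using z by blast
    from tail_two_pi_third(1)[OF z'] have "Re z \<le> 0" by (rule order_trans) simp
    from M1[OF this] have e: "norm (Ef z) \<le> \<bar>M1\<bar>" by simp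
    have "2 \<le> norm (z - of_real b)" using n norm_triangle_ineq2[of z "of_real b"] by (simp add: R_def)
    from M2[OF this] have r: "norm (Rf z) \<le> \<bar>M2\<bar>" by simp
    have "norm (Mf z) \<le> (2^m * exp (- norm z)) * (\<bar>M1\<bar> + \<bar>M2\<bar>)"
      unfolding Mf_def norm_mult
    proof (rule mult_mono)
      show "norm (Hf z) \<le> 2^m * exp (- norm z)"
        using n by (intro Hf_decay[OF z]) (auto simp: R_def)
      show "norm (Ef z + Rf z) \<le> \<bar>M1\<bar> + \<bar>M2\<bar>" using e r norm_triangle_ineq[of "Ef z" "Rf z"] by linarith
    qed auto
    then show ?thesis by (simp add: mult_ac)
  qed
  then show ?thesis by (intro that[of "2^m * (\<bar>M1\<bar> + \<bar>M2\<bar>)" R]) (auto simp: R_def)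
qed

lemma residue_kint: "w \<noteq> of_real b \<Longrightarrow> residue (kint w) w = - hf w"
proof -
  assume "w \<noteq> of_real b"
  have "kint w = (\<lambda>z. (- hf z) / (z - w))"
    by (rule ext) (simp add: kint_def minus_divide_left[symmetric] minus_divide_right)
  moreover have "residue (\<lambda>z. (- hf z) / (z - w)) w = - hf w"
    using \<open>w \<noteq> of_real b\<close> by (intro residue_simple[of "- {of_real b}"] holomorphic_intros hf_holomorphic) auto
  ultimately show ?thesis by simp
qed

lemma contour_kint:
  assumes \<Gamma>: "valid_path \<Gamma>" "pathfinish \<Gamma> = pathstart \<Gamma>" and "of_real b \<notin> path_image \<Gamma>" "w \<notin> path_image \<Gamma>" "w \<noteq> of_real b"
  shows "contour_integral \<Gamma> (kint w) = winding_number \<Gamma> (of_real b) * Rf w - 2 * of_real pi * \<i> * winding_number \<Gamma> w * hf w"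
proof -
  have "contour_integral \<Gamma> (kint w) = 2 * pi * \<i> * (\<Sum>p\<in>{of_real b, w}. winding_number \<Gamma> p * residue (kint w) p)"
  proof (rule Residue_theorem[of UNIV])
    show "kint w holomorphic_on UNIV - {of_real b, w}"
      by (rule holomorphic_on_subset[OF kint_holomorphic]) auto
  qed (use assms in auto)
  then show ?thesis using assms(5) by (simp add: residue_kint Rf_def algebra_simps)
qed

lemma kint_contour_integrable:
  assumes "valid_path \<Gamma>" "of_real b \<notin> path_image \<Gamma>" "w \<notin> path_image \<Gamma>"
  shows "kint w contour_integrable_on \<Gamma>"
  by (rule contour_integrable_holomorphic_simple[OF kint_holomorphic]) (use assms in auto)

section \<open>The inner integral along a general infinite curve\<close>

text \<open>The curve \<open>c\<close> is compared with a reference curve that avoids the disc of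
  radius \<open>B\<close>. The closing loop \<Gamma> misses the real ray up to \<open>b\<close>, so
  its winding number around \<open>b\<close> is 0 and only the pole at z = w contributes. As one
  \<Gamma> serves the whole disc, the position of \<open>w\<close> relative to \<open>c\<close>
  enters through a winding number alone.\<close>

lemma line_kint_winding:
  assumes c: "cone_curve (pi/3) (-pi/3) c" and real: "\<And>t x. c t = of_real x \<Longrightarrow> b < x"
  obtains \<Gamma> where "valid_path \<Gamma>" "pathfinish \<Gamma> = pathstart \<Gamma>"
    "path_image \<Gamma> \<subseteq> range c \<union> {z. B < norm z}" "path_image \<Gamma> \<inter> of_real ` {..b} = {}"
    "\<And>w. \<lbrakk>norm w \<le> B; w \<notin> range c; w \<noteq> of_real b\<rbrakk> \<Longrightarrow>
       line_integral c (kint w) = Ef w - 2 * of_real pi * \<i> * winding_number \<Gamma> w * hf w"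
proof -
  define R where "R = \<bar>B\<bar> + 1 + \<bar>R1\<bar> + \<bar>b\<bar>"
  have Rb: "B + 1 \<le> R" "R1 \<le> R"
    using abs_ge_self[of B] abs_ge_zero[of b] abs_ge_zero[of B] abs_ge_zero[of R1] abs_ge_self[of R1] unfolding R_def by linarith+
  \<comment> \<open>Large enough that \<open>V q\<close> lies outside the disc of radius
    \<open>B\<close> and to the right of \<open>b\<close>.\<close>
  define q where "q = \<bar>B\<bar> + \<bar>b\<bar> + 1"
  obtain \<Gamma> where cl: "closing_loop c (V q) (tail (pi/3) R \<union> tail (-pi/3) R) \<Gamma>"
    using closing_loop_exists[OF c V_cone_curve] by blast
  then have \<Gamma>: "valid_path \<Gamma>" "pathfinish \<Gamma> = pathstart \<Gamma>"
    "path_image \<Gamma> \<subseteq> range c \<union> range (V q) \<union> (tail (pi/3) R \<union> tail (-pi/3) R)"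
    by (simp_all add: closing_loop_def)
  have q: "B < q" "b < q"
    using abs_ge_self[of B] abs_ge_self[of b] abs_ge_zero[of B] abs_ge_zero[of b] unfolding q_def by linarith+
  have V: "B < norm (V q t)" "V q t \<noteq> of_real x" if "x \<le> b" for t x
  proof -
    show "B < norm (V q t)" using Re_V_ge[of q t] complex_Re_le_cmod[of "V q t"] q by linarith
    show "V q t \<noteq> of_real x" using Re_V_ge[of q t] q that by auto
  qed
  have T: "B < norm z" "z \<noteq> of_real x" if "z \<in> tail (pi/3) R \<union> tail (-pi/3) R" for z x
  proof -
    have "R < norm z" using that tail_norm by blast
    then show "B < norm z" using Rb by linarith
    have "z \<in> tail (pi/3) R \<or> z \<in> tail (-pi/3) R" using that by blast
    from tail_pi_third(2)[OF this] show "z \<noteq> of_real x" by auto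
  qed
  have 1: "path_image \<Gamma> \<subseteq> range c \<union> {z. B < norm z}"
    using \<Gamma>(3) V(1)[OF order_refl] T(1) by blast
  have R: "c t \<noteq> of_real x" if "x \<le> b" for t x using real[of t x] that by force
  have 2: "path_image \<Gamma> \<inter> of_real ` {..b} = {}"
  proof -
    have "z \<noteq> of_real x" if "z \<in> path_image \<Gamma>" "x \<le> b" for z x
    proof -
      have "z \<in> range c \<union> range (V q) \<union> (tail (pi/3) R \<union> tail (-pi/3) R)"
        by (rule subsetD[OF \<Gamma>(3) that(1)])
      then show ?thesis
        using R[OF that(2)] V(2)[OF that(2)] T(2)[of z x] by (elim UnE rangeE) simp_all
    qed
    then show ?thesis by blast
  qed
  have nb: "winding_number \<Gamma> (of_real b) = 0"
    by (rule winding_number_zero_unbounded[OF valid_path_imp_path[OF \<Gamma>(1)] \<Gamma>(2) connected_real_ray unbounded_real_ray]) (use 2 in auto)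
  show ?thesis
  proof (rule that[OF \<Gamma>(1,2) 1 2])
    fix w assume w: "norm w \<le> B" "w \<notin> range c" "w \<noteq> of_real b"
    have wV: "w \<noteq> V q t" for t using V(1)[OF order_refl, of t] w(1) by auto
    have wG: "w \<notin> path_image \<Gamma>" using 1 w by auto
    have sub: "range c \<union> range (V q) \<union> (tail (pi/3) R \<union> tail (-pi/3) R) \<subseteq> - {of_real b, w}"
    proof
      fix z assume z: "z \<in> range c \<union> range (V q) \<union> (tail (pi/3) R \<union> tail (-pi/3) R)"
      then have "z \<noteq> of_real b"
        using R[OF order_refl] V(2)[OF order_refl] T(2)[of z b] by (elim UnE rangeE) simp_all
      moreover have "z \<noteq> w"
        using z w(2) wV T(1)[of z] w(1) by (elim UnE rangeE) auto
      ultimately show "z \<in> - {of_real b, w}" by simp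
    qed
    have "line_integral c (kint w) - line_integral (V q) (kint w) = contour_integral \<Gamma> (kint w)"
    proof (rule closing_loop_integral(1)[OF cl kint_holomorphic _ sub])
      show "norm (kint w z) \<le> 2^m * exp (- norm z)" if "z \<in> tail (pi/3) R \<union> tail (-pi/3) R" for z
        using w(1) Rb by (intro kint_decay[OF _ _ that]) auto
    qed auto
    also have "contour_integral \<Gamma> (kint w) = - 2 * of_real pi * \<i> * winding_number \<Gamma> w * hf w"
      using contour_kint[OF \<Gamma>(1,2) _ wG w(3)] 2 nb by auto
    also have "line_integral (V q) (kint w) = Ef w"
      using Ef_eq[of q w] complex_Re_le_cmod[of w] w(1) q by (simp add: Eq_def)
    finally show "line_integral c (kint w) = Ef w - 2 * of_real pi * \<i> * winding_number \<Gamma> w * hf w"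
      by (simp add: algebra_simps)
  qed
qed

text \<open>A path in the complement of \<open>c\<close> joins \<open>w\<close> to a real point far
  to the left. With \<open>B\<close> bounding this path, \<Gamma> misses both the path and the real
  ray continuing it to minus infinity, so the winding number around \<open>w\<close> is 0.\<close>

lemma line_kint_left:
  assumes c: "cone_curve (pi/3) (-pi/3) c" and real: "\<And>t x. c t = of_real x \<Longrightarrow> b < x"
    and w: "w \<notin> range c" "w \<noteq> of_real b"
    and left: "eventually (\<lambda>x. connected_component (- range c) w (of_real x)) at_bot"
  shows "line_integral c (kint w) = Ef w"
proof -
  obtain x0 where x0: "\<And>x. x \<le> x0 \<Longrightarrow> connected_component (- range c) w (of_real x)"
    using left unfolding eventually_at_bot_linorder by blast
  \<comment> \<open>At most \<open>b\<close>, so that the real ray up to x is one that \<Gamma> is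
    known to avoid.\<close>
  define x where "x = min x0 b"
  have "connected_component (- range c) w (of_real x)" using x0 by (simp add: x_def)
  then have "path_component (- range c) w (of_real x)"
    using open_path_connected_component[of "- range c" w] closed_range_cone_curve[OF c] by (simp add: open_Compl)
  then obtain p where p: "path p" "path_image p \<subseteq> - range c" "pathstart p = w" "pathfinish p = of_real x"
    unfolding path_component_def by blast
  obtain B where B: "\<And>z. z \<in> path_image p \<Longrightarrow> norm z \<le> B"
    using bounded_path_image[OF p(1)] unfolding bounded_iff by blast
  obtain \<Gamma> where \<Gamma>: "valid_path \<Gamma>" "pathfinish \<Gamma> = pathstart \<Gamma>"
    "path_image \<Gamma> \<subseteq> range c \<union> {z. B < norm z}" "path_image \<Gamma> \<inter> of_real ` {..b} = {}"
    and L: "\<And>w. \<lbrakk>norm w \<le> B; w \<notin> range c; w \<noteq> of_real b\<rbrakk> \<Longrightarrow>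
       line_integral c (kint w) = Ef w - 2 * of_real pi * \<i> * winding_number \<Gamma> w * hf w"
    by (rule line_kint_winding[OF c real, where B = B]) (assumption, rule that, blast+)
  have wp: "w \<in> path_image p" using p(3) by (metis pathstart_in_path_image)
  have "winding_number \<Gamma> w = 0"
  proof (rule winding_number_zero_unbounded[OF valid_path_imp_path[OF \<Gamma>(1)] \<Gamma>(2)])
    show "connected (path_image p \<union> of_real ` {..x})"
      using p(4) pathfinish_in_path_image[of p]
      by (intro connected_Un connected_path_image p(1) connected_real_ray) auto
    show "\<not> bounded (path_image p \<union> of_real ` {..x})"
      using unbounded_real_ray[of x] by simp
    have "path_image p \<inter> path_image \<Gamma> = {}" using \<Gamma>(3) p(2) B by force
    moreover have "of_real ` {..x} \<inter> path_image \<Gamma> = {}" using \<Gamma>(4) by (auto simp: x_def)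
    ultimately show "(path_image p \<union> of_real ` {..x}) \<inter> path_image \<Gamma> = {}" by blast
  qed (use wp in simp)
  then show ?thesis using L[OF B[OF wp] w] by simp
qed

text \<open>The winding number of \<Gamma> is constant on a connected set that \<Gamma> avoids. This
  serves the outer loop, where only the constancy of \<kappa> matters and not its value.\<close>

lemma line_kint_connected:
  assumes c: "cone_curve (pi/3) (-pi/3) c" and real: "\<And>t x. c t = of_real x \<Longrightarrow> b < x"
    and X: "connected X" "bounded X" "X \<inter> range c = {}" "of_real b \<notin> X"
  obtains \<kappa> where "\<And>w. w \<in> X \<Longrightarrow> line_integral c (kint w) = Ef w + \<kappa> * hf w"
proof -
  obtain B where B: "\<And>z. z \<in> X \<Longrightarrow> norm z \<le> B"
    using X(2) unfolding bounded_iff by blast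
  obtain \<Gamma> where \<Gamma>: "valid_path \<Gamma>" "pathfinish \<Gamma> = pathstart \<Gamma>"
    "path_image \<Gamma> \<subseteq> range c \<union> {z. B < norm z}" "path_image \<Gamma> \<inter> of_real ` {..b} = {}"
    and L: "\<And>w. \<lbrakk>norm w \<le> B; w \<notin> range c; w \<noteq> of_real b\<rbrakk> \<Longrightarrow>
       line_integral c (kint w) = Ef w - 2 * of_real pi * \<i> * winding_number \<Gamma> w * hf w"
    by (rule line_kint_winding[OF c real, where B = B]) (assumption, rule that, blast+)
  have "X \<inter> path_image \<Gamma> = {}" using \<Gamma>(3) X(3) B by force
  then obtain N where N: "\<And>w. w \<in> X \<Longrightarrow> winding_number \<Gamma> w = N"
    using winding_number_constant[OF valid_path_imp_path[OF \<Gamma>(1)] \<Gamma>(2) X(1)] unfolding constant_on_def by blast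
  show ?thesis
  proof (rule that[of "- 2 * of_real pi * \<i> * N"])
    fix w assume "w \<in> X"
    with L[of w] B[of w] X N[of w] show "line_integral c (kint w) = Ef w + - 2 * of_real pi * \<i> * N * hf w"
      by auto
  qed
qed

end

section \<open>The outer integral\<close>

text \<open>What the proof of contour independence needs. Besides the admissible contours, this covers the
  contours made of rays at angles \<open>\<plusminus> 3 * pi/5\<close> and \<open>\<plusminus> 2 * pi/5\<close> and of sectors with vertex \<open>p\<close>, which have
  other asymptotic directions.\<close>

definition good_contours ::
    "real \<Rightarrow> real \<Rightarrow> (real \<Rightarrow> complex) \<Rightarrow> (real \<Rightarrow> complex) \<Rightarrow>
     (real \<Rightarrow> complex) \<Rightarrow> (real \<Rightarrow> complex) \<Rightarrow> complex \<Rightarrow> bool" where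
  "good_contours a b \<gamma> g \<gamma>' g' p \<longleftrightarrow>
     cone_curve (-2*pi/3) (2*pi/3) \<gamma> \<and> (\<forall>t x. \<gamma> t = of_real x \<longrightarrow> b < x \<and> x < a) \<and>
     valid_path g \<and> pathfinish g = pathstart g \<and> of_real a \<notin> path_image g \<and> of_real b \<notin> path_image g \<and>
     winding_number g (of_real a) = 1 \<and> winding_number g (of_real b) = 0 \<and>
     connected (path_image g - {p}) \<and> finite {t \<in> {0..1}. g t = p} \<and>
     cone_curve (pi/3) (-pi/3) \<gamma>' \<and> (\<forall>t x. \<gamma>' t = of_real x \<longrightarrow> b < x) \<and>
     valid_path g' \<and> pathfinish g' = pathstart g' \<and> of_real b \<notin> path_image g' \<and>
     winding_number g' (of_real b) = 1 \<and> (\<forall>w \<in> range \<gamma> - {p}. norm (winding_number g' w) \<le> 1) \<and>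
     path_image g' \<inter> range \<gamma> \<subseteq> {p} \<and> path_image g' \<inter> path_image g \<subseteq> {p} \<and>
     range \<gamma> \<inter> range \<gamma>' \<subseteq> {p} \<and> range \<gamma>' \<inter> path_image g \<subseteq> {p} \<and>
     left_of_curve (range \<gamma>) \<gamma>'"

text \<open>The primitive of F is the winding number times Q - Q p. The second factor vanishes at
  the contact point, which makes the product continuous where the winding number jumps. Far out the
  winding number is 0, so both limits of the primitive are 0. At visits to \<open>p\<close> with
  nonzero velocity F is arbitrary; these are countably many.\<close>

lemma integral_winding_excursions:
  fixes e Q :: "complex \<Rightarrow> complex"
  assumes \<gamma>: "cone_curve \<alpha> \<beta> \<gamma>"
    and g: "valid_path g'" "pathfinish g' = pathstart g'"
    and meet: "path_image g' \<inter> range \<gamma> \<subseteq> {p}"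
    and bound: "\<And>w. w \<in> range \<gamma> - {p} \<Longrightarrow> norm (winding_number g' w) \<le> 1"
    and Q: "\<And>w. (Q has_field_derivative e w) (at w)"
    and F: "\<And>t. \<gamma> t \<noteq> p \<Longrightarrow> F t = winding_number g' (\<gamma> t) * e (\<gamma> t) * vector_derivative \<gamma> (at t)"
    and F0: "\<And>t. \<gamma> t = p \<Longrightarrow> vector_derivative \<gamma> (at t) = 0 \<Longrightarrow> F t = 0"
  shows "(F has_integral 0) UNIV"
proof -
  have lc: "line_curve \<gamma>" using \<gamma> by (simp add: cone_curve_def)
  have cg: "isCont \<gamma> t" for t
    using line_curve_continuous_on[OF lc, of UNIV] by (simp add: continuous_on_eq_continuous_at)
  define q where "q t = Q (\<gamma> t) - Q p" for t
  \<comment> \<open>The value 0 at visits to \<open>p\<close> is the continuous extension, since |G|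
    \<le> |q| and \<open>q\<close> vanishes there.\<close>
  define G where "G t = (if \<gamma> t = p then 0 else winding_number g' (\<gamma> t) * q t)" for t
  obtain S where S: "countable S" "\<And>t. t \<notin> S \<Longrightarrow> (\<gamma> has_vector_derivative vector_derivative \<gamma> (at t)) (at t)"
    by (rule line_curve_deriv[OF lc]) (rule that, assumption+)
  \<comment> \<open>Visits with zero velocity may be uncountably many and are kept out of the
    exceptional set; the derivative of \<open>G\<close> is computed at them.\<close>
  define S' where "S' = S \<union> {t. t \<notin> S \<and> \<gamma> t = p \<and> vector_derivative \<gamma> (at t) \<noteq> 0}"
  have "countable {t. t \<notin> S \<and> \<gamma> t = p \<and> vector_derivative \<gamma> (at t) \<noteq> 0}"
    by (rule countable_transversal_hits[where c = \<gamma> and p = p and d = "\<lambda>t. vector_derivative \<gamma> (at t)"])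
       (use S(2) in blast)
  then have S'c: "countable S'" using S(1) by (simp add: S'_def)
  have q_cont: "isCont q t" for t
    unfolding q_def using cg[of t] DERIV_isCont[OF Q] by (intro continuous_intros isCont_o2[where f = \<gamma> and g = Q]) auto
  have q_der: "(q has_vector_derivative e (\<gamma> t) * vector_derivative \<gamma> (at t)) (at t)" if "t \<notin> S" for t
  proof -
    have "((Q \<circ> \<gamma>) has_vector_derivative vector_derivative \<gamma> (at t) * e (\<gamma> t)) (at t)"
      by (rule field_vector_diff_chain_at[OF S(2)[OF that] Q])
    from has_vector_derivative_diff[OF this has_vector_derivative_const[of "Q p"]]
    show ?thesis by (simp add: q_def[abs_def] o_def mult.commute)
  qed
  have Gle: "norm (G t) \<le> norm (q t)" for t
    using bound[of "\<gamma> t"] by (auto simp: G_def norm_mult mult_left_le_one_le)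
  have Gp: "G t = 0" "q t = 0" if "\<gamma> t = p" for t using that by (auto simp: G_def q_def)
  have local_const: "\<exists>U. open U \<and> t \<in> U \<and> (\<forall>s\<in>U. G s = winding_number g' (\<gamma> t) * q s)" if "\<gamma> t \<noteq> p" for t
  proof -
    have op: "open (- path_image g' - {p})" using g(1) by (simp add: closed_valid_path_image open_Compl open_Diff)
    moreover have "\<gamma> t \<in> - path_image g' - {p}" using meet that by blast
    ultimately obtain r where r: "r > 0" "ball (\<gamma> t) r \<subseteq> - path_image g' - {p}"
      using open_contains_ball by blast
    have "winding_number g' constant_on ball (\<gamma> t) r"
      by (rule winding_number_constant[OF valid_path_imp_path[OF g(1)] g(2)]) (use r in auto)
    then have const: "winding_number g' w = winding_number g' (\<gamma> t)" if "w \<in> ball (\<gamma> t) r" for w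
      unfolding constant_on_def using that r(1) by (metis centre_in_ball)
    define U where "U = \<gamma> -` ball (\<gamma> t) r"
    have "open U" unfolding U_def using cg
      by (intro open_vimage) (auto simp: continuous_on_eq_continuous_at)
    moreover have "G s = winding_number g' (\<gamma> t) * q s" if "s \<in> U" for s
      using that r(2) const[of "\<gamma> s"] by (auto simp: G_def U_def)
    ultimately show ?thesis using r(1) by (intro exI[of _ U]) (auto simp: U_def)
  qed
  have G_cont: "isCont G t" for t
  proof (cases "\<gamma> t = p")
    case True
    have "(q \<longlongrightarrow> 0) (at t)" using q_cont[of t] Gp(2)[OF True] by (simp add: isCont_def)
    then have "(G \<longlongrightarrow> 0) (at t)"
      by (rule Lim_null_comparison[OF always_eventually, rotated, OF tendsto_norm_zero]) (use Gle in auto)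
    then show ?thesis using Gp(1)[OF True] by (simp add: isCont_def)
  next
    case False
    from local_const[OF this] obtain U where U: "open U" "t \<in> U" "\<And>s. s \<in> U \<Longrightarrow> G s = winding_number g' (\<gamma> t) * q s" by blast
    have "isCont (\<lambda>s. winding_number g' (\<gamma> t) * q s) t" by (intro continuous_intros q_cont)
    moreover have "eventually (\<lambda>s. G s = winding_number g' (\<gamma> t) * q s) (nhds t)"
      using U by (auto simp: eventually_nhds)
    ultimately show ?thesis
      using isCont_cong[of G "\<lambda>s. winding_number g' (\<gamma> t) * q s" t] by simp
  qed
  have G_der: "(G has_vector_derivative F t) (at t)" if t: "t \<notin> S'" for t
  proof (cases "\<gamma> t = p")
    case True
    \<comment> \<open>Zero velocity makes the derivative of \<open>q\<close> vanish, and |G| \<le>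
      |q| then forces that of \<open>G\<close> to vanish too.\<close>
    have d0: "vector_derivative \<gamma> (at t) = 0" "t \<notin> S" using t True by (auto simp: S'_def)
    then have "(q has_vector_derivative 0) (at t)" using q_der[of t] by simp
    then have "((\<lambda>s. norm (q s - q t) / norm (s - t)) \<longlongrightarrow> 0) (at t)"
      unfolding has_vector_derivative_def has_derivative_iff_norm by simp
    then have "((\<lambda>s. norm (G s - G t) / norm (s - t)) \<longlongrightarrow> 0) (at t)"
      by (rule Lim_null_comparison[rotated]) (use Gle Gp[OF True] in \<open>auto simp: divide_right_mono\<close>)
    then have "(G has_vector_derivative 0) (at t)"
      unfolding has_vector_derivative_def has_derivative_iff_norm by (simp add: bounded_linear_zero)
    then show ?thesis using F0[OF True d0(1)] by simp
  next
    case False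
    from local_const[OF this] obtain U where U: "open U" "t \<in> U" "\<And>s. s \<in> U \<Longrightarrow> G s = winding_number g' (\<gamma> t) * q s" by blast
    have "((\<lambda>s. winding_number g' (\<gamma> t) * q s) has_vector_derivative winding_number g' (\<gamma> t) * (e (\<gamma> t) * vector_derivative \<gamma> (at t))) (at t)"
      by (intro has_vector_derivative_mult_right q_der) (use t in \<open>auto simp: S'_def\<close>)
    then have "(G has_vector_derivative winding_number g' (\<gamma> t) * (e (\<gamma> t) * vector_derivative \<gamma> (at t))) (at t)"
      by (rule has_vector_derivative_transform_within_open[OF _ U(1,2)]) (use U(3) in simp)
    then show ?thesis using F[OF False] by (simp add: mult.assoc)
  qed
  obtain B where B: "\<And>z. B \<le> norm z \<Longrightarrow> winding_number g' z = 0"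
    using winding_number_zero_at_infinity[OF valid_path_imp_path[OF g(1)] g(2)] by blast
  have G0: "(G \<longlongrightarrow> 0) Fl" if "filterlim \<gamma> at_infinity Fl" for Fl
  proof -
    have "eventually (\<lambda>t. norm (\<gamma> t) > B) Fl"
      using filterlim_at_infinity_imp_norm_at_top[OF that] unfolding filterlim_at_top_dense by blast
    then have "eventually (\<lambda>t. 0 = G t) Fl"
      by eventually_elim (use B in \<open>auto simp: G_def\<close>)
    then show ?thesis by (rule Lim_transform_eventually[OF tendsto_const])
  qed
  have "(F has_integral (0 - 0)) UNIV"
  proof (rule has_integral_UNIV_limit[where G = G])
    show "(F has_integral (G t - G s)) {s..t}" if "s \<le> t" for s t
    proof (rule fundamental_theorem_of_calculus_countable[OF S'c that])
      show "continuous_on {s..t} G" using G_cont by (simp add: continuous_at_imp_continuous_on)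
      show "(G has_vector_derivative F x) (at x within {s..t})" if "x \<in> {s..t} - S'" for x
        using G_der[of x] that by (simp add: has_vector_derivative_at_within)
    qed
  qed (use G0 cone_curve_at_infinity[OF \<gamma>] in auto)
  then show ?thesis by simp
qed

text \<open>The case c = 0 occurs for \<xi>1 = \<xi>2, that is on the diagonal of the
  kernel.\<close>

lemma exp_primitive:
  "\<exists>Q. \<forall>w::complex. (Q has_field_derivative exp (c * w)) (at w)"
proof (cases "c = 0")
  case True
  then have "((\<lambda>w. w) has_field_derivative exp (c * w)) (at w)" for w
    by (auto intro!: derivative_eq_intros)
  then show ?thesis by blast
next
  case False
  then have "((\<lambda>w. exp (c * w) / c) has_field_derivative exp (c * w)) (at w)" for w
    by (auto intro!: derivative_eq_intros)
  then show ?thesis by blast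
qed

context kernel_data
begin

definition inner_integral :: "(real \<Rightarrow> complex) \<Rightarrow> (real \<Rightarrow> complex) \<Rightarrow> complex \<Rightarrow> complex" where
  "inner_integral \<gamma>' g' w = line_integral \<gamma>' (prelimit_integrand m a b \<xi>1 \<xi>2 w) + contour_integral g' (prelimit_integrand m a b \<xi>1 \<xi>2 w)"

text \<open>The plane without the real rays up to \<open>b\<close> and from \<open>a\<close> on. It
  is not convex but starlike about \<open>mid\<close>, and contains every outer infinite curve, so
  Cauchy's theorem for \<open>Mf\<close> applies in it.\<close>

definition slit_plane :: "complex set" where
  "slit_plane = {z. Im z \<noteq> 0 \<or> (b < Re z \<and> Re z < a)}"

lemma open_slit_plane: "open slit_plane"
proof -
  have "slit_plane = {z. Im z < 0} \<union> {z. Im z > 0} \<union> ({z. b < Re z} \<inter> {z. Re z < a})"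
    by (auto simp: slit_plane_def)
  then show ?thesis
    by (simp add: open_halfspace_Im_lt open_halfspace_Im_gt open_halfspace_Re_lt open_halfspace_Re_gt open_Un open_Int)
qed

definition mid :: complex where "mid = of_real ((a + b) / 2)"

lemma starlike_slit_plane: "starlike slit_plane"
  unfolding starlike_def
proof (intro bexI[of _ mid] ballI subsetI)
  show "mid \<in> slit_plane" using ba by (simp add: slit_plane_def mid_def)
  fix z w assume z: "z \<in> slit_plane" and "w \<in> closed_segment mid z"
  then obtain u where u: "0 \<le> u" "u \<le> 1" "w = (1 - u) *\<^sub>R mid + u *\<^sub>R z" by (auto simp: closed_segment_def)
  have Im: "Im w = u * Im z" and Re: "Re w = (1 - u) * ((a + b) / 2) + u * Re z"
    using u(3) by (simp_all add: mid_def)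
  show "w \<in> slit_plane"
  proof (cases "u = 0 \<or> Im z = 0")
    case False
    then show ?thesis using Im by (simp add: slit_plane_def)
  next
    case True
    then consider "u = 0" | "u > 0" "Im z = 0" "b < Re z" "Re z < a"
      using z u(1) by (cases "u = 0") (auto simp: slit_plane_def less_le)
    then have "b < Re w \<and> Re w < a"
    proof cases
      case 1 then show ?thesis using Re ba by simp
    next
      case 2
      have l: "(1-u) * b + u * b < (1 - u) * ((a + b) / 2) + u * Re z"
        using 2 u ba by (intro add_le_less_mono mult_left_mono mult_strict_left_mono) auto
      have r: "(1 - u) * ((a + b) / 2) + u * Re z < (1-u) * a + u * a"
        using 2 u ba by (intro add_le_less_mono mult_left_mono mult_strict_left_mono) auto
      from l r show ?thesis unfolding Re by (simp add: algebra_simps)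
    qed
    then show ?thesis by (simp add: slit_plane_def)
  qed
qed

lemma line_Mf_independent:
  assumes "cone_curve (-2*pi/3) (2*pi/3) \<gamma>" "\<And>t x. \<gamma> t = of_real x \<Longrightarrow> b < x \<and> x < a"
    and "cone_curve (-2*pi/3) (2*pi/3) \<delta>" "\<And>t x. \<delta> t = of_real x \<Longrightarrow> b < x \<and> x < a"
  shows "line_integral \<gamma> Mf = line_integral \<delta> Mf"
    and "(\<lambda>t. Mf (\<gamma> t) * vector_derivative \<gamma> (at t)) integrable_on UNIV"
proof -
  obtain C R where CR: "0 \<le> C" "\<And>z. z \<in> tail (-2*pi/3) R \<union> tail (2*pi/3) R \<Longrightarrow> norm (Mf z) \<le> C * exp (- norm z)"
    by (rule Mf_decay) (rule that, assumption+)
  obtain \<Gamma> where cl: "closing_loop \<gamma> \<delta> (tail (-2*pi/3) R \<union> tail (2*pi/3) R) \<Gamma>"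
    using closing_loop_exists[OF assms(1,3)] by blast
  then have \<Gamma>: "valid_path \<Gamma>" "pathfinish \<Gamma> = pathstart \<Gamma>"
    "path_image \<Gamma> \<subseteq> range \<gamma> \<union> range \<delta> \<union> (tail (-2*pi/3) R \<union> tail (2*pi/3) R)"
    by (simp_all add: closing_loop_def)
  have sl: "z \<in> slit_plane" if "\<And>x. z = of_real x \<Longrightarrow> b < x \<and> x < a" for z
  proof (cases "Im z = 0")
    case True
    then have "z = of_real (Re z)" by (simp add: complex_eq_iff)
    from that[OF this] show ?thesis by (simp add: slit_plane_def)
  qed (simp add: slit_plane_def)
  have tails: "z \<in> slit_plane" if "z \<in> tail (-2*pi/3) R \<union> tail (2*pi/3) R" for z
    using that tail_two_pi_third(2)[of z R] by (simp add: slit_plane_def)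
  have sub: "range \<gamma> \<union> range \<delta> \<union> (tail (-2*pi/3) R \<union> tail (2*pi/3) R) \<subseteq> slit_plane"
  proof -
    have "\<gamma> t \<in> slit_plane" "\<delta> t \<in> slit_plane" for t
      by (rule sl[OF assms(2)], assumption, rule sl[OF assms(4)], assumption)
    with tails show ?thesis by blast
  qed
  have holo: "Mf holomorphic_on slit_plane"
    by (rule holomorphic_on_subset[OF Mf_holomorphic]) (auto simp: slit_plane_def)
  note C = closing_loop_integral[OF cl holo open_slit_plane sub CR]
  show "(\<lambda>t. Mf (\<gamma> t) * vector_derivative \<gamma> (at t)) integrable_on UNIV" by (rule C(2))
  have "contour_integral \<Gamma> Mf = 0"
    by (rule contour_integral_unique[OF Cauchy_theorem_starlike_simple[OF open_slit_plane starlike_slit_plane holo \<Gamma>(1) order_trans[OF \<Gamma>(3) sub] \<Gamma>(2)]])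
  with C(1) show "line_integral \<gamma> Mf = line_integral \<delta> Mf" by simp
qed

text \<open>Both corrections come from the pole at z = w: \<kappa> from the infinite curve, being 0
  if \<open>w\<close> lies to its left, and the winding number from the loop.\<close>

lemma inner_eq:
  assumes "valid_path g'" "pathfinish g' = pathstart g'" "of_real b \<notin> path_image g'" "winding_number g' (of_real b) = 1"
    and w: "w \<notin> path_image g'" "w \<noteq> of_real a" "w \<noteq> of_real b"
    and L: "line_integral \<gamma>' (kint w) = Ef w + \<kappa> * hf w"
  shows "inner_integral \<gamma>' g' w = Mf w + (\<kappa> - 2 * of_real pi * \<i> * winding_number g' w) * exp (of_real (\<xi>2 - \<xi>1) * w)"
proof -
  have 1: "line_integral \<gamma>' (\<lambda>z. Hf w * kint w z) = Hf w * line_integral \<gamma>' (kint w)"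
    unfolding line_integral_def by (simp only: mult.assoc integral_mult_right)
  have 2: "contour_integral g' (\<lambda>z. Hf w * kint w z) = Hf w * contour_integral g' (kint w)"
    by (rule contour_integral_lmul[OF kint_contour_integrable[OF assms(1,3) w(1)]])
  have 3: "contour_integral g' (kint w) = Rf w - 2 * of_real pi * \<i> * winding_number g' w * hf w"
    using contour_kint[OF assms(1-3) w(1,3)] assms(4) by simp
  have "inner_integral \<gamma>' g' w = Hf w * (Ef w + \<kappa> * hf w) + Hf w * (Rf w - 2 * of_real pi * \<i> * winding_number g' w * hf w)"
    unfolding inner_integral_def prelimit_integrand_eq 1 2 3 L ..
  also have "\<dots> = Mf w + (\<kappa> - 2 * of_real pi * \<i> * winding_number g' w) * (Hf w * hf w)"
    by (simp add: Mf_def algebra_simps)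
  finally show ?thesis unfolding Hf_hf[OF w(2,3)] .
qed

text \<open>The right-hand side mentions no contour of the given system, so any two good systems for
  the same data give the same double integral.\<close>

theorem good_contours_integral:
  assumes good: "good_contours a b \<gamma> g \<gamma>' g' p"
  shows "line_integral \<gamma> (inner_integral \<gamma>' g') + contour_integral g (inner_integral \<gamma>' g')
    = line_integral (vee mid 1 (-2*pi/3) (2*pi/3)) Mf + 2 * of_real pi * \<i> * residue Mf (of_real a)"
proof -
  note G = good[unfolded good_contours_def]
  have \<gamma>: "cone_curve (-2*pi/3) (2*pi/3) \<gamma>" and \<gamma>r: "\<And>t x. \<gamma> t = of_real x \<Longrightarrow> b < x \<and> x < a"
    and g: "valid_path g" "pathfinish g = pathstart g" "of_real a \<notin> path_image g" "of_real b \<notin> path_image g"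
      "winding_number g (of_real a) = 1" "winding_number g (of_real b) = 0"
      "connected (path_image g - {p})" "finite {t \<in> {0..1}. g t = p}"
    and \<gamma>': "cone_curve (pi/3) (-pi/3) \<gamma>'" and \<gamma>'r: "\<And>t x. \<gamma>' t = of_real x \<Longrightarrow> b < x"
    and g': "valid_path g'" "pathfinish g' = pathstart g'" "of_real b \<notin> path_image g'" "winding_number g' (of_real b) = 1"
    and g'b: "\<And>w. w \<in> range \<gamma> - {p} \<Longrightarrow> norm (winding_number g' w) \<le> 1"
    and meet: "path_image g' \<inter> range \<gamma> \<subseteq> {p}" "path_image g' \<inter> path_image g \<subseteq> {p}"
      "range \<gamma> \<inter> range \<gamma>' \<subseteq> {p}" "range \<gamma>' \<inter> path_image g \<subseteq> {p}"
    and left: "left_of_curve (range \<gamma>) \<gamma>'"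
    using G by (elim conjE; simp; fail)+
  define E where "E w = exp (of_real (\<xi>2 - \<xi>1) * w)" for w :: complex
  obtain Q where "\<forall>w. (Q has_field_derivative E w) (at w)"
    using exp_primitive[of "of_real (\<xi>2 - \<xi>1)"] unfolding E_def by blast
  then have Q: "\<And>w. (Q has_field_derivative E w) (at w)" by blast
  let ?\<delta> = "vee mid 1 (-2*pi/3) (2*pi/3)"
  have \<delta>: "cone_curve (-2*pi/3) (2*pi/3) ?\<delta>" by (rule vee_cone_curve) auto
  have \<delta>r: "b < x \<and> x < a" if "?\<delta> t = of_real x" for t x
  proof -
    have s: "sin (-2*pi/3) \<noteq> 0" "sin (2*pi/3) \<noteq> 0"
      by (simp_all add: sin_120)
    have "Im (?\<delta> t) = 0" using that by simp
    then have "t = 0" using s by (auto simp: vee_def mid_def split: if_splits)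
    then show ?thesis using that ba by (simp add: vee_def mid_def complex_eq_iff)
  qed
  have inner_\<gamma>: "inner_integral \<gamma>' g' (\<gamma> t) = Mf (\<gamma> t) - 2 * of_real pi * \<i> * winding_number g' (\<gamma> t) * E (\<gamma> t)" if "\<gamma> t \<noteq> p" for t
  proof -
    have ne: "\<gamma> t \<noteq> of_real a" "\<gamma> t \<noteq> of_real b" using \<gamma>r[of t a] \<gamma>r[of t b] by auto
    have ni: "\<gamma> t \<notin> range \<gamma>'" "\<gamma> t \<notin> path_image g'" using meet that by blast+
    have "eventually (\<lambda>x. connected_component (- range \<gamma>') (\<gamma> t) (of_real x)) at_bot"
      using left ni(1) unfolding left_of_curve_def by blast
    from line_kint_left[OF \<gamma>' \<gamma>'r ni(1) ne(2) this]
    have L: "line_integral \<gamma>' (kint (\<gamma> t)) = Ef (\<gamma> t) + 0 * hf (\<gamma> t)" by simp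
    show ?thesis using inner_eq[OF g' ni(2) ne L] by (simp add: E_def)
  qed
  \<comment> \<open>Obtained by solving for the winding term. At visits to the contact point, F
    absorbs whatever value the inner integral has there; with zero velocity F is 0, as
    required.\<close>
  define F where "F t = (inner_integral \<gamma>' g' (\<gamma> t) - Mf (\<gamma> t)) / (- 2 * of_real pi * \<i>) * vector_derivative \<gamma> (at t)" for t
  have F0: "(F has_integral 0) UNIV"
  proof (rule integral_winding_excursions[OF \<gamma> g'(1,2) meet(1) g'b Q])
    show "F t = winding_number g' (\<gamma> t) * E (\<gamma> t) * vector_derivative \<gamma> (at t)" if "\<gamma> t \<noteq> p" for t
      by (simp add: F_def inner_\<gamma>[OF that])
  qed (simp_all add: F_def)
  have "line_integral \<gamma> (inner_integral \<gamma>' g') = line_integral \<gamma> Mf"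
  proof -
    have "((\<lambda>t. Mf (\<gamma> t) * vector_derivative \<gamma> (at t) + (- 2 * of_real pi * \<i>) * F t) has_integral (line_integral \<gamma> Mf + (- 2 * of_real pi * \<i>) * 0)) UNIV"
      unfolding line_integral_def
      by (intro has_integral_add has_integral_mult_right F0 integrable_integral line_Mf_independent(2)[OF \<gamma> \<gamma>r \<gamma> \<gamma>r])
    moreover have "(\<lambda>t. Mf (\<gamma> t) * vector_derivative \<gamma> (at t) + (- 2 * of_real pi * \<i>) * F t)
        = (\<lambda>t. inner_integral \<gamma>' g' (\<gamma> t) * vector_derivative \<gamma> (at t))"
    proof -
      have "M * v + c * ((I - M) / c * v) = I * v" if "c \<noteq> 0" for M I v c :: complex
      proof -
        have "c * ((I - M) / c * v) = (I - M) * v" using that by simp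
        then show ?thesis by (simp only:) (simp add: algebra_simps)
      qed
      from this[of "- 2 * of_real pi * \<i>"] show ?thesis unfolding F_def by (intro ext) simp
    qed
    ultimately show ?thesis by (simp add: line_integral_def[of \<gamma> "inner_integral \<gamma>' g'"] integral_unique)
  qed
  also have "\<dots> = line_integral ?\<delta> Mf" by (rule line_Mf_independent(1)[OF \<gamma> \<gamma>r \<delta> \<delta>r])
  finally have 1: "line_integral \<gamma> (inner_integral \<gamma>' g') = line_integral ?\<delta> Mf" .

  \<comment> \<open>The loop without the contact point is connected, so \<kappa> and the winding
    number are constant on it. The correction is then one constant times an entire function and
    integrates to zero over the loop.\<close>
  define X where "X = path_image g - {p}"
  have X: "X \<inter> range \<gamma>' = {}" "of_real b \<notin> X" "bounded X"
    using meet g(4) bounded_subset[OF bounded_path_image[OF valid_path_imp_path[OF g(1)]], of X] by (auto simp: X_def)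
  obtain \<kappa> where \<kappa>: "\<And>w. w \<in> X \<Longrightarrow> line_integral \<gamma>' (kint w) = Ef w + \<kappa> * hf w"
    by (rule line_kint_connected[OF \<gamma>' \<gamma>'r g(7)[folded X_def] X(3,1,2)]) (assumption, rule that, blast)
  have "X \<inter> path_image g' = {}" using meet(2) by (auto simp: X_def)
  then obtain N where N: "\<And>w. w \<in> X \<Longrightarrow> winding_number g' w = N"
    using winding_number_constant[OF valid_path_imp_path[OF g'(1)] g'(2) g(7)[folded X_def]]
    unfolding constant_on_def by blast
  define c where "c = \<kappa> - 2 * of_real pi * \<i> * N"
  have inner_g: "inner_integral \<gamma>' g' w = Mf w + c * E w" if "w \<in> X" for w
  proof -
    have w: "w \<notin> path_image g'" "w \<noteq> of_real a" "w \<noteq> of_real b"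
      using that g(3,4) meet(2) by (auto simp: X_def)
    show ?thesis using inner_eq[OF g' w \<kappa>[OF that]] N[OF that] by (simp add: E_def c_def)
  qed
  have MfI: "(Mf has_contour_integral (2 * of_real pi * \<i> * residue Mf (of_real a))) g"
  proof -
    have sub: "path_image g \<subseteq> - {of_real a, of_real b}" using g by auto
    have "Mf contour_integrable_on g"
      by (rule contour_integrable_holomorphic_simple[OF Mf_holomorphic _ g(1) sub]) auto
    moreover have "contour_integral g Mf = 2 * pi * \<i> * (\<Sum>q\<in>{of_real a, of_real b}. winding_number g q * residue Mf q)"
    proof (rule Residue_theorem[of UNIV])
      show "Mf holomorphic_on UNIV - {of_real a, of_real b}"
        by (rule holomorphic_on_subset[OF Mf_holomorphic]) auto
    qed (use g in auto)
    ultimately show ?thesis using g(5,6) ba has_contour_integral_integral by fastforce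
  qed
  have EI: "(E has_contour_integral 0) g"
    by (rule Cauchy_theorem_convex_simple[of _ UNIV]) (use g in \<open>auto simp: E_def[abs_def] intro!: holomorphic_intros\<close>)
  have "((\<lambda>w. Mf w + c * E w) has_contour_integral (2 * of_real pi * \<i> * residue Mf (of_real a) + c * 0)) g"
    by (intro has_contour_integral_add has_contour_integral_lmul MfI EI)
  then have "((\<lambda>t. (Mf (g t) + c * E (g t)) * vector_derivative g (at t)) has_integral (2 * of_real pi * \<i> * residue Mf (of_real a))) {0..1}"
    using has_integral_localized_vector_derivative[of "\<lambda>w. Mf w + c * E w" g g 0 1]
    by (simp add: has_contour_integral_def)
  then have "((\<lambda>t. inner_integral \<gamma>' g' (g t) * vector_derivative g (at t)) has_integral (2 * of_real pi * \<i> * residue Mf (of_real a))) {0..1}"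
  \<comment> \<open>Only finitely many parameters of the loop meet the contact point, so the
    undefined inner integral there is harmless.\<close>
  proof (rule has_integral_spike_finite[OF g(8), rotated])
    fix t assume "t \<in> {0..1} - {t \<in> {0..1}. g t = p}"
    then have "g t \<in> X" by (auto simp: X_def path_image_def)
    then show "inner_integral \<gamma>' g' (g t) * vector_derivative g (at t) = (Mf (g t) + c * E (g t)) * vector_derivative g (at t)"
      by (simp add: inner_g)
  qed
  then have "contour_integral g (inner_integral \<gamma>' g') = 2 * of_real pi * \<i> * residue Mf (of_real a)"
    by (simp add: contour_integral_integral integral_unique)
  with 1 show ?thesis by simp
qed

end

section \<open>Admissible contours\<close>

lemma infinite_curve_imp_cone_curve:
  assumes "infinite_curve \<alpha> \<beta> c"
  shows "cone_curve \<alpha> \<beta> c"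
proof -
  have key: "eventually (\<lambda>t. c t \<in> tail \<theta> R) F"
    if inf: "filterlim c at_infinity F" and sg: "((\<lambda>t. sgn (c t)) \<longlongrightarrow> cis \<theta>) F" for \<theta> R F
  proof -
    have "((\<lambda>t. Re (sgn (c t) * cis (-\<theta>))) \<longlongrightarrow> Re (cis \<theta> * cis (-\<theta>))) F"
      by (intro tendsto_intros sg)
    moreover have "Re (cis \<theta> * cis (-\<theta>)) = 1" unfolding cis_mult by simp
    ultimately have lim: "((\<lambda>t. Re (sgn (c t) * cis (-\<theta>))) \<longlongrightarrow> 1) F" by simp
    have 1: "eventually (\<lambda>t. Re (sgn (c t) * cis (-\<theta>)) > 9/10) F"
      using order_tendstoD(1)[OF lim, of "9/10"] by simp
    \<comment> \<open>Multiplied by 9/10 this bound still exceeds R.\<close>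
    have 2: "eventually (\<lambda>t. norm (c t) > 2 * \<bar>R\<bar> + 1) F"
      using filterlim_at_infinity_imp_norm_at_top[OF inf] unfolding filterlim_at_top_dense by blast
    from 1 2 show ?thesis
    proof eventually_elim
      case (elim t)
      define s where "s = Re (sgn (c t) * cis (-\<theta>))"
      have "Re (c t * cis (-\<theta>)) = norm (c t) * s"
      proof -
        have "c t = of_real (norm (c t)) * sgn (c t)"
          by (cases "c t = 0") (simp_all add: sgn_eq)
        then have "c t * cis (-\<theta>) = of_real (norm (c t)) * (sgn (c t) * cis (-\<theta>))"
          by (metis mult.assoc)
        then show ?thesis by (simp only: Re_complex_of_real times_complex.sel s_def) simp
      qed
      moreover have "norm (c t) * s > norm (c t) * (9/10)"
        using elim by (intro mult_strict_left_mono) (auto simp: s_def)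
      ultimately show ?case
        using elim(2) unfolding tail_def mem_Collect_eq by (simp add: mult.commute)
    qed
  qed
  show ?thesis
    unfolding cone_curve_def line_curve_def
    using assms unfolding infinite_curve_def by (auto intro: key)
qed

text \<open>Shifting the parametrisation makes \<open>p\<close> the base point of the loop; a simple
  path without its endpoints is connected.\<close>

lemma connected_simple_closed_delete:
  assumes "simple_path g" "pathfinish g = pathstart g"
  shows "connected (path_image g - {p})"
proof (cases "p \<in> path_image g")
  case True
  then obtain t where t: "t \<in> {0..1}" "p = g t" by (auto simp: path_image_def)
  let ?s = "shiftpath t g"
  have "simple_path ?s" using t by (intro simple_path_shiftpath assms) auto
  then have "connected (path_image ?s - {pathstart ?s, pathfinish ?s})"
    by (rule connected_simple_path_endless)
  then show ?thesis
    using t assms by (simp add: path_image_shiftpath pathstart_shiftpath pathfinish_shiftpath)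
next
  case False
  then show ?thesis
    using assms connected_path_image simple_path_imp_path by fastforce
qed

lemma finite_simple_path_hits:
  assumes "simple_path g"
  shows "finite {t \<in> {0..1}. g t = p}"
proof -
  have inj: "inj_on g {0<..<1}"
    using assms unfolding simple_path_def loop_free_def inj_on_def by fastforce
  have "finite {t \<in> {0<..<1}. g t = p}"
  proof (cases "{t \<in> {0<..<1}. g t = p} = {}")
    case False
    then obtain t0 where "t0 \<in> {0<..<1}" "g t0 = p" by blast
    then have "{t \<in> {0<..<1}. g t = p} \<subseteq> {t0}" using inj by (auto dest: inj_onD)
    then show ?thesis by (rule finite_subset) simp
  qed (simp only: finite.emptyI)
  moreover have "{t \<in> {0..1}. g t = p} \<subseteq> {0, 1} \<union> {t \<in> {0<..<1}. g t = p}" by auto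
  ultimately show ?thesis by (meson finite.emptyI finite.insertI finite_Un finite_subset)
qed

lemma admissible_imp_good:
  assumes "admissible_contours a b \<gamma> g \<gamma>' g'"
  obtains p where "good_contours a b \<gamma> g \<gamma>' g' p"
proof -
  note A = assms[unfolded admissible_contours_def crosses_real_axis_between_def ccw_loop_around_def]
  from A obtain p :: real where p: "b < p" "p < a"
    "path_image g' \<inter> range \<gamma> \<subseteq> {of_real p}" "path_image g' \<inter> path_image g \<subseteq> {of_real p}"
    "range \<gamma> \<inter> range \<gamma>' \<subseteq> {of_real p}" "range \<gamma>' \<inter> path_image g \<subseteq> {of_real p}"
    by (elim conjE exE) (rule that, assumption+)
  have g: "valid_path g" "simple_path g" "pathfinish g = pathstart g" "of_real a \<in> inside (path_image g)"
      "winding_number g (of_real a) = 1" "of_real b \<in> outside (path_image g)"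
    and g': "valid_path g'" "simple_path g'" "pathfinish g' = pathstart g'" "of_real b \<in> inside (path_image g')"
      "winding_number g' (of_real b) = 1"
    and inf: "infinite_curve (-2*pi/3) (2*pi/3) \<gamma>" "infinite_curve (pi/3) (-pi/3) \<gamma>'"
    and real: "\<forall>x. complex_of_real x \<in> range \<gamma> \<longrightarrow> b < x \<and> x < a" "\<forall>x. complex_of_real x \<in> range \<gamma>' \<longrightarrow> b < x \<and> x < a"
    and left: "left_of_curve (range \<gamma>) \<gamma>'"
    using A by meson+
  note cg = inf[THEN infinite_curve_imp_cone_curve]
  \<comment> \<open>A simple closed curve winds 0 or \<plusminus> 1 times around a point off
    it.\<close>
  have bound: "norm (winding_number g' w) \<le> 1" if "w \<in> range \<gamma> - {of_real p}" for w
  proof -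
    have "w \<notin> path_image g'" using that p(3) by blast
    from simple_closed_path_winding_number_cases[OF g'(2,3) this] show ?thesis by auto
  qed
  have nb: "winding_number g (of_real b) = 0"
    by (rule winding_number_zero_in_outside[OF valid_path_imp_path[OF g(1)] g(3,6)])
  have off: "of_real a \<notin> path_image g" "of_real b \<notin> path_image g" "of_real b \<notin> path_image g'"
    using g(4,6) g'(4) inside_no_overlap outside_no_overlap by blast+
  have nr: "b < x \<and> x < a" if "\<gamma> t = of_real x" for t x
    using real(1) that by (metis rangeI)
  have nr': "b < x" if "\<gamma>' t = of_real x" for t x
    using real(2) that by (metis rangeI)
  have "good_contours a b \<gamma> g \<gamma>' g' (of_real p)"
    unfolding good_contours_def
    by (intro conjI allI impI ballI cg g(1,3,5) g'(1,3,5) p(3-6) nb off left bound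
        connected_simple_closed_delete[OF g(2,3)] finite_simple_path_hits[OF g(2)])
      ((drule nr nr', blast)+, assumption)
  then show ?thesis by (rule that)
qed

section \<open>Sector loops\<close>

text \<open>Boundary of a circular sector, counterclockwise from its vertex. With \<delta> = 0 it
  replaces the loop around \<open>a\<close>, with \<delta> = pi the one around \<open>b\<close>; for
  growing radius its sides become the four rays of the limiting contours at \<plusminus> pi/5 and
  \<plusminus> 4 pi/5.\<close>

definition sector_loop :: "complex \<Rightarrow> real \<Rightarrow> real \<Rightarrow> real \<Rightarrow> complex" where
  "sector_loop c r \<delta> = linepath c (c + of_real r * cis (\<delta> - pi/5)) +++
     part_circlepath c r (\<delta> - pi/5) (\<delta> + pi/5) +++ linepath (c + of_real r * cis (\<delta> + pi/5)) c"

lemma part_circlepath_start_finish: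
  "pathstart (part_circlepath c r s t) = c + of_real r * cis s"
  "pathfinish (part_circlepath c r s t) = c + of_real r * cis t"
  by (simp_all add: cis_conv_exp mult.commute)

lemma sector_loop_path:
  "valid_path (sector_loop c r \<delta>)" "pathstart (sector_loop c r \<delta>) = c" "pathfinish (sector_loop c r \<delta>) = c"
  unfolding sector_loop_def
  by (auto intro!: valid_path_join simp: part_circlepath_start_finish simp del: pathstart_part_circlepath pathfinish_part_circlepath)

lemma path_image_sector_loop:
  assumes "z \<in> path_image (sector_loop c r \<delta>)" "r > 0"
  obtains s \<psi> where "0 \<le> s" "s \<le> r" "\<bar>\<psi>\<bar> \<le> pi/5" "z = c + of_real s * cis (\<delta> + \<psi>)" "s = r \<or> \<bar>\<psi>\<bar> = pi/5"
proof -
  consider "z \<in> closed_segment c (c + of_real r * cis (\<delta> - pi/5))"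
    | "z \<in> path_image (part_circlepath c r (\<delta> - pi/5) (\<delta> + pi/5))"
    | "z \<in> closed_segment (c + of_real r * cis (\<delta> + pi/5)) c"
    using assms(1) unfolding sector_loop_def
    by (auto dest!: subsetD[OF path_image_join_subset])
  then show ?thesis
  proof cases
    case 1
    then obtain u where "0 \<le> u" "u \<le> 1" "z = (1 - u) *\<^sub>R c + u *\<^sub>R (c + of_real r * cis (\<delta> - pi/5))"
      by (auto simp: closed_segment_def)
    then show ?thesis using assms(2)
      by (intro that[of "u * r" "-pi/5"]) (auto simp: scaleR_conv_of_real algebra_simps mult_left_le_one_le)
  next
    case 2
    then obtain x where x: "x \<in> closed_segment (\<delta> - pi/5) (\<delta> + pi/5)" "z = c + of_real r * cis x"
      by (auto simp: path_image_part_circlepath' cis_conv_exp)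
    have "\<delta> - pi/5 \<le> \<delta> + pi/5" by simp
    with x(1) have "x \<le> \<delta> + pi/5" "\<delta> - pi/5 \<le> x" by (auto simp: closed_segment_eq_real_ivl)
    then have "\<bar>x - \<delta>\<bar> \<le> pi/5" by (intro abs_leI) linarith+
    then show ?thesis using assms(2) x(2) by (intro that[of r "x - \<delta>"]) auto
  next
    case 3
    then obtain u where "0 \<le> u" "u \<le> 1" "z = (1 - u) *\<^sub>R (c + of_real r * cis (\<delta> + pi/5)) + u *\<^sub>R c"
      by (auto simp: closed_segment_def)
    then show ?thesis using assms(2)
      by (intro that[of "(1 - u) * r" "pi/5"]) (auto simp: scaleR_conv_of_real algebra_simps mult_left_le_one_le)
  qed
qed

text \<open>The infinite closed sector. Two half-plane conditions give convexity at once and avoid a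
  choice of branch for the argument.\<close>

definition sector :: "complex \<Rightarrow> real \<Rightarrow> complex set" where
  "sector c \<delta> = {z. 0 \<le> Im ((z - c) * cis (pi/5 - \<delta>)) \<and> Im ((z - c) * cis (-pi/5 - \<delta>)) \<le> 0}"

lemma convex_sector: "convex (sector c \<delta>)"
proof -
  have eq: "Im ((z - c) * e) = inner (\<i> * cnj e) z - Im (c * e)" for z e :: complex
    by (simp add: inner_complex_def algebra_simps)
  have "sector c \<delta> = {z. inner (\<i> * cnj (cis (pi/5 - \<delta>))) z \<ge> Im (c * cis (pi/5 - \<delta>))} \<inter>
      {z. inner (\<i> * cnj (cis (-pi/5 - \<delta>))) z \<le> Im (c * cis (-pi/5 - \<delta>))}"
    unfolding sector_def eq by (simp only: set_eq_iff mem_Collect_eq Int_iff le_diff_eq diff_le_eq add_0 simp_thms)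
  then show ?thesis by (metis convex_Int convex_halfspace_ge convex_halfspace_le)
qed

lemma in_sector_polar:
  "c + of_real s * cis \<psi> \<in> sector c \<delta> \<longleftrightarrow> 0 \<le> s * sin (\<psi> - \<delta> + pi/5) \<and> s * sin (\<psi> - \<delta> - pi/5) \<le> 0"
proof -
  have pe: "(c + of_real s * cis \<psi> - c) * cis e = of_real s * cis (\<psi> + e)" for e
    by (simp only: add_diff_cancel_left' mult.assoc cis_mult)
  have "Im ((c + of_real s * cis \<psi> - c) * cis e) = s * sin (\<psi> + e)" for e
    unfolding pe by simp
  then show ?thesis unfolding sector_def mem_Collect_eq by (simp only:) (simp add: algebra_simps)
qed

lemma sector_loop_in_sector:
  assumes "r > 0"
  shows "path_image (sector_loop c r \<delta>) \<subseteq> sector c \<delta>"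
proof
  fix z assume "z \<in> path_image (sector_loop c r \<delta>)"
  then obtain s \<psi> where s: "0 \<le> s" "\<bar>\<psi>\<bar> \<le> pi/5" "z = c + of_real s * cis (\<delta> + \<psi>)"
    using path_image_sector_loop[OF _ assms] by metis
  have "0 \<le> sin (\<psi> + pi/5)" using s(2) by (intro sin_ge_zero) (auto simp: abs_le_iff)
  moreover have "0 \<le> sin (pi/5 - \<psi>)" using s(2) by (intro sin_ge_zero) (auto simp: abs_le_iff)
  then have "sin (\<psi> - pi/5) \<le> 0" using sin_minus[of "pi/5 - \<psi>"] by simp
  ultimately show "z \<in> sector c \<delta>"
    unfolding s(3) in_sector_polar using s(1) by (simp add: mult_nonneg_nonpos)
qed

lemma winding_number_sector_loop_outside:
  assumes "r > 0" "z \<notin> sector c \<delta>"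
  shows "winding_number (sector_loop c r \<delta>) z = 0"
  by (rule winding_number_zero_outside[OF valid_path_imp_path[OF sector_loop_path(1)] convex_sector _ assms(2)
      sector_loop_in_sector[OF assms(1)]]) (simp add: sector_loop_path)

text \<open>The complementary loop \<open>L2\<close>, along the reflex arc, is added. The straight
  sides cancel and a full circle remains, which winds once around the point. \<open>L2\<close>
  misses the ray from the point outwards along the axis, so its winding number is 0.\<close>

lemma winding_number_sector_loop:
  assumes "0 < x" "x < r"
  shows "winding_number (sector_loop c r \<delta>) (c + of_real x * cis \<delta>) = 1"
proof -
  have r: "r > 0" using assms by simp
  define z where "z = c + of_real x * cis \<delta>"
  define A where "A = c + of_real r * cis (\<delta> - pi/5)"
  define B where "B = c + of_real r * cis (\<delta> + pi/5)"
  define arc1 where "arc1 = part_circlepath c r (\<delta> - pi/5) (\<delta> + pi/5)"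
  \<comment> \<open>The reflex arc of angle 8 pi/5 that completes \<open>arc1\<close> to the full
    circle.\<close>
  define arc2 where "arc2 = part_circlepath c r (\<delta> + pi/5) (\<delta> + pi/5 + 8*pi/5)"
  define L2 where "L2 = linepath c B +++ arc2 +++ linepath A c"
  have cisA: "cis (\<delta> + pi/5 + 8*pi/5) = cis (\<delta> - pi/5)"
  proof -
    have "cis (\<delta> - pi/5 + 2*pi) = cis (\<delta> - pi/5)" unfolding cis_mult[symmetric] by simp
    then show ?thesis by (simp add: algebra_simps)
  qed
  have ends: "pathstart arc1 = A" "pathfinish arc1 = B" "pathstart arc2 = B" "pathfinish arc2 = A"
    unfolding arc1_def arc2_def part_circlepath_start_finish cisA A_def B_def by simp_all
  have val: "valid_path arc1" "valid_path arc2" by (simp_all add: arc1_def arc2_def)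
  have L1: "sector_loop c r \<delta> = linepath c A +++ arc1 +++ linepath B c"
    by (simp add: sector_loop_def A_def B_def arc1_def)
  have valL2: "valid_path L2" unfolding L2_def using ends val by (intro valid_path_join) auto
  have clL2: "pathfinish L2 = pathstart L2" by (simp add: L2_def)
  \<comment> \<open>No point at an angle between pi/5 and 9 pi/5 from the axis, measured in either
    direction, lies on the open axis: the sine would have to vanish and the cosine to be
    positive.\<close>
  have on_ray: "False" if "c + of_real s * cis (\<delta> + \<psi>) = c + of_real y * cis \<delta>" "y > 0" "s \<ge> 0" "pi/5 \<le> \<bar>\<psi>\<bar>" "\<bar>\<psi>\<bar> \<le> 9*pi/5" for s y \<psi>
  proof -
    have "of_real s * cis \<psi> = of_real y"
    proof -
      have "of_real s * cis (\<delta> + \<psi>) = of_real s * cis \<psi> * cis \<delta>" by (simp add: cis_mult mult.assoc add.commute)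
      with that(1) have "of_real s * cis \<psi> * cis \<delta> = of_real y * cis \<delta>" by simp
      then show ?thesis by simp
    qed
    then have sc: "s * cos \<psi> = y" "s * sin \<psi> = 0" by (simp_all add: complex_eq_iff)
    then have "s \<noteq> 0" using that(2) by auto
    then have "sin \<bar>\<psi>\<bar> = 0" "cos \<bar>\<psi>\<bar> > 0" using sc that(2,3) by (auto simp: abs_if zero_less_mult_iff)
    then show False
    proof (cases "\<bar>\<psi>\<bar> < pi")
      case True
      then have "sin \<bar>\<psi>\<bar> > 0" using that(4) pi_gt_zero by (intro sin_gt_zero) (linarith, simp)
      then show False using \<open>sin \<bar>\<psi>\<bar> = 0\<close> by simp
    next
      case False
      show False
      proof (cases "\<bar>\<psi>\<bar> = pi")
        case True
        then show False using \<open>cos \<bar>\<psi>\<bar> > 0\<close> by simp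
      next
        case False
        with \<open>\<not> \<bar>\<psi>\<bar> < pi\<close> have "sin \<bar>\<psi>\<bar> < 0" using that(5) pi_gt_zero by (intro sin_lt_zero) (linarith, linarith)
        then show False using \<open>sin \<bar>\<psi>\<bar> = 0\<close> by simp
      qed
    qed
  qed
  define Y where "Y = (\<lambda>y. c + of_real y * cis \<delta>) ` {x..}"
  have imL2: "\<exists>s \<psi>. 0 \<le> s \<and> pi/5 \<le> \<bar>\<psi>\<bar> \<and> \<bar>\<psi>\<bar> \<le> 9*pi/5 \<and> w = c + of_real s * cis (\<delta> + \<psi>)" if "w \<in> path_image L2" for w
  proof -
    have "path_image L2 \<subseteq> path_image (linepath c B) \<union> (path_image arc2 \<union> path_image (linepath A c))"
      unfolding L2_def by (rule order_trans[OF path_image_join_subset Un_mono[OF order_refl path_image_join_subset]])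
    with that consider "w \<in> closed_segment c B" | "w \<in> path_image arc2" | "w \<in> closed_segment A c"
      unfolding path_image_linepath by blast
    then show ?thesis
    proof cases
      case 1
      then obtain u where "0 \<le> u" "w = (1 - u) *\<^sub>R c + u *\<^sub>R B" by (auto simp: closed_segment_def)
      then show ?thesis using r by (intro exI[of _ "u * r"] exI[of _ "pi/5"]) (auto simp: B_def scaleR_conv_of_real algebra_simps)
    next
      case 2
      then obtain y where y: "y \<in> closed_segment (\<delta> + pi/5) (\<delta> + pi/5 + 8*pi/5)" "w = c + of_real r * cis y"
        by (auto simp: arc2_def path_image_part_circlepath' cis_conv_exp)
      have "pi/5 \<le> y - \<delta>" "y - \<delta> \<le> 9*pi/5" using y(1) by (auto simp: closed_segment_eq_real_ivl split: if_splits)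
      then show ?thesis using r y(2) pi_gt_zero by (intro exI[of _ r] exI[of _ "y - \<delta>"]) auto
    next
      case 3
      then obtain u where "u \<le> 1" "w = (1 - u) *\<^sub>R A + u *\<^sub>R c" by (auto simp: closed_segment_def)
      then show ?thesis using r by (intro exI[of _ "(1 - u) * r"] exI[of _ "-(pi/5)"]) (auto simp: A_def scaleR_conv_of_real algebra_simps)
    qed
  qed
  have n2: "winding_number L2 z = 0"
  proof (rule winding_number_zero_unbounded[OF valid_path_imp_path[OF valL2] clL2])
    show "connected Y" unfolding Y_def by (intro connected_continuous_image continuous_intros) (auto intro: convex_connected)
    show "z \<in> Y" by (auto simp: Y_def z_def)
    show "Y \<inter> path_image L2 = {}"
    proof (rule ccontr)
      assume "Y \<inter> path_image L2 \<noteq> {}"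
      then obtain y where y: "y \<ge> x" "c + of_real y * cis \<delta> \<in> path_image L2" by (auto simp: Y_def)
      from imL2[OF y(2)] obtain s \<psi> where "0 \<le> s" "pi/5 \<le> \<bar>\<psi>\<bar>" "\<bar>\<psi>\<bar> \<le> 9*pi/5"
        "c + of_real y * cis \<delta> = c + of_real s * cis (\<delta> + \<psi>)" by (elim exE conjE)
      then show False using on_ray[of s \<psi> y] y(1) assms(1) by simp
    qed
    show "\<not> bounded Y"
    proof
      assume "bounded Y"
      then obtain M where M: "\<And>y. y \<ge> x \<Longrightarrow> norm (c + of_real y * cis \<delta>) \<le> M"
        unfolding bounded_iff Y_def by blast
      define y where "y = x + \<bar>M\<bar> + norm c + 1"
      have "norm (of_real y * cis \<delta>) \<le> norm (c + of_real y * cis \<delta>) + norm c"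
        by (metis add_diff_cancel_left' norm_triangle_ineq4)
      moreover have "y \<ge> 0" using assms(1) by (simp add: y_def)
      then have "norm (of_real y * cis \<delta>) = y" by (simp add: norm_mult)
      moreover have "norm (c + of_real y * cis \<delta>) \<le> M" using assms(1) by (intro M) (simp add: y_def)
      ultimately show False using assms(1) by (simp add: y_def)
    qed
  qed
  define f where "f w = 1 / (w - z)" for w
  have zc: "z \<in> ball c r" using assms by (simp add: z_def dist_norm norm_mult)
  have sph: "path_image arc1 \<subseteq> sphere c r" "path_image arc2 \<subseteq> sphere c r"
    unfolding arc1_def arc2_def using r by (intro path_image_part_circlepath_subset'; simp)+
  have zA: "z \<notin> path_image arc1" "z \<notin> path_image arc2" using sph zc by auto
  have zseg: "z \<notin> closed_segment c A" "z \<notin> closed_segment c B"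
  proof -
    show "z \<notin> closed_segment c A"
    proof
      assume "z \<in> closed_segment c A"
      then obtain u where u: "0 \<le> u" "z = (1 - u) *\<^sub>R c + u *\<^sub>R A" by (auto simp: closed_segment_def)
      then have "c + of_real (u * r) * cis (\<delta> + - (pi/5)) = c + of_real x * cis \<delta>"
        by (simp add: z_def A_def scaleR_conv_of_real algebra_simps)
      from on_ray[OF this assms(1)] u(1) r show False by simp
    qed
    show "z \<notin> closed_segment c B"
    proof
      assume "z \<in> closed_segment c B"
      then obtain u where u: "0 \<le> u" "z = (1 - u) *\<^sub>R c + u *\<^sub>R B" by (auto simp: closed_segment_def)
      then have "c + of_real (u * r) * cis (\<delta> + pi/5) = c + of_real x * cis \<delta>"
        by (simp add: z_def B_def scaleR_conv_of_real algebra_simps)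
      from on_ray[OF this assms(1)] u(1) r show False by simp
    qed
  qed
  have fh: "f holomorphic_on - {z}" unfolding f_def by (intro holomorphic_intros) auto
  have ci: "f contour_integrable_on q" if "valid_path q" "z \<notin> path_image q" for q
    by (rule contour_integrable_holomorphic_simple[OF fh _ that(1)]) (use that in auto)
  have ci1: "f contour_integrable_on linepath c A" "f contour_integrable_on linepath B c"
    "f contour_integrable_on linepath c B" "f contour_integrable_on linepath A c"
    "f contour_integrable_on arc1" "f contour_integrable_on arc2"
    using zseg zA val by (auto intro!: ci simp: closed_segment_commute)
  have "contour_integral (sector_loop c r \<delta>) f = contour_integral (linepath c A) f + (contour_integral arc1 f + contour_integral (linepath B c) f)"
    unfolding L1 using ends val ci1 by (simp add: contour_integral_join contour_integrable_joinI valid_path_join)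
  moreover have "contour_integral L2 f = contour_integral (linepath c B) f + (contour_integral arc2 f + contour_integral (linepath A c) f)"
    unfolding L2_def using ends val ci1 by (simp add: contour_integral_join contour_integrable_joinI valid_path_join)
  moreover have "contour_integral (linepath B c) f = - contour_integral (linepath c B) f"
    "contour_integral (linepath A c) f = - contour_integral (linepath c A) f"
    using contour_integral_reversepath[of "linepath c B" f] contour_integral_reversepath[of "linepath c A" f] by simp_all
  ultimately have sum: "contour_integral (sector_loop c r \<delta>) f + contour_integral L2 f = contour_integral arc1 f + contour_integral arc2 f"
    by simp
  \<comment> \<open>The full circle as two arcs. Its winding number is integrated explicitly at the
    centre and carried to z by constancy on the disc.\<close>
  define L3 where "L3 = arc1 +++ arc2"
  have v3: "valid_path L3" "pathfinish L3 = pathstart L3" unfolding L3_def using val ends by (auto intro: valid_path_join)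
  have im3: "path_image L3 \<subseteq> sphere c r" unfolding L3_def using sph path_image_join_subset by blast
  have "winding_number L3 constant_on ball c r"
    by (rule winding_number_constant[OF valid_path_imp_path[OF v3(1)] v3(2)]) (use im3 in auto)
  then have "winding_number L3 z = winding_number L3 c"
    using zc r unfolding constant_on_def by (metis centre_in_ball)
  also have "winding_number L3 c = 1"
  proof -
    have cn: "c \<notin> path_image L3" using im3 r by auto
    have fh: "(\<lambda>w. 1 / (w - c)) holomorphic_on - {c}" by (intro holomorphic_intros) auto
    have ci: "(\<lambda>w. 1 / (w - c)) contour_integrable_on q" if "valid_path q" "path_image q \<subseteq> sphere c r" for q
      by (rule contour_integrable_holomorphic_simple[OF fh _ that(1)]) (use that r in auto)
    have arc: "contour_integral (part_circlepath c r s t) (\<lambda>w. 1 / (w - c)) = of_real (t - s) * \<i>" if "s < t" for s t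
    proof -
      have "contour_integral (part_circlepath c r s t) (\<lambda>w. 1 / (w - c))
        = integral {s..t} (\<lambda>u. 1 / (c + of_real r * cis u - c) * of_real r * \<i> * cis u)"
        by (rule contour_integral_part_circlepath_eq[OF that])
      also have "\<dots> = integral {s..t} (\<lambda>u. \<i>)" using r by (intro integral_cong) simp
      also have "\<dots> = of_real (t - s) * \<i>" using that by (simp add: scaleR_conv_of_real)
      finally show ?thesis .
    qed
    have "contour_integral L3 (\<lambda>w. 1 / (w - c)) = contour_integral arc1 (\<lambda>w. 1 / (w - c)) + contour_integral arc2 (\<lambda>w. 1 / (w - c))"
      unfolding L3_def by (intro contour_integral_join ci val sph)
    also have "\<dots> = of_real (2 * pi / 5) * \<i> + of_real (8 * pi / 5) * \<i>"
      unfolding arc1_def arc2_def by (subst (1 2) arc) (auto simp: field_simps)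
    also have "\<dots> = 2 * of_real pi * \<i>" by (simp add: field_simps)
    finally show ?thesis
      using winding_number_valid_path[OF v3(1) cn] by simp
  qed
  finally have "winding_number L3 z = 1" .
  moreover have "z \<notin> path_image L3" using im3 zc by auto
  ultimately have "contour_integral L3 f = 2 * of_real pi * \<i>"
    using winding_number_valid_path[OF v3(1)] by (simp add: f_def[abs_def] field_simps)
  moreover have "contour_integral L3 f = contour_integral arc1 f + contour_integral arc2 f"
    unfolding L3_def by (intro contour_integral_join ci1 val)
  moreover have "contour_integral L2 f = 0"
  proof -
    have "z \<notin> path_image L2"
    proof
      assume "z \<in> path_image L2"
      from imL2[OF this] obtain s \<psi> where "0 \<le> s" "pi/5 \<le> \<bar>\<psi>\<bar>" "\<bar>\<psi>\<bar> \<le> 9*pi/5"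
        "z = c + of_real s * cis (\<delta> + \<psi>)" by (elim exE conjE)
      then show False using on_ray[of s \<psi> x] assms(1) by (simp add: z_def)
    qed
    with winding_number_valid_path[OF valL2 this] n2 show ?thesis by (simp add: f_def[abs_def])
  qed
  ultimately have I: "contour_integral (sector_loop c r \<delta>) f = 2 * of_real pi * \<i>" using sum by simp
  have "z \<notin> path_image (sector_loop c r \<delta>)"
  proof
    assume z: "z \<in> path_image (sector_loop c r \<delta>)"
    have "path_image (sector_loop c r \<delta>) \<subseteq> path_image (linepath c A) \<union> (path_image arc1 \<union> path_image (linepath B c))"
      unfolding L1 by (rule order_trans[OF path_image_join_subset Un_mono[OF order_refl path_image_join_subset]])
    with z zseg zA show False unfolding path_image_linepath closed_segment_commute[of B c] by blast
  qed
  from winding_number_valid_path[OF sector_loop_path(1) this] I show ?thesis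
    by (simp add: f_def[abs_def] z_def)
qed

section \<open>Rays and sectors\<close>

text \<open>pi/15 is the angle between the ray at 3 pi/5 and the direction 2 pi/3, and also between
  2 pi/5 and pi/3; 9/10 is the cosine of the aperture of a tail.\<close>

lemma cos_pi_15: "9/10 < cos (pi/15)"
proof -
  have s: "0 \<le> sin (pi/30)" using pi_gt_zero by (intro sin_ge_zero) auto
  have "sin (pi/30) \<le> pi/30" by (rule sin_x_le_x) simp
  then have "sin (pi/30) < 2/15" using pi_less_4 by linarith
  then have "(sin (pi/30))\<^sup>2 < (2/15)\<^sup>2" using s by (intro power_strict_mono) auto
  moreover have "cos (2 * (pi/30)) = 1 - 2 * (sin (pi/30))\<^sup>2" by (rule cos_double_sin)
  ultimately show ?thesis by (simp add: power2_eq_square)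
qed

lemma sin_cos_fifths:
  "0 < sin (pi/5)" "0 < sin (2*pi/5)" "0 < sin (3*pi/5)" "0 < cos (pi/5)" "0 < cos (2*pi/5)" "cos (3*pi/5) < 0"
proof -
  show "0 < sin (pi/5)" "0 < sin (2*pi/5)" "0 < sin (3*pi/5)"
    using pi_gt_zero by (auto intro!: sin_gt_zero)
  show "0 < cos (pi/5)" "0 < cos (2*pi/5)" using pi_gt_zero by (auto intro!: cos_gt_zero)
  have e: "3*pi/5 = pi - 2*pi/5" by simp
  show "cos (3*pi/5) < 0" unfolding e cos_pi_minus using \<open>0 < cos (2*pi/5)\<close> by simp
qed

lemma sector_loop_eq_vertex:
  assumes "r > 0" "t \<in> {0..1}" "sector_loop c r \<delta> t = c"
  shows "t = 0 \<or> t = 1"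
proof (rule ccontr)
  assume t: "\<not> (t = 0 \<or> t = 1)"
  then have t01: "0 < t" "t < 1" using assms(2) by auto
  have ne: "of_real r * cis e \<noteq> 0" for e using assms(1) by simp
  consider "t \<le> 1/2" | "\<not> t \<le> 1/2" "2*t - 1 \<le> 1/2" | "\<not> t \<le> 1/2" "\<not> 2*t - 1 \<le> 1/2" by linarith
  then show False
  proof cases
    case 1
    then have "sector_loop c r \<delta> t - c = of_real (2*t) * (of_real r * cis (\<delta> - pi/5))"
      by (simp add: sector_loop_def joinpaths_def linepath_def scaleR_conv_of_real algebra_simps)
    then show False using assms(3) t01 assms(1) by simp
  next
    case 2
    then have "sector_loop c r \<delta> t - c = part_circlepath c r (\<delta> - pi/5) (\<delta> + pi/5) (2*(2*t-1)) - c"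
      by (simp add: sector_loop_def joinpaths_def)
    also have "norm \<dots> = r" using assms(1) by (simp add: part_circlepath_def norm_mult)
    finally show False using assms by simp
  next
    case 3
    then have "sector_loop c r \<delta> t - c = of_real (4 - 4*t) * (of_real r * cis (\<delta> + pi/5))"
      by (simp add: sector_loop_def joinpaths_def linepath_def scaleR_conv_of_real algebra_simps)
    moreover have "4 - 4*t \<noteq> 0" using t01 by simp
    ultimately show False using assms(3) ne by (metis diff_self mult_eq_0_iff of_real_eq_0_iff)
  qed
qed

lemma sector_loop_delete:
  assumes "r > 0"
  shows "connected (path_image (sector_loop c r \<delta>) - {c})" "finite {t \<in> {0..1}. sector_loop c r \<delta> t = c}"
proof -
  have sub: "{t \<in> {0..1}. sector_loop c r \<delta> t = c} \<subseteq> {0, 1}"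
    using sector_loop_eq_vertex[OF assms] by blast
  then show "finite {t \<in> {0..1}. sector_loop c r \<delta> t = c}" by (rule finite_subset) simp
  have ends: "sector_loop c r \<delta> 0 = c" "sector_loop c r \<delta> 1 = c"
    using sector_loop_path[of c r \<delta>] by (simp_all add: pathstart_def pathfinish_def)
  have "path_image (sector_loop c r \<delta>) - {c} = sector_loop c r \<delta> ` {0<..<1}"
  proof (intro set_eqI iffI)
    fix z assume "z \<in> path_image (sector_loop c r \<delta>) - {c}"
    then obtain t where "t \<in> {0..1}" "z = sector_loop c r \<delta> t" "z \<noteq> c" by (auto simp: path_image_def)
    moreover from this have "t \<noteq> 0" "t \<noteq> 1" using ends by auto
    ultimately show "z \<in> sector_loop c r \<delta> ` {0<..<1}" by auto
  next
    fix z assume "z \<in> sector_loop c r \<delta> ` {0<..<1}"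
    then obtain t where "t \<in> {0<..<1}" "z = sector_loop c r \<delta> t" by blast
    moreover from this have "z \<noteq> c" using sector_loop_eq_vertex[OF assms, of t] by auto
    ultimately show "z \<in> path_image (sector_loop c r \<delta>) - {c}" by (auto simp: path_image_def)
  qed
  moreover have "connected (sector_loop c r \<delta> ` {0<..<1})"
  proof (rule connected_continuous_image)
    have "continuous_on {0..1} (sector_loop c r \<delta>)"
      using valid_path_imp_path[OF sector_loop_path(1)] unfolding path_def .
    then show "continuous_on {0<..<1} (sector_loop c r \<delta>)" by (rule continuous_on_subset) auto
  qed simp
  ultimately show "connected (path_image (sector_loop c r \<delta>) - {c})" by simp
qed

lemma sector_loop_avoids_axis:
  assumes "0 < x" "x < r"
  shows "c + of_real x * cis \<delta> \<notin> path_image (sector_loop c r \<delta>)"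
proof
  assume "c + of_real x * cis \<delta> \<in> path_image (sector_loop c r \<delta>)"
  then obtain s \<psi> where s: "0 \<le> s" "c + of_real x * cis \<delta> = c + of_real s * cis (\<delta> + \<psi>)" "s = r \<or> \<bar>\<psi>\<bar> = pi/5"
    by (rule path_image_sector_loop) (use assms in auto)
  have e: "of_real x * cis \<delta> = of_real s * cis (\<delta> + \<psi>)" using s(2) by simp
  then have "norm (of_real x * cis \<delta>) = norm (of_real s * cis (\<delta> + \<psi>))" by simp
  then have "x = s" using s(1) assms by (simp add: norm_mult)
  then have "\<bar>\<psi>\<bar> = pi/5" using s(3) assms by auto
  have "of_real x * cis \<delta> = of_real x * (cis \<delta> * cis \<psi>)" using e \<open>x = s\<close> by (simp add: cis_mult)
  then have "cis \<psi> = 1" using assms(1) by simp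
  then have "sin \<psi> = 0" by (simp add: complex_eq_iff)
  then have "sin \<bar>\<psi>\<bar> = 0" by (auto simp: abs_if)
  then show False using sin_cos_fifths(1) \<open>\<bar>\<psi>\<bar> = pi/5\<close> by simp
qed

lemma sector_rays:
  assumes "s \<ge> 0" "s \<noteq> 0"
  shows "c + of_real s * cis (3*pi/5) \<notin> sector c pi" "c + of_real s * cis (-3*pi/5) \<notin> sector c pi"
    "c + of_real s * cis (2*pi/5) \<notin> sector c 0" "c + of_real s * cis (-2*pi/5) \<notin> sector c 0"
    "c + of_real s * cis pi \<notin> sector c 0"
proof -
  have s: "s > 0" using assms by simp
  have p: "sin (pi/5) > 0" by (rule sin_cos_fifths)
  have sp: "\<not> s * sin (pi/5) \<le> 0" using mult_pos_pos[OF s p] by linarith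
  have sn: "\<not> 0 \<le> s * sin (- (pi/5))" using sp by simp
  have e: "3*pi/5 - pi + pi/5 = - (pi/5)" "2*pi/5 - 0 - pi/5 = pi/5" "-2*pi/5 - 0 + pi/5 = - (pi/5)" by simp_all
  show "c + of_real s * cis (3*pi/5) \<notin> sector c pi"
    unfolding in_sector_polar e using sn by blast
  show "c + of_real s * cis (2*pi/5) \<notin> sector c 0"
    unfolding in_sector_polar e using sp by blast
  show "c + of_real s * cis (-2*pi/5) \<notin> sector c 0"
    unfolding in_sector_polar e using sn by blast
  have "sin (-3*pi/5 - pi - pi/5) = sin (pi/5)"
  proof -
    have "-3*pi/5 - pi - pi/5 = pi/5 - 2*pi" by simp
    then show ?thesis by (simp only: sin_diff) simp
  qed
  then show "c + of_real s * cis (-3*pi/5) \<notin> sector c pi"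
    unfolding in_sector_polar using sp by metis
  have "pi - 0 + pi/5 = pi/5 + pi" by simp
  then have e5: "sin (pi - 0 + pi/5) = - sin (pi/5)" by (simp only: sin_periodic_pi)
  show "c + of_real s * cis pi \<notin> sector c 0"
    unfolding in_sector_polar e5 using sp by auto
qed

lemma sector_Int_opposite: "sector c 0 \<inter> sector c pi \<subseteq> {c}"
proof
  fix z assume z: "z \<in> sector c 0 \<inter> sector c pi"
  have e: "cis (pi/5 - pi) = - cis (pi/5)" "cis (-pi/5 - pi) = - cis (-pi/5)"
    by (simp_all only: cis_divide[symmetric] cis_pi) simp_all
  define p q where "p = Re (z - c)" and "q = Im (z - c)"
  have 1: "Im ((z - c) * cis (pi/5)) = p * sin (pi/5) + q * cos (pi/5)"
    and 2: "Im ((z - c) * cis (-pi/5)) = - p * sin (pi/5) + q * cos (pi/5)"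
    by (simp_all add: p_def q_def algebra_simps)
  have "Im ((z - c) * cis (pi/5)) = 0" "Im ((z - c) * cis (-pi/5)) = 0"
    using z unfolding sector_def Int_iff mem_Collect_eq e by auto
  then have "q * cos (pi/5) = 0" "p * sin (pi/5) = 0" unfolding 1 2 by linarith+
  then have "p = 0" "q = 0" using sin_cos_fifths by auto
  then show "z \<in> {c}" by (simp add: p_def q_def complex_eq_iff)
qed

lemma vee_Re: "Re (vee p D \<alpha> \<beta> t) = Re p + D * \<bar>t\<bar> * cos (if t < 0 then \<alpha> else \<beta>)"
  by (simp add: vee_def)

text \<open>All four curves pass through the midpoint c, which takes the role of the contact point.
  The bound on \<open>r\<close> puts \<open>a\<close> and \<open>b\<close> inside their sectors. The
  vertical line through c separates the infinite curves, and each infinite curve leaves c outside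
  the sector of the loop belonging to the other variable.\<close>

lemma std_good:
  assumes ab: "b < a" and "D > 0" and r: "(a - b) / 2 < r"
  defines "c \<equiv> complex_of_real ((a + b) / 2)"
  shows "good_contours a b (vee c D (-3*pi/5) (3*pi/5)) (sector_loop c r 0)
    (vee c D (2*pi/5) (-2*pi/5)) (sector_loop c r pi) c"
proof -
  define d where "d = (a - b) / 2"
  have d: "0 < d" "d < r" using ab r by (auto simp: d_def)
  have r0: "r > 0" using d by simp
  have a: "of_real a = c + of_real d * cis 0" and b: "of_real b = c + of_real d * cis pi"
    by (simp_all add: c_def d_def complex_eq_iff field_simps)
  let ?\<gamma> = "vee c D (-3*pi/5) (3*pi/5)" and ?\<gamma>' = "vee c D (2*pi/5) (-2*pi/5)"
  have c15: "9/10 < cos (-(pi/15))" using cos_pi_15 by simp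
  have cone: "cone_curve (-2*pi/3) (2*pi/3) ?\<gamma>" "cone_curve (pi/3) (-pi/3) ?\<gamma>'"
  proof -
    have e: "-3*pi/5 - (-2*pi/3) = pi/15" "3*pi/5 - 2*pi/3 = -(pi/15)" "2*pi/5 - pi/3 = pi/15" "-2*pi/5 - (-pi/3) = -(pi/15)"
      by simp_all
    show "cone_curve (-2*pi/3) (2*pi/3) ?\<gamma>" "cone_curve (pi/3) (-pi/3) ?\<gamma>'"
      using c15 cos_pi_15 \<open>D > 0\<close> by (intro vee_cone_curve; simp only: e)+
  qed
  have vr: "t = 0" if "vee c D \<alpha> \<beta> t = of_real x" "sin \<alpha> \<noteq> 0" "sin \<beta> \<noteq> 0" for \<alpha> \<beta> t x
  proof -
    have "Im (vee c D \<alpha> \<beta> t) = 0" using that by simp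
    then have "D * \<bar>t\<bar> * sin (if t < 0 then \<alpha> else \<beta>) = 0" by (simp add: vee_def c_def)
    then show ?thesis using that \<open>D > 0\<close> by (auto split: if_splits)
  qed
  have v0: "vee c D \<alpha> \<beta> 0 = c" for \<alpha> \<beta> by (simp add: vee_def)
  have cx: "b < x \<and> x < a" if "c = of_real x" for x
  proof -
    have "x = (a + b) / 2" using that unfolding c_def by (simp only: of_real_eq_iff)
    then show ?thesis using ab by simp
  qed
  have sn: "sin (-3*pi/5) \<noteq> 0" "sin (3*pi/5) \<noteq> 0" "sin (2*pi/5) \<noteq> 0" "sin (-2*pi/5) \<noteq> 0"
    using sin_cos_fifths by simp_all
  have real: "b < x \<and> x < a" if "?\<gamma> t = of_real x" for t x
    using vr[OF that sn(1,2)] that v0 cx by simp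
  have real': "b < x" if "?\<gamma>' t = of_real x" for t x
    using vr[OF that sn(3,4)] that v0 cx by simp
  have im: "path_image (sector_loop c r \<delta>) \<subseteq> sector c \<delta>" for \<delta> by (rule sector_loop_in_sector[OF r0])
  have g_sect: "?\<gamma> t \<notin> sector c pi" if "t \<noteq> 0" for t
  proof -
    have "0 \<le> D * \<bar>t\<bar>" "D * \<bar>t\<bar> \<noteq> 0" using that \<open>D > 0\<close> by auto
    from sector_rays(1,2)[OF this, of c] show ?thesis
      unfolding vee_def by (cases "t < 0") (simp_all only: if_True if_False not_False_eq_True)
  qed
  have g'_sect: "?\<gamma>' t \<notin> sector c 0" if "t \<noteq> 0" for t
  proof -
    have "0 \<le> D * \<bar>t\<bar>" "D * \<bar>t\<bar> \<noteq> 0" using that \<open>D > 0\<close> by auto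
    from sector_rays(3,4)[OF this, of c] show ?thesis
      unfolding vee_def by (cases "t < 0") (simp_all only: if_True if_False not_False_eq_True)
  qed
  have b_sect: "of_real b \<notin> sector c 0" unfolding b using sector_rays(5)[of d c] d by simp
  have Re_g: "Re (?\<gamma> t) < Re c" if "t \<noteq> 0" for t
    using that sin_cos_fifths(6) \<open>D > 0\<close> by (auto simp: vee_Re mult_pos_neg)
  have Re_g': "Re c \<le> Re (?\<gamma>' t)" for t
    using sin_cos_fifths(5) \<open>D > 0\<close> by (auto simp: vee_Re)
  have left: "left_of_curve (range ?\<gamma>) ?\<gamma>'"
    unfolding left_of_curve_def
  proof
    fix z assume "z \<in> range ?\<gamma> - range ?\<gamma>'"
    then obtain t where t: "z = ?\<gamma> t" "?\<gamma> t \<notin> range ?\<gamma>'" by blast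
    have "t \<noteq> 0" using t(2) v0 by (metis rangeI)
    then have z: "Re z < Re c" using t Re_g by simp
    have "convex {w. Re w < Re c}" by (rule convex_halfspace_Re_lt)
    then have conn: "connected {w. Re w < Re c}" by (rule convex_connected)
    have sub: "{w. Re w < Re c} \<subseteq> - range ?\<gamma>'" 
    proof (rule subsetI, rule ComplI)
      fix w assume w: "w \<in> {w. Re w < Re c}" "w \<in> range ?\<gamma>'"
      then obtain t where "w = ?\<gamma>' t" by blast
      with w(1) Re_g'[of t] show False by simp
    qed
    have "eventually (\<lambda>x. x < Re c) at_bot" by (rule eventually_gt_at_bot)
    then show "eventually (\<lambda>x. connected_component (- range ?\<gamma>') z (of_real x)) at_bot"
      by eventually_elim (use conn sub z in \<open>auto simp: connected_component_def intro!: exI[of _ "{w. Re w < Re c}"]\<close>)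
  qed
  have inter1: "range ?\<gamma> \<inter> range ?\<gamma>' \<subseteq> {c}"
  proof
    fix z assume "z \<in> range ?\<gamma> \<inter> range ?\<gamma>'"
    then obtain t u where tu: "z = ?\<gamma> t" "z = ?\<gamma>' u" by blast
    have "t = 0" using Re_g[of t] Re_g'[of u] tu by force
    then show "z \<in> {c}" using tu v0 by simp
  qed
  have inter2: "path_image (sector_loop c r pi) \<inter> range ?\<gamma> \<subseteq> {c}"
  proof
    fix z assume "z \<in> path_image (sector_loop c r pi) \<inter> range ?\<gamma>"
    then obtain t where "z = ?\<gamma> t" "?\<gamma> t \<in> sector c pi" using im by blast
    then show "z \<in> {c}" using g_sect[of t] v0 by (cases "t = 0") auto
  qed
  have inter3: "range ?\<gamma>' \<inter> path_image (sector_loop c r 0) \<subseteq> {c}"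
  proof
    fix z assume "z \<in> range ?\<gamma>' \<inter> path_image (sector_loop c r 0)"
    then obtain t where "z = ?\<gamma>' t" "?\<gamma>' t \<in> sector c 0" using im by blast
    then show "z \<in> {c}" using g'_sect[of t] v0 by (cases "t = 0") auto
  qed
  have inter4: "path_image (sector_loop c r pi) \<inter> path_image (sector_loop c r 0) \<subseteq> {c}"
    using im[of 0] im[of pi] sector_Int_opposite[of c] by blast
  have bound: "norm (winding_number (sector_loop c r pi) w) \<le> 1" if "w \<in> range ?\<gamma> - {c}" for w
  proof -
    from that obtain t where t: "w = ?\<gamma> t" by blast
    moreover have "?\<gamma> t \<noteq> c" using that t by simp
    ultimately have "w \<notin> sector c pi" using g_sect[of t] v0 by (cases "t = 0") auto
    from winding_number_sector_loop_outside[OF r0 this] show ?thesis by simp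
  qed
  have na: "of_real a \<notin> path_image (sector_loop c r 0)" unfolding a by (rule sector_loop_avoids_axis[OF d])
  have nb: "of_real b \<notin> path_image (sector_loop c r pi)" unfolding b by (rule sector_loop_avoids_axis[OF d])
  have nb0: "of_real b \<notin> path_image (sector_loop c r 0)" using im[of 0] b_sect by blast
  have wa: "winding_number (sector_loop c r 0) (of_real a) = 1" unfolding a by (rule winding_number_sector_loop[OF d])
  have wb: "winding_number (sector_loop c r pi) (of_real b) = 1" unfolding b by (rule winding_number_sector_loop[OF d])
  have wb0: "winding_number (sector_loop c r 0) (of_real b) = 0"
    by (rule winding_number_sector_loop_outside[OF r0 b_sect])
  have cl: "pathfinish (sector_loop c r \<delta>) = pathstart (sector_loop c r \<delta>)" for \<delta>
    by (simp add: sector_loop_path)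
  show ?thesis
    unfolding good_contours_def
    by (intro conjI allI impI ballI cone sector_loop_path(1) cl na nb nb0 wa wb wb0 sector_loop_delete[OF r0]
        inter1 inter2 inter3 inter4 bound left) (drule real real', blast, assumption?)+
qed

section \<open>Decomposition of the rescaled contours into pieces\<close>

text \<open>Pieces of the contours in the rescaled variable: the two rays of the infinite curve
  (\<open>j = 0, 1\<close>), then the two sides of length \<open>\<rho>\<close> (\<open>j = 2, 3\<close>) and the arc (\<open>j = 4\<close>) of the sector loop.
  The factor \<open>omega\<close> is the oriented derivative, extended by \<open>0\<close>, so that all pieces live on \<open>{0<..}\<close>.\<close>

definition zeta :: "real \<Rightarrow> nat \<Rightarrow> real \<Rightarrow> complex" where
  "zeta \<rho> j r = (if j = 0 then of_real r * cis (-3*pi/5) else if j = 1 then of_real r * cis (3*pi/5)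
     else if j = 2 then of_real r * cis (pi/5) else if j = 3 then of_real r * cis (-pi/5)
     else of_real \<rho> * cis (r - pi/5))"

definition omega :: "real \<Rightarrow> nat \<Rightarrow> real \<Rightarrow> complex" where
  "omega \<rho> j r = (if j = 0 then - cis (-3*pi/5) else if j = 1 then cis (3*pi/5)
     else if j = 2 then (if r \<le> \<rho> then - cis (pi/5) else 0) else if j = 3 then (if r \<le> \<rho> then cis (-pi/5) else 0)
     else (if r \<le> 2*pi/5 then of_real \<rho> * \<i> * cis (r - pi/5) else 0))"

lemma has_integral_reflect_UNIV:
  fixes f :: "real \<Rightarrow> complex"
  assumes "(f has_integral i) UNIV"
  shows "((\<lambda>x. f (-x)) has_integral i) UNIV"
  unfolding has_integral_alt'
proof (intro conjI allI impI)
  note A = assms[unfolded has_integral_alt']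
  show "(\<lambda>x. if x \<in> UNIV then f (-x) else 0) integrable_on cbox a b" for a b
    using A Henstock_Kurzweil_Integration.integrable_reflect_real[where f = f and a = "-b" and b = "-a"] by (auto simp: box_real)
  fix e :: real assume "e > 0"
  then obtain B where B: "B > 0" "\<And>a b. ball 0 B \<subseteq> cbox a b \<Longrightarrow> norm (integral (cbox a b) f - i) < e"
    using A by (auto simp only: UNIV_I if_True)
  show "\<exists>B>0. \<forall>a b. ball 0 B \<subseteq> cbox a b \<longrightarrow> norm (integral (cbox a b) (\<lambda>x. if x \<in> UNIV then f (-x) else 0) - i) < e"
  proof (intro exI[of _ B] conjI allI impI B(1))
    fix a b :: real assume sub: "ball 0 B \<subseteq> cbox a b"
    have "ball 0 B \<subseteq> cbox (-b) (-a)"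
    proof
      fix x :: real assume "x \<in> ball 0 B"
      then have "- x \<in> ball 0 B" by simp
      then have "- x \<in> cbox a b" using sub by blast
      then show "x \<in> cbox (-b) (-a)" by (auto simp: box_real)
    qed
    from B(2)[OF this] show "norm (integral (cbox a b) (\<lambda>x. if x \<in> UNIV then f (-x) else 0) - i) < e"
      using Henstock_Kurzweil_Integration.integral_reflect_real[where f = f and a = "-b" and b = "-a"] by (simp add: box_real)
  qed
qed

lemma has_integral_reflect_half_line:
  fixes f :: "real \<Rightarrow> complex"
  assumes "(f has_integral i) {0<..}"
  shows "((\<lambda>x. f (-x)) has_integral i) {..<0}"
proof -
  have "((\<lambda>x. if x \<in> {0<..} then f x else 0) has_integral i) UNIV"
    unfolding has_integral_restrict_UNIV by (rule assms)
  from has_integral_reflect_UNIV[OF this]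
  have "((\<lambda>x. if x \<in> {..<0} then f (-x) else 0) has_integral i) UNIV" by simp
  then show ?thesis unfolding has_integral_restrict_UNIV .
qed

lemma line_integral_vee:
  assumes I\<alpha>: "((\<lambda>r. f (p + of_real (D * r) * cis \<alpha>)) has_integral I\<alpha>) {0<..}"
    and I\<beta>: "((\<lambda>r. f (p + of_real (D * r) * cis \<beta>)) has_integral I\<beta>) {0<..}"
  shows "line_integral (vee p D \<alpha> \<beta>) f = of_real D * (cis \<beta> * I\<beta> - cis \<alpha> * I\<alpha>)"
proof -
  define F where "F t = f (vee p D \<alpha> \<beta> t) * vee_deriv D \<alpha> \<beta> t" for t
  have "((\<lambda>r. (of_real D * cis \<beta>) * f (p + of_real (D * r) * cis \<beta>)) has_integral (of_real D * cis \<beta>) * I\<beta>) {0<..}"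
    by (intro has_integral_mult_right I\<beta>)
  then have 1: "(F has_integral (of_real D * cis \<beta>) * I\<beta>) {0<..}"
    by (rule has_integral_eq[rotated]) (auto simp: F_def vee_def vee_deriv_def)
  have "((\<lambda>r. (- of_real D * cis \<alpha>) * f (p + of_real (D * r) * cis \<alpha>)) has_integral (- of_real D * cis \<alpha>) * I\<alpha>) {0<..}"
    by (intro has_integral_mult_right I\<alpha>)
  from has_integral_reflect_half_line[OF this]
  have 2: "(F has_integral (- of_real D * cis \<alpha>) * I\<alpha>) {..<0}"
    by (rule has_integral_eq[rotated]) (auto simp: F_def vee_def vee_deriv_def)
  have "(F has_integral ((of_real D * cis \<beta>) * I\<beta> + (- of_real D * cis \<alpha>) * I\<alpha>)) ({0<..} \<union> {..<0})"
  proof (rule has_integral_Un[OF 1 2])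
    have "{0<..} \<inter> {..<0::real} = {}" by auto
    then show "negligible ({0<..} \<inter> {..<0::real})" by simp
  qed
  then have "(F has_integral ((of_real D * cis \<beta>) * I\<beta> + (- of_real D * cis \<alpha>) * I\<alpha>)) UNIV"
    by (subst has_integral_spike_set_eq[of _ "{0<..} \<union> {..<0}"]) (auto intro!: negligible_subset[OF negligible_sing[of 0]])
  moreover have "integral UNIV (\<lambda>t. f (vee p D \<alpha> \<beta> t) * vector_derivative (vee p D \<alpha> \<beta>) (at t)) = integral UNIV F"
    by (rule integral_spike[of "{0}"]) (auto simp: F_def vector_derivative_at[OF vee_has_derivative])
  ultimately show ?thesis by (simp add: line_integral_def integral_unique algebra_simps)
qed

lemma has_contour_integral_radius:
  assumes "\<rho> > 0" and I: "((\<lambda>r. f (c + of_real (D * r) * cis \<theta>)) has_integral I) {0..\<rho>}"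
  shows "(f has_contour_integral (of_real D * cis \<theta> * I)) (linepath c (c + of_real (D * \<rho>) * cis \<theta>))"
proof -
  define F where "F r = f (c + of_real (D * r) * cis \<theta>)" for r
  have "(F has_integral I) (cbox 0 \<rho>)" using I by (simp add: F_def[abs_def] box_real)
  from has_integral_affinity[OF this, of \<rho> 0] \<open>\<rho> > 0\<close>
  have "((\<lambda>x. F (\<rho> * x)) has_integral ((1/\<rho>) *\<^sub>R I)) ((\<lambda>x. x / \<rho>) ` {0..\<rho>})"
    by (simp add: box_real divide_inverse mult.commute)
  moreover have "(\<lambda>x. x / \<rho>) ` {0..\<rho>} = {0..1}" using \<open>\<rho> > 0\<close> by simp
  ultimately have "((\<lambda>x. F (\<rho> * x)) has_integral ((1/\<rho>) *\<^sub>R I)) {0..1}" by simp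
  from has_integral_mult_left[OF this, of "of_real (D * \<rho>) * cis \<theta>"]
  have "((\<lambda>x. F (\<rho> * x) * (of_real (D * \<rho>) * cis \<theta>)) has_integral (((1/\<rho>) *\<^sub>R I) * (of_real (D * \<rho>) * cis \<theta>))) {0..1}" .
  moreover have "((1/\<rho>) *\<^sub>R I) * (of_real (D * \<rho>) * cis \<theta>) = of_real D * cis \<theta> * I"
    using \<open>\<rho> > 0\<close> by (simp add: scaleR_conv_of_real)
  moreover have "F (\<rho> * x) = f (linepath c (c + of_real (D * \<rho>) * cis \<theta>) x)" for x
    unfolding F_def by (rule arg_cong[where f = f]) (simp add: linepath_def scaleR_conv_of_real algebra_simps)
  ultimately show ?thesis
    unfolding has_contour_integral_linepath by simp
qed

lemma contour_integral_sector_loop: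
  assumes "\<rho> > 0" "D > 0"
    and I1: "((\<lambda>r. f (c + of_real (D * r) * cis (\<delta> - pi/5))) has_integral I1) {0..\<rho>}"
    and I2: "((\<lambda>r. f (c + of_real (D * r) * cis (\<delta> + pi/5))) has_integral I2) {0..\<rho>}"
    and I3: "((\<lambda>u. f (c + of_real (D * \<rho>) * cis (\<delta> + (u - pi/5))) * cis (\<delta> + (u - pi/5))) has_integral I3) {0..2*pi/5}"
  shows "contour_integral (sector_loop c (D * \<rho>) \<delta>) f
    = of_real D * (cis (\<delta> - pi/5) * I1 + of_real \<rho> * \<i> * I3 - cis (\<delta> + pi/5) * I2)"
proof -
  let ?A = "c + of_real (D * \<rho>) * cis (\<delta> - pi/5)" and ?B = "c + of_real (D * \<rho>) * cis (\<delta> + pi/5)"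
  let ?arc = "part_circlepath c (D * \<rho>) (\<delta> - pi/5) (\<delta> + pi/5)"
  have 1: "(f has_contour_integral (of_real D * cis (\<delta> - pi/5) * I1)) (linepath c ?A)"
    by (rule has_contour_integral_radius[OF assms(1) I1])
  have 2: "(f has_contour_integral - (of_real D * cis (\<delta> + pi/5) * I2)) (linepath ?B c)"
    by (rule has_contour_integral_reverse_linepath[OF has_contour_integral_radius[OF assms(1) I2]])
  define F where "F u = f (c + of_real (D * \<rho>) * cis (\<delta> + (u - pi/5))) * cis (\<delta> + (u - pi/5))" for u
  have "(F has_integral I3) (cbox 0 (2*pi/5))" using I3 by (simp add: F_def[abs_def] box_real)
  from has_integral_affinity[OF this, of 1 "- (\<delta> - pi/5)"]
  have "((\<lambda>x. F (x - (\<delta> - pi/5))) has_integral I3) ((\<lambda>x. x + (\<delta> - pi/5)) ` {0..2*pi/5})"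
    by (simp add: box_real algebra_simps)
  moreover have "(\<lambda>x. x + (\<delta> - pi/5)) ` {0..2*pi/5} = {\<delta> - pi/5..\<delta> + pi/5}"
    using image_add_atLeastAtMost'[of "\<delta> - pi/5" 0 "2*pi/5"] by (simp add: algebra_simps)
  ultimately have "((\<lambda>x. F (x - (\<delta> - pi/5))) has_integral I3) {\<delta> - pi/5..\<delta> + pi/5}" by metis
  from has_integral_mult_left[OF this, of "of_real (D * \<rho>) * \<i>"]
  have "((\<lambda>x. f (c + of_real (D * \<rho>) * cis x) * of_real (D * \<rho>) * \<i> * cis x) has_integral (I3 * (of_real (D * \<rho>) * \<i>))) {\<delta> - pi/5..\<delta> + pi/5}"
    by (rule has_integral_eq[rotated]) (simp add: F_def algebra_simps)
  then have 3: "(f has_contour_integral (I3 * (of_real (D * \<rho>) * \<i>))) ?arc"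
    by (subst has_contour_integral_part_circlepath_iff) (use pi_gt_zero in auto)
  have "(f has_contour_integral (of_real D * cis (\<delta> - pi/5) * I1 + (I3 * (of_real (D * \<rho>) * \<i>) + - (of_real D * cis (\<delta> + pi/5) * I2))))
    (sector_loop c (D * \<rho>) \<delta>)"
    unfolding sector_loop_def
    by (intro has_contour_integral_join 1 2 3 valid_path_join valid_path_linepath valid_path_part_circlepath)
       (simp_all only: part_circlepath_start_finish pathstart_linepath)
  from contour_integral_unique[OF this] show ?thesis by (simp add: algebra_simps)
qed

lemma has_integral_truncate:
  fixes g :: "real \<Rightarrow> complex"
  assumes "L > 0" "((\<lambda>r. g r * (if r \<le> L then k r else 0)) has_integral J) {0<..}"
  shows "((\<lambda>r. g r * k r) has_integral J) {0..L}"
proof -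
  have "((\<lambda>r. if r \<in> {0<..L} then g r * k r else 0) has_integral J) {0<..}"
    by (rule has_integral_eq[OF _ assms(2)]) auto
  then have "((\<lambda>r. g r * k r) has_integral J) {0<..L}"
    by (subst (asm) has_integral_restrict) auto
  then show ?thesis
    by (subst has_integral_spike_set_eq[of _ "{0<..L}"]) (auto intro!: negligible_subset[OF negligible_sing[of 0]])
qed

text \<open>The factor \<open>cis \<delta>\<close> lets one list of pieces serve both contours:
  \<delta> = 0 gives the outer one, and \<delta> = pi maps every point to its opposite with respect
  to \<open>c\<close>, which gives the inner one.\<close>

lemma line_plus_loop_integral:
  assumes "\<rho> > 0" "D > 0" and \<sigma>: "cis \<alpha> = cis \<delta> * cis (-3*pi/5)" "cis \<beta> = cis \<delta> * cis (3*pi/5)"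
    and I: "\<And>j. j < 5 \<Longrightarrow> (\<lambda>r. f (c + of_real D * cis \<delta> * zeta \<rho> j r) * omega \<rho> j r) integrable_on {0<..}"
  shows "line_integral (vee c D \<alpha> \<beta>) f + contour_integral (sector_loop c (D * \<rho>) \<delta>) f
    = of_real D * cis \<delta> * (\<Sum>j<5. integral {0<..} (\<lambda>r. f (c + of_real D * cis \<delta> * zeta \<rho> j r) * omega \<rho> j r))"
proof -
  define J where "J j = integral {0<..} (\<lambda>r. f (c + of_real D * cis \<delta> * zeta \<rho> j r) * omega \<rho> j r)" for j
  have HJ: "((\<lambda>r. f (c + of_real D * cis \<delta> * zeta \<rho> j r) * omega \<rho> j r) has_integral J j) {0<..}" if "j < 5" for j
    unfolding J_def using I[OF that] by (rule integrable_integral)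
  have cc: "cis t * cis (-t) = 1" "cis (-t) * cis t = 1" for t by (simp_all add: cis_mult)
  have c1: "cis (-3*pi/5) * cis (3*pi/5) = 1" "cis (3*pi/5) * cis (-3*pi/5) = 1" "cis (-pi/5) * cis (pi/5) = 1" "cis (pi/5) * cis (-pi/5) = 1"
    by (simp_all add: cis_mult)
  have "((\<lambda>r. f (c + of_real (D * r) * cis \<alpha>)) has_integral (J 0 * (- cis (3*pi/5)))) {0<..}"
    by (rule has_integral_eq[OF _ has_integral_mult_left[OF HJ, of 0 "- cis (3*pi/5)"]])
       (simp_all add: zeta_def omega_def \<sigma>(1) mult.assoc c1[simplified] mult.left_commute[of "cis \<delta>"])
  moreover have "((\<lambda>r. f (c + of_real (D * r) * cis \<beta>)) has_integral (J 1 * cis (-3*pi/5))) {0<..}"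
    by (rule has_integral_eq[OF _ has_integral_mult_left[OF HJ, of 1 "cis (-3*pi/5)"]])
       (simp_all add: zeta_def omega_def \<sigma>(2) mult.assoc c1[simplified] mult.left_commute[of "cis \<delta>"])
  ultimately have L: "line_integral (vee c D \<alpha> \<beta>) f = of_real D * (cis \<beta> * (J 1 * cis (-3*pi/5)) - cis \<alpha> * (J 0 * (- cis (3*pi/5))))"
    by (rule line_integral_vee)
  have e: "cis (\<delta> - pi/5) = cis \<delta> * cis (-pi/5)" "cis (\<delta> + pi/5) = cis \<delta> * cis (pi/5)"
    "cis (\<delta> + (u - pi/5)) = cis \<delta> * cis (u - pi/5)" for u
    by (simp_all only: cis_mult) simp_all
  have "((\<lambda>r. f (c + of_real D * cis \<delta> * zeta \<rho> 2 r) * (- cis (pi/5))) has_integral J 2) {0..\<rho>}"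
    by (rule has_integral_truncate[OF assms(1)]) (use HJ[of 2] in \<open>simp add: omega_def\<close>)
  then have I2: "((\<lambda>r. f (c + of_real (D * r) * cis (\<delta> + pi/5))) has_integral (J 2 * (- cis (-pi/5)))) {0..\<rho>}"
    by (rule has_integral_eq[OF _ has_integral_mult_left, rotated])
       (simp_all add: zeta_def e mult.assoc c1[simplified] mult.left_commute[of "cis \<delta>"])
  have "((\<lambda>r. f (c + of_real D * cis \<delta> * zeta \<rho> 3 r) * cis (-pi/5)) has_integral J 3) {0..\<rho>}"
    by (rule has_integral_truncate[OF assms(1)]) (use HJ[of 3] in \<open>simp add: omega_def\<close>)
  then have I1: "((\<lambda>r. f (c + of_real (D * r) * cis (\<delta> - pi/5))) has_integral (J 3 * cis (pi/5))) {0..\<rho>}"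
    by (rule has_integral_eq[OF _ has_integral_mult_left, rotated])
       (simp_all add: zeta_def e mult.assoc c1[simplified] mult.left_commute[of "cis \<delta>"])
  have "((\<lambda>r. f (c + of_real D * cis \<delta> * zeta \<rho> 4 r) * (of_real \<rho> * \<i> * cis (r - pi/5))) has_integral J 4) {0..2*pi/5}"
    by (rule has_integral_truncate) (use HJ[of 4] in \<open>simp_all add: omega_def\<close>)
  then have I3: "((\<lambda>u. f (c + of_real (D * \<rho>) * cis (\<delta> + (u - pi/5))) * cis (\<delta> + (u - pi/5))) has_integral (J 4 * (cis \<delta> / (of_real \<rho> * \<i>)))) {0..2*pi/5}"
  proof (rule has_integral_eq[OF _ has_integral_mult_left, rotated])
    fix u :: real
    have gen: "(X * (A * C)) * (B / A) = X * (B * C)" if "A \<noteq> 0" for X A B C :: complex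
      using that by simp
    have z4: "c + of_real D * cis \<delta> * zeta \<rho> 4 u = c + of_real (D * \<rho>) * cis (\<delta> + (u - pi/5))"
      unfolding e by (simp add: zeta_def mult_ac)
    show "f (c + of_real D * cis \<delta> * zeta \<rho> 4 u) * (of_real \<rho> * \<i> * cis (u - pi/5)) * (cis \<delta> / (of_real \<rho> * \<i>))
        = f (c + of_real (D * \<rho>) * cis (\<delta> + (u - pi/5))) * cis (\<delta> + (u - pi/5))"
      unfolding z4 by (subst gen) (use assms(1) in \<open>simp_all add: e\<close>)
  qed
  have C: "contour_integral (sector_loop c (D * \<rho>) \<delta>) f
    = of_real D * (cis (\<delta> - pi/5) * (J 3 * cis (pi/5)) + of_real \<rho> * \<i> * (J 4 * (cis \<delta> / (of_real \<rho> * \<i>))) - cis (\<delta> + pi/5) * (J 2 * (- cis (-pi/5))))"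
    by (rule contour_integral_sector_loop[OF assms(1,2) I1 I2 I3])
  have S: "(\<Sum>j<5. J j) = J 0 + J 1 + J 2 + J 3 + J 4"
    by (simp add: eval_nat_numeral)
  have k: "(s * x) * (y * x') = s * y" "(s * x) * (y * (- x')) = - (s * y)" if "x * x' = 1" for s x y x' :: complex
  proof -
    have "(s * x) * (y * x') = s * y * (x * x')" by (simp only: mult_ac)
    then show "(s * x) * (y * x') = s * y" using that by simp
    have "(s * x) * (y * (- x')) = - (s * y * (x * x'))" by (simp add: mult_ac)
    then show "(s * x) * (y * (- x')) = - (s * y)" using that by simp
  qed
  have L': "line_integral (vee c D \<alpha> \<beta>) f = of_real D * (cis \<delta> * J 1 + cis \<delta> * J 0)"
    unfolding L \<sigma> k(1)[OF c1(2)] k(2)[OF c1(1)] by simp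
  have "of_real \<rho> * \<i> * (J 4 * (cis \<delta> / (of_real \<rho> * \<i>))) = cis \<delta> * J 4"
    using assms(1) by simp
  then have C': "contour_integral (sector_loop c (D * \<rho>) \<delta>) f = of_real D * (cis \<delta> * J 3 + cis \<delta> * J 4 + cis \<delta> * J 2)"
    unfolding C e k(1)[OF c1(3)] k(2)[OF c1(4)] by simp
  show ?thesis unfolding L' C' J_def[symmetric] S by (simp add: algebra_simps)
qed

section \<open>Asymptotics of the rescaled integrand\<close>

text \<open>A dominating function of product form allows dominated convergence twice: for fixed r
  with B r times B, and then for the outer integral with B times the integral of B. Joint
  measurability makes the inner integral measurable in r.\<close>

lemma iterated_dominated_convergence:
  fixes G :: "nat \<Rightarrow> real \<Rightarrow> real \<Rightarrow> complex"
  assumes S: "S \<in> sets borel"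
    and meas: "\<And>n. case_prod (G n) \<in> borel_measurable (borel \<Otimes>\<^sub>M borel)"
    and B: "set_integrable lborel S B" "\<And>r. r \<in> S \<Longrightarrow> 0 \<le> B r"
    and bnd: "\<And>n r s. r \<in> S \<Longrightarrow> s \<in> S \<Longrightarrow> norm (G n r s) \<le> B r * B s"
    and lim: "\<And>r s. r \<in> S \<Longrightarrow> s \<in> S \<Longrightarrow> (\<lambda>n. G n r s) \<longlonglongrightarrow> G' r s"
  shows "\<And>n r. r \<in> S \<Longrightarrow> G n r integrable_on S"
    and "\<And>n. (\<lambda>r. integral S (G n r)) integrable_on S"
    and "(\<lambda>n. integral S (\<lambda>r. integral S (G n r))) \<longlonglongrightarrow> integral S (\<lambda>r. integral S (G' r))"
    and "(\<lambda>r. integral S (G' r)) integrable_on S"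
proof -
  have sm: "G n r \<in> borel_measurable borel" for n r
    using measurable_compose[OF measurable_Pair1' meas[of n], of r] by simp
  have Sl: "S \<in> sets lborel" using S by simp
  have ind: "(\<lambda>s. indicator S s *\<^sub>R G n r s) \<in> borel_measurable lborel" for n r
    using sm[of n r] S by measurable
  have w: "integrable lborel (\<lambda>s. B r * (indicator S s *\<^sub>R B s))" for r
    using B(1) unfolding set_integrable_def by (rule integrable_mult_right)
  have inner_bnd: "norm (indicator S s *\<^sub>R G n r s) \<le> B r * (indicator S s *\<^sub>R B s)" if "r \<in> S" for n r s
    using bnd[OF that, of s n] by (auto simp: indicator_def)
  have si: "set_integrable lborel S (G n r)" if "r \<in> S" for n r
    unfolding set_integrable_def
    by (rule Bochner_Integration.integrable_bound[OF w[of r] ind])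
       (use inner_bnd[OF that] in \<open>auto intro!: AE_I2 order_trans[OF _ abs_ge_self]\<close>)
  show "G n r integrable_on S" if "r \<in> S" for n r
    by (rule set_borel_integral_eq_integral(1)[OF si[OF that]])
  define I where "I n r = (LINT s|lborel. indicator S s *\<^sub>R G n r s)" for n r
  define I' where "I' r = (LINT s|lborel. indicator S s *\<^sub>R G' r s)" for r
  have I: "I n r = integral S (G n r)" if "r \<in> S" for n r
    using set_borel_integral_eq_integral(2)[OF si[OF that]] by (simp add: I_def set_lebesgue_integral_def)
  have limind: "(\<lambda>n. indicator S s *\<^sub>R G n r s) \<longlonglongrightarrow> indicator S s *\<^sub>R G' r s" if "r \<in> S" for r s
    using lim[OF that, of s] by (auto simp: indicator_def)
  have meas': "(\<lambda>s. indicator S s *\<^sub>R G' r s) \<in> borel_measurable lborel" if "r \<in> S" for r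
    by (rule borel_measurable_LIMSEQ_metric[OF ind limind[OF that]])
  have conv: "(\<lambda>n. I n r) \<longlonglongrightarrow> I' r" if "r \<in> S" for r
    unfolding I_def I'_def
    by (rule integral_dominated_convergence[where s = "\<lambda>n s. indicator S s *\<^sub>R G n r s", OF meas'[OF that] ind w[of r]])
       (intro AE_I2 limind[OF that] inner_bnd[OF that])+
  have int': "integrable lborel (\<lambda>s. indicator S s *\<^sub>R G' r s)" if "r \<in> S" for r
    by (rule integrable_dominated_convergence[where s = "\<lambda>n s. indicator S s *\<^sub>R G n r s", OF meas'[OF that] ind w[of r]])
       (intro AE_I2 limind[OF that] inner_bnd[OF that])+
  have I': "I' r = integral S (G' r)" if "r \<in> S" for r
    using set_borel_integral_eq_integral(2)[of S "G' r"] int'[OF that]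
    by (simp add: I'_def set_lebesgue_integral_def set_integrable_def)
  define b where "b = (LINT s|lborel. indicator S s *\<^sub>R B s)"
  have Ibnd: "norm (I n r) \<le> B r * b" if "r \<in> S" for n r
  proof -
    have "norm (I n r) \<le> (LINT s|lborel. norm (indicator S s *\<^sub>R G n r s))"
      unfolding I_def by (rule integral_norm_bound)
    also have "\<dots> \<le> (LINT s|lborel. B r * (indicator S s *\<^sub>R B s))"
      using si[OF that] inner_bnd[OF that] w[of r] unfolding set_integrable_def
      by (intro integral_mono integrable_norm) auto
    finally show ?thesis by (simp add: b_def)
  qed
  have Im: "I n \<in> borel_measurable lborel" for n
  proof -
    have "case_prod (\<lambda>r s. indicator S s *\<^sub>R G n r s) \<in> borel_measurable (borel \<Otimes>\<^sub>M lborel)"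
    proof -
      have "(\<lambda>x. indicator S (snd x) *\<^sub>R case_prod (G n) x) \<in> borel_measurable (borel \<Otimes>\<^sub>M borel)"
        using meas[of n] S by measurable
      then show ?thesis by (simp add: case_prod_unfold cong: measurable_cong_sets)
    qed
    from lborel.borel_measurable_lebesgue_integral[OF this] show ?thesis
      by (simp add: I_def[abs_def])
  qed
  have Imi: "(\<lambda>r. indicator S r *\<^sub>R I n r) \<in> borel_measurable lborel" for n
    using Im[of n] S by measurable
  have W: "integrable lborel (\<lambda>r. (indicator S r *\<^sub>R B r) * b)"
    using B(1) unfolding set_integrable_def by (rule integrable_mult_left)
  have Wb: "norm (indicator S r *\<^sub>R I n r) \<le> (indicator S r *\<^sub>R B r) * b" for n r
    using Ibnd[of r n] by (auto simp: indicator_def)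
  have Wl: "(\<lambda>n. indicator S r *\<^sub>R I n r) \<longlonglongrightarrow> indicator S r *\<^sub>R I' r" for r
    using conv[of r] by (auto simp: indicator_def)
  have Im': "(\<lambda>r. indicator S r *\<^sub>R I' r) \<in> borel_measurable lborel"
    by (rule borel_measurable_LIMSEQ_metric[OF Imi Wl])
  have o1: "integrable lborel (\<lambda>r. indicator S r *\<^sub>R I n r)" for n
    by (rule Bochner_Integration.integrable_bound[OF W Imi])
       (use Wb in \<open>auto intro!: AE_I2 order_trans[OF _ abs_ge_self]\<close>)
  have o2: "integrable lborel (\<lambda>r. indicator S r *\<^sub>R I' r)"
    by (rule integrable_dominated_convergence[where s = "\<lambda>n r. indicator S r *\<^sub>R I n r", OF Im' Imi W])
       (intro AE_I2 Wl Wb)+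
  have o3: "(\<lambda>n. LINT r|lborel. indicator S r *\<^sub>R I n r) \<longlonglongrightarrow> (LINT r|lborel. indicator S r *\<^sub>R I' r)"
    by (rule integral_dominated_convergence[where s = "\<lambda>n r. indicator S r *\<^sub>R I n r", OF Im' Imi W])
       (intro AE_I2 Wl Wb)+
  have e: "(LINT r|lborel. indicator S r *\<^sub>R I n r) = integral S (\<lambda>r. integral S (G n r))"
    and oi: "(\<lambda>r. integral S (G n r)) integrable_on S" for n
  proof -
    have "integral S (I n) = integral S (\<lambda>r. integral S (G n r))"
      by (rule integral_cong) (rule I)
    then show "(LINT r|lborel. indicator S r *\<^sub>R I n r) = integral S (\<lambda>r. integral S (G n r))"
      using set_borel_integral_eq_integral(2)[of S "I n"] o1 by (simp add: set_lebesgue_integral_def set_integrable_def)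
    have "I n integrable_on S"
      using set_borel_integral_eq_integral(1)[of S "I n"] o1 by (simp add: set_integrable_def)
    then show "(\<lambda>r. integral S (G n r)) integrable_on S"
      by (rule integrable_eq) (rule I)
  qed
  have "I' integrable_on S"
    using set_borel_integral_eq_integral(1)[of S I'] o2 by (simp add: set_integrable_def)
  then show "(\<lambda>r. integral S (G' r)) integrable_on S"
    by (rule integrable_eq) (rule I')
  have e': "(LINT r|lborel. indicator S r *\<^sub>R I' r) = integral S (\<lambda>r. integral S (G' r))"
  proof -
    have "integral S I' = integral S (\<lambda>r. integral S (G' r))"
      by (rule integral_cong) (rule I')
    then show ?thesis
      using set_borel_integral_eq_integral(2)[of S I'] o2 by (simp add: set_lebesgue_integral_def set_integrable_def)
  qed
  show "(\<lambda>r. integral S (G n r)) integrable_on S" for n by (rule oi)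
  show "(\<lambda>n. integral S (\<lambda>r. integral S (G n r))) \<longlonglongrightarrow> integral S (\<lambda>r. integral S (G' r))"
    using o3 unfolding e e' .
qed

text \<open>The integrand of the Gamma function at 1/2. The factor 1 / sqrt r is each variable's
  share of the singularity at the origin.\<close>

lemma set_integrable_exp_over_sqrt: "set_integrable lborel {0<..} (\<lambda>r::real. exp (-r) / sqrt r)"
proof -
  have "(\<lambda>t. complex_of_real t powr (1/2 - 1) / of_real (exp t)) absolutely_integrable_on {0<..}"
    by (rule absolutely_integrable_Gamma_integral') simp
  then have "(\<lambda>t. norm (complex_of_real t powr (1/2 - 1) / of_real (exp t))) absolutely_integrable_on {0<..}"
    by (rule set_integrable_norm)
  moreover have "indicator {0<..} t *\<^sub>R norm (complex_of_real t powr (1/2 - 1) / of_real (exp t))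
      = indicator {0<..} t *\<^sub>R (exp (-t) / sqrt t)" for t :: real
  proof (cases "t > 0")
    case True
    then have "norm (complex_of_real t powr (1/2 - 1)) = t powr (-1/2)"
      by (simp add: norm_powr_real_powr)
    also have "\<dots> = 1 / sqrt t" using True by (simp add: powr_minus_divide powr_half_sqrt)
    finally have "norm (complex_of_real t powr (1/2 - 1)) = 1 / sqrt t" .
    then have "norm (complex_of_real t powr (1/2 - 1) / of_real (exp t)) = 1 / sqrt t / exp t"
      by (simp only: norm_divide norm_of_real abs_exp_cancel)
    also have "\<dots> = exp (-t) / sqrt t" by (simp add: exp_minus field_simps)
    finally show ?thesis by (rule arg_cong)
  qed simp
  ultimately have "integrable lebesgue (\<lambda>r::real. indicator {0<..} r *\<^sub>R (exp (-r) / sqrt r))"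
    unfolding set_integrable_def by (simp only:)
  then show ?thesis
    unfolding set_integrable_def by (subst (asm) integrable_completion) auto
qed

section \<open>The phase function along rays\<close>

text \<open>From the midpoint of the singularities, in units of half their distance, (w - b) / (w -
  a) becomes - (1 + s) / (1 - s). Its logarithm up to that sign is taken here without its Taylor
  polynomial of degree 4; the removed terms combine with the cubic exponent.\<close>

definition Phi :: "complex \<Rightarrow> complex" where
  "Phi s = Ln (1 + s) - Ln (1 - s) - 2 * s - 2 * s^3 / 3"

definition Phi_dom :: "complex set" where
  "Phi_dom = {s. Im s \<noteq> 0 \<or> \<bar>Re s\<bar> < 1}"

lemma Phi_dom_nonpos:
  assumes "s \<in> Phi_dom"
  shows "1 + s \<notin> \<real>\<^sub>\<le>\<^sub>0" "1 - s \<notin> \<real>\<^sub>\<le>\<^sub>0" "1 + s \<noteq> 0" "1 - s \<noteq> 0"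
  using assms by (auto simp: Phi_dom_def complex_nonpos_Reals_iff complex_eq_iff)

lemma Phi_deriv:
  assumes "s \<in> Phi_dom"
  shows "(Phi has_field_derivative 2 * s^4 / (1 - s^2)) (at s)"
proof -
  note d = Phi_dom_nonpos[OF assms]
  have p: "((\<lambda>s. 1 + s) has_field_derivative 1) (at s)" "((\<lambda>s. 1 - s) has_field_derivative -1) (at s)"
    "((\<lambda>s. 2 * s) has_field_derivative 2) (at s)" "((\<lambda>s. 2 * s^3 / 3) has_field_derivative 2 * s^2) (at s)"
    by (auto intro!: derivative_eq_intros)
  have "(Phi has_field_derivative (inverse (1 + s) * 1 - inverse (1 - s) * -1 - 2 - 2 * s^2)) (at s)"
    unfolding Phi_def[abs_def]
    by (intro DERIV_diff DERIV_chain2[OF has_field_derivative_Ln] p d(1,2))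
  then have "(Phi has_field_derivative (1 / (1 + s) + 1 / (1 - s) - 2 - 2 * s^2)) (at s)"
    by (simp add: inverse_eq_divide)
  moreover have "1 / (1 + s) + 1 / (1 - s) - 2 - 2 * s^2 = 2 * s^4 / (1 - s^2)"
  proof -
    have e: "1 - s^2 = (1 + s) * (1 - s)" by (simp add: power2_eq_square algebra_simps)
    have "1 / (1 + s) + 1 / (1 - s) = 2 / ((1 + s) * (1 - s))"
      using d(3,4) by (simp add: add_frac_eq)
    moreover have "2 / X - 2 - 2 * s^2 = (2 - (2 + 2 * s^2) * X) / X" if "X \<noteq> 0" for X :: complex
      using that by (simp add: diff_divide_distrib)
    ultimately have "1 / (1 + s) + 1 / (1 - s) - 2 - 2 * s^2
        = (2 - (2 + 2 * s^2) * ((1 + s) * (1 - s))) / ((1 + s) * (1 - s))"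
      using d(3,4) by (simp only: mult_eq_0_iff not_False_eq_True de_Morgan_disj simp_thms)
    also have "2 - (2 + 2 * s^2) * ((1 + s) * (1 - s)) = 2 * s^4"
      by (simp add: eval_nat_numeral algebra_simps)
    finally show ?thesis unfolding e .
  qed
  ultimately show ?thesis by simp
qed

lemma exp_Phi:
  assumes "s \<in> Phi_dom"
  shows "exp (of_nat m * Phi s) = ((1 + s) / (1 - s)) ^ m * exp (- of_nat m * (2 * s + 2 * s^3 / 3))"
proof -
  note d = Phi_dom_nonpos[OF assms]
  have "exp (of_nat m * Phi s) = exp (Phi s) ^ m" by (rule exp_of_nat_mult)
  also have "exp (Phi s) = (1 + s) / (1 - s) * exp (- (2 * s + 2 * s^3 / 3))"
  proof -
    have "Phi s = Ln (1 + s) - Ln (1 - s) + - (2 * s + 2 * s^3 / 3)" by (simp add: Phi_def)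
    then have "exp (Phi s) = exp (Ln (1 + s) - Ln (1 - s)) * exp (- (2 * s + 2 * s^3 / 3))" by (simp only: exp_add)
    then show ?thesis using d(3,4) by (simp add: exp_diff)
  qed
  finally show ?thesis
    by (simp only: power_mult_distrib exp_of_nat_mult[symmetric] mult_minus_left mult_minus_right)
qed

text \<open>The difference has derivative 2 z^6 / (1 - z^2) and vanishes at 0. The seventh order
  matters: with m \<epsilon>^5 = 1 the error is of order \<epsilon>^2.\<close>

lemma Phi_small:
  assumes "norm s \<le> 1/2"
  shows "norm (Phi s - 2/5 * s^5) \<le> 4 * norm s ^ 7"
proof -
  define f where "f s = Phi s - 2/5 * s^5" for s
  have dom: "z \<in> Phi_dom" if "norm z \<le> 1/2" for z :: complex
    using that abs_Re_le_cmod[of z] by (auto simp: Phi_dom_def)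
  have "norm (f s - f 0) \<le> (4 * norm s ^ 6) * norm (s - 0)"
  proof (rule field_differentiable_bound[where S = "cball 0 (norm s)" and f' = "\<lambda>z. 2 * z^6 / (1 - z^2)"])
    fix z :: complex assume z: "z \<in> cball 0 (norm s)"
    then have nz: "norm z \<le> norm s" "norm z \<le> 1/2" using assms by auto
    have z2: "norm (z^2) \<le> 1/4"
      using power_mono[OF nz(2), of 2] by (simp add: norm_power norm_mult power2_eq_square)
    then have ne: "1 - z^2 \<noteq> 0" by auto
    have "(f has_field_derivative (2 * z^4 / (1 - z^2) - 2 * z^4)) (at z)"
      unfolding f_def[abs_def]
      by (auto intro!: derivative_eq_intros Phi_deriv[OF dom[OF nz(2)]])
    moreover have "2 * z^4 / (1 - z^2) - 2 * z^4 = 2 * z^6 / (1 - z^2)"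
    proof -
      have "2 * z^4 / (1 - z^2) - 2 * z^4 = (2 * z^4 - 2 * z^4 * (1 - z^2)) / (1 - z^2)" using ne by (simp add: field_simps)
      also have "2 * z^4 - 2 * z^4 * (1 - z^2) = 2 * z^6" by (simp add: eval_nat_numeral algebra_simps)
      finally show ?thesis .
    qed
    ultimately show "(f has_field_derivative 2 * z^6 / (1 - z^2)) (at z within cball 0 (norm s))"
      by (simp add: has_field_derivative_at_within)
    have "1/2 \<le> norm (1 - z^2)" using norm_triangle_ineq2[of 1 "z^2"] z2 by simp
    then have "norm (2 * z^6 / (1 - z^2)) \<le> (2 * norm z ^ 6) / (1/2)"
      unfolding norm_divide norm_mult norm_power by (intro frac_le) auto
    also have "\<dots> \<le> 4 * norm s ^ 6" using power_mono[OF nz(1), of 6] by simp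
    finally show "norm (2 * z^6 / (1 - z^2)) \<le> 4 * norm s ^ 6" .
  qed auto
  moreover have "f 0 = 0" by (simp add: f_def Phi_def)
  ultimately show ?thesis by (simp add: f_def power_Suc2[of _ 6, symmetric] eval_nat_numeral mult_ac)
qed

text \<open>These are directions in which the leading term 2 s^5 / 5 of \<open>Phi\<close> is real
  and negative.\<close>

lemma cis_fifths_power: "cis (pi/5) ^ 5 = -1" "cis (3*pi/5) ^ 5 = -1"
proof -
  show "cis (pi/5) ^ 5 = -1" by (simp add: Complex.DeMoivre cis_pi)
  have "cis (3*pi/5) ^ 5 = cis (pi + 2*pi)" by (simp add: Complex.DeMoivre)
  also have "\<dots> = -1" unfolding cis_mult[symmetric] by (simp add: cis_pi)
  finally show "cis (3*pi/5) ^ 5 = -1" .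
qed

text \<open>Because e^5 = -1, the derivative along the ray is -2 r^4 / (1 - r^2 e^2): its numerator
  is real, so the sign depends on Re (1 - r^2 e^2) alone.\<close>

lemma Re_Phi_ray_deriv:
  assumes e: "norm e = 1" "e ^ 5 = -1" and dom: "of_real r * e \<in> Phi_dom"
  shows "((\<lambda>r. Re (Phi (of_real r * e))) has_real_derivative
    (- 2 * r^4 * (1 - r^2 * Re (e^2)) / (norm (1 - of_real (r^2) * e^2))^2)) (at r)"
proof -
  define q where "q = of_real (r^2) * e^2"
  have "((\<lambda>r. of_real r * e) has_vector_derivative e) (at r)" by (auto intro!: derivative_eq_intros)
  from field_vector_diff_chain_at[OF this Phi_deriv[OF dom]]
  have "((\<lambda>r. Phi (of_real r * e)) has_vector_derivative e * (2 * (of_real r * e)^4 / (1 - (of_real r * e)^2))) (at r)"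
    by (simp add: o_def)
  then have D1: "((\<lambda>r. Re (Phi (of_real r * e))) has_vector_derivative Re (e * (2 * (of_real r * e)^4 / (1 - (of_real r * e)^2)))) (at r)"
    by (rule bounded_linear.has_vector_derivative[OF bounded_linear_Re])
  have E1: "e * (2 * (of_real r * e)^4 / (1 - (of_real r * e)^2)) = - of_real (2 * r^4) / (1 - q)"
  proof -
    have "e * (2 * (of_real r * e)^4 / (1 - (of_real r * e)^2)) = 2 * of_real (r^4) * e^5 / (1 - q)"
      by (simp add: q_def power_mult_distrib eval_nat_numeral mult_ac)
    then show ?thesis by (simp add: e(2))
  qed
  have E2: "Re (- of_real (2 * r^4) / (1 - q)) = - 2 * r^4 * (1 - r^2 * Re (e^2)) / (norm (1 - q))^2"
  proof -
    have "Re (- of_real (2 * r^4) / (1 - q)) = - (2 * r^4) * Re (1 / (1 - q))"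
      using Re_complex_of_real by (simp add: divide_inverse)
    moreover have "Re (1 / (1 - q)) = Re (1 - q) / (norm (1 - q))^2"
      by (simp add: Re_divide cmod_power2)
    moreover have "Re (1 - q) = 1 - r^2 * Re (e^2)" by (simp add: q_def)
    ultimately show ?thesis by simp
  qed
  show ?thesis
    using D1 unfolding has_real_derivative_iff_has_vector_derivative E1 E2 unfolding q_def .
qed

text \<open>The right-hand side of the hypothesis on \<open>k\<close> makes the derivative of \<open>Re (Phi (r e))\<close> at most
  \<open>- 2 k r\<^sup>4 / (1 + r\<^sup>2) \<le> - 2 k (\<mu> r\<^sup>2 - \<mu>\<^sup>2 / 2)\<close>. The free parameter \<open>\<mu>\<close> will be proportional to
  \<open>\<epsilon>\<^sup>2\<close>, which yields a cubic bound uniformly in the scaling.\<close>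

lemma Re_Phi_ray_bound:
  assumes e: "norm e = 1" "e ^ 5 = -1" and dom: "\<And>r. r > 0 \<Longrightarrow> of_real r * e \<in> Phi_dom"
    and "0 \<le> k" and k: "\<And>r. 0 \<le> r \<Longrightarrow> r \<le> R \<Longrightarrow> k * (1 + r^2) \<le> 1 - r^2 * Re (e^2)"
    and \<mu>: "0 \<le> \<mu>" "\<mu> \<le> 1/2" and r: "0 \<le> r" "r \<le> R"
  shows "Re (Phi (of_real r * e)) \<le> - (2 * k) * (\<mu> * r^3 / 3 - \<mu>^2 * r / 2)"
proof -
  define h where "h r = Re (Phi (of_real r * e)) + 2 * k * (\<mu> * r^3 / 3 - \<mu>^2 * r / 2)" for r
  have dom0: "of_real x * e \<in> Phi_dom" if "0 \<le> x" for x
    using dom[of x] that by (cases "x = 0") (auto simp: Phi_dom_def)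
  have "h 0 \<ge> h r"
  proof (rule DERIV_nonpos_imp_nonincreasing[OF r(1)])
    fix x assume x: "0 \<le> x" "x \<le> r"
    define N where "N = norm (1 - of_real (x^2) * e^2)"
    let ?D = "- 2 * x^4 * (1 - x^2 * Re (e^2)) / N^2"
    have "N \<noteq> 0"
    proof
      assume "N = 0"
      then have "(of_real x * e)^2 = 1" by (simp add: N_def power_mult_distrib)
      then have "of_real x * e = 1 \<or> of_real x * e = -1" by (simp add: power2_eq_1_iff)
      moreover have "1 \<notin> Phi_dom" "- 1 \<notin> Phi_dom" by (simp_all add: Phi_dom_def)
      ultimately show False using dom0[OF x(1)] by metis
    qed
    then have N0: "N > 0" by (simp add: N_def)
    have N1: "N \<le> 1 + x^2"
      using norm_triangle_ineq4[of 1 "of_real (x^2) * e^2"] e(1) by (simp add: N_def norm_mult norm_power)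
    have d1: "(h has_real_derivative (?D + 2 * k * (\<mu> * x^2 - \<mu>^2 / 2))) (at x)"
      unfolding h_def[abs_def] N_def
      by (rule DERIV_add[OF Re_Phi_ray_deriv[OF e dom0[OF x(1)]]]) (auto intro!: derivative_eq_intros)
    have sq: "N^2 \<le> (1 + x^2)^2" using N0 N1 by (intro power_mono) auto
    have p: "1 + x^2 > 0" by (smt (verit) zero_le_power2)
    have "x^4 / (1 + x^2) * k = x^4 * (k * (1 + x^2)) / (1 + x^2)^2" using p by (simp add: power2_eq_square)
    also have "\<dots> \<le> x^4 * (1 - x^2 * Re (e^2)) / N^2"
    proof (rule frac_le)
      show "x^4 * (k * (1 + x^2)) \<le> x^4 * (1 - x^2 * Re (e^2))"
        using k[OF x(1)] x r by (intro mult_left_mono) auto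
      have "0 \<le> k * (1 + x^2)" using \<open>0 \<le> k\<close> p by simp
      also have "\<dots> \<le> 1 - x^2 * Re (e^2)" using k[OF x(1)] x r by auto
      finally show "0 \<le> x^4 * (1 - x^2 * Re (e^2))" by simp
    qed (use N0 sq in auto)
    finally have "x^4 / (1 + x^2) * k \<le> x^4 * (1 - x^2 * Re (e^2)) / N^2" .
    moreover have "?D = - 2 * (x^4 * (1 - x^2 * Re (e^2)) / N^2)" by simp
    moreover have "- 2 * k * (x^4 / (1 + x^2)) = - 2 * (x^4 / (1 + x^2) * k)" by simp
    ultimately have D: "?D \<le> - 2 * k * (x^4 / (1 + x^2))" by linarith
    \<comment> \<open>After multiplication by 1 + x^2 this follows from (x^2 - \<mu>)^2 \<ge> 0 and
      \<mu> \<le> 1/2.\<close>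
    have "\<mu> * x^2 - \<mu>^2 / 2 \<le> x^4 / (1 + x^2)"
    proof -
      have "0 \<le> (x^2 - \<mu>)^2 / 2" by simp
      moreover have "\<mu> * x^4 \<le> 1/2 * x^4" using \<mu> by (intro mult_right_mono) auto
      moreover have "0 \<le> \<mu>^2 * x^2 / 2" by simp
      moreover have "(\<mu> * x^2 - \<mu>^2 / 2) * (1 + x^2) = \<mu> * x^4 + \<mu> * x^2 - \<mu>^2/2 - \<mu>^2 * x^2 / 2"
        by (simp add: eval_nat_numeral algebra_simps)
      moreover have "(x^2 - \<mu>)^2 / 2 = x^4/2 - \<mu> * x^2 + \<mu>^2/2"
        by (simp add: power2_diff power_mult[symmetric] field_simps)
      ultimately have "(\<mu> * x^2 - \<mu>^2 / 2) * (1 + x^2) \<le> x^4" by linarith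
      then show ?thesis using p by (simp add: pos_le_divide_eq)
    qed
    then have "2 * k * (\<mu> * x^2 - \<mu>^2 / 2) \<le> 2 * k * (x^4 / (1 + x^2))"
      using \<open>0 \<le> k\<close> by (intro mult_left_mono) auto
    with D have "?D + 2 * k * (\<mu> * x^2 - \<mu>^2 / 2) \<le> 0" by simp
    with d1 show "\<exists>y. (h has_real_derivative y) (at x) \<and> y \<le> 0" by blast
  qed
  moreover have "h 0 = 0" by (simp add: h_def Phi_def)
  ultimately show ?thesis by (simp add: h_def)
qed

text \<open>At \<plusminus> 3 pi/5 the real part of e^2 is - cos (pi/5) < 0, so Re Phi decreases
  along the whole ray. At \<plusminus> pi/5 it is c = cos (2 pi/5), which lies between 0 and 1/2,
  and the decrease is guaranteed as long as r^2 \<le> 2.\<close>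

lemma Re_Phi_directions:
  "\<exists>k>0. \<forall>\<mu> r e. 0 \<le> \<mu> \<longrightarrow> \<mu> \<le> 1/2 \<longrightarrow> 0 \<le> r \<longrightarrow>
      e = cis (-3*pi/5) \<or> e = cis (3*pi/5) \<or> r^2 \<le> 2 \<and> (e = cis (pi/5) \<or> e = cis (-pi/5)) \<longrightarrow>
      Re (Phi (of_real r * e)) \<le> - (2 * k) * (\<mu> * r^3 / 3 - \<mu>^2 * r / 2) \<and> of_real r * e \<in> Phi_dom"
proof -
  define c where "c = cos (2*pi/5)"
  \<comment> \<open>Chosen so that k (1 + r^2) = 1 - c r^2 at r^2 = 2, the end of the sides of the
    sector.\<close>
  define k where "k = (1 - 2 * c) / 3"
  have "cos (2*pi/5) < cos (pi/3)" by (rule cos_monotone_0_pi) auto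
  then have c2: "c < 1/2" by (simp add: c_def cos_60)
  have c0: "0 < c" using sin_cos_fifths(5) by (simp add: c_def)
  have "cos (pi/3) < cos (pi/5)" by (rule cos_monotone_0_pi) auto
  then have c5: "1/2 < cos (pi/5)" by (simp add: cos_60)
  have k: "0 < k" "k < 1/3" using c0 c2 by (auto simp: k_def)
  have sq: "Re (cis \<psi> ^ 2) = cos (2 * \<psi>)" for \<psi> by (simp add: Complex.DeMoivre)
  have c65: "cos (6*pi/5) = - cos (pi/5)"
  proof -
    have "6*pi/5 = pi/5 + pi" by simp
    then show ?thesis by (simp only: cos_periodic_pi)
  qed
  have neg5: "cis (-\<psi>) ^ 5 = -1" if "cis \<psi> ^ 5 = -1" for \<psi>
    using arg_cong[OF that, of cnj] by (simp add: cis_cnj)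
  have m5: "cis (-3*pi/5) ^ 5 = -1" "cis (-pi/5) ^ 5 = -1"
    using neg5[OF cis_fifths_power(1)] neg5[OF cis_fifths_power(2)] by simp_all
  have dom: "of_real r * cis \<psi> \<in> Phi_dom" if "0 \<le> r" "sin \<psi> \<noteq> 0" for r \<psi>
    using that by (cases "r = 0") (auto simp: Phi_dom_def)
  have A: "Re (Phi (of_real r * cis \<psi>)) \<le> - (2 * k) * (\<mu> * r^3 / 3 - \<mu>^2 * r / 2)"
    if "0 \<le> \<mu>" "\<mu> \<le> 1/2" "0 \<le> r" "cis \<psi> ^ 5 = -1" "sin \<psi> \<noteq> 0" "cos (2 * \<psi>) = - cos (pi/5)" for \<mu> r \<psi>
  proof (rule Re_Phi_ray_bound[where R = r])
    fix x :: real assume "0 \<le> x" "x \<le> r"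
    have "k * (1 + x^2) \<le> 1 + x^2 * k" using k by (simp add: algebra_simps)
    also have "\<dots> \<le> 1 + x^2 * cos (pi/5)" using k c5 by (intro add_left_mono mult_left_mono) auto
    finally show "k * (1 + x^2) \<le> 1 - x^2 * Re (cis \<psi> ^ 2)" by (simp only: sq that(6))
  qed (use that k dom in auto)
  have B: "Re (Phi (of_real r * cis \<psi>)) \<le> - (2 * k) * (\<mu> * r^3 / 3 - \<mu>^2 * r / 2)"
    if "0 \<le> \<mu>" "\<mu> \<le> 1/2" "0 \<le> r" "r^2 \<le> 2" "cis \<psi> ^ 5 = -1" "sin \<psi> \<noteq> 0" "cos (2 * \<psi>) = c" for \<mu> r \<psi>
  proof (rule Re_Phi_ray_bound[where R = r])
    fix x :: real assume x: "0 \<le> x" "x \<le> r"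
    have "x^2 \<le> 2" using power_mono[OF x(2,1), of 2] that(4) by simp
    then have "(k + c) * x^2 \<le> (k + c) * 2" using k c0 by (intro mult_left_mono) auto
    then have "k * (1 + x^2) \<le> 1 - x^2 * c" by (simp add: k_def field_simps)
    then show "k * (1 + x^2) \<le> 1 - x^2 * Re (cis \<psi> ^ 2)" by (simp only: sq that(7))
  qed (use that k dom in auto)
  have s: "sin (3*pi/5) \<noteq> 0" "sin (pi/5) \<noteq> 0" "sin (-3*pi/5) \<noteq> 0" "sin (-pi/5) \<noteq> 0" using sin_cos_fifths by auto
  have co: "cos (2 * (3*pi/5)) = - cos (pi/5)" "cos (2 * (-3*pi/5)) = - cos (pi/5)" "cos (2 * (pi/5)) = c" "cos (2 * (-pi/5)) = c"
    using c65 by (simp_all add: c_def)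
  show ?thesis
  proof (intro exI[of _ k] conjI[OF k(1)] allI impI)
    fix \<mu> r :: real and e
    assume \<mu>: "0 \<le> \<mu>" "\<mu> \<le> 1/2" "0 \<le> r"
      and "e = cis (-3*pi/5) \<or> e = cis (3*pi/5) \<or> r^2 \<le> 2 \<and> (e = cis (pi/5) \<or> e = cis (-pi/5))"
    then consider "e = cis (-3*pi/5)" | "e = cis (3*pi/5)" | "r^2 \<le> 2" "e = cis (pi/5)" | "r^2 \<le> 2" "e = cis (-pi/5)" by blast
    then show "Re (Phi (of_real r * e)) \<le> - (2 * k) * (\<mu> * r^3 / 3 - \<mu>^2 * r / 2) \<and> of_real r * e \<in> Phi_dom"
    proof cases
      case 1 then show ?thesis using A[OF \<mu> m5(1) s(3) co(2)] dom[OF \<mu>(3) s(3)] by simp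
    next
      case 2 then show ?thesis using A[OF \<mu> cis_fifths_power(2) s(1) co(1)] dom[OF \<mu>(3) s(1)] by simp
    next
      case 3 then show ?thesis using B[OF \<mu> 3(1) cis_fifths_power(1) s(2) co(3)] dom[OF \<mu>(3) s(2)] by simp
    next
      case 4 then show ?thesis using B[OF \<mu> 4(1) m5(2) s(4) co(4)] dom[OF \<mu>(3) s(4)] by simp
    qed
  qed
qed

section \<open>The phase function along the arc\<close>

text \<open>On the circle of radius sqrt 2 one has u * cnj u = 2, which turns u^5 * cnj (1 - u^2)
  into u^5 - 4 u^3. The two terms give sin (5 \<psi>) and sin (3 \<psi>).\<close>

lemma Re_Phi_arc_deriv:
  assumes "0 < \<psi>" "\<psi> < pi"
  shows "((\<lambda>\<psi>. Re (Phi (of_real (sqrt 2) * cis \<psi>))) has_real_derivative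
    (- (8 * sqrt 2) * (sin (5 * \<psi>) - 2 * sin (3 * \<psi>)) / (norm (1 - (of_real (sqrt 2) * cis \<psi>)^2))^2)) (at \<psi>)"
proof -
  define u where "u = of_real (sqrt 2) * cis \<psi>"
  have dom: "u \<in> Phi_dom" using sin_gt_zero[OF assms] by (simp add: u_def Phi_dom_def)
  have v1: "(cis has_vector_derivative (\<i> * cis \<psi>)) (at \<psi>)"
    by (auto simp: has_vector_derivative_complex_iff intro!: derivative_eq_intros)
  have v: "((\<lambda>\<psi>. of_real (sqrt 2) * cis \<psi>) has_vector_derivative \<i> * u) (at \<psi>)"
    by (rule has_vector_derivative_eq_rhs[OF has_vector_derivative_mult_right[OF v1]]) (simp add: u_def mult_ac)
  have "((\<lambda>\<psi>. Phi (of_real (sqrt 2) * cis \<psi>)) has_vector_derivative \<i> * u * (2 * u^4 / (1 - u^2))) (at \<psi>)"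
    using field_vector_diff_chain_at[OF v, of Phi, OF Phi_deriv[OF dom, unfolded u_def]] by (simp add: o_def u_def)
  then have D: "((\<lambda>\<psi>. Re (Phi (of_real (sqrt 2) * cis \<psi>))) has_vector_derivative Re (\<i> * u * (2 * u^4 / (1 - u^2)))) (at \<psi>)"
    by (rule bounded_linear.has_vector_derivative[OF bounded_linear_Re])
  have "norm u = sqrt 2" by (simp add: u_def norm_mult)
  then have n2: "u * cnj u = 2" unfolding complex_norm_square[symmetric] by simp
  have "\<i> * u * (2 * u^4 / (1 - u^2)) = 2 * \<i> * (u^5 * cnj (1 - u^2)) / of_real ((norm (1 - u^2))^2)"
    unfolding complex_div_cnj[of _ "1 - u^2"] times_divide_eq_right
    by (simp add: eval_nat_numeral mult_ac)
  also have "u^5 * cnj (1 - u^2) = u^5 - (u * cnj u)^2 * u^3"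
    by (simp add: eval_nat_numeral algebra_simps)
  also have "\<dots> = u^5 - 4 * u^3" by (simp add: n2)
  also have "u^5 = of_real (4 * sqrt 2) * cis (5 * \<psi>)"
  proof -
    have "sqrt 2 ^ 5 = 4 * sqrt 2" by (simp add: eval_nat_numeral)
    then show ?thesis unfolding u_def power_mult_distrib Complex.DeMoivre of_real_power[symmetric] by simp
  qed
  also have "u^3 = of_real (2 * sqrt 2) * cis (3 * \<psi>)"
  proof -
    have "sqrt 2 ^ 3 = 2 * sqrt 2" by (simp add: eval_nat_numeral)
    then show ?thesis unfolding u_def power_mult_distrib Complex.DeMoivre of_real_power[symmetric] by simp
  qed
  finally have "Re (\<i> * u * (2 * u^4 / (1 - u^2)))
      = Re (2 * \<i> * (of_real (4 * sqrt 2) * cis (5 * \<psi>) - 4 * (of_real (2 * sqrt 2) * cis (3 * \<psi>)))) / (norm (1 - u^2))^2"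
    by (simp only: Re_divide_of_real)
  also have "Re (2 * \<i> * (of_real (4 * sqrt 2) * cis (5 * \<psi>) - 4 * (of_real (2 * sqrt 2) * cis (3 * \<psi>))))
      = - (8 * sqrt 2) * (sin (5 * \<psi>) - 2 * sin (3 * \<psi>))"
    by (simp add: algebra_simps)
  finally show ?thesis using D unfolding has_real_derivative_iff_has_vector_derivative u_def by simp
qed

text \<open>With y = cos (2 \<psi>) and the factor sin \<psi> taken out, the claim becomes 2 (2 y^2
  - 1) \<le> 1 + 2 y, which holds for 0 \<le> y \<le> 1.\<close>

lemma sin5_le_2_sin3:
  fixes \<psi> :: real
  assumes "0 \<le> \<psi>" "\<psi> \<le> pi/5"
  shows "sin (5 * \<psi>) \<le> 2 * sin (3 * \<psi>)"
proof -
  define y where "y = cos (2 * \<psi>)"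
  have y: "0 \<le> y" "y \<le> 1" using assms by (auto simp: y_def intro!: cos_ge_zero)
  have s0: "0 \<le> sin \<psi>" using assms by (intro sin_ge_zero) auto
  have "5 * \<psi> = 4 * \<psi> + \<psi>" "3 * \<psi> = 4 * \<psi> - \<psi>" by simp_all
  then have 1: "sin (5 * \<psi>) - sin (3 * \<psi>) = 2 * cos (4 * \<psi>) * sin \<psi>"
    unfolding \<open>5 * \<psi> = _\<close> \<open>3 * \<psi> = _\<close> sin_add sin_diff by simp
  have "3 * \<psi> = 2 * \<psi> + \<psi>" by simp
  then have "sin (3 * \<psi>) = sin (2 * \<psi>) * cos \<psi> + cos (2 * \<psi>) * sin \<psi>" by (simp only: sin_add)
  also have "\<dots> = sin \<psi> * (2 * (cos \<psi>)^2 + y)" by (simp only: sin_double y_def[symmetric]) (simp add: power2_eq_square algebra_simps)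
  also have "2 * (cos \<psi>)^2 = 1 + y" unfolding y_def cos_double_cos by simp
  finally have 2: "sin (3 * \<psi>) = sin \<psi> * (1 + 2 * y)" by simp
  have 3: "cos (4 * \<psi>) = 2 * y^2 - 1" using cos_double_cos[of "2 * \<psi>"] by (simp add: y_def)
  have "y^2 \<le> y" using y by (simp add: power2_eq_square mult_left_le)
  moreover have "2 * (2 * q - 1) \<le> 1 + 2 * y" if "q \<le> y" for q :: real using that y by argo
  ultimately have "2 * (2 * y^2 - 1) \<le> 1 + 2 * y" by blast
  then have "sin \<psi> * (2 * (2 * y^2 - 1)) \<le> sin \<psi> * (1 + 2 * y)" by (rule mult_left_mono[OF _ s0])
  moreover have "sin (5 * \<psi>) - sin \<psi> * (1 + 2 * y) = sin \<psi> * (2 * (2 * y^2 - 1))"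
    using 1 unfolding 2 3 by (simp only: mult_ac)
  ultimately show ?thesis unfolding 2 by argo
qed

text \<open>Re Phi increases along the upper half of the arc, so the maximum is at the corner with
  the side of the sector, where the ray bound applies. Conjugation gives the lower half. The middle
  of the arc is on the branch cut of \<open>Phi\<close>; there the bound follows by continuity of
  the modulus \<open>P\<close>, in which no logarithm occurs.\<close>

lemma Phi_arc_bound:
  "\<exists>c>0. \<forall>\<psi> s. \<bar>\<psi>\<bar> \<le> pi/5 \<longrightarrow> s = of_real (sqrt 2) * cis \<psi> \<longrightarrow>
      norm ((1 + s) / (1 - s) * exp (- (2 * s + 2 * s^3 / 3))) \<le> exp (- c)"
proof -
  define S where "S \<psi> = complex_of_real (sqrt 2) * cis \<psi>" for \<psi>
  define P where "P \<psi> = norm ((1 + S \<psi>) / (1 - S \<psi>) * exp (- (2 * S \<psi> + 2 * S \<psi>^3 / 3)))" for \<psi>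
  obtain k where k: "k > 0" and K0: "\<forall>\<mu> r e. 0 \<le> \<mu> \<longrightarrow> \<mu> \<le> 1/2 \<longrightarrow> 0 \<le> r \<longrightarrow>
      e = cis (-3*pi/5) \<or> e = cis (3*pi/5) \<or> r^2 \<le> 2 \<and> (e = cis (pi/5) \<or> e = cis (-pi/5)) \<longrightarrow>
      Re (Phi (of_real r * e)) \<le> - (2 * k) * (\<mu> * r^3 / 3 - \<mu>^2 * r / 2) \<and> of_real r * e \<in> Phi_dom"
    using Re_Phi_directions by blast
  note K = K0[rule_format]
  \<comment> \<open>The value of \<mu> r^3 / 3 - \<mu>^2 r / 2 at r = sqrt 2 and \<mu> = 1/2 is 5/24
    * sqrt 2.\<close>
  define c where "c = 2 * k * (5/24 * sqrt 2)"
  have "Re (Phi (S (pi/5))) \<le> - (2 * k) * (1/2 * sqrt 2^3 / 3 - (1/2)^2 * sqrt 2 / 2)"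
    using K[of "1/2" "sqrt 2" "cis (pi/5)"] by (simp add: S_def)
  also have "1/2 * sqrt 2^3 / 3 - (1/2)^2 * sqrt 2 / 2 = 5/24 * sqrt 2" by (simp add: eval_nat_numeral)
  finally have top: "Re (Phi (S (pi/5))) \<le> - c" by (simp add: c_def)
  have dom: "S \<psi> \<in> Phi_dom" if "sin \<psi> \<noteq> 0" for \<psi> using that by (simp add: S_def Phi_dom_def)
  have P_eq: "P \<psi> = exp (Re (Phi (S \<psi>)))" if "sin \<psi> \<noteq> 0" for \<psi>
    using exp_Phi[OF dom[OF that], of 1] by (simp add: P_def flip: norm_exp_eq_Re)
  have pos: "P \<psi> \<le> exp (- c)" if "0 < \<psi>" "\<psi> \<le> pi/5" for \<psi>
  proof -
    have "Re (Phi (S \<psi>)) \<le> Re (Phi (S (pi/5)))"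
    proof (rule DERIV_nonneg_imp_nondecreasing[OF that(2)])
      fix x assume x: "\<psi> \<le> x" "x \<le> pi/5"
      have "0 \<le> - (8 * sqrt 2) * (sin (5 * x) - 2 * sin (3 * x)) / (norm (1 - (of_real (sqrt 2) * cis x)^2))^2"
        using sin5_le_2_sin3[of x] x that(1) by (intro divide_nonneg_nonneg mult_nonpos_nonpos) auto
      with Re_Phi_arc_deriv[of x] x that(1)
      show "\<exists>y. ((\<lambda>\<psi>. Re (Phi (S \<psi>))) has_real_derivative y) (at x) \<and> 0 \<le> y"
        unfolding S_def using pi_gt_zero by (intro exI conjI) auto
    qed
    with top have "Re (Phi (S \<psi>)) \<le> - c" by simp
    moreover have "sin \<psi> \<noteq> 0" using sin_gt_zero[of \<psi>] that pi_gt_zero by auto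
    ultimately show ?thesis by (simp add: P_eq)
  qed
  have sym: "P (- \<psi>) = P \<psi>" for \<psi>
  proof -
    have "S (- \<psi>) = cnj (S \<psi>)" by (simp add: S_def cis_cnj)
    then have "(1 + S (-\<psi>)) / (1 - S (-\<psi>)) * exp (- (2 * S (-\<psi>) + 2 * S (-\<psi>)^3 / 3))
        = cnj ((1 + S \<psi>) / (1 - S \<psi>) * exp (- (2 * S \<psi> + 2 * S \<psi>^3 / 3)))"
      by (simp add: exp_cnj)
    then show ?thesis unfolding P_def by (simp only: complex_mod_cnj)
  qed
  have "isCont P 0"
  proof -
    have "1 - S 0 \<noteq> 0" by (simp add: S_def complex_eq_iff)
    moreover have "isCont S 0" unfolding S_def[abs_def] cis_conv_exp by (intro continuous_intros)
    ultimately show ?thesis unfolding P_def[abs_def] by (intro continuous_intros) auto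
  qed
  then have "(P \<longlongrightarrow> P 0) (at_right 0)"
    unfolding isCont_def by (rule filterlim_mono) (auto simp: at_within_le_at)
  then have zero: "P 0 \<le> exp (- c)"
  proof (rule tendsto_upperbound)
    have "\<forall>\<^sub>F x in at_right (0::real). x \<in> {0<..<pi/5}" by (rule eventually_at_right_real) simp
    then show "\<forall>\<^sub>F x in at_right 0. P x \<le> exp (- c)" by (rule eventually_mono) (auto intro: pos)
  qed simp
  have "P \<psi> \<le> exp (- c)" if "\<bar>\<psi>\<bar> \<le> pi/5" for \<psi>
    using pos[of \<psi>] pos[of "- \<psi>"] zero sym[of \<psi>] that by (cases \<psi> "0::real" rule: linorder_cases) auto
  moreover have "c > 0" using k by (simp add: c_def)
  ultimately show ?thesis unfolding P_def S_def by auto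
qed

lemma cubic_minus_linear_bound:
  fixes C C' r :: real
  assumes "0 \<le> C" "0 \<le> C'" "0 \<le> r"
  defines "M \<equiv> C + C' + 1"
  shows "- (r^3) + C * r^2 + C' * r \<le> C * M^2 + C' * M"
proof (cases "r \<le> M")
  case True
  have "C * r^2 \<le> C * M^2" "C' * r \<le> C' * M"
    using True assms by (auto intro!: mult_left_mono power_mono)
  moreover have "0 \<le> r^3" using assms by simp
  ultimately show ?thesis by linarith
next
  case False
  have r1: "1 \<le> r" and rM: "C + C' \<le> r" using False assms by (auto simp: M_def)
  have "C' * r \<le> C' * r^2" using assms r1 by (intro mult_left_mono) (auto simp: power2_eq_square)
  moreover have "(C + C') * r^2 \<le> r * r^2" using rM by (intro mult_right_mono) auto
  moreover have "r * r^2 = r^3" by (simp add: eval_nat_numeral)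
  moreover have "0 \<le> C * M^2" "0 \<le> C' * M" using assms by auto
  ultimately show ?thesis by (simp add: algebra_simps)
qed

section \<open>Bounds and limit of the rescaled exponential\<close>

text \<open>The first two factors amount to \<open>exp (m * Phi (\<epsilon> * z))\<close>, but they also make sense where the arc
  of the sector crosses the branch cut of \<open>Phi\<close>.\<close>

definition Ehat :: "nat \<Rightarrow> real \<Rightarrow> real \<Rightarrow> real \<Rightarrow> real \<Rightarrow> complex \<Rightarrow> complex" where
  "Ehat m \<epsilon> \<kappa>3 \<kappa>2 \<kappa>1 z =
     ((1 + of_real \<epsilon> * z) / (1 - of_real \<epsilon> * z)) ^ m *
     exp (- of_nat m * (2 * (of_real \<epsilon> * z) + 2 * (of_real \<epsilon> * z)^3 / 3)) *
     exp (of_real \<kappa>3 * z^3 + of_real \<kappa>2 * z^2 + of_real \<kappa>1 * z)"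

lemma norm_exp_cubic:
  fixes z :: complex
  assumes "\<bar>\<kappa>3\<bar> \<le> C" "\<bar>\<kappa>2\<bar> \<le> C" "\<bar>\<kappa>1\<bar> \<le> C"
  shows "norm (exp (of_real \<kappa>3 * z^3 + of_real \<kappa>2 * z^2 + of_real \<kappa>1 * z))
    \<le> exp (C * norm z^3 + C * norm z^2 + C * norm z)"
proof -
  have t: "norm (of_real \<kappa> * z^n) \<le> C * norm z^n" if "\<bar>\<kappa>\<bar> \<le> C" for \<kappa> :: real and n
    unfolding norm_mult norm_power using that by (intro mult_right_mono) auto
  have "norm (of_real \<kappa>3 * z^3 + of_real \<kappa>2 * z^2 + of_real \<kappa>1 * z)
      \<le> norm (of_real \<kappa>3 * z^3) + norm (of_real \<kappa>2 * z^2) + norm (of_real \<kappa>1 * z)"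
    by (intro norm_triangle_mono norm_triangle_ineq order_refl)
  also have "\<dots> \<le> C * norm z^3 + C * norm z^2 + C * norm z"
    using t[OF assms(1), of 3] t[OF assms(2), of 2] t[OF assms(3), of 1] by simp
  finally have "Re (of_real \<kappa>3 * z^3 + of_real \<kappa>2 * z^2 + of_real \<kappa>1 * z) \<le> C * norm z^3 + C * norm z^2 + C * norm z"
    using complex_Re_le_cmod order_trans by blast
  then show ?thesis by simp
qed

text \<open>With \<mu> = L \<epsilon>^2 and m \<epsilon>^5 = 1, the bound on m Re Phi becomes a
  polynomial in r without \<epsilon>. Its cubic term outweighs the bounded perturbation in the third
  factor of \<open>Ehat\<close>.\<close>

lemma Ehat_ray_bound:
  assumes "C \<ge> 0"
  shows "\<exists>K L. K > 0 \<and> L > 0 \<and> (\<forall>m \<epsilon> \<kappa>3 \<kappa>2 \<kappa>1 r e. of_nat m * \<epsilon>^5 = 1 \<longrightarrow> 0 < \<epsilon> \<longrightarrow> L * \<epsilon>^2 \<le> 1/2 \<longrightarrow>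
      \<bar>\<kappa>3\<bar> \<le> C \<longrightarrow> \<bar>\<kappa>2\<bar> \<le> C \<longrightarrow> \<bar>\<kappa>1\<bar> \<le> C \<longrightarrow> 0 \<le> r \<longrightarrow>
      e = cis (-3*pi/5) \<or> e = cis (3*pi/5) \<or> r \<le> sqrt 2 / \<epsilon> \<and> (e = cis (pi/5) \<or> e = cis (-pi/5)) \<longrightarrow>
      norm (Ehat m \<epsilon> \<kappa>3 \<kappa>2 \<kappa>1 (of_real r * e)) \<le> K * exp (- r))"
proof -
  obtain k where k: "k > 0" and K0: "\<forall>\<mu> r e. 0 \<le> \<mu> \<longrightarrow> \<mu> \<le> 1/2 \<longrightarrow> 0 \<le> r \<longrightarrow>
      e = cis (-3*pi/5) \<or> e = cis (3*pi/5) \<or> r^2 \<le> 2 \<and> (e = cis (pi/5) \<or> e = cis (-pi/5)) \<longrightarrow>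
      Re (Phi (of_real r * e)) \<le> - (2 * k) * (\<mu> * r^3 / 3 - \<mu>^2 * r / 2) \<and> of_real r * e \<in> Phi_dom"
    using Re_Phi_directions by blast
  note K = K0[rule_format]
  \<comment> \<open>Makes the coefficient of -r^3 equal to C + 1, one more than the perturbation can
    cancel.\<close>
  define L where "L = 3 * (C + 1) / (2 * k)"
  have L: "L > 0" using k assms by (simp add: L_def)
  \<comment> \<open>The last summand 1 reserves the factor exp (-r); k L^2 is the linear term left
    by the phase.\<close>
  define C' where "C' = C + k * L^2 + 1"
  have C': "C' \<ge> 0" using assms k by (simp add: C'_def)
  define M where "M = C + C' + 1"
  define K0 where "K0 = C * M^2 + C' * M"
  show ?thesis
  proof (rule exI[of _ "exp K0"], rule exI[of _ L], intro conjI allI impI)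
    fix m :: nat and \<epsilon> \<kappa>3 \<kappa>2 \<kappa>1 r :: real and e
    assume m: "of_nat m * \<epsilon>^5 = 1" and \<epsilon>: "0 < \<epsilon>" "L * \<epsilon>^2 \<le> 1/2"
      and \<kappa>: "\<bar>\<kappa>3\<bar> \<le> C" "\<bar>\<kappa>2\<bar> \<le> C" "\<bar>\<kappa>1\<bar> \<le> C" and r: "0 \<le> r"
      and e: "e = cis (-3*pi/5) \<or> e = cis (3*pi/5) \<or> r \<le> sqrt 2 / \<epsilon> \<and> (e = cis (pi/5) \<or> e = cis (-pi/5))"
    define z where "z = of_real r * e"
    have nz: "norm z = r" using e r by (auto simp: z_def norm_mult)
    have sz: "of_real \<epsilon> * z = of_real (\<epsilon> * r) * e" by (simp add: z_def)
    have "e = cis (-3*pi/5) \<or> e = cis (3*pi/5) \<or> (\<epsilon> * r)^2 \<le> 2 \<and> (e = cis (pi/5) \<or> e = cis (-pi/5))"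
    proof -
      have "(\<epsilon> * r)^2 \<le> 2" if "r \<le> sqrt 2 / \<epsilon>"
      proof -
        have "\<epsilon> * r \<le> sqrt 2" using that \<epsilon> by (simp add: pos_le_divide_eq mult.commute)
        then have "(\<epsilon> * r)^2 \<le> sqrt 2 ^ 2" using \<epsilon> r by (intro power_mono) auto
        then show ?thesis by simp
      qed
      with e show ?thesis by blast
    qed
    from K[OF _ \<epsilon>(2) _ this] L \<epsilon> r
    have bnd: "Re (Phi (of_real \<epsilon> * z)) \<le> - (2 * k) * (L * \<epsilon>^2 * (\<epsilon> * r)^3 / 3 - (L * \<epsilon>^2)^2 * (\<epsilon> * r) / 2)"
      and dom: "of_real \<epsilon> * z \<in> Phi_dom" unfolding sz by auto
    have "of_nat m * Re (Phi (of_real \<epsilon> * z)) \<le> of_nat m * (- (2 * k) * (L * \<epsilon>^2 * (\<epsilon> * r)^3 / 3 - (L * \<epsilon>^2)^2 * (\<epsilon> * r) / 2))"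
      by (rule mult_left_mono[OF bnd]) simp
    also have "\<dots> = - (2 * k) * (of_nat m * \<epsilon>^5) * (L * r^3 / 3 - L^2 * r / 2)"
      by (simp add: eval_nat_numeral algebra_simps)
    also have "\<dots> = - (C + 1) * r^3 + k * L^2 * r"
    proof -
      have "2 * k * L = 3 * (C + 1)" using k by (simp add: L_def)
      moreover have "- (2 * k) * (L * r^3 / 3) = - ((2 * k * L) * (r^3 / 3))" by simp
      moreover have "- (3 * (C + 1) * (r^3 / 3)) = - (C + 1) * r^3" by (simp add: algebra_simps)
      ultimately have "- (2 * k) * (L * r^3 / 3) = - (C + 1) * r^3" by (simp only:)
      then show ?thesis unfolding m by (simp add: algebra_simps)
    qed
    finally have R: "of_nat m * Re (Phi (of_real \<epsilon> * z)) \<le> - (C + 1) * r^3 + k * L^2 * r" .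
    have "Ehat m \<epsilon> \<kappa>3 \<kappa>2 \<kappa>1 z = exp (of_nat m * Phi (of_real \<epsilon> * z)) * exp (of_real \<kappa>3 * z^3 + of_real \<kappa>2 * z^2 + of_real \<kappa>1 * z)"
      unfolding Ehat_def exp_Phi[OF dom] ..
    then have "norm (Ehat m \<epsilon> \<kappa>3 \<kappa>2 \<kappa>1 z) = norm (exp (of_nat m * Phi (of_real \<epsilon> * z)))
        * norm (exp (of_real \<kappa>3 * z^3 + of_real \<kappa>2 * z^2 + of_real \<kappa>1 * z))"
      by (simp only: norm_mult)
    also have "\<dots> \<le> exp (- (C + 1) * r^3 + k * L^2 * r) * exp (C * r^3 + C * r^2 + C * r)"
    proof (rule mult_mono[OF _ norm_exp_cubic[OF \<kappa>, of z, unfolded nz] exp_ge_zero norm_ge_zero])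
      have "Re (of_nat m * Phi (of_real \<epsilon> * z)) = of_nat m * Re (Phi (of_real \<epsilon> * z))" by simp
      with R show "norm (exp (of_nat m * Phi (of_real \<epsilon> * z))) \<le> exp (- (C + 1) * r^3 + k * L^2 * r)"
        unfolding norm_exp_eq_Re by (simp only: exp_le_cancel_iff)
    qed
    also have "\<dots> = exp ((- (r^3) + C * r^2 + C' * r) - r)"
      unfolding exp_add[symmetric] by (rule arg_cong[where f = exp]) (simp add: C'_def algebra_simps)
    also have "\<dots> \<le> exp (K0 - r)"
      using cubic_minus_linear_bound[OF assms C' r] by (simp add: K0_def M_def)
    finally show "norm (Ehat m \<epsilon> \<kappa>3 \<kappa>2 \<kappa>1 (of_real r * e)) \<le> exp K0 * exp (- r)"
      by (simp add: z_def exp_add[symmetric])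
  qed (use L in auto)
qed

text \<open>The first two factors are at most exp (- c m) with m = \<epsilon>^(-5), while the third
  grows at most like the exponential of a cubic in 1 / \<epsilon>. The extra square root accounts
  for half of the length factor of the arc; the other half is matched by the square root of
  \<open>norm (zeta \<rho> j r)\<close>.\<close>

lemma Ehat_arc_bound:
  assumes C: "C \<ge> 0" and \<epsilon>: "\<epsilon> \<longlonglongrightarrow> 0" "\<And>n. \<epsilon> n > 0" and m: "\<And>n. of_nat (m n) * \<epsilon> n^5 = 1"
  shows "\<exists>\<delta>. \<delta> \<longlonglongrightarrow> 0 \<and> (\<forall>n \<kappa>3 \<kappa>2 \<kappa>1 \<psi>. \<bar>\<kappa>3\<bar> \<le> C \<longrightarrow> \<bar>\<kappa>2\<bar> \<le> C \<longrightarrow> \<bar>\<kappa>1\<bar> \<le> C \<longrightarrow> \<bar>\<psi>\<bar> \<le> pi/5 \<longrightarrow>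
      norm (Ehat (m n) (\<epsilon> n) \<kappa>3 \<kappa>2 \<kappa>1 (of_real (sqrt 2 / \<epsilon> n) * cis \<psi>)) * sqrt (sqrt 2 / \<epsilon> n) \<le> \<delta> n)"
proof -
  obtain c where c: "c > 0" "\<forall>\<psi> s. \<bar>\<psi>\<bar> \<le> pi/5 \<longrightarrow> s = of_real (sqrt 2) * cis \<psi> \<longrightarrow>
      norm ((1 + s) / (1 - s) * exp (- (2 * s + 2 * s^3 / 3))) \<le> exp (- c)"
    using Phi_arc_bound by blast
  define F where "F x = exp (- c * x^5 + C * (sqrt 2 * x)^3 + C * (sqrt 2 * x)^2 + C * (sqrt 2 * x)) * sqrt (sqrt 2 * x)" for x :: real
  have "(F \<longlongrightarrow> 0) at_top" unfolding F_def[abs_def] using c(1) by real_asymp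
  moreover have "filterlim (\<lambda>n. 1 / \<epsilon> n) at_top sequentially"
    using filterlim_inverse_at_top[OF \<epsilon>(1) always_eventually] \<epsilon>(2) by (simp add: inverse_eq_divide)
  ultimately have lim: "(\<lambda>n. F (1 / \<epsilon> n)) \<longlonglongrightarrow> 0" by (rule filterlim_compose)
  show ?thesis
  proof (intro exI[of _ "\<lambda>n. F (1 / \<epsilon> n)"] conjI[OF lim] allI impI)
    fix n and \<kappa>3 \<kappa>2 \<kappa>1 \<psi> :: real assume \<kappa>: "\<bar>\<kappa>3\<bar> \<le> C" "\<bar>\<kappa>2\<bar> \<le> C" "\<bar>\<kappa>1\<bar> \<le> C" and \<psi>: "\<bar>\<psi>\<bar> \<le> pi/5"
    define \<rho> where "\<rho> = sqrt 2 / \<epsilon> n"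
    have \<rho>: "\<rho> > 0" using \<epsilon>(2)[of n] by (simp add: \<rho>_def)
    define z where "z = of_real \<rho> * cis \<psi>"
    have nz: "norm z = \<rho>" using \<rho> by (simp add: z_def norm_mult)
    define s where "s = of_real (\<epsilon> n) * z"
    have s: "s = of_real (sqrt 2) * cis \<psi>" using \<epsilon>(2)[of n] by (simp add: s_def z_def \<rho>_def)
    have "of_nat (m n) = (1 / \<epsilon> n) ^ 5" using m[of n] \<epsilon>(2)[of n] by (simp add: field_simps)
    then have mx: "- c * (1 / \<epsilon> n)^5 = of_nat (m n) * (- c)" by simp
    have "((1 + s) / (1 - s)) ^ m n * exp (- of_nat (m n) * (2 * s + 2 * s^3 / 3))
        = ((1 + s) / (1 - s) * exp (- (2 * s + 2 * s^3 / 3))) ^ m n"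
      by (simp only: power_mult_distrib exp_of_nat_mult[symmetric] mult_minus_left mult_minus_right)
    then have "norm (((1 + s) / (1 - s)) ^ m n * exp (- of_nat (m n) * (2 * s + 2 * s^3 / 3))) \<le> exp (- c) ^ m n"
      unfolding norm_power by (simp only: norm_power) (rule power_mono[OF c(2)[rule_format, OF \<psi> s]], simp)
    also have "\<dots> = exp (- c * (1 / \<epsilon> n)^5)" unfolding mx exp_of_nat_mult ..
    finally have "norm (Ehat (m n) (\<epsilon> n) \<kappa>3 \<kappa>2 \<kappa>1 z) \<le> exp (- c * (1 / \<epsilon> n)^5) * exp (C * \<rho>^3 + C * \<rho>^2 + C * \<rho>)"
      unfolding Ehat_def s_def[symmetric] norm_mult[of "_ * _" "exp (of_real \<kappa>3 * z^3 + _ + _)"]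
      using norm_exp_cubic[OF \<kappa>, of z] by (intro mult_mono) (auto simp: nz)
    also have "\<dots> = exp (- c * (1 / \<epsilon> n)^5 + C * \<rho>^3 + C * \<rho>^2 + C * \<rho>)"
      unfolding exp_add[symmetric] by (rule arg_cong[where f = exp]) simp
    finally have "norm (Ehat (m n) (\<epsilon> n) \<kappa>3 \<kappa>2 \<kappa>1 z) * sqrt \<rho> \<le> exp (- c * (1 / \<epsilon> n)^5 + C * \<rho>^3 + C * \<rho>^2 + C * \<rho>) * sqrt \<rho>"
      using \<rho> by (intro mult_right_mono) auto
    also have "\<dots> = F (1 / \<epsilon> n)" by (simp add: F_def \<rho>_def)
    finally show "norm (Ehat (m n) (\<epsilon> n) \<kappa>3 \<kappa>2 \<kappa>1 (of_real (sqrt 2 / \<epsilon> n) * cis \<psi>)) * sqrt (sqrt 2 / \<epsilon> n) \<le> F (1 / \<epsilon> n)"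
      by (simp only: z_def \<rho>_def)
  qed
qed

text \<open>Since m \<epsilon>^5 = 1, \<open>Phi_small\<close> shows that m * Phi (\<epsilon> z)
  differs from 2/5 z^5 by at most 4 \<epsilon>^2 |z|^7.\<close>

lemma Ehat_tendsto:
  assumes \<epsilon>: "\<epsilon> \<longlonglongrightarrow> 0" "\<And>n. \<epsilon> n > 0" and m: "\<And>n. of_nat (m n) * \<epsilon> n^5 = 1"
    and \<kappa>: "\<kappa>3 \<longlonglongrightarrow> k3" "\<kappa>2 \<longlonglongrightarrow> k2" "\<kappa>1 \<longlonglongrightarrow> k1"
  shows "(\<lambda>n. Ehat (m n) (\<epsilon> n) (\<kappa>3 n) (\<kappa>2 n) (\<kappa>1 n) z)
    \<longlonglongrightarrow> exp (2/5 * z^5 + of_real k3 * z^3 + of_real k2 * z^2 + of_real k1 * z)"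
proof -
  define P where "P n = of_nat (m n) * Phi (of_real (\<epsilon> n) * z)" for n
  have "(\<lambda>n. norm (of_real (\<epsilon> n) * z)) \<longlonglongrightarrow> norm (of_real 0 * z)"
    by (intro tendsto_intros \<epsilon>(1))
  then have ev: "\<forall>\<^sub>F n in sequentially. norm (of_real (\<epsilon> n) * z) < 1/2"
    by (rule order_tendstoD) simp
  have mc: "complex_of_real (of_nat (m n)) * of_real (\<epsilon> n)^5 = 1" for n
    using arg_cong[OF m[of n], of complex_of_real] by simp
  have "(\<lambda>n. P n - 2/5 * z^5) \<longlonglongrightarrow> 0"
  proof (rule Lim_null_comparison)
    have "(\<lambda>n. 4 * \<epsilon> n^2 * norm z^7) \<longlonglongrightarrow> 4 * 0^2 * norm z^7" by (intro tendsto_intros \<epsilon>(1))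
    then show "(\<lambda>n. 4 * \<epsilon> n^2 * norm z^7) \<longlonglongrightarrow> 0" by simp
    show "\<forall>\<^sub>F n in sequentially. norm (P n - 2/5 * z^5) \<le> 4 * \<epsilon> n^2 * norm z^7"
      using ev
    proof eventually_elim
      case (elim n)
      define s where "s = of_real (\<epsilon> n) * z"
      have "of_nat (m n) * (2/5 * s^5) = 2/5 * (complex_of_real (of_nat (m n)) * of_real (\<epsilon> n)^5) * z^5"
        by (simp add: s_def power_mult_distrib)
      then have "P n - 2/5 * z^5 = of_nat (m n) * (Phi s - 2/5 * s^5)"
        unfolding mc by (simp add: P_def s_def right_diff_distrib)
      then have "norm (P n - 2/5 * z^5) \<le> of_nat (m n) * (4 * norm s^7)"
        using Phi_small[of s] elim by (simp add: norm_mult s_def mult_left_mono)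
      also have "\<dots> = 4 * (of_nat (m n) * \<epsilon> n^5) * \<epsilon> n^2 * norm z^7"
        using \<epsilon>(2)[of n] by (simp add: s_def norm_mult power_mult_distrib eval_nat_numeral)
      finally show ?case unfolding m by simp
    qed
  qed
  then have "(\<lambda>n. (P n - 2/5 * z^5) + 2/5 * z^5) \<longlonglongrightarrow> 0 + 2/5 * z^5" by (intro tendsto_intros)
  then have Pl: "P \<longlonglongrightarrow> 2/5 * z^5" by simp
  have "(\<lambda>n. exp (P n) * exp (of_real (\<kappa>3 n) * z^3 + of_real (\<kappa>2 n) * z^2 + of_real (\<kappa>1 n) * z))
      \<longlonglongrightarrow> exp (2/5 * z^5) * exp (of_real k3 * z^3 + of_real k2 * z^2 + of_real k1 * z)"
    by (intro tendsto_intros Pl \<kappa>)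
  then have lim: "(\<lambda>n. exp (P n) * exp (of_real (\<kappa>3 n) * z^3 + of_real (\<kappa>2 n) * z^2 + of_real (\<kappa>1 n) * z))
      \<longlonglongrightarrow> exp (2/5 * z^5 + of_real k3 * z^3 + of_real k2 * z^2 + of_real k1 * z)"
    by (simp add: exp_add mult.assoc)
  show ?thesis
  proof (rule Lim_transform_eventually[OF lim])
    show "\<forall>\<^sub>F n in sequentially. exp (P n) * exp (of_real (\<kappa>3 n) * z^3 + of_real (\<kappa>2 n) * z^2 + of_real (\<kappa>1 n) * z)
        = Ehat (m n) (\<epsilon> n) (\<kappa>3 n) (\<kappa>2 n) (\<kappa>1 n) z"
      using ev
    proof eventually_elim
      case (elim n)
      have "of_real (\<epsilon> n) * z \<in> Phi_dom" using elim abs_Re_le_cmod[of "of_real (\<epsilon> n) * z"] unfolding Phi_dom_def by auto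
      then show ?case unfolding P_def Ehat_def by (simp only: exp_Phi)
    qed
  qed
qed

section \<open>The denominator on pairs of pieces\<close>

text \<open>The squared norm is at least A^2 + B^2 - 2 A B cos (pi/5), and A^2 + B^2 \<ge> 2 A
  B.\<close>

lemma norm_sum_cis_ge:
  assumes "0 < A" "0 < B" "- cos (pi/5) \<le> cos (\<alpha> - \<beta>)"
  shows "sqrt (2 * (1 - cos (pi/5))) * (sqrt A * sqrt B) \<le> norm (of_real A * cis \<alpha> + of_real B * cis \<beta>)"
proof -
  have "(norm (of_real A * cis \<alpha> + of_real B * cis \<beta>))^2 = (A * cos \<alpha> + B * cos \<beta>)^2 + (A * sin \<alpha> + B * sin \<beta>)^2"
    by (simp add: cmod_power2)
  also have "\<dots> = A^2 * ((cos \<alpha>)^2 + (sin \<alpha>)^2) + B^2 * ((cos \<beta>)^2 + (sin \<beta>)^2) + 2 * (A * B) * cos (\<alpha> - \<beta>)"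
    unfolding cos_diff by algebra
  also have "\<dots> = A^2 + B^2 + 2 * (A * B) * cos (\<alpha> - \<beta>)" by simp
  finally have n: "(norm (of_real A * cis \<alpha> + of_real B * cis \<beta>))^2 = A^2 + B^2 + 2 * (A * B) * cos (\<alpha> - \<beta>)" .
  have "2 * (A * B) * (- cos (pi/5)) \<le> 2 * (A * B) * cos (\<alpha> - \<beta>)" using assms by (intro mult_left_mono) auto
  moreover have "0 \<le> (A - B)^2" by simp
  moreover have e1: "(A - B)^2 = A^2 + B^2 - 2 * (A * B)" by (simp add: power2_diff)
  moreover have e2: "2 * (1 - cos (pi/5)) * (A * B) = 2 * (A * B) + 2 * (A * B) * (- cos (pi/5))"
    by (simp add: algebra_simps)
  ultimately have "2 * (1 - cos (pi/5)) * (A * B) \<le> (norm (of_real A * cis \<alpha> + of_real B * cis \<beta>))^2"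
    unfolding n e1 e2 by linarith
  then have "sqrt (2 * (1 - cos (pi/5)) * (A * B)) \<le> norm (of_real A * cis \<alpha> + of_real B * cis \<beta>)"
    by (rule real_le_lsqrt[OF norm_ge_zero])
  then show ?thesis by (simp add: real_sqrt_mult)
qed

lemma zeta_polar:
  assumes "0 < \<rho>" "0 < r" "omega \<rho> j r \<noteq> 0"
  obtains A \<alpha> where "0 < A" "norm (zeta \<rho> j r) = A" "zeta \<rho> j r = of_real A * cis \<alpha>"
    "\<alpha> = -3*pi/5 \<or> \<alpha> = 3*pi/5 \<or> \<bar>\<alpha>\<bar> \<le> pi/5"
proof -
  consider "j = 0" | "j = 1" | "j = 2" | "j = 3" | "j \<notin> {0,1,2,3}" by blast
  then show thesis
  proof cases
    case 1 with assms show ?thesis by (intro that[of r "-3*pi/5"]) (auto simp: zeta_def norm_mult)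
  next
    case 2 with assms show ?thesis by (intro that[of r "3*pi/5"]) (auto simp: zeta_def norm_mult)
  next
    case 3 with assms show ?thesis by (intro that[of r "pi/5"]) (auto simp: zeta_def norm_mult)
  next
    case 4 with assms show ?thesis by (intro that[of r "-pi/5"]) (auto simp: zeta_def norm_mult)
  next
    case 5
    then have "r \<le> 2*pi/5" using assms(3) by (auto simp: omega_def split: if_splits)
    then have "\<bar>r - pi/5\<bar> \<le> pi/5" using assms(2) by (intro abs_leI) linarith+
    with assms 5 show ?thesis by (intro that[of \<rho> "r - pi/5"]) (auto simp: zeta_def norm_mult)
  qed
qed

text \<open>The angles of two points on the pieces differ by at most 4 pi/5 or by exactly 6 pi/5, so
  the points are never nearly opposite. The product form of the bound splits the singularity of the
  denominator into one factor for each variable.\<close>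

lemma norm_zeta_sum_ge:
  assumes "0 < \<rho>" "0 < r" "0 < s" "omega \<rho> j r \<noteq> 0" "omega \<rho> k s \<noteq> 0"
  shows "sqrt (2 * (1 - cos (pi/5))) * (sqrt (norm (zeta \<rho> j r)) * sqrt (norm (zeta \<rho> k s))) \<le> norm (zeta \<rho> j r + zeta \<rho> k s)"
proof -
  obtain A \<alpha> where A: "0 < A" "norm (zeta \<rho> j r) = A" "zeta \<rho> j r = of_real A * cis \<alpha>" "\<alpha> = -3*pi/5 \<or> \<alpha> = 3*pi/5 \<or> \<bar>\<alpha>\<bar> \<le> pi/5"
    by (rule zeta_polar[OF assms(1,2,4)])
  obtain B \<beta> where B: "0 < B" "norm (zeta \<rho> k s) = B" "zeta \<rho> k s = of_real B * cis \<beta>" "\<beta> = -3*pi/5 \<or> \<beta> = 3*pi/5 \<or> \<bar>\<beta>\<bar> \<le> pi/5"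
    by (rule zeta_polar[OF assms(1,3,5)])
  have e: "4*pi/5 = pi - pi/5" by simp
  have c4: "cos (4*pi/5) = - cos (pi/5)" unfolding e cos_pi_minus ..
  have e6: "6*pi/5 = pi/5 + pi" by simp
  have c6: "cos (6*pi/5) = - cos (pi/5)" unfolding e6 cos_periodic_pi ..
  have "\<bar>\<alpha> - \<beta>\<bar> \<le> 4*pi/5 \<or> \<bar>\<alpha> - \<beta>\<bar> = 6*pi/5"
  proof -
    define x where "x = pi/5"
    have x: "x > 0" "pi/5 = x" "-3*pi/5 = -3*x" "3*pi/5 = 3*x" "4*pi/5 = 4*x" "6*pi/5 = 6*x" by (simp_all add: x_def)
    have "\<bar>\<alpha> - \<beta>\<bar> \<le> 4*x \<or> \<bar>\<alpha> - \<beta>\<bar> = 6*x"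
      using A(4) B(4) x(1) unfolding x(2-4) by argo
    then show ?thesis unfolding x(5,6) .
  qed
  then have "- cos (pi/5) \<le> cos \<bar>\<alpha> - \<beta>\<bar>"
  proof
    assume "\<bar>\<alpha> - \<beta>\<bar> \<le> 4*pi/5"
    then have "cos (4*pi/5) \<le> cos \<bar>\<alpha> - \<beta>\<bar>" using pi_gt_zero by (intro cos_monotone_0_pi_le) auto
    then show ?thesis by (simp only: c4)
  qed (simp only: c6)
  then have "- cos (pi/5) \<le> cos (\<alpha> - \<beta>)" by simp
  from norm_sum_cis_ge[OF A(1) B(1) this] show ?thesis unfolding A(2) B(2) unfolding A(3) B(3) .
qed

section \<open>Convergence of the rescaled integrals over pairs of pieces\<close>

lemma borel_measurable_cis [measurable]: "cis \<in> borel_measurable borel"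
  unfolding cis_conv_exp[abs_def] by measurable

lemma borel_measurable_zeta [measurable]: "zeta \<rho> j \<in> borel_measurable borel"
  unfolding zeta_def[abs_def] by measurable

lemma borel_measurable_omega [measurable]: "omega \<rho> j \<in> borel_measurable borel"
  unfolding omega_def[abs_def] by measurable

lemma borel_measurable_Ehat [measurable]: "Ehat m \<epsilon> \<kappa>3 \<kappa>2 \<kappa>1 \<in> borel_measurable borel"
  unfolding Ehat_def[abs_def] by measurable

text \<open>The second point is the negative of the rescaled inner variable: this turns the
  difference in the denominator into a sum and gives both exponentials the form \<open>Ehat\<close>
  with the same cubic coefficient.\<close>

definition scaled_integrand ::
    "nat \<Rightarrow> real \<Rightarrow> real \<Rightarrow> real \<Rightarrow> real \<Rightarrow> real \<Rightarrow> real \<Rightarrow> nat \<Rightarrow> nat \<Rightarrow> real \<Rightarrow> real \<Rightarrow> complex" where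
  "scaled_integrand m \<epsilon> \<kappa>3 \<kappa>2 \<kappa>1 \<tau>2 \<tau>1 j k r s =
     (Ehat m \<epsilon> \<kappa>3 \<kappa>2 \<kappa>1 (zeta (sqrt 2 / \<epsilon>) j r) * omega (sqrt 2 / \<epsilon>) j r) *
     (Ehat m \<epsilon> \<kappa>3 \<tau>2 \<tau>1 (zeta (sqrt 2 / \<epsilon>) k s) * omega (sqrt 2 / \<epsilon>) k s) /
     (zeta (sqrt 2 / \<epsilon>) j r + zeta (sqrt 2 / \<epsilon>) k s)"

definition limit_exponential :: "real \<Rightarrow> real \<Rightarrow> real \<Rightarrow> complex \<Rightarrow> complex" where
  "limit_exponential k3 k2 k1 z = exp (2/5 * z^5 + of_real k3 * z^3 + of_real k2 * z^2 + of_real k1 * z)"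

text \<open>For \<open>j < 4\<close> the points \<open>zeta \<rho> j r\<close> do not depend on \<open>\<rho>\<close>, and \<open>omega r j r\<close> is the untruncated
  direction of the ray.\<close>

definition limit_integrand :: "real \<Rightarrow> real \<Rightarrow> real \<Rightarrow> real \<Rightarrow> real \<Rightarrow> nat \<Rightarrow> nat \<Rightarrow> real \<Rightarrow> real \<Rightarrow> complex" where
  "limit_integrand k3 k2 k1 l2 l1 j k r s =
     (if j < 4 \<and> k < 4 then
       (limit_exponential k3 k2 k1 (zeta 0 j r) * omega r j r) *
       (limit_exponential k3 l2 l1 (zeta 0 k s) * omega s k s) / (zeta 0 j r + zeta 0 k s)
     else 0)"

text \<open>The factor Q is what the lower bound on the denominator later cancels. On the rays exp
  (-r) / sqrt r times Q is just exp (-r); on the arc the additional bound with \<delta> makes the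
  contribution vanish in the limit.\<close>

lemma Ehat_omega_bound:
  assumes C: "C \<ge> 0" and \<epsilon>: "\<epsilon> \<longlonglongrightarrow> 0" "\<And>n. \<epsilon> n > 0" and m: "\<And>n. of_nat (m n) * \<epsilon> n^5 = 1"
  obtains K \<delta> N where "K \<ge> 0" "\<delta> \<longlonglongrightarrow> 0"
    "\<forall>n\<ge>N. \<forall>\<kappa>3 \<kappa>2 \<kappa>1 j r. \<bar>\<kappa>3\<bar> \<le> C \<longrightarrow> \<bar>\<kappa>2\<bar> \<le> C \<longrightarrow> \<bar>\<kappa>1\<bar> \<le> C \<longrightarrow> j < 5 \<longrightarrow> 0 < r \<longrightarrow>
       (let A = norm (Ehat (m n) (\<epsilon> n) \<kappa>3 \<kappa>2 \<kappa>1 (zeta (sqrt 2 / \<epsilon> n) j r) * omega (sqrt 2 / \<epsilon> n) j r);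
            Q = sqrt (norm (zeta (sqrt 2 / \<epsilon> n) j r))
        in A \<le> K * (exp (- r) / sqrt r) * Q \<and> (j = 4 \<longrightarrow> A \<le> \<delta> n * Q))"
proof -
  obtain K1 L where K1: "K1 > 0" and L: "L > 0" and ray0: "\<forall>m \<epsilon> \<kappa>3 \<kappa>2 \<kappa>1 r e. of_nat m * \<epsilon>^5 = 1 \<longrightarrow> 0 < \<epsilon> \<longrightarrow> L * \<epsilon>^2 \<le> 1/2 \<longrightarrow>
      \<bar>\<kappa>3\<bar> \<le> C \<longrightarrow> \<bar>\<kappa>2\<bar> \<le> C \<longrightarrow> \<bar>\<kappa>1\<bar> \<le> C \<longrightarrow> 0 \<le> r \<longrightarrow>
      e = cis (-3*pi/5) \<or> e = cis (3*pi/5) \<or> r \<le> sqrt 2 / \<epsilon> \<and> (e = cis (pi/5) \<or> e = cis (-pi/5)) \<longrightarrow>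
      norm (Ehat m \<epsilon> \<kappa>3 \<kappa>2 \<kappa>1 (of_real r * e)) \<le> K1 * exp (- r)"
    using Ehat_ray_bound[OF C] by blast
  note ray = ray0[rule_format]
  obtain \<delta> where \<delta>: "\<delta> \<longlonglongrightarrow> 0" and arc0: "\<forall>n \<kappa>3 \<kappa>2 \<kappa>1 \<psi>. \<bar>\<kappa>3\<bar> \<le> C \<longrightarrow> \<bar>\<kappa>2\<bar> \<le> C \<longrightarrow> \<bar>\<kappa>1\<bar> \<le> C \<longrightarrow> \<bar>\<psi>\<bar> \<le> pi/5 \<longrightarrow>
      norm (Ehat (m n) (\<epsilon> n) \<kappa>3 \<kappa>2 \<kappa>1 (of_real (sqrt 2 / \<epsilon> n) * cis \<psi>)) * sqrt (sqrt 2 / \<epsilon> n) \<le> \<delta> n"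
    using Ehat_arc_bound[OF C \<epsilon> m] by blast
  note arc = arc0[rule_format]
  have "(\<lambda>n. L * \<epsilon> n^2) \<longlonglongrightarrow> L * 0^2" by (intro tendsto_intros \<epsilon>(1))
  then have "\<forall>\<^sub>F n in sequentially. L * \<epsilon> n^2 < 1/2" by (rule order_tendstoD) simp
  moreover have "\<forall>\<^sub>F n in sequentially. \<delta> n < 1" by (rule order_tendstoD[OF \<delta>]) simp
  ultimately have "\<forall>\<^sub>F n in sequentially. L * \<epsilon> n^2 < 1/2 \<and> \<delta> n < 1" by (rule eventually_conj)
  then obtain N where N: "\<forall>n\<ge>N. L * \<epsilon> n^2 < 1/2 \<and> \<delta> n < 1" unfolding eventually_sequentially by blast
  \<comment> \<open>On the arc the parameter is at most 2 pi/5 < 2, so K at least exp 2 * sqrt 2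
    makes K exp (-r) / sqrt r at least 1 there.\<close>
  define K where "K = K1 + exp 2 * sqrt 2"
  have K: "K \<ge> 0" "K1 \<le> K" "exp 2 * sqrt 2 \<le> K" using K1 by (auto simp: K_def)
  have main: "norm (Ehat (m n) (\<epsilon> n) \<kappa>3 \<kappa>2 \<kappa>1 (zeta \<rho> j r) * omega \<rho> j r) \<le> K * (exp (- r) / sqrt r) * sqrt (norm (zeta \<rho> j r))
      \<and> (j = 4 \<longrightarrow> norm (Ehat (m n) (\<epsilon> n) \<kappa>3 \<kappa>2 \<kappa>1 (zeta \<rho> j r) * omega \<rho> j r) \<le> \<bar>\<delta> n\<bar> * sqrt (norm (zeta \<rho> j r)))"
    if n: "n \<ge> N" and \<kappa>: "\<bar>\<kappa>3\<bar> \<le> C" "\<bar>\<kappa>2\<bar> \<le> C" "\<bar>\<kappa>1\<bar> \<le> C" and j: "j < 5" and r: "0 < r" and \<rho>_def: "\<rho> = sqrt 2 / \<epsilon> n"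
    for n \<kappa>3 \<kappa>2 \<kappa>1 j r \<rho>
  proof (cases "omega \<rho> j r = 0")
    case True
    show ?thesis unfolding True using K r by simp
  next
    case nz: False
    have \<rho>: "\<rho> > 0" using \<epsilon>(2)[of n] by (simp add: \<rho>_def)
    show ?thesis
    proof (cases "j = 4")
      case False
      with j have "j = 0 \<or> j = 1 \<or> j = 2 \<or> j = 3" by linarith
      then obtain e where e: "zeta \<rho> j r = of_real r * e" "norm e = 1" "norm (omega \<rho> j r) \<le> 1"
          "e = cis (-3*pi/5) \<or> e = cis (3*pi/5) \<or> r \<le> \<rho> \<and> (e = cis (pi/5) \<or> e = cis (-pi/5))"
      proof (elim disjE)
        assume "j = 0" with that[of "cis (-3*pi/5)"] show ?thesis by (simp add: zeta_def omega_def)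
      next
        assume "j = 1" with that[of "cis (3*pi/5)"] show ?thesis by (simp add: zeta_def omega_def)
      next
        assume "j = 2" with that[of "cis (pi/5)"] nz show ?thesis by (simp add: zeta_def omega_def split: if_splits)
      next
        assume "j = 3" with that[of "cis (-pi/5)"] nz show ?thesis by (simp add: zeta_def omega_def split: if_splits)
      qed
      have nr: "norm (zeta \<rho> j r) = r" using e(1,2) r by (simp add: norm_mult)
      have "norm (Ehat (m n) (\<epsilon> n) \<kappa>3 \<kappa>2 \<kappa>1 (zeta \<rho> j r)) \<le> K1 * exp (- r)"
        unfolding e(1) using N n e(4) r unfolding \<rho>_def by (intro ray[OF m \<epsilon>(2) _ \<kappa>]) auto
      then have "norm (Ehat (m n) (\<epsilon> n) \<kappa>3 \<kappa>2 \<kappa>1 (zeta \<rho> j r) * omega \<rho> j r) \<le> K1 * exp (- r) * 1"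
        unfolding norm_mult using e(3) K1 by (intro mult_mono) auto
      also have "\<dots> \<le> K * exp (- r)" using K by simp
      also have "K * exp (- r) = K * (exp (- r) / sqrt r) * sqrt (norm (zeta \<rho> j r))" unfolding nr using r by simp
      finally show ?thesis using False by simp
    next
      case True
      then have rp: "r \<le> 2*pi/5" using nz by (auto simp: omega_def split: if_splits)
      have z: "zeta \<rho> j r = of_real \<rho> * cis (r - pi/5)" using True by (simp add: zeta_def)
      have nr: "norm (zeta \<rho> j r) = \<rho>" unfolding z using \<rho> by (simp add: norm_mult)
      have no: "norm (omega \<rho> j r) = sqrt \<rho> * sqrt \<rho>" using True rp \<rho> by (simp add: omega_def norm_mult)
      have "\<bar>r - pi/5\<bar> \<le> pi/5" using rp r by (intro abs_leI) linarith+
      from arc[OF \<kappa> this, of n] have "norm (Ehat (m n) (\<epsilon> n) \<kappa>3 \<kappa>2 \<kappa>1 (zeta \<rho> j r)) * sqrt \<rho> \<le> \<delta> n"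
        unfolding z unfolding \<rho>_def .
      then have "norm (Ehat (m n) (\<epsilon> n) \<kappa>3 \<kappa>2 \<kappa>1 (zeta \<rho> j r)) * sqrt \<rho> * sqrt \<rho> \<le> \<delta> n * sqrt \<rho>"
        using \<rho> by (intro mult_right_mono) auto
      then have A: "norm (Ehat (m n) (\<epsilon> n) \<kappa>3 \<kappa>2 \<kappa>1 (zeta \<rho> j r) * omega \<rho> j r) \<le> \<delta> n * sqrt \<rho>"
        unfolding norm_mult no by (simp only: mult.assoc)
      have d1: "\<delta> n \<le> 1" using N n by (auto intro: less_imp_le)
      have "1 \<le> K * (exp (- r) / sqrt r)"
      proof -
        have r2: "r \<le> 2" using rp pi_less_4 by simp
        have "exp (r - 2) * sqrt r \<le> 1 * sqrt 2" using r2 r by (intro mult_mono) auto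
        then have "sqrt r * exp r \<le> exp 2 * sqrt 2" by (simp add: exp_diff field_simps)
        also have "\<dots> \<le> K" by (rule K(3))
        finally show ?thesis using r by (simp add: exp_minus field_simps)
      qed
      with d1 have "\<delta> n * sqrt \<rho> \<le> K * (exp (- r) / sqrt r) * sqrt \<rho>" using \<rho> by (intro mult_right_mono) auto
      moreover have "\<delta> n * sqrt \<rho> \<le> \<bar>\<delta> n\<bar> * sqrt \<rho>" using \<rho> by (intro mult_right_mono) auto
      ultimately show ?thesis using A unfolding nr by linarith
    qed
  qed
  have \<delta>': "(\<lambda>n. \<bar>\<delta> n\<bar>) \<longlonglongrightarrow> 0" using tendsto_rabs[OF \<delta>] by simp
  show thesis
    by (rule that[OF K(1) \<delta>', of N]) (unfold Let_def, intro allI impI main[OF _ _ _ _ _ _ refl])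
qed

text \<open>Pointwise limits come from \<open>Ehat_tendsto\<close> on the rays, whose truncation at
  \<rho> eventually passes every fixed parameter, and are 0 if a piece is the arc. The integrability
  statements hold only from some index on, when the uniform bounds are available.\<close>

lemma scaled_integrand_limit:
  assumes \<epsilon>: "\<epsilon> \<longlonglongrightarrow> 0" "\<And>n. \<epsilon> n > 0" and m: "\<And>n. of_nat (m n) * \<epsilon> n^5 = 1"
    and \<kappa>: "\<kappa>3 \<longlonglongrightarrow> k3" "\<kappa>2 \<longlonglongrightarrow> k2" "\<kappa>1 \<longlonglongrightarrow> k1" "\<tau>2 \<longlonglongrightarrow> l2" "\<tau>1 \<longlonglongrightarrow> l1"
  defines "G \<equiv> \<lambda>n. scaled_integrand (m n) (\<epsilon> n) (\<kappa>3 n) (\<kappa>2 n) (\<kappa>1 n) (\<tau>2 n) (\<tau>1 n)"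
    and "G' \<equiv> limit_integrand k3 k2 k1 l2 l1"
  shows "\<exists>N. \<forall>n\<ge>N. \<forall>j<5. \<forall>k<5. (\<forall>r>0. G n j k r integrable_on {0<..}) \<and>
      (\<lambda>r. integral {0<..} (G n j k r)) integrable_on {0<..}" (is ?A)
    and "j < 5 \<Longrightarrow> k < 5 \<Longrightarrow> (\<lambda>n. integral {0<..} (\<lambda>r. integral {0<..} (G n j k r))) \<longlonglongrightarrow>
      integral {0<..} (\<lambda>r. integral {0<..} (G' j k r))" (is "_ \<Longrightarrow> _ \<Longrightarrow> ?B j k")
    and "j < 5 \<Longrightarrow> k < 5 \<Longrightarrow> (\<lambda>r. integral {0<..} (G' j k r)) integrable_on {0<..}" (is "_ \<Longrightarrow> _ \<Longrightarrow> ?D j k")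
proof -
  have bd: "\<exists>C. \<forall>n. norm (f n) \<le> C" if "f \<longlonglongrightarrow> l" for f :: "nat \<Rightarrow> real" and l
    using convergent_imp_Bseq[OF convergentI[OF that]] unfolding Bseq_def by blast
  obtain C1 where C1: "\<forall>n. norm (\<kappa>3 n) \<le> C1" using bd[OF \<kappa>(1)] by blast
  obtain C2 where C2: "\<forall>n. norm (\<kappa>2 n) \<le> C2" using bd[OF \<kappa>(2)] by blast
  obtain C3 where C3: "\<forall>n. norm (\<kappa>1 n) \<le> C3" using bd[OF \<kappa>(3)] by blast
  obtain C4 where C4: "\<forall>n. norm (\<tau>2 n) \<le> C4" using bd[OF \<kappa>(4)] by blast
  obtain C5 where C5: "\<forall>n. norm (\<tau>1 n) \<le> C5" using bd[OF \<kappa>(5)] by blast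
  define C where "C = max 0 (max C1 (max C2 (max C3 (max C4 C5))))"
  have C: "C \<ge> 0" by (simp add: C_def)
  have le: "C1 \<le> C" "C2 \<le> C" "C3 \<le> C" "C4 \<le> C" "C5 \<le> C"
    unfolding C_def by (simp_all only: le_max_iff_disj order_refl simp_thms)
  note C0 = C1[rule_format, unfolded real_norm_def] C2[rule_format, unfolded real_norm_def]
    C3[rule_format, unfolded real_norm_def] C4[rule_format, unfolded real_norm_def] C5[rule_format, unfolded real_norm_def]
  have bC: "\<bar>\<kappa>3 n\<bar> \<le> C" "\<bar>\<kappa>2 n\<bar> \<le> C" "\<bar>\<kappa>1 n\<bar> \<le> C" "\<bar>\<tau>2 n\<bar> \<le> C" "\<bar>\<tau>1 n\<bar> \<le> C" for n
    by (rule order_trans[OF C0(1) le(1)] order_trans[OF C0(2) le(2)] order_trans[OF C0(3) le(3)]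
      order_trans[OF C0(4) le(4)] order_trans[OF C0(5) le(5)])+
  obtain K \<delta> N where K: "K \<ge> 0" and \<delta>: "\<delta> \<longlonglongrightarrow> 0" and bnd0:
    "\<forall>n\<ge>N. \<forall>\<kappa>3 \<kappa>2 \<kappa>1 j r. \<bar>\<kappa>3\<bar> \<le> C \<longrightarrow> \<bar>\<kappa>2\<bar> \<le> C \<longrightarrow> \<bar>\<kappa>1\<bar> \<le> C \<longrightarrow> j < 5 \<longrightarrow> 0 < r \<longrightarrow>
       (let A = norm (Ehat (m n) (\<epsilon> n) \<kappa>3 \<kappa>2 \<kappa>1 (zeta (sqrt 2 / \<epsilon> n) j r) * omega (sqrt 2 / \<epsilon> n) j r);
            Q = sqrt (norm (zeta (sqrt 2 / \<epsilon> n) j r))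
        in A \<le> K * (exp (- r) / sqrt r) * Q \<and> (j = 4 \<longrightarrow> A \<le> \<delta> n * Q))"
    by (rule Ehat_omega_bound[OF C \<epsilon> m])
  note bnd = bnd0[rule_format, unfolded Let_def]
  define \<rho> where "\<rho> n = sqrt 2 / \<epsilon> n" for n
  have \<rho>: "\<rho> n > 0" for n using \<epsilon>(2)[of n] by (simp add: \<rho>_def)
  define c0 where "c0 = sqrt (2 * (1 - cos (pi/5)))"
  have c0: "c0 > 0"
  proof -
    have "cos (pi/5) < cos 0" by (rule cos_monotone_0_pi) auto
    then show ?thesis by (simp add: c0_def)
  qed
  define b where "b r = K * (exp (- r) / sqrt r)" for r :: real
  have b0: "b r \<ge> 0" if "r > 0" for r using that K by (simp add: b_def)
  \<comment> \<open>Shares the constant 1 / c0 of the denominator equally between the two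
    variables.\<close>
  define B where "B r = b r / sqrt c0" for r
  have BB: "B r * B s = b r * b s / c0" for r s using c0 by (simp add: B_def)
  \<comment> \<open>The square roots of the norms in the bounds for the two factors cancel against
    the lower bound for the denominator.\<close>
  have quot: "norm (G n j k r s) \<le> A * A' / c0"
    if rs: "0 < r" "0 < s" and A0: "0 \<le> A" "0 \<le> A'"
      and A: "norm (Ehat (m n) (\<epsilon> n) (\<kappa>3 n) (\<kappa>2 n) (\<kappa>1 n) (zeta (\<rho> n) j r) * omega (\<rho> n) j r) \<le> A * sqrt (norm (zeta (\<rho> n) j r))"
      and A': "norm (Ehat (m n) (\<epsilon> n) (\<kappa>3 n) (\<tau>2 n) (\<tau>1 n) (zeta (\<rho> n) k s) * omega (\<rho> n) k s) \<le> A' * sqrt (norm (zeta (\<rho> n) k s))"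
    for n j k r s A A'
  proof (cases "omega (\<rho> n) j r = 0 \<or> omega (\<rho> n) k s = 0")
    case True
    then have "G n j k r s = 0" by (auto simp: G_def scaled_integrand_def \<rho>_def)
    then show ?thesis using A0 c0 by simp
  next
    case False
    define P where "P = sqrt (norm (zeta (\<rho> n) j r)) * sqrt (norm (zeta (\<rho> n) k s))"
    define Z where "Z = norm (zeta (\<rho> n) j r + zeta (\<rho> n) k s)"
    have PZ: "c0 * P \<le> Z" unfolding c0_def P_def Z_def using False norm_zeta_sum_ge[OF \<rho> rs] by blast
    have "P > 0"
    proof -
      have "norm (zeta (\<rho> n) j r) > 0" "norm (zeta (\<rho> n) k s) > 0"
        using zeta_polar[OF \<rho>[of n] rs(1), of j] zeta_polar[OF \<rho>[of n] rs(2), of k] False by metis+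
      then show ?thesis by (simp add: P_def)
    qed
    then have Z0: "Z > 0" using PZ c0 mult_pos_pos[of c0 P] by linarith
    have "norm (G n j k r s) = norm (Ehat (m n) (\<epsilon> n) (\<kappa>3 n) (\<kappa>2 n) (\<kappa>1 n) (zeta (\<rho> n) j r) * omega (\<rho> n) j r) *
        norm (Ehat (m n) (\<epsilon> n) (\<kappa>3 n) (\<tau>2 n) (\<tau>1 n) (zeta (\<rho> n) k s) * omega (\<rho> n) k s) / Z"
      unfolding G_def scaled_integrand_def \<rho>_def[symmetric] Z_def norm_divide by (simp only: norm_mult)
    also have "\<dots> \<le> (A * sqrt (norm (zeta (\<rho> n) j r))) * (A' * sqrt (norm (zeta (\<rho> n) k s))) / Z"
      using A A' A0 Z0 by (intro divide_right_mono mult_mono) auto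
    also have "\<dots> = (A * A') * P / Z" by (simp add: P_def mult_ac)
    also have "\<dots> \<le> (A * A') / c0"
    proof -
      have "A * A' * (c0 * P) \<le> A * A' * Z" using A0 PZ by (intro mult_left_mono) auto
      then show ?thesis using Z0 c0 by (simp add: field_simps)
    qed
    finally show ?thesis .
  qed
  have bE: "norm (Ehat (m n) (\<epsilon> n) (\<kappa>3 n) (\<kappa>2 n) (\<kappa>1 n) (zeta (\<rho> n) j r) * omega (\<rho> n) j r) \<le> b r * sqrt (norm (zeta (\<rho> n) j r))"
    "norm (Ehat (m n) (\<epsilon> n) (\<kappa>3 n) (\<tau>2 n) (\<tau>1 n) (zeta (\<rho> n) j r) * omega (\<rho> n) j r) \<le> b r * sqrt (norm (zeta (\<rho> n) j r))"
    if "n \<ge> N" "j < 5" "0 < r" for n j r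
    unfolding \<rho>_def b_def
    using bnd[OF that(1) bC(1)[of n] bC(2)[of n] bC(3)[of n] that(2,3)] bnd[OF that(1) bC(1)[of n] bC(4)[of n] bC(5)[of n] that(2,3)] by blast+
  have b4: "norm (Ehat (m n) (\<epsilon> n) (\<kappa>3 n) (\<kappa>2 n) (\<kappa>1 n) (zeta (\<rho> n) 4 r) * omega (\<rho> n) 4 r) \<le> \<bar>\<delta> n\<bar> * sqrt (norm (zeta (\<rho> n) 4 r))"
    "norm (Ehat (m n) (\<epsilon> n) (\<kappa>3 n) (\<tau>2 n) (\<tau>1 n) (zeta (\<rho> n) 4 r) * omega (\<rho> n) 4 r) \<le> \<bar>\<delta> n\<bar> * sqrt (norm (zeta (\<rho> n) 4 r))"
    if "n \<ge> N" "0 < r" for n r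
  proof -
    have w: "x \<le> \<bar>\<delta> n\<bar> * sqrt y" if "x \<le> \<delta> n * sqrt y" "0 \<le> y" for x y
      using order_trans[OF that(1) mult_right_mono[OF abs_ge_self]] that(2) by simp
    show "norm (Ehat (m n) (\<epsilon> n) (\<kappa>3 n) (\<kappa>2 n) (\<kappa>1 n) (zeta (\<rho> n) 4 r) * omega (\<rho> n) 4 r) \<le> \<bar>\<delta> n\<bar> * sqrt (norm (zeta (\<rho> n) 4 r))"
      using bnd[OF that(1) bC(1)[of n] bC(2)[of n] bC(3)[of n] _ that(2), of 4] unfolding \<rho>_def by (intro w) auto
    show "norm (Ehat (m n) (\<epsilon> n) (\<kappa>3 n) (\<tau>2 n) (\<tau>1 n) (zeta (\<rho> n) 4 r) * omega (\<rho> n) 4 r) \<le> \<bar>\<delta> n\<bar> * sqrt (norm (zeta (\<rho> n) 4 r))"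
      using bnd[OF that(1) bC(1)[of n] bC(4)[of n] bC(5)[of n] _ that(2), of 4] unfolding \<rho>_def by (intro w) auto
  qed
  have S: "{0::real<..} \<in> sets borel" by simp
  have meas: "case_prod (G n j k) \<in> borel_measurable (borel \<Otimes>\<^sub>M borel)" for n j k
    unfolding G_def scaled_integrand_def case_prod_unfold by measurable
  have Bi: "set_integrable lborel {0<..} B"
  proof -
    have "set_integrable lborel {0<..} (\<lambda>r. (K / sqrt c0) * (exp (- r) / sqrt r))"
      by (intro set_integrable_mult_right set_integrable_exp_over_sqrt)
    then show ?thesis by (simp add: B_def[abs_def] b_def mult.commute)
  qed
  have B0: "0 \<le> B r" if "r \<in> {0<..}" for r using b0[of r] that c0 by (simp add: B_def)
  \<comment> \<open>The domination is available from index N on, hence the shift, undone at the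
    end.\<close>
  have Gb: "norm (G (n + N) j k r s) \<le> B r * B s" if "j < 5" "k < 5" "r \<in> {0<..}" "s \<in> {0<..}" for n j k r s
    unfolding BB using that by (intro quot bE b0) auto
  have lim: "(\<lambda>n. G n j k r s) \<longlonglongrightarrow> G' j k r s" if jk: "j < 5" "k < 5" and rs: "r \<in> {0<..}" "s \<in> {0<..}" for j k r s
  proof (cases "j < 4 \<and> k < 4")
    case True
    have z: "zeta (\<rho> n) j r = zeta 0 j r" "zeta (\<rho> n) k s = zeta 0 k s" for n
      using True by (auto simp: zeta_def)
    have "filterlim \<rho> at_top sequentially"
    proof -
      have "filterlim (\<lambda>n. inverse (\<epsilon> n)) at_top sequentially"
        by (rule filterlim_inverse_at_top[OF \<epsilon>(1) always_eventually]) (use \<epsilon>(2) in simp)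
      then have "filterlim (\<lambda>n. sqrt 2 * inverse (\<epsilon> n)) at_top sequentially"
        by (rule filterlim_tendsto_pos_mult_at_top[OF tendsto_const, rotated]) simp
      then show ?thesis by (simp add: \<rho>_def[abs_def] divide_inverse)
    qed
    then have "\<forall>\<^sub>F n in sequentially. max r s \<le> \<rho> n" by (simp only: filterlim_at_top)
    then have ev: "\<forall>\<^sub>F n in sequentially. omega (\<rho> n) j r = omega r j r \<and> omega (\<rho> n) k s = omega s k s"
      by eventually_elim (use True in \<open>auto simp: omega_def\<close>)
    have "(\<lambda>n. (Ehat (m n) (\<epsilon> n) (\<kappa>3 n) (\<kappa>2 n) (\<kappa>1 n) (zeta 0 j r) * omega r j r) *
       (Ehat (m n) (\<epsilon> n) (\<kappa>3 n) (\<tau>2 n) (\<tau>1 n) (zeta 0 k s) * omega s k s) * inverse (zeta 0 j r + zeta 0 k s)) \<longlonglongrightarrow>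
       (limit_exponential k3 k2 k1 (zeta 0 j r) * omega r j r) *
       (limit_exponential k3 l2 l1 (zeta 0 k s) * omega s k s) * inverse (zeta 0 j r + zeta 0 k s)"
      unfolding limit_exponential_def
      by (intro tendsto_mult tendsto_const Ehat_tendsto \<epsilon> m \<kappa>)
    then have l: "(\<lambda>n. (Ehat (m n) (\<epsilon> n) (\<kappa>3 n) (\<kappa>2 n) (\<kappa>1 n) (zeta 0 j r) * omega r j r) *
       (Ehat (m n) (\<epsilon> n) (\<kappa>3 n) (\<tau>2 n) (\<tau>1 n) (zeta 0 k s) * omega s k s) * inverse (zeta 0 j r + zeta 0 k s)) \<longlonglongrightarrow> G' j k r s"
      using True by (simp add: G'_def limit_integrand_def divide_inverse)
    show ?thesis
    proof (rule Lim_transform_eventually[OF l])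
      show "\<forall>\<^sub>F n in sequentially. (Ehat (m n) (\<epsilon> n) (\<kappa>3 n) (\<kappa>2 n) (\<kappa>1 n) (zeta 0 j r) * omega r j r) *
       (Ehat (m n) (\<epsilon> n) (\<kappa>3 n) (\<tau>2 n) (\<tau>1 n) (zeta 0 k s) * omega s k s) * inverse (zeta 0 j r + zeta 0 k s) = G n j k r s"
        using ev by eventually_elim (unfold G_def scaled_integrand_def \<rho>_def[symmetric] z, simp only: divide_inverse)
    qed
  next
    case False
    then have G0: "G' j k r s = 0" by (auto simp: G'_def limit_integrand_def)
    from False jk have jk4: "j = 4 \<or> k = 4" by linarith
    define M where "M = max (b r) (b s) / c0"
    have "(\<lambda>n. \<bar>\<delta> n\<bar> * M) \<longlonglongrightarrow> \<bar>0\<bar> * M" by (intro tendsto_intros \<delta>)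
    then have l0: "(\<lambda>n. \<bar>\<delta> n\<bar> * M) \<longlonglongrightarrow> 0" by simp
    show ?thesis unfolding G0
    proof (rule Lim_null_comparison[OF _ l0])
      show "\<forall>\<^sub>F n in sequentially. norm (G n j k r s) \<le> \<bar>\<delta> n\<bar> * M"
        using eventually_ge_at_top[of N]
      proof eventually_elim
        case (elim n)
        have r0: "0 < r" "0 < s" using rs by auto
        from jk4 show ?case
        proof
          assume j: "j = 4"
          have "norm (G n j k r s) \<le> \<bar>\<delta> n\<bar> * b s / c0"
            unfolding j by (rule quot[OF r0 _ b0[OF r0(2)] b4(1)[OF elim r0(1)] bE(2)[OF elim jk(2) r0(2)]]) simp
          also have "\<dots> \<le> \<bar>\<delta> n\<bar> * M" unfolding M_def using c0 by (auto intro!: mult_left_mono divide_right_mono simp flip: times_divide_eq_right)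
          finally show ?thesis .
        next
          assume k: "k = 4"
          have "norm (G n j k r s) \<le> b r * \<bar>\<delta> n\<bar> / c0"
            unfolding k by (rule quot[OF r0 b0[OF r0(1)] _ bE(1)[OF elim jk(1) r0(1)] b4(2)[OF elim r0(2)]]) simp
          also have "\<dots> = \<bar>\<delta> n\<bar> * b r / c0" by simp
          also have "\<dots> \<le> \<bar>\<delta> n\<bar> * M" unfolding M_def using c0 by (auto intro!: mult_left_mono divide_right_mono simp flip: times_divide_eq_right)
          finally show ?thesis .
        qed
      qed
    qed
  qed
  have lim': "(\<lambda>n. G (n + N) j k r s) \<longlonglongrightarrow> G' j k r s" if "j < 5" "k < 5" "r \<in> {0<..}" "s \<in> {0<..}" for j k r s
    by (rule LIMSEQ_ignore_initial_segment[OF lim[OF that]])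
  note DC = iterated_dominated_convergence[where G = "\<lambda>n. G (n + N) j k" and G' = "G' j k" and B = B for j k,
      OF S meas Bi B0 Gb lim']
  have D1: "G (n + N) j k r integrable_on {0<..}" if "j < 5" "k < 5" "r > 0" for n j k r
    by (rule DC(1)) (use that in auto)
  have D2: "(\<lambda>r. integral {0<..} (G (n + N) j k r)) integrable_on {0<..}" if "j < 5" "k < 5" for n j k
    by (rule DC(2)) (use that in auto)
  show ?A
  proof (intro exI[of _ N] allI impI conjI)
    fix n j k :: nat assume n: "N \<le> n" and jk: "j < 5" "k < 5"
    have e: "n - N + N = n" using n by simp
    show "G n j k r integrable_on {0<..}" if "r > 0" for r
      using D1[OF jk that, of "n - N"] unfolding e .
    show "(\<lambda>r. integral {0<..} (G n j k r)) integrable_on {0<..}"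
      using D2[OF jk, of "n - N"] unfolding e .
  qed
  show "?B j k" if "j < 5" "k < 5"
    by (rule LIMSEQ_offset[of _ N], rule DC(3)) (use that in auto)
  show "?D j k" if "j < 5" "k < 5"
    by (rule DC(4)) (use that in auto)
qed

section \<open>Rescaling of the double integral\<close>

text \<open>Expansion about the midpoint: the cubes of c cancel between the two variables, and
  opposite signs of the rescaled variables make the quadratic coefficients opposite and all others
  of the same form. The terms that \<open>Phi\<close> subtracts are added back to the polynomial,
  which produces the multiples of m in \<open>\<kappa>3\<close> and
  \<open>\<kappa>1\<close>.\<close>

lemma prelimit_integrand_scaled:
  fixes m :: nat and a b \<xi>1 \<xi>2 \<epsilon> :: real and z y :: complex
  assumes "b < a"
  defines "c \<equiv> (a + b) / 2" and "D \<equiv> (a - b) / 2 * \<epsilon>"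
  defines "\<kappa>3 \<equiv> 2 * real m * \<epsilon>^3 / 3 - D^3 / 3"
    and "\<kappa>1 \<equiv> \<lambda>\<xi>. 2 * real m * \<epsilon> + D * (\<xi> - c^2)"
  shows "prelimit_integrand m a b \<xi>1 \<xi>2 (of_real c + of_real D * z) (of_real c - of_real D * y) =
    exp (of_real ((\<xi>2 - \<xi>1) * c)) *
    (Ehat m \<epsilon> \<kappa>3 (- (c * D^2)) (\<kappa>1 \<xi>2) z * Ehat m \<epsilon> \<kappa>3 (c * D^2) (\<kappa>1 \<xi>1) y / (of_real D * (z + y)))"
proof -
  define d where "d = (a - b) / 2"
  have d: "complex_of_real d \<noteq> 0" using assms(1) by (simp add: d_def)
  have ab: "a = c + d" "b = c - d" by (simp_all add: c_def d_def field_simps)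
  have D: "D = d * \<epsilon>" by (simp add: D_def d_def)
  have q: "(of_real d * X) / (- (of_real d * Y)) = - (X / Y)" for X Y :: complex using d by simp
  have q': "(- (of_real d * X)) / (of_real d * Y) = - (X / Y)" for X Y :: complex using d by simp
  define R where "R x = (1 + of_real \<epsilon> * x) / (1 - of_real \<epsilon> * x)" for x :: complex
  have r1: "(of_real c + of_real D * z - of_real b) / (of_real c + of_real D * z - of_real a) = - R z"
    unfolding R_def q[symmetric] ab D by (simp add: algebra_simps)
  have r2: "(of_real c - of_real D * y - of_real a) / (of_real c - of_real D * y - of_real b) = - R y"
    unfolding R_def q'[symmetric] ab D by (simp add: algebra_simps)
  \<comment> \<open>Each quotient carries a factor -1; the m-th powers of the two signs
    cancel.\<close>
  have sgn: "(- R z) ^ m * (- R y) ^ m = R z ^ m * R y ^ m"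
    by (simp add: power_mult_distrib[symmetric])
  define C DD n E x1 x2 where v: "C = complex_of_real c" "DD = complex_of_real D" "n = (of_nat m :: complex)"
    "E = complex_of_real \<epsilon>" "x1 = complex_of_real \<xi>1" "x2 = complex_of_real \<xi>2"
  have ex: "(- ((C + DD * z)^3) / 3 + x2 * (C + DD * z)) - (- ((C - DD * y)^3) / 3 + x1 * (C - DD * y))
      = (x2 - x1) * C
        + ((- n * (2 * (E * z) + 2 * (E * z)^3 / 3) + ((2 * n * E^3 / 3 - DD^3 / 3) * z^3 + - (C * DD^2) * z^2 + (2 * n * E + DD * (x2 - C^2)) * z))
        + (- n * (2 * (E * y) + 2 * (E * y)^3 / 3) + ((2 * n * E^3 / 3 - DD^3 / 3) * y^3 + (C * DD^2) * y^2 + (2 * n * E + DD * (x1 - C^2)) * y)))"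
    by (simp add: power3_eq_cube power2_eq_square field_simps)
  have K: "complex_of_real \<kappa>3 = 2 * n * E^3 / 3 - DD^3 / 3" "complex_of_real (- (c * D^2)) = - (C * DD^2)"
    "complex_of_real (c * D^2) = C * DD^2" "complex_of_real (\<kappa>1 \<xi>2) = 2 * n * E + DD * (x2 - C^2)"
    "complex_of_real (\<kappa>1 \<xi>1) = 2 * n * E + DD * (x1 - C^2)" "complex_of_real ((\<xi>2 - \<xi>1) * c) = (x2 - x1) * C"
    by (simp_all add: \<kappa>3_def \<kappa>1_def v)
  have g: "U * (1 / w) * p * r = (S * T1 * T2 * (p' * r')) / w" if "U = S * (T1 * T2)" "p * r = p' * r'" for U w p r S T1 T2 p' r' :: complex
    using that by (simp add: mult.assoc)
  have dw: "(C + DD * z) - (C - DD * y) = DD * (z + y)" by (simp add: algebra_simps)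
  have "prelimit_integrand m a b \<xi>1 \<xi>2 (of_real c + of_real D * z) (of_real c - of_real D * y) =
      exp ((- ((C + DD * z)^3) / 3 + x2 * (C + DD * z)) - (- ((C - DD * y)^3) / 3 + x1 * (C - DD * y)))
       * (1 / (DD * (z + y))) * (- R z) ^ m * (- R y) ^ m"
    unfolding prelimit_integrand_def r1 r2 exp_diff unfolding v(1,2)[symmetric] v(5,6)[symmetric] dw ..
  also have "\<dots> = exp ((x2 - x1) * C) *
        exp (- n * (2 * (E * z) + 2 * (E * z)^3 / 3) + ((2 * n * E^3 / 3 - DD^3 / 3) * z^3 + - (C * DD^2) * z^2 + (2 * n * E + DD * (x2 - C^2)) * z))
        * exp (- n * (2 * (E * y) + 2 * (E * y)^3 / 3) + ((2 * n * E^3 / 3 - DD^3 / 3) * y^3 + (C * DD^2) * y^2 + (2 * n * E + DD * (x1 - C^2)) * y))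
        * (R z ^ m * R y ^ m) / (DD * (z + y))"
    by (rule g[OF _ sgn]) (unfold ex exp_add[of "(x2 - x1) * C"] exp_add[of "_ + _" "_ + _"], rule refl)
  also have "\<dots> = exp ((x2 - x1) * C) *
    (Ehat m \<epsilon> \<kappa>3 (- (c * D^2)) (\<kappa>1 \<xi>2) z * Ehat m \<epsilon> \<kappa>3 (c * D^2) (\<kappa>1 \<xi>1) y / (DD * (z + y)))"
    unfolding Ehat_def K R_def v(3,4)[symmetric] exp_add[of "- n * _"] by (simp only: mult_ac times_divide_eq_right times_divide_eq_left)
  finally show ?thesis unfolding K(6) v(2) .
qed

text \<open>The given contours are exchanged for the rays and sectors, where the double integral
  splits over pairs of pieces. The two differentials contribute - D^2, the minus from the half turn
  of the inner contour, and the pole contributes 1 / D.\<close>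

lemma good_contours_integral_scaled:
  fixes a b \<xi>1 \<xi>2 \<epsilon> :: real and m :: nat
  assumes ba: "b < a" and \<epsilon>: "\<epsilon> > 0" and good: "good_contours a b \<gamma> g \<gamma>' g' p"
  defines "c \<equiv> (a + b) / 2" and "D \<equiv> (a - b) / 2 * \<epsilon>"
  defines "\<kappa>3 \<equiv> 2 * real m * \<epsilon>^3 / 3 - D^3 / 3"
    and "\<kappa>1 \<equiv> \<lambda>\<xi>. 2 * real m * \<epsilon> + D * (\<xi> - c^2)"
  defines "G \<equiv> scaled_integrand m \<epsilon> \<kappa>3 (- (c * D^2)) (\<kappa>1 \<xi>2) (c * D^2) (\<kappa>1 \<xi>1)"
    and "f \<equiv> prelimit_integrand m a b \<xi>1 \<xi>2"
  assumes I1: "\<And>j k r. j < 5 \<Longrightarrow> k < 5 \<Longrightarrow> r > 0 \<Longrightarrow> G j k r integrable_on {0<..}"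
    and I2: "\<And>j k. j < 5 \<Longrightarrow> k < 5 \<Longrightarrow> (\<lambda>r. integral {0<..} (G j k r)) integrable_on {0<..}"
  shows "line_integral \<gamma> (\<lambda>w. line_integral \<gamma>' (f w) + contour_integral g' (f w))
      + contour_integral g (\<lambda>w. line_integral \<gamma>' (f w) + contour_integral g' (f w))
    = - (of_real D * exp (of_real ((\<xi>2 - \<xi>1) * c))) * (\<Sum>j<5. \<Sum>k<5. integral {0<..} (\<lambda>r. integral {0<..} (G j k r)))"
proof -
  interpret kernel_data a b \<xi>1 \<xi>2 m by unfold_locales (rule ba)
  define \<rho> where "\<rho> = sqrt 2 / \<epsilon>"
  have \<rho>: "\<rho> > 0" using \<epsilon> by (simp add: \<rho>_def)
  have D: "D > 0" using ba \<epsilon> by (simp add: D_def)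
  define E0 where "E0 = exp (complex_of_real ((\<xi>2 - \<xi>1) * c))"
  have inn: "inner_integral \<eta> h = (\<lambda>w. line_integral \<eta> (f w) + contour_integral h (f w))" for \<eta> h
    unfolding f_def by (rule ext) (simp only: inner_integral_def)
  define \<gamma>1 where "\<gamma>1 = vee (of_real c) D (-3*pi/5) (3*pi/5)"
  define \<gamma>2 where "\<gamma>2 = vee (of_real c) D (2*pi/5) (-2*pi/5)"
  define g1 where "g1 = sector_loop (of_real c) (D * \<rho>) 0"
  define g2 where "g2 = sector_loop (of_real c) (D * \<rho>) pi"
  \<comment> \<open>The scale \<epsilon> cancels: in the original variable the loops have radius
    sqrt 2 times the half-distance of \<open>a\<close> and \<open>b\<close>, so they enclose these
    points.\<close>
  have "D * \<rho> = (a - b) / 2 * sqrt 2" using \<epsilon> by (simp add: D_def \<rho>_def)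
  moreover have "(a - b) / 2 * 1 < (a - b) / 2 * sqrt 2" using ba by (intro mult_strict_left_mono) auto
  ultimately have "(a - b) / 2 < D * \<rho>" by simp
  then have "good_contours a b \<gamma>1 g1 \<gamma>2 g2 (of_real c)"
    unfolding \<gamma>1_def \<gamma>2_def g1_def g2_def c_def by (intro std_good ba D)
  from good_contours_integral[OF this] good_contours_integral[OF good]
  have eq: "line_integral \<gamma> (inner_integral \<gamma>' g') + contour_integral g (inner_integral \<gamma>' g')
      = line_integral \<gamma>1 (inner_integral \<gamma>2 g2) + contour_integral g1 (inner_integral \<gamma>2 g2)" by simp
  have c1: "cis (2*pi/5) = cis pi * cis (-3*pi/5)" unfolding cis_mult by (rule arg_cong[where f = cis]) simp
  have c2: "cis (-2*pi/5) = cis pi * cis (3*pi/5)"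
  proof -
    have "pi + 3*pi/5 = -2*pi/5 + 2*pi" by simp
    then have "cis pi * cis (3*pi/5) = cis (-2*pi/5) * cis (2*pi)" unfolding cis_mult by (simp only:)
    then show ?thesis by simp
  qed
  have S: "f (of_real c + of_real D * z) (of_real c - of_real D * y) =
      E0 * (Ehat m \<epsilon> \<kappa>3 (- (c * D^2)) (\<kappa>1 \<xi>2) z * Ehat m \<epsilon> \<kappa>3 (c * D^2) (\<kappa>1 \<xi>1) y / (of_real D * (z + y)))" for z y
    unfolding f_def E0_def \<kappa>3_def \<kappa>1_def c_def D_def by (rule prelimit_integrand_scaled[OF ba])
  have f_scaled: "f (of_real c + of_real D * zeta \<rho> j r) (of_real c + of_real D * cis pi * zeta \<rho> k s) * omega \<rho> k s * omega \<rho> j r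
      = (E0 / of_real D) * G j k r s" for j k r s
  proof -
    have w: "of_real c + of_real D * cis pi * zeta \<rho> k s = of_real c - of_real D * zeta \<rho> k s" by (simp add: cis_pi)
    have alg: "E0 * (X * Y / (d * Z)) * p * q = (E0 / d) * ((X * q) * (Y * p) / Z)" for X Y d Z p q :: complex
      by simp
    show ?thesis
      unfolding w S alg G_def scaled_integrand_def \<rho>_def[symmetric] ..
  qed
  have inner: "inner_integral \<gamma>2 g2 (of_real c + of_real D * zeta \<rho> j r) * omega \<rho> j r
      = - E0 * (\<Sum>k<5. integral {0<..} (G j k r))" if "j < 5" "r > 0" for j r
  \<comment> \<open>Beyond a truncation \<open>omega\<close> is 0 and both sides vanish; otherwise
    \<open>omega\<close> can be divided out of \<open>f_scaled\<close>.\<close>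
  proof (cases "omega \<rho> j r = 0")
    case True
    then have "G j k r = (\<lambda>s. 0)" for k by (simp add: G_def scaled_integrand_def[abs_def] \<rho>_def)
    with True show ?thesis by simp
  next
    case False
    define w where "w = of_real c + of_real D * zeta \<rho> j r"
    have f_eq: "f w (of_real c + of_real D * cis pi * zeta \<rho> k s) * omega \<rho> k s
        = (E0 / (of_real D * omega \<rho> j r)) * G j k r s" for k s
    proof -
      have div: "X = (E0 / d) * Y / q \<Longrightarrow> X = (E0 / (d * q)) * Y" for X d Y q :: complex by simp
      show ?thesis
        by (rule div, unfold nonzero_eq_divide_eq[OF False] w_def, rule f_scaled)
    qed
    have "inner_integral \<gamma>2 g2 w = line_integral \<gamma>2 (f w) + contour_integral g2 (f w)" by (simp only: inn)
    also have "\<dots> = of_real D * cis pi * (\<Sum>k<5. integral {0<..} (\<lambda>s. f w (of_real c + of_real D * cis pi * zeta \<rho> k s) * omega \<rho> k s))"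
      unfolding \<gamma>2_def g2_def
    proof (rule line_plus_loop_integral[OF \<rho> D c1 c2])
      show "(\<lambda>s. f w (of_real c + of_real D * cis pi * zeta \<rho> k s) * omega \<rho> k s) integrable_on {0<..}" if "k < 5" for k
        unfolding f_eq using I1[OF \<open>j < 5\<close> that \<open>r > 0\<close>] by (rule integrable_on_mult_right)
    qed
    also have "\<dots> = - of_real D * (\<Sum>k<5. (E0 / (of_real D * omega \<rho> j r)) * integral {0<..} (G j k r))"
      unfolding f_eq integral_mult_right by (simp add: cis_pi)
    also have "\<dots> = - (E0 / omega \<rho> j r) * (\<Sum>k<5. integral {0<..} (G j k r))"
      using D unfolding sum_distrib_left[symmetric] by simp
    finally show ?thesis unfolding w_def using False by simp
  qed
  have J: "((\<lambda>r. inner_integral \<gamma>2 g2 (of_real c + of_real D * cis 0 * zeta \<rho> j r) * omega \<rho> j r) has_integral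
      (- E0 * (\<Sum>k<5. integral {0<..} (\<lambda>r. integral {0<..} (G j k r))))) {0<..}" if "j < 5" for j
  proof (rule has_integral_eq)
    show "((\<lambda>r. - E0 * (\<Sum>k<5. integral {0<..} (G j k r))) has_integral
      (- E0 * (\<Sum>k<5. integral {0<..} (\<lambda>r. integral {0<..} (G j k r))))) {0<..}"
      by (intro has_integral_mult_right has_integral_sum integrable_integral I2[OF that]) auto
  qed (use inner[OF that] in simp)
  have "line_integral \<gamma>1 (inner_integral \<gamma>2 g2) + contour_integral g1 (inner_integral \<gamma>2 g2)
      = of_real D * cis 0 * (\<Sum>j<5. integral {0<..} (\<lambda>r. inner_integral \<gamma>2 g2 (of_real c + of_real D * cis 0 * zeta \<rho> j r) * omega \<rho> j r))"
    unfolding \<gamma>1_def g1_def by (rule line_plus_loop_integral[OF \<rho> D]) (use J in \<open>auto simp: integrable_on_def\<close>)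
  also have "(\<Sum>j<5. integral {0<..} (\<lambda>r. inner_integral \<gamma>2 g2 (of_real c + of_real D * cis 0 * zeta \<rho> j r) * omega \<rho> j r))
      = (\<Sum>j<5. - E0 * (\<Sum>k<5. integral {0<..} (\<lambda>r. integral {0<..} (G j k r))))"
    by (intro sum.cong refl integral_unique J) simp
  also have "of_real D * cis 0 * \<dots> = - (of_real D * E0) * (\<Sum>j<5. \<Sum>k<5. integral {0<..} (\<lambda>r. integral {0<..} (G j k r)))"
    unfolding sum_distrib_left[symmetric] by simp
  finally show ?thesis using eq unfolding inn E0_def by simp
qed

section \<open>The quintic kernel as a sum over pieces\<close>

lemma outgoing_ray_integral_open:
  "outgoing_ray_integral \<phi> f = integral {0<..} (\<lambda>r. f (of_real r * cis \<phi>) * cis \<phi>)"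
  unfolding outgoing_ray_integral_def
  by (rule integral_spike_set) (auto intro!: negligible_subset[OF negligible_sing[of 0]])

lemma sum_lessThan_4: "(\<Sum>j<(4::nat). F j) = F 0 + F 1 + F 2 + (F 3 :: 'a :: comm_monoid_add)"
  by (simp add: eval_nat_numeral lessThan_Suc ac_simps)

lemma sum_lessThan_5: "(\<Sum>j<(5::nat). F j) = (\<Sum>j<4. F j) + (F 4 :: 'a :: comm_monoid_add)"
proof -
  have "(5::nat) = Suc 4" by simp
  then show ?thesis by (simp only: sum.lessThan_Suc)
qed

lemma quintic_contour_integral_eq:
  "quintic_contour_integral f = (\<Sum>j<4. integral {0<..} (\<lambda>r. f (zeta 0 j r) * omega r j r))"
  by (simp add: quintic_contour_integral_def outgoing_ray_integral_open sum_lessThan_4 zeta_def omega_def)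

text \<open>The second contour is the negative of the first; the minus sign is that of the
  differential under z' = - y.\<close>

lemma quintic_contour_integral'_eq:
  "quintic_contour_integral' f = - (\<Sum>j<4. integral {0<..} (\<lambda>r. f (- zeta 0 j r) * omega r j r))"
proof -
  have opp: "cis (\<phi> + pi) = - cis \<phi>" for \<phi> by (simp add: cis_mult[symmetric] cis_pi)
  have "2*pi/5 = -3*pi/5 + pi" by simp
  then have 1: "cis (2*pi/5) = - cis (-3*pi/5)" by (simp only: opp)
  have "3*pi/5 = -2*pi/5 + pi" by simp
  then have 2: "cis (-2*pi/5) = - cis (3*pi/5)" by (simp only: opp minus_minus)
  have "pi/5 = -4*pi/5 + pi" by simp
  then have 3: "cis (-4*pi/5) = - cis (pi/5)" by (simp only: opp minus_minus)
  have "4*pi/5 = -pi/5 + pi" by simp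
  then have 4: "cis (4*pi/5) = - cis (-pi/5)" by (simp only: opp)
  show ?thesis
    unfolding quintic_contour_integral'_def outgoing_ray_integral_open sum_lessThan_4 1 2 3 4
    by (simp add: zeta_def omega_def)
qed

text \<open>The pairs involving the arc are zero, so the sums may run to 5 as before the limit.
  Integrability of the inner integrals is used to exchange the sum over k with the outer
  integral.\<close>

lemma quintic_kernel_eq:
  assumes "\<And>j k. j < 4 \<Longrightarrow> k < 4 \<Longrightarrow> (\<lambda>r. integral {0<..} (limit_integrand (- \<theta> / 3) (- \<eta>) v2 \<eta> v1 j k r)) integrable_on {0<..}"
  shows "quintic_kernel \<theta> \<eta> v1 v2 = - (1 / (2 * of_real pi * \<i>)^2) *
    (\<Sum>j<5. \<Sum>k<5. integral {0<..} (\<lambda>r. integral {0<..} (limit_integrand (- \<theta> / 3) (- \<eta>) v2 \<eta> v1 j k r)))"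
proof -
  define L where "L = limit_integrand (- \<theta> / 3) (- \<eta>) v2 \<eta> v1"
  have L4: "(\<Sum>j<5. \<Sum>k<5. integral {0<..} (\<lambda>r. integral {0<..} (L j k r)))
      = (\<Sum>j<4. \<Sum>k<4. integral {0<..} (\<lambda>r. integral {0<..} (L j k r)))"
  proof -
    have "L j k r = (\<lambda>s. 0)" if "j = 4 \<or> k = 4" for j k r
      using that by (auto simp: L_def limit_integrand_def)
    then show ?thesis by (simp add: sum_lessThan_5)
  qed
  define q where "q z z' = 1 / (z - z') * (exp (quintic_exponent \<theta> \<eta> v2 z) / exp (quintic_exponent \<theta> \<eta> v1 z'))" for z z'
  have q: "q z (- y) * p * o' = (limit_exponential (- \<theta> / 3) (- \<eta>) v2 z * o') * (limit_exponential (- \<theta> / 3) \<eta> v1 y * p) / (z + y)"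
    for z y p o'
  proof -
    have "quintic_exponent \<theta> \<eta> v2 z = 2/5 * z^5 + of_real (- \<theta> / 3) * z^3 + of_real (- \<eta>) * z^2 + of_real v2 * z"
      by (simp add: quintic_exponent_def)
    moreover have "- quintic_exponent \<theta> \<eta> v1 (- y) = 2/5 * y^5 + of_real (- \<theta> / 3) * y^3 + of_real \<eta> * y^2 + of_real v1 * y"
      by (simp add: quintic_exponent_def)
    moreover have "exp A / exp B = exp A * exp (- B)" for A B :: complex by (simp add: exp_minus divide_inverse)
    ultimately show ?thesis unfolding q_def limit_exponential_def by simp
  qed
  have "quintic_contour_integral (\<lambda>z. quintic_contour_integral' (q z))
      = (\<Sum>j<4. integral {0<..} (\<lambda>r. - (\<Sum>k<4. integral {0<..} (L j k r))))"
    unfolding quintic_contour_integral_eq quintic_contour_integral'_eq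
  proof (intro sum.cong refl integral_cong)
    fix j r assume j: "j \<in> {..<4::nat}"
    have "(\<Sum>k<4. integral {0<..} (\<lambda>s. q (zeta 0 j r) (- zeta 0 k s) * omega s k s)) * omega r j r
        = (\<Sum>k<4. integral {0<..} (L j k r))"
      unfolding sum_distrib_right
    proof (intro sum.cong refl)
      fix k assume k: "k \<in> {..<4::nat}"
      have "(\<lambda>s. q (zeta 0 j r) (- zeta 0 k s) * omega s k s * omega r j r) = L j k r"
        unfolding q L_def limit_integrand_def[abs_def] using j k by simp
      then show "integral {0<..} (\<lambda>s. q (zeta 0 j r) (- zeta 0 k s) * omega s k s) * omega r j r = integral {0<..} (L j k r)"
        unfolding integral_mult_left[symmetric] by (simp only:)
    qed
    then show "- (\<Sum>k<4. integral {0<..} (\<lambda>s. q (zeta 0 j r) (- zeta 0 k s) * omega s k s)) * omega r j r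
        = - (\<Sum>k<4. integral {0<..} (L j k r))" by simp
  qed
  also have "\<dots> = (\<Sum>j<4. - (\<Sum>k<4. integral {0<..} (\<lambda>r. integral {0<..} (L j k r))))"
    unfolding integral_neg
    by (intro sum.cong refl arg_cong[where f = uminus] integral_sum) (use assms in \<open>auto simp: L_def\<close>)
  finally show ?thesis
    unfolding quintic_kernel_def q_def[symmetric] L_def[symmetric] L4 by (simp add: sum_negf)
qed

section \<open>Uniform convergence\<close>

text \<open>If uniformity fails, there are points p n with limit l, possibly outside B, and indices
  M n at which F stays far from G (p n). Larger indices M' n bring F close to G (p n) at the same
  points. By the hypothesis both sequences of values tend to G l, a contradiction; this takes the
  place of a continuity argument for G.\<close>

lemma uniform_limit_by_sequences:
  fixes F :: "nat \<Rightarrow> 'a::heine_borel \<Rightarrow> 'b::metric_space"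
  assumes B: "bounded B"
    and H: "\<And>M p l. \<lbrakk>\<And>n. n < M n; \<And>n. p n \<in> B; p \<longlonglongrightarrow> l\<rbrakk> \<Longrightarrow> (\<lambda>n. F (M n) (p n)) \<longlonglongrightarrow> G l"
  shows "uniform_limit B F G sequentially"
proof (rule uniform_limitI, rule ccontr)
  fix e :: real assume e: "e > 0" and "\<not> (\<forall>\<^sub>F n in sequentially. \<forall>x\<in>B. dist (F n x) (G x) < e)"
  then have "\<forall>n. \<exists>q. n < fst q \<and> snd q \<in> B \<and> e \<le> dist (F (fst q) (snd q)) (G (snd q))"
    unfolding eventually_sequentially by (metis fst_conv snd_conv not_less Suc_le_eq)
  then obtain q where q: "\<forall>n. n < fst (q n) \<and> snd (q n) \<in> B \<and> e \<le> dist (F (fst (q n)) (snd (q n))) (G (snd (q n)))"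
    by (rule choice[THEN exE])
  have "bounded (range (\<lambda>n. snd (q n)))" by (rule bounded_subset[OF B]) (use q in auto)
  then obtain l r where r: "strict_mono r" and l: "((\<lambda>n. snd (q n)) \<circ> r) \<longlonglongrightarrow> l"
    using bounded_imp_convergent_subsequence by blast
  define p where "p n = snd (q (r n))" for n
  define M where "M n = fst (q (r n))" for n
  have pB: "p n \<in> B" for n using q by (simp add: p_def)
  have pl: "p \<longlonglongrightarrow> l" using l by (simp add: p_def[abs_def] o_def)
  have Mn: "n < M n" for n using q seq_suble[OF r, of n] le_less_trans unfolding M_def by blast
  have far: "e \<le> dist (F (M n) (p n)) (G (p n))" for n using q by (simp add: p_def M_def)
  have "\<exists>k>n. dist (F k (p n)) (G (p n)) < inverse (real (Suc n))" for n
  proof -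
    \<comment> \<open>The hypothesis for the constant sequence at p n; the successor makes the k-th
      index exceed k.\<close>
    have "(\<lambda>k. F (Suc k) (p n)) \<longlonglongrightarrow> G (p n)" by (rule H) (use pB in auto)
    then have "\<forall>\<^sub>F k in sequentially. dist (F (Suc k) (p n)) (G (p n)) < inverse (real (Suc n))"
      by (rule tendstoD) simp
    then obtain N where "\<forall>k\<ge>N. dist (F (Suc k) (p n)) (G (p n)) < inverse (real (Suc n))"
      unfolding eventually_sequentially by blast
    then have "dist (F (Suc (max N n)) (p n)) (G (p n)) < inverse (real (Suc n))" by simp
    then show ?thesis by (intro exI[of _ "Suc (max N n)"]) simp
  qed
  then obtain M' where M': "\<forall>n. n < M' n \<and> dist (F (M' n) (p n)) (G (p n)) < inverse (real (Suc n))"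
    using choice[of "\<lambda>n k. n < k \<and> dist (F k (p n)) (G (p n)) < inverse (real (Suc n))"] by blast
  have c1: "(\<lambda>n. F (M n) (p n)) \<longlonglongrightarrow> G l" by (rule H[OF Mn pB pl])
  have c2: "(\<lambda>n. F (M' n) (p n)) \<longlonglongrightarrow> G l" by (rule H[OF _ pB pl]) (use M' in blast)
  have "(\<lambda>n. dist (F (M n) (p n)) (F (M' n) (p n)) + inverse (real (Suc n))) \<longlonglongrightarrow> dist (G l) (G l) + 0"
    by (intro tendsto_add tendsto_dist c1 c2 LIMSEQ_inverse_real_of_nat)
  then have "e \<le> dist (G l) (G l) + 0"
  proof (rule LIMSEQ_le_const, intro exI allI impI)
    fix n :: nat
    have "e \<le> dist (F (M n) (p n)) (F (M' n) (p n)) + dist (F (M' n) (p n)) (G (p n))"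
      by (rule order_trans[OF far dist_triangle])
    then show "e \<le> dist (F (M n) (p n)) (F (M' n) (p n)) + inverse (real (Suc n))"
      using M'[rule_format, of n] by linarith
  qed
  then show False using e by simp
qed

section \<open>Algebra of the scaling\<close>

text \<open>Here u = (2m)^(1/3), x = m^(-1/5), t = \<theta>/6, h = \<eta>/2 and w = (v -
  \<theta>^2/18)/2. Fractional powers enter only through the two relations for u and x, so
  everything is polynomial algebra. In the third identity 2 t^2 + 2 w = v, which explains the shift
  by \<theta>^2/18 in \<open>xi_scaled\<close>.\<close>

lemma scaling_identities:
  fixes u x m t h w A :: real
  assumes u: "u^3 = 2 * m" and x: "m * x^5 = 1" and A: "A = 1 + t * x^2"
  shows "2 * m * x^3 - (u * A * x)^3 = - (6 * t + 6 * t^2 * x^2 + 2 * t^3 * x^4)"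
    and "(u * h * x^3) * (u * A * x)^2 = 2 * h * A^2"
    and "2 * m * x + u * A * x * (- (u^2 * (1 - t * x^2 - w * x^4)) - (u * h * x^3)^2)
      = 2 * t^2 + 2 * A * w - 2 * A * h^2 * x^2"
    and "(u^2 * x^4) * (u * x^3) = 2 * x^2"
proof -
  have "2 * m * x^3 - (u * A * x)^3 = 2 * m * x^3 - u^3 * (A^3 * x^3)"
    by (simp add: power_mult_distrib mult_ac)
  also have "\<dots> = - (2 * (m * x^5) * (3 * t + 3 * t^2 * x^2 + t^3 * x^4))"
    unfolding u A by (simp add: eval_nat_numeral algebra_simps)
  finally show "2 * m * x^3 - (u * A * x)^3 = - (6 * t + 6 * t^2 * x^2 + 2 * t^3 * x^4)"
    unfolding x by simp
  have "(u * h * x^3) * (u * A * x)^2 = u^3 * (h * A^2 * x^5)" by (simp add: eval_nat_numeral mult_ac)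
  also have "\<dots> = 2 * (m * x^5) * (h * A^2)" unfolding u by (simp only: mult_ac)
  finally show "(u * h * x^3) * (u * A * x)^2 = 2 * h * A^2" unfolding x by simp
  have "(u^2 * x^4) * (u * x^3) = u^3 * (x^5 * x^2)" by (simp add: eval_nat_numeral mult_ac)
  also have "\<dots> = 2 * (m * x^5) * x^2" unfolding u by (simp only: mult_ac)
  finally show "(u^2 * x^4) * (u * x^3) = 2 * x^2" unfolding x by simp
  have "2 * m * x + u * A * x * (- (u^2 * (1 - t * x^2 - w * x^4)) - (u * h * x^3)^2)
      = 2 * m * x - u^3 * (A * x * (1 - t * x^2 - w * x^4)) - u^3 * (A * h^2 * x^7)"
    by (simp add: eval_nat_numeral algebra_simps)
  also have "\<dots> = 2 * m * x * (1 - A * (1 - t * x^2)) + 2 * (m * x^5) * (A * w - A * h^2 * x^2)"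
    unfolding u by (simp add: eval_nat_numeral algebra_simps)
  \<comment> \<open>Here the divergent orders m x and m x^3 cancel; this is what fixes the \<theta>
    term of \<open>xi_scaled\<close> against that of \<open>a_scaled\<close> and
    \<open>b_scaled\<close>.\<close>
  also have "1 - A * (1 - t * x^2) = t^2 * x^4" unfolding A by (simp add: eval_nat_numeral algebra_simps)
  also have "2 * m * x * (t^2 * x^4) = 2 * (m * x^5) * t^2" by (simp add: eval_nat_numeral mult_ac)
  finally show "2 * m * x + u * A * x * (- (u^2 * (1 - t * x^2 - w * x^4)) - (u * h * x^3)^2)
      = 2 * t^2 + 2 * A * w - 2 * A * h^2 * x^2"
    unfolding x by (simp add: algebra_simps)
qed

text \<open>The last equation says that the prefactor of the kernel is the reciprocal of u x, the
  leading part of the length scale D.\<close>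

lemma powr_scales:
  assumes "m \<ge> (1::nat)"
  defines "x \<equiv> real m powr (-1/5)" and "u \<equiv> (2 * real m) powr (1/3)"
  shows "x > 0" "u > 0" "u^3 = 2 * real m" "real m * x^5 = 1" "x^2 = real m powr (-2/5)" "x^3 = real m powr (-3/5)"
    "x^4 = real m powr (-4/5)" "u^2 = (2 * real m) powr (2/3)"
    "2 powr (-1/3) * real m powr (-2/15) * (u * x) = 1"
proof -
  have m: "real m > 0" using assms(1) by simp
  show "x > 0" "u > 0" using m by (simp_all add: x_def u_def)
  show "x^2 = real m powr (-2/5)" "x^3 = real m powr (-3/5)" "x^4 = real m powr (-4/5)" "u^2 = (2 * real m) powr (2/3)"
    using m by (simp_all add: x_def u_def powr_power)
  show "u^3 = 2 * real m" using m by (simp add: u_def powr_power)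
  have "x^5 = real m powr (-1)" using m by (simp add: x_def powr_power)
  then show "real m * x^5 = 1" using m by (simp add: powr_minus)
  have "2 powr (-1/3) * real m powr (-2/15) * (u * x)
      = (2 powr (-1/3) * 2 powr (1/3)) * (real m powr (-2/15) * real m powr (1/3) * real m powr (-1/5))"
    using m by (simp add: u_def x_def powr_mult)
  also have "\<dots> = 1" using m by (simp add: powr_add[symmetric])
  finally show "2 powr (-1/3) * real m powr (-2/15) * (u * x) = 1" .
qed

text \<open>An exact identity for each m: all divergent powers of m have cancelled, and the
  remaining coefficients are polynomials in \<epsilon> and the parameters that converge as
  \<epsilon> tends to 0.\<close>

lemma rescaled_prelimit_kernel_eq:
  fixes \<theta> \<eta> v1 v2 :: real
  assumes m: "m \<ge> 1"
    and adm: "admissible_contours (a_scaled m \<theta> \<eta>) (b_scaled m \<theta> \<eta>) \<gamma> g \<gamma>' g'"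
  defines "\<epsilon> \<equiv> real m powr (-1/5)"
  defines "A \<equiv> 1 + \<theta> / 6 * \<epsilon>^2"
  defines "\<kappa>1 \<equiv> \<lambda>v. \<theta>^2 / 18 + A * (v - \<theta>^2 / 18) - A * \<eta>^2 * \<epsilon>^2 / 2"
  defines "G \<equiv> scaled_integrand m \<epsilon> (- (\<theta> / 3 + \<theta>^2 * \<epsilon>^2 / 18 + \<theta>^3 * \<epsilon>^4 / 324)) (- (\<eta> * A^2)) (\<kappa>1 v2) (\<eta> * A^2) (\<kappa>1 v1)"
  assumes I1: "\<And>j k r. j < 5 \<Longrightarrow> k < 5 \<Longrightarrow> r > 0 \<Longrightarrow> G j k r integrable_on {0<..}"
    and I2: "\<And>j k. j < 5 \<Longrightarrow> k < 5 \<Longrightarrow> (\<lambda>r. integral {0<..} (G j k r)) integrable_on {0<..}"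
  shows "rescaled_prelimit_kernel m \<theta> \<eta> v1 v2 \<gamma> g \<gamma>' g' = - (1 / (2 * of_real pi * \<i>)^2) *
    (of_real A * exp (of_real ((v2 - v1) * \<eta> * \<epsilon>^2 / 2)) * (\<Sum>j<5. \<Sum>k<5. integral {0<..} (\<lambda>r. integral {0<..} (G j k r))))"
proof -
  define u where "u = (2 * real m) powr (1/3)"
  note sc = powr_scales[OF m, folded \<epsilon>_def u_def]
  define a b where "a = a_scaled m \<theta> \<eta>" and "b = b_scaled m \<theta> \<eta>"
  define \<xi> where "\<xi> v = xi_scaled m \<theta> v" for v
  define w where "w v = (v - \<theta>^2 / 18) / 2" for v
  have a: "a = u * (A + \<eta> / 2 * \<epsilon>^3)" and b: "b = u * (- A + \<eta> / 2 * \<epsilon>^3)"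
    unfolding a_def b_def a_scaled_def b_scaled_def A_def sc(5,6) u_def by (simp_all add: mult.commute)
  have \<xi>: "\<xi> v = - (u^2 * (1 - \<theta> / 6 * \<epsilon>^2 - w v * \<epsilon>^4))" for v
    unfolding \<xi>_def xi_scaled_def sc(5,7,8) w_def by (simp add: field_simps)
  have ba: "b < a" using adm unfolding a_def b_def admissible_contours_def by linarith
  obtain p where good: "good_contours a b \<gamma> g \<gamma>' g' p"
    using admissible_imp_good[OF adm] unfolding a_def b_def by blast
  define c where "c = (a + b) / 2"
  define D where "D = (a - b) / 2 * \<epsilon>"
  have c: "c = u * (\<eta> / 2) * \<epsilon>^3" unfolding c_def a b by (simp add: field_simps)
  have D: "D = u * A * \<epsilon>" unfolding D_def a b by (simp add: field_simps)
  note id = scaling_identities[OF sc(3,4), of A "\<theta> / 6", OF A_def[THEN meta_eq_to_obj_eq]]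
  have k3: "2 * real m * \<epsilon>^3 / 3 - D^3 / 3 = - (\<theta> / 3 + \<theta>^2 * \<epsilon>^2 / 18 + \<theta>^3 * \<epsilon>^4 / 324)"
  proof -
    have "2 * real m * \<epsilon>^3 / 3 - D^3 / 3 = (2 * real m * \<epsilon>^3 - D^3) / 3" by (simp add: diff_divide_distrib)
    also have "\<dots> = - (6 * (\<theta> / 6) + 6 * (\<theta> / 6)^2 * \<epsilon>^2 + 2 * (\<theta> / 6)^3 * \<epsilon>^4) / 3" unfolding D id(1) ..
    finally show ?thesis by (simp add: power_divide field_simps)
  qed
  have k2: "c * D^2 = \<eta> * A^2" unfolding c D id(2) by simp
  have k1: "2 * real m * \<epsilon> + D * (\<xi> v - c^2) = \<kappa>1 v" for v
    unfolding c D \<xi> id(3) \<kappa>1_def w_def by (simp add: power_divide field_simps)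
  have E: "(\<xi> v2 - \<xi> v1) * c = (v2 - v1) * \<eta> * \<epsilon>^2 / 2"
  proof -
    have "(\<xi> v2 - \<xi> v1) * c = ((w v2 - w v1) * (\<eta> / 2)) * ((u^2 * \<epsilon>^4) * (u * \<epsilon>^3))"
      unfolding \<xi> c by (simp add: algebra_simps)
    also have "\<dots> = (v2 - v1) * \<eta> * \<epsilon>^2 / 2" unfolding id(4) w_def by (simp add: field_simps)
    finally show ?thesis .
  qed
  define f where "f = prelimit_integrand m a b (\<xi> v1) (\<xi> v2)"
  have main: "line_integral \<gamma> (\<lambda>w. line_integral \<gamma>' (f w) + contour_integral g' (f w))
      + contour_integral g (\<lambda>w. line_integral \<gamma>' (f w) + contour_integral g' (f w))
    = - (of_real D * exp (of_real ((v2 - v1) * \<eta> * \<epsilon>^2 / 2))) * (\<Sum>j<5. \<Sum>k<5. integral {0<..} (\<lambda>r. integral {0<..} (G j k r)))"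
    by (rule good_contours_integral_scaled[OF ba sc(1) good, where m = m and ?\<xi>1.0 = "\<xi> v1" and ?\<xi>2.0 = "\<xi> v2", folded c_def D_def, unfolded k1 k2 k3 E, folded G_def f_def];
      (rule I1 I2; assumption))
  have pref: "of_real (2 powr (-1/3) * real m powr (-2/15)) * complex_of_real D = of_real A"
  proof -
    have "2 powr (-1/3) * real m powr (-2/15) * D = (2 powr (-1/3) * real m powr (-2/15) * (u * \<epsilon>)) * A"
      unfolding D by (simp only: mult_ac)
    also have "\<dots> = A" unfolding sc(9) by simp
    finally show ?thesis unfolding of_real_mult[symmetric] by (simp only:)
  qed
  have alg: "P / q * (- (d * E) * S) = - (1 / q) * (P * d * E * S)" for P q d E S :: complex by simp
  show ?thesis
    unfolding rescaled_prelimit_kernel_def Let_def a_def[symmetric] b_def[symmetric] \<xi>_def[symmetric] f_def[symmetric]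
      main alg pref ..
qed

text \<open>Parameters and contours may change with n; this is the sequential form needed for
  uniformity. The contours disappear through the exact identity, so no control of how they vary
  enters.\<close>

lemma rescaled_prelimit_kernel_tendsto:
  fixes \<theta> \<eta> v1 v2 :: "nat \<Rightarrow> real"
  assumes M: "\<And>n. n < M n" and l: "\<theta> \<longlonglongrightarrow> t" "\<eta> \<longlonglongrightarrow> h" "v1 \<longlonglongrightarrow> y1" "v2 \<longlonglongrightarrow> y2"
    and adm: "\<forall>\<^sub>F n in sequentially. admissible_contours (a_scaled (M n) (\<theta> n) (\<eta> n)) (b_scaled (M n) (\<theta> n) (\<eta> n)) (\<gamma> n) (g n) (\<gamma>' n) (g' n)"
  shows "(\<lambda>n. rescaled_prelimit_kernel (M n) (\<theta> n) (\<eta> n) (v1 n) (v2 n) (\<gamma> n) (g n) (\<gamma>' n) (g' n))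
    \<longlonglongrightarrow> quintic_kernel t h y1 y2"
proof -
  define \<epsilon> where "\<epsilon> n = real (M n) powr (-1/5)" for n
  have M1: "M n \<ge> 1" for n using M[of n] by simp
  note sc = powr_scales[OF M1, folded \<epsilon>_def]
  have "filterlim M at_top sequentially"
    by (rule filterlim_at_top_mono[OF filterlim_ident always_eventually]) (use M less_imp_le in blast)
  then have "filterlim (\<lambda>n. real (M n)) at_top sequentially"
    by (rule filterlim_compose[OF filterlim_real_sequentially])
  then have \<epsilon>0: "\<epsilon> \<longlonglongrightarrow> 0" unfolding \<epsilon>_def[abs_def] by (intro tendsto_neg_powr) auto
  define A where "A n = 1 + \<theta> n / 6 * \<epsilon> n^2" for n
  have "A \<longlonglongrightarrow> 1 + t / 6 * 0^2" unfolding A_def[abs_def] by (intro tendsto_intros l \<epsilon>0) simp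
  then have A: "A \<longlonglongrightarrow> 1" by simp
  define \<kappa>3 where "\<kappa>3 n = - (\<theta> n / 3 + \<theta> n^2 * \<epsilon> n^2 / 18 + \<theta> n^3 * \<epsilon> n^4 / 324)" for n
  define \<kappa>1 where "\<kappa>1 v n = \<theta> n^2 / 18 + A n * (v - \<theta> n^2 / 18) - A n * \<eta> n^2 * \<epsilon> n^2 / 2" for v n
  have "\<kappa>3 \<longlonglongrightarrow> - (t / 3 + t^2 * 0^2 / 18 + t^3 * 0^4 / 324)"
    unfolding \<kappa>3_def[abs_def] by (intro tendsto_intros l \<epsilon>0) auto
  then have k3: "\<kappa>3 \<longlonglongrightarrow> - t / 3" by simp
  have "(\<lambda>n. \<eta> n * A n^2) \<longlonglongrightarrow> h * 1^2" by (intro tendsto_intros l A)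
  then have k2: "(\<lambda>n. \<eta> n * A n^2) \<longlonglongrightarrow> h" by simp
  have k2': "(\<lambda>n. - (\<eta> n * A n^2)) \<longlonglongrightarrow> - h" by (intro tendsto_minus k2)
  have k1: "(\<lambda>n. \<kappa>1 (v n) n) \<longlonglongrightarrow> y" if "v \<longlonglongrightarrow> y" for v y
  proof -
    have "(\<lambda>n. \<kappa>1 (v n) n) \<longlonglongrightarrow> t^2 / 18 + 1 * (y - t^2 / 18) - 1 * h^2 * 0^2 / 2"
      unfolding \<kappa>1_def by (intro tendsto_intros l \<epsilon>0 A that) auto
    then show ?thesis by simp
  qed
  define G where "G n = scaled_integrand (M n) (\<epsilon> n) (\<kappa>3 n) (- (\<eta> n * A n^2)) (\<kappa>1 (v2 n) n) (\<eta> n * A n^2) (\<kappa>1 (v1 n) n)" for n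
  define L where "L = limit_integrand (- t / 3) (- h) y2 h y1"
  note lim = scaled_integrand_limit[OF \<epsilon>0 sc(1) sc(4) k3 k2' k1[OF l(4)] k2 k1[OF l(3)], folded G_def L_def]
  define T where "T n = - (1 / (2 * of_real pi * \<i>)^2) *
    (of_real (A n) * exp (of_real ((v2 n - v1 n) * \<eta> n * \<epsilon> n^2 / 2)) * (\<Sum>j<5. \<Sum>k<5. integral {0<..} (\<lambda>r. integral {0<..} (G n j k r))))" for n
  have "(\<lambda>n. (v2 n - v1 n) * \<eta> n * \<epsilon> n^2 / 2) \<longlonglongrightarrow> (y2 - y1) * h * 0^2 / 2"
    by (intro tendsto_intros l \<epsilon>0) auto
  then have E: "(\<lambda>n. (v2 n - v1 n) * \<eta> n * \<epsilon> n^2 / 2) \<longlonglongrightarrow> 0" by simp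
  have "T \<longlonglongrightarrow> - (1 / (2 * of_real pi * \<i>)^2) *
    (of_real 1 * exp (of_real 0) * (\<Sum>j<5. \<Sum>k<5. integral {0<..} (\<lambda>r. integral {0<..} (L j k r))))"
    unfolding T_def[abs_def]
    by (intro tendsto_mult tendsto_const tendsto_of_real tendsto_exp tendsto_sum A E lim(2)) auto
  moreover have "quintic_kernel t h y1 y2 = - (1 / (2 * of_real pi * \<i>)^2) *
    (\<Sum>j<5. \<Sum>k<5. integral {0<..} (\<lambda>r. integral {0<..} (L j k r)))"
    unfolding L_def by (rule quintic_kernel_eq) (use lim(3)[unfolded L_def] in simp)
  ultimately have T: "T \<longlonglongrightarrow> quintic_kernel t h y1 y2" by simp
  obtain N where N: "\<forall>n\<ge>N. \<forall>j<5. \<forall>k<5. (\<forall>r>0. G n j k r integrable_on {0<..}) \<and>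
      (\<lambda>r. integral {0<..} (G n j k r)) integrable_on {0<..}"
    using lim(1) by blast
  show ?thesis
  proof (rule Lim_transform_eventually[OF T])
    show "\<forall>\<^sub>F n in sequentially. T n = rescaled_prelimit_kernel (M n) (\<theta> n) (\<eta> n) (v1 n) (v2 n) (\<gamma> n) (g n) (\<gamma>' n) (g' n)"
      using adm eventually_ge_at_top[of N]
    proof eventually_elim
      case (elim n)
      have "rescaled_prelimit_kernel (M n) (\<theta> n) (\<eta> n) (v1 n) (v2 n) (\<gamma> n) (g n) (\<gamma>' n) (g' n) = T n"
        unfolding T_def G_def \<kappa>3_def \<kappa>1_def A_def \<epsilon>_def
        by (rule rescaled_prelimit_kernel_eq[OF M1 elim(1)])
           (use N elim(2) in \<open>simp_all only: G_def \<kappa>3_def \<kappa>1_def A_def \<epsilon>_def\<close>)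
      then show ?case by simp
    qed
  qed
qed

theorem proposition6p2:
  fixes B :: "(real \<times> real \<times> real \<times> real) set"
    and \<gamma> g \<gamma>' g' :: "nat \<Rightarrow> real \<Rightarrow> real \<Rightarrow> real \<Rightarrow> real \<Rightarrow> real \<Rightarrow> complex"
  assumes "bounded B"
    and "\<forall>\<^sub>F m in sequentially. \<forall>(\<theta>, \<eta>, v1, v2) \<in> B.
           admissible_contours (a_scaled m \<theta> \<eta>) (b_scaled m \<theta> \<eta>)
             (\<gamma> m \<theta> \<eta> v1 v2) (g m \<theta> \<eta> v1 v2) (\<gamma>' m \<theta> \<eta> v1 v2) (g' m \<theta> \<eta> v1 v2)"
  shows "uniform_limit B
           (\<lambda>m (\<theta>, \<eta>, v1, v2). rescaled_prelimit_kernel m \<theta> \<eta> v1 v2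
              (\<gamma> m \<theta> \<eta> v1 v2) (g m \<theta> \<eta> v1 v2) (\<gamma>' m \<theta> \<eta> v1 v2) (g' m \<theta> \<eta> v1 v2))
           (\<lambda>(\<theta>, \<eta>, v1, v2). quintic_kernel \<theta> \<eta> v1 v2)
           sequentially"
proof (rule uniform_limit_by_sequences[OF assms(1)])
  fix M :: "nat \<Rightarrow> nat" and p :: "nat \<Rightarrow> real \<times> real \<times> real \<times> real" and l
  assume M: "\<And>n. n < M n" and p: "\<And>n. p n \<in> B" and pl: "p \<longlonglongrightarrow> l"
  obtain t h y1 y2 where l: "l = (t, h, y1, y2)" by (metis prod.exhaust)
  define \<theta> \<eta> v1 v2 where "\<theta> n = fst (p n)" and "\<eta> n = fst (snd (p n))"
    and "v1 n = fst (snd (snd (p n)))" and "v2 n = snd (snd (snd (p n)))" for n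
  have pn: "p n = (\<theta> n, \<eta> n, v1 n, v2 n)" for n by (simp add: \<theta>_def \<eta>_def v1_def v2_def)
  have lims: "\<theta> \<longlonglongrightarrow> t" "\<eta> \<longlonglongrightarrow> h" "v1 \<longlonglongrightarrow> y1" "v2 \<longlonglongrightarrow> y2"
    using tendsto_fst[OF pl] tendsto_fst[OF tendsto_snd[OF pl]] tendsto_fst[OF tendsto_snd[OF tendsto_snd[OF pl]]]
      tendsto_snd[OF tendsto_snd[OF tendsto_snd[OF pl]]]
    by (simp_all add: l \<theta>_def[abs_def] \<eta>_def[abs_def] v1_def[abs_def] v2_def[abs_def])
  have "filterlim M at_top sequentially"
    by (rule filterlim_at_top_mono[OF filterlim_ident always_eventually]) (use M less_imp_le in blast)
  from eventually_compose_filterlim[OF assms(2) this]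
  have adm: "\<forall>\<^sub>F n in sequentially. admissible_contours (a_scaled (M n) (\<theta> n) (\<eta> n)) (b_scaled (M n) (\<theta> n) (\<eta> n))
      (\<gamma> (M n) (\<theta> n) (\<eta> n) (v1 n) (v2 n)) (g (M n) (\<theta> n) (\<eta> n) (v1 n) (v2 n))
      (\<gamma>' (M n) (\<theta> n) (\<eta> n) (v1 n) (v2 n)) (g' (M n) (\<theta> n) (\<eta> n) (v1 n) (v2 n))"
  proof eventually_elim
    case (elim n)
    from bspec[OF elim p[of n]] show ?case by (simp only: pn prod.case)
  qed
  show "(\<lambda>n. (\<lambda>(\<theta>, \<eta>, v1, v2). rescaled_prelimit_kernel (M n) \<theta> \<eta> v1 v2
              (\<gamma> (M n) \<theta> \<eta> v1 v2) (g (M n) \<theta> \<eta> v1 v2) (\<gamma>' (M n) \<theta> \<eta> v1 v2) (g' (M n) \<theta> \<eta> v1 v2)) (p n))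
    \<longlonglongrightarrow> (\<lambda>(\<theta>, \<eta>, v1, v2). quintic_kernel \<theta> \<eta> v1 v2) l"
    unfolding pn l prod.case by (rule rescaled_prelimit_kernel_tendsto[OF M lims adm])
qed

end
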